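(* Let $K$ be a number field with ring of integers $\mathcal{O}$ and let $B$ be a quaternion algebra over $K$. There is an algorithm which, given as input a Bass order $R$ in $B$ and a genus $\mathcal{G}$ of Bass orders in $B$ that contains at least one suborder of $R$, outputs an order $R'\subseteq R$ belonging to $\mathcal{G}$. Here it is assumed that either no prime of $\mathcal{O}$ above $2$ divides the discriminants of $R$ and of the orders in $\mathcal{G}$, or $2$ is inert in $K$ (that is, $2\mathcal{O}$ is a prime ideal).
   Context: A lattice in $B$ is a finitely generated $\mathcal{O}$-submodule $\Lambda\subset B$ with $\Lambda\otimes_{\mathcal{O}}K\simeq B$; an order is a lattice that is a subring with unity. For $x\in B$ with canonical involution $x\mapsto\bar x$, $\operatorname{Tr}(x)=x+\bar x$ and $N(x)=x\bar x$. The (reduced) discriminant $d(R)$ of an order $R$ is the ideal of $\mathcal{O}$ whose square is generated by $\{\det(\operatorname{Tr}(x_i\bar x_j)) : x_1,\dots,x_4\in R\}$. For a lattice $\Lambda$, $R_l(\Lambda)=\{x\in B: x\Lambda\subseteq\Lambda\}$, $R_r(\Lambda)=\{x\in B:\Lambda x\subseteq\Lambda\}$ and $\Lambda^{-1}=\{x\in B:\Lambda x\Lambda\subseteq\Lambda\}$; $\Lambda$ is invertible if $\Lambda\Lambda^{-1}=R_l(\Lambda)$ and $\Lambda^{-1}\Lambda=R_r(\Lambda)$. An order $R$ is Gorenstein if every lattice $\Lambda$ with $R_l(\Lambda)=R$ is invertible, and is a Bass order if every order containing it is Gorenstein. Subscript $\mathfrak{p}$ denotes completion at a nonzero prime $\mathfrak{p}$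 of $\mathcal{O}$. Two orders $R,R'$ in $B$ are in the same genus if $R_\mathfrak{p}\simeq R'_\mathfrak{p}$ for all $\mathfrak{p}$. Input conventions: $R$ is given by a finite set of $\mathcal{O}$-module generators. A genus is given by a finite list of pairs $(\mathfrak{p},f_\mathfrak{p})$, where $f_\mathfrak{p}$ is a nondegenerate ternary quadratic form with coefficients in $\mathcal{O}$, meaning that the orders in the genus have completion at $\mathfrak{p}$ isomorphic to the even Clifford algebra of $f_\mathfrak{p}$ over $\mathcal{O}_\mathfrak{p}$ for the primes $\mathfrak{p}$ in the list, and completion isomorphic to $M_2(\mathcal{O}_\mathfrak{p})$ at all other primes. The output is a finite set of $\mathcal{O}$-module generators of $R'$. *)

theory Defs
  imports
    "HOL-Analysis.Determinants"
    "HOL-Library.Nat_Bijection"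
    "HOL-Library.FuncSet"
    "HOL-Computational_Algebra.Polynomial"
    "HOL-Algebra.Ideal_Product"
    "HOL-Algebra.QuotRing"
    "HOL-Algebra.Module"
begin

section \<open>Algorithms: partial recursive functions\<close>

datatype recf =
    Zero
  | Succ
  | Proj nat
  | Comp recf "recf list"
  | PrimRec recf recf
  | Mu recf

text \<open>\<open>computes P xs y\<close>: the computation of \<open>P\<close> on the arguments \<open>xs\<close> terminates with value \<open>y\<close>.\<close>

inductive computes :: "recf \<Rightarrow> nat list \<Rightarrow> nat \<Rightarrow> bool" where
  zero: "computes Zero xs 0"
| succ: "computes Succ (x # xs) (Suc x)"
| proj: "i < length xs \<Longrightarrow> computes (Proj i) xs (xs ! i)"
| comp: "list_all2 (\<lambda>g y. computes g xs y) gs ys \<Longrightarrow> computes f ys z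
         \<Longrightarrow> computes (Comp f gs) xs z"
| primrec_0: "computes f xs y \<Longrightarrow> computes (PrimRec f g) (0 # xs) y"
| primrec_Suc: "computes (PrimRec f g) (n # xs) y \<Longrightarrow> computes g (n # y # xs) z
         \<Longrightarrow> computes (PrimRec f g) (Suc n # xs) z"
| mu: "computes f (n # xs) 0 \<Longrightarrow> (\<forall>m<n. \<exists>y. computes f (m # xs) (Suc y))
         \<Longrightarrow> computes (Mu f) xs n"

inductive_cases computes_elims:
  "computes Zero xs z" "computes Succ xs z" "computes (Proj i) xs z" "computes (Comp f gs) xs z"
  "computes (PrimRec f g) (0 # xs) z" "computes (PrimRec f g) (Suc n # xs) z" "computes (Mu f) xs z"

lemma computes_deterministic:
  assumes "computes P xs y" "computes P xs z"
  shows "y = z"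
  using assms
proof (induction arbitrary: z rule: computes.induct)
  case (zero xs)
  then show ?case by (elim computes_elims(1)) simp
next
  case (succ x xs)
  then show ?case by (elim computes_elims(2)) simp
next
  case (proj i xs)
  from proj.prems show ?case by (elim computes_elims(3)) simp
next
  case (comp xs gs ys f z z')
  from comp.prems obtain ys' where
    ys': "list_all2 (\<lambda>g y. computes g xs y) gs ys'" "computes f ys' z'"
    by (rule computes_elims(4))
  have "ys = ys'"
  proof (rule nth_equalityI)
    show "length ys = length ys'"
      using comp.IH(1)[THEN list_all2_lengthD] ys'(1)[THEN list_all2_lengthD] by simp
    show "ys ! i = ys' ! i" if "i < length ys" for i
    proof -
      have "length ys' = length ys"
        using comp.IH(1)[THEN list_all2_lengthD] ys'(1)[THEN list_all2_lengthD] by simp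
      then show ?thesis
        using list_all2_nthD2[OF comp.IH(1) that] list_all2_nthD2[OF ys'(1), of i] that by simp
    qed
  qed
  then show ?case using comp.IH(2) ys'(2) by blast
next
  case (primrec_0 f xs y g)
  from primrec_0.prems have "computes f xs z" by (rule computes_elims(5))
  then show ?case using primrec_0.IH by blast
next
  case (primrec_Suc f g n xs y z z')
  from primrec_Suc.prems obtain y' where
    "computes (PrimRec f g) (n # xs) y'" "computes g (n # y' # xs) z'"
    by (rule computes_elims(6))
  then show ?case using primrec_Suc.IH by blast
next
  case (mu f n xs z)
  from mu.prems have z: "computes f (z # xs) 0 \<and> (\<forall>m<z. \<exists>y. computes f (m # xs) (Suc y))"
    by (rule computes_elims(7)) (intro conjI)
  show ?case
  proof (cases n z rule: linorder_cases)
    case less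
    then obtain y where "computes f (n # xs) (Suc y)" using z by blast
    then show ?thesis using mu.IH(1) by blast
  next
    case greater
    then show ?thesis using mu.IH(2) z by blast
  qed
qed


section \<open>Number fields, quaternion algebras and orders\<close>

class number_field = field_char_0 +
  assumes finite_dim_over_rat: "\<exists>S. finite S \<and> (\<forall>x. \<exists>q :: 'a \<Rightarrow> rat. x = (\<Sum>s\<in>S. of_rat (q s) * s))"

definition ring_on :: "'a::ring_1 set \<Rightarrow> 'a ring" where
  "ring_on S = \<lparr>carrier = S, mult = (*), one = 1, zero = 0, add = (+)\<rparr>"

definition integer_ring :: "'k::number_field ring" where
  "integer_ring = ring_on {x. algebraic_int x}"

definition nonzero_prime :: "'k::number_field set \<Rightarrow> bool" where
  "nonzero_prime \<pp> \<longleftrightarrow> primeideal \<pp> integer_ring \<and> \<pp> \<noteq> {0}"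

definition ideal_dvd :: "('a, 'm) ring_scheme \<Rightarrow> 'a set \<Rightarrow> 'a set \<Rightarrow> bool" where
  "ideal_dvd A I J \<longleftrightarrow> (\<exists>I'. ideal I' A \<and> J = ideal_prod A I I')"

definition ideal_power :: "('a, 'm) ring_scheme \<Rightarrow> 'a set \<Rightarrow> nat \<Rightarrow> 'a set" where
  "ideal_power A I n = (ideal_prod A I ^^ n) (carrier A)"

locale quaternion_algebra = vector_space smul
  for smul :: "'k::number_field \<Rightarrow> 'b::ring_1 \<Rightarrow> 'b" +
  assumes smul_mult_left: "smul a x * y = smul a (x * y)"
    and smul_mult_right: "x * smul a y = smul a (x * y)"
    and dim_4: "dim UNIV = 4"
    and central: "{z. \<forall>x. z * x = x * z} = range (\<lambda>a. smul a 1)"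
    and simple: "ideal I (ring_on (UNIV :: 'b set)) \<Longrightarrow> I = {0} \<or> I = UNIV"

definition canonical_involution :: "('k::number_field \<Rightarrow> 'b::ring_1 \<Rightarrow> 'b) \<Rightarrow> 'b \<Rightarrow> 'b" where
  "canonical_involution smul = (THE \<sigma>.
     (\<forall>x y. \<sigma> (x + y) = \<sigma> x + \<sigma> y) \<and> (\<forall>a x. \<sigma> (smul a x) = smul a (\<sigma> x)) \<and>
     (\<forall>x y. \<sigma> (x * y) = \<sigma> y * \<sigma> x) \<and> (\<forall>x. \<sigma> (\<sigma> x) = x) \<and>
     (\<forall>x. x + \<sigma> x \<in> range (\<lambda>a. smul a 1)) \<and> (\<forall>x. x * \<sigma> x \<in> range (\<lambda>a. smul a 1)))"

definition reduced_trace :: "('k::number_field \<Rightarrow> 'b::ring_1 \<Rightarrow> 'b) \<Rightarrow> 'b \<Rightarrow> 'k" where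
  "reduced_trace smul x = (THE a. x + canonical_involution smul x = smul a 1)"

definition O_span :: "('k::number_field \<Rightarrow> 'b::ring_1 \<Rightarrow> 'b) \<Rightarrow> 'b set \<Rightarrow> 'b set" where
  "O_span smul S = {\<Sum>x\<in>F. smul (c x) x | F c. finite F \<and> F \<subseteq> S \<and> (\<forall>x\<in>F. algebraic_int (c x))}"

definition is_lattice :: "('k::number_field \<Rightarrow> 'b::ring_1 \<Rightarrow> 'b) \<Rightarrow> 'b set \<Rightarrow> bool" where
  "is_lattice smul \<Lambda> \<longleftrightarrow>
     (\<exists>F. finite F \<and> \<Lambda> = O_span smul F) \<and> module.span smul \<Lambda> = UNIV"

definition is_order :: "('k::number_field \<Rightarrow> 'b::ring_1 \<Rightarrow> 'b) \<Rightarrow> 'b set \<Rightarrow> bool" where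
  "is_order smul R \<longleftrightarrow> is_lattice smul R \<and> 1 \<in> R \<and> (\<forall>x\<in>R. \<forall>y\<in>R. x * y \<in> R)"

definition reduced_disc :: "('k::number_field \<Rightarrow> 'b::ring_1 \<Rightarrow> 'b) \<Rightarrow> 'b set \<Rightarrow> 'k set" where
  "reduced_disc smul R = (THE d. ideal d integer_ring \<and>
     ideal_prod integer_ring d d = genideal integer_ring
       {det (\<chi> i j. reduced_trace smul (x i * canonical_involution smul (x j)) :: 'k ^ 4 ^ 4) |
        x. \<forall>i. x i \<in> R})"

definition left_order :: "'b::ring_1 set \<Rightarrow> 'b set" where
  "left_order \<Lambda> = {x. \<forall>y\<in>\<Lambda>. x * y \<in> \<Lambda>}"

definition right_order :: "'b::ring_1 set \<Rightarrow> 'b set" where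
  "right_order \<Lambda> = {x. \<forall>y\<in>\<Lambda>. y * x \<in> \<Lambda>}"

definition lattice_inverse :: "'b::ring_1 set \<Rightarrow> 'b set" where
  "lattice_inverse \<Lambda> = {x. \<forall>y\<in>\<Lambda>. \<forall>z\<in>\<Lambda>. y * x * z \<in> \<Lambda>}"

definition lattice_prod ::
    "('k::number_field \<Rightarrow> 'b::ring_1 \<Rightarrow> 'b) \<Rightarrow> 'b set \<Rightarrow> 'b set \<Rightarrow> 'b set" where
  "lattice_prod smul \<Lambda> M = O_span smul {x * y | x y. x \<in> \<Lambda> \<and> y \<in> M}"

definition invertible_lattice :: "('k::number_field \<Rightarrow> 'b::ring_1 \<Rightarrow> 'b) \<Rightarrow> 'b set \<Rightarrow> bool" where
  "invertible_lattice smul \<Lambda> \<longleftrightarrow>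
     lattice_prod smul \<Lambda> (lattice_inverse \<Lambda>) = left_order \<Lambda> \<and>
     lattice_prod smul (lattice_inverse \<Lambda>) \<Lambda> = right_order \<Lambda>"

definition gorenstein_order :: "('k::number_field \<Rightarrow> 'b::ring_1 \<Rightarrow> 'b) \<Rightarrow> 'b set \<Rightarrow> bool" where
  "gorenstein_order smul R \<longleftrightarrow> is_order smul R \<and>
     (\<forall>\<Lambda>. is_lattice smul \<Lambda> \<and> left_order \<Lambda> = R \<longrightarrow> invertible_lattice smul \<Lambda>)"

definition bass_order :: "('k::number_field \<Rightarrow> 'b::ring_1 \<Rightarrow> 'b) \<Rightarrow> 'b set \<Rightarrow> bool" where
  "bass_order smul R \<longleftrightarrow> is_order smul R \<and>
     (\<forall>S. is_order smul S \<and> R \<subseteq> S \<longrightarrow> gorenstein_order smul S)"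


section \<open>Completions\<close>

text \<open>
  The inverse limit of the quotients \<open>A / J n\<close>; a compatible system of residues is a
  decreasing sequence of cosets.
\<close>

definition completion :: "('a, 'm) ring_scheme \<Rightarrow> (nat \<Rightarrow> 'a set) \<Rightarrow> (nat \<Rightarrow> 'a set) ring" where
  "completion A J =
     \<lparr>carrier = {x. \<forall>n. x n \<in> carrier (A Quot J n) \<and> x (Suc n) \<subseteq> x n},
      mult = (\<lambda>x y n. x n \<otimes>\<^bsub>A Quot J n\<^esub> y n),
      one = (\<lambda>n. \<one>\<^bsub>A Quot J n\<^esub>),
      zero = (\<lambda>n. \<zero>\<^bsub>A Quot J n\<^esub>),
      add = (\<lambda>x y n. x n \<oplus>\<^bsub>A Quot J n\<^esub> y n)\<rparr>"

definition O_completion :: "'k::number_field set \<Rightarrow> (nat \<Rightarrow> 'k set) ring" where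
  "O_completion \<pp> = completion integer_ring (ideal_power integer_ring \<pp>)"

definition O_embed :: "'k::number_field set \<Rightarrow> 'k \<Rightarrow> nat \<Rightarrow> 'k set" where
  "O_embed \<pp> a = (\<lambda>n. ideal_power integer_ring \<pp> n +>\<^bsub>integer_ring\<^esub> a)"

definition ideal_power_order ::
    "('k::number_field \<Rightarrow> 'b::ring_1 \<Rightarrow> 'b) \<Rightarrow> 'k set \<Rightarrow> 'b set \<Rightarrow> nat \<Rightarrow> 'b set" where
  "ideal_power_order smul \<pp> R n =
     O_span smul {smul a x | a x. a \<in> ideal_power integer_ring \<pp> n \<and> x \<in> R}"

text \<open>
  Associative algebras over a commutative ring are modelled by the record type of modules, which
  also carries a multiplication and a unit; multiplication need not be commutative.
\<close>

definition order_completion ::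
    "('k::number_field \<Rightarrow> 'b::ring_1 \<Rightarrow> 'b) \<Rightarrow> 'k set \<Rightarrow> 'b set \<Rightarrow> (nat \<Rightarrow> 'k set, nat \<Rightarrow> 'b set) module" where
  "order_completion smul \<pp> R =
     ring.extend (completion (ring_on R) (ideal_power_order smul \<pp> R))
       (module.fields (\<lambda>a x n. \<Union>c\<in>a n. \<Union>r\<in>x n. ideal_power_order smul \<pp> R n +>\<^bsub>ring_on R\<^esub> smul c r))"

definition algebra_iso ::
    "('a, 'm) ring_scheme \<Rightarrow> ('a, 'c, 'm1) module_scheme \<Rightarrow> ('a, 'd, 'm2) module_scheme \<Rightarrow> bool" where
  "algebra_iso A M N \<longleftrightarrow>
     (\<exists>h\<in>ring_iso M N. \<forall>a\<in>carrier A. \<forall>x\<in>carrier M. h (a \<odot>\<^bsub>M\<^esub> x) = a \<odot>\<^bsub>N\<^esub> h x)"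

definition matrix_algebra :: "('a, 'm) ring_scheme \<Rightarrow> nat \<Rightarrow> ('a, nat \<times> nat \<Rightarrow> 'a) module" where
  "matrix_algebra A n =
     (let I = {..<n} \<times> {..<n} in
     \<lparr>carrier = I \<rightarrow>\<^sub>E carrier A,
      mult = (\<lambda>X Y. \<lambda>(i, j)\<in>I. \<Oplus>\<^bsub>A\<^esub>k\<in>{..<n}. X (i, k) \<otimes>\<^bsub>A\<^esub> Y (k, j)),
      one = (\<lambda>(i, j)\<in>I. if i = j then \<one>\<^bsub>A\<^esub> else \<zero>\<^bsub>A\<^esub>),
      zero = (\<lambda>_\<in>I. \<zero>\<^bsub>A\<^esub>),
      add = (\<lambda>X Y. \<lambda>p\<in>I. X p \<oplus>\<^bsub>A\<^esub> Y p),
      smult = (\<lambda>a X. \<lambda>p\<in>I. a \<otimes>\<^bsub>A\<^esub> X p)\<rparr>)"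


section \<open>Ternary quadratic forms and even Clifford algebras\<close>

text \<open>
  A function \<open>f\<close> stands for the ternary form with coefficient \<open>f i j\<close> at \<open>x\<^sub>i x\<^sub>j\<close> for
  \<open>i \<le> j < 3\<close>; its other values are irrelevant.
\<close>

definition qf_eval :: "('a, 'm) ring_scheme \<Rightarrow> (nat \<Rightarrow> nat \<Rightarrow> 'a) \<Rightarrow> (nat \<Rightarrow> 'a) \<Rightarrow> 'a" where
  "qf_eval A f v = (\<Oplus>\<^bsub>A\<^esub>i\<in>{..<3}. \<Oplus>\<^bsub>A\<^esub>j\<in>{i..<3}. f i j \<otimes>\<^bsub>A\<^esub> (v i \<otimes>\<^bsub>A\<^esub> v j))"

definition qf_nondegenerate :: "('a, 'm) ring_scheme \<Rightarrow> (nat \<Rightarrow> nat \<Rightarrow> 'a) \<Rightarrow> bool" where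
  "qf_nondegenerate A f \<longleftrightarrow>
     (\<forall>v \<in> {..<3} \<rightarrow>\<^sub>E carrier A.
        (\<forall>w \<in> {..<3} \<rightarrow>\<^sub>E carrier A.
           qf_eval A f (\<lambda>i. v i \<oplus>\<^bsub>A\<^esub> w i) \<ominus>\<^bsub>A\<^esub> qf_eval A f v \<ominus>\<^bsub>A\<^esub> qf_eval A f w = \<zero>\<^bsub>A\<^esub>)
        \<longrightarrow> (\<forall>i<3. v i = \<zero>\<^bsub>A\<^esub>))"

definition integral_form :: "(nat \<Rightarrow> nat \<Rightarrow> 'k::number_field) \<Rightarrow> bool" where
  "integral_form f \<longleftrightarrow> (\<forall>i j. i \<le> j \<and> j < 3 \<longrightarrow> algebraic_int (f i j))"

text \<open>
  The tensor algebra of the free module with basis \<open>e\<^sub>0, \<dots>, e\<^sub>n\<^sub>-\<^sub>1\<close>: a word \<open>[i\<^sub>1, \<dots>, i\<^sub>r]\<close>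
  stands for the pure tensor of \<open>e\<close> at \<open>i\<^sub>1, \<dots>, i\<^sub>r\<close>.
\<close>

definition tensor_algebra :: "('a, 'm) ring_scheme \<Rightarrow> nat \<Rightarrow> ('a, nat list \<Rightarrow> 'a) module" where
  "tensor_algebra A n =
     \<lparr>carrier = {t. (\<forall>w. t w \<in> carrier A) \<and> finite {w. t w \<noteq> \<zero>\<^bsub>A\<^esub>} \<and>
                    (\<forall>w. t w \<noteq> \<zero>\<^bsub>A\<^esub> \<longrightarrow> set w \<subseteq> {..<n})},
      mult = (\<lambda>s t w. \<Oplus>\<^bsub>A\<^esub>i\<in>{..length w}. s (take i w) \<otimes>\<^bsub>A\<^esub> t (drop i w)),
      one = (\<lambda>w. if w = [] then \<one>\<^bsub>A\<^esub> else \<zero>\<^bsub>A\<^esub>),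
      zero = (\<lambda>w. \<zero>\<^bsub>A\<^esub>),
      add = (\<lambda>s t w. s w \<oplus>\<^bsub>A\<^esub> t w),
      smult = (\<lambda>a t w. a \<otimes>\<^bsub>A\<^esub> t w)\<rparr>"

definition tensor_vec :: "('a, 'm) ring_scheme \<Rightarrow> nat \<Rightarrow> (nat \<Rightarrow> 'a) \<Rightarrow> nat list \<Rightarrow> 'a" where
  "tensor_vec A n v = (\<lambda>w. if length w = 1 \<and> hd w < n then v (hd w) else \<zero>\<^bsub>A\<^esub>)"

definition clifford_ideal ::
    "('a, 'm) ring_scheme \<Rightarrow> (nat \<Rightarrow> nat \<Rightarrow> 'a) \<Rightarrow> (nat list \<Rightarrow> 'a) set" where
  "clifford_ideal A f =
     (let T = tensor_algebra A 3 in
      genideal T {tensor_vec A 3 v \<otimes>\<^bsub>T\<^esub> tensor_vec A 3 v \<ominus>\<^bsub>T\<^esub> qf_eval A f v \<odot>\<^bsub>T\<^esub> \<one>\<^bsub>T\<^esub> |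
                  v. v \<in> {..<3} \<rightarrow>\<^sub>E carrier A})"

definition even_clifford ::
    "('a, 'm) ring_scheme \<Rightarrow> (nat \<Rightarrow> nat \<Rightarrow> 'a) \<Rightarrow> ('a, (nat list \<Rightarrow> 'a) set) module" where
  "even_clifford A f =
     (let T = tensor_algebra A 3; I = clifford_ideal A f in
      ring.extend
        ((T Quot I)\<lparr>carrier := {I +>\<^bsub>T\<^esub> t | t. t \<in> carrier T \<and> (\<forall>w. t w \<noteq> \<zero>\<^bsub>A\<^esub> \<longrightarrow> even (length w))}\<rparr>)
        (module.fields (\<lambda>a X. \<Union>t\<in>X. I +>\<^bsub>T\<^esub> (a \<odot>\<^bsub>T\<^esub> t))))"


section \<open>Genera\<close>

definition same_genus :: "('k::number_field \<Rightarrow> 'b::ring_1 \<Rightarrow> 'b) \<Rightarrow> 'b set \<Rightarrow> 'b set \<Rightarrow> bool" where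
  "same_genus smul R S \<longleftrightarrow>
     (\<forall>\<pp>. nonzero_prime \<pp> \<longrightarrow>
        algebra_iso (O_completion \<pp>) (order_completion smul \<pp> R) (order_completion smul \<pp> S))"

definition is_genus :: "('k::number_field \<Rightarrow> 'b::ring_1 \<Rightarrow> 'b) \<Rightarrow> 'b set set \<Rightarrow> bool" where
  "is_genus smul G \<longleftrightarrow>
     (\<exists>R. is_order smul R \<and> G = {S. is_order smul S \<and> same_genus smul R S})"

text \<open>
  In the list describing a genus, a prime is given by a list of generators of the ideal.
\<close>

definition describes_genus ::
    "('k::number_field \<Rightarrow> 'b::ring_1 \<Rightarrow> 'b) \<Rightarrow> ('k list \<times> (nat \<Rightarrow> nat \<Rightarrow> 'k)) list \<Rightarrow> 'b set set \<Rightarrow> bool" where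
  "describes_genus smul L G \<longleftrightarrow>
     (\<forall>(ps, f) \<in> set L.
        set ps \<subseteq> carrier integer_ring \<and> nonzero_prime (genideal integer_ring (set ps)) \<and>
        integral_form f \<and> qf_nondegenerate integer_ring f) \<and>
     (\<forall>S\<in>G.
        (\<forall>(ps, f) \<in> set L. let \<pp> = genideal integer_ring (set ps) in
           algebra_iso (O_completion \<pp>) (order_completion smul \<pp> S)
             (even_clifford (O_completion \<pp>) (\<lambda>i j. O_embed \<pp> (f i j)))) \<and>
        (\<forall>\<pp>. nonzero_prime \<pp> \<and> \<pp> \<notin> (\<lambda>(ps, f). genideal integer_ring (set ps)) ` set L \<longrightarrow>
           algebra_iso (O_completion \<pp>) (order_completion smul \<pp> S)
             (matrix_algebra (O_completion \<pp>) 2)))"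


section \<open>Encoding of the data by natural numbers\<close>

definition ordered_basis :: "('f::field \<Rightarrow> 'v::ab_group_add \<Rightarrow> 'v) \<Rightarrow> 'v list \<Rightarrow> bool" where
  "ordered_basis s bs \<longleftrightarrow>
     distinct bs \<and> \<not> module.dependent s (set bs) \<and> module.span s (set bs) = UNIV"

definition coords :: "('f::field \<Rightarrow> 'v::ab_group_add \<Rightarrow> 'v) \<Rightarrow> 'v list \<Rightarrow> 'v \<Rightarrow> 'f list" where
  "coords s bs x = map (module.representation s (set bs) x) bs"

abbreviation rat_scale :: "rat \<Rightarrow> 'k::number_field \<Rightarrow> 'k" where
  "rat_scale q x \<equiv> of_rat q * x"

definition encode_rat :: "rat \<Rightarrow> nat" where
  "encode_rat q = (case quotient_of q of (a, b) \<Rightarrow> prod_encode (int_encode a, int_encode b))"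

definition encode_K :: "'k::number_field list \<Rightarrow> 'k \<Rightarrow> nat" where
  "encode_K \<kappa> x = list_encode (map encode_rat (coords rat_scale \<kappa> x))"

definition encode_B ::
    "('k::number_field \<Rightarrow> 'b::ring_1 \<Rightarrow> 'b) \<Rightarrow> 'k list \<Rightarrow> 'b list \<Rightarrow> 'b \<Rightarrow> nat" where
  "encode_B smul \<kappa> \<beta> x = list_encode (map (encode_K \<kappa>) (coords smul \<beta> x))"

definition encode_gens ::
    "('k::number_field \<Rightarrow> 'b::ring_1 \<Rightarrow> 'b) \<Rightarrow> 'k list \<Rightarrow> 'b list \<Rightarrow> 'b list \<Rightarrow> nat" where
  "encode_gens smul \<kappa> \<beta> gs = list_encode (map (encode_B smul \<kappa> \<beta>) gs)"

definition encode_form :: "'k::number_field list \<Rightarrow> (nat \<Rightarrow> nat \<Rightarrow> 'k) \<Rightarrow> nat" where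
  "encode_form \<kappa> f =
     list_encode (map (\<lambda>(i, j). encode_K \<kappa> (f i j)) [(0,0), (0,1), (0,2), (1,1), (1,2), (2,2)])"

definition encode_genus ::
    "'k::number_field list \<Rightarrow> ('k list \<times> (nat \<Rightarrow> nat \<Rightarrow> 'k)) list \<Rightarrow> nat" where
  "encode_genus \<kappa> L =
     list_encode (map (\<lambda>(ps, f). prod_encode (list_encode (map (encode_K \<kappa>) ps), encode_form \<kappa> f)) L)"

end

theory Submission
 imports Defs "Jordan_Normal_Form.Char_Poly" "HOL-Computational_Algebra.Polynomial_Factorial"
begin

text \<open>
  The algorithm is an unbounded search, which terminates on the inputs admitted by the promise: it enumerates
  pairs of a candidate \<open>out\<close> and a finite certificate that \<open>out\<close> spans an order in the genus. At a
  listed prime the certificate is a local basis whose multiplication table satisfies the Clifford relations of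
  the given form modulo a high power of a denominator of the dual lattice. Two orders with such tables are
  locally conjugate: for bases \<open>e\<close>, \<open>e'\<close> and the dual basis \<open>a\<close> of \<open>e\<close>, the element
  \<open>x = (\<Sum>k. e' k * y * a k)\<close> intertwines the multiplications up to a small discrepancy, it is invertible because
  \<open>\<Sum>k. e k * y * a k\<close> is a scalar, and Nakayama's lemma shows that conjugation by \<open>x\<close> maps one order onto
  the other. At the other primes a suborder of \<open>R\<close> in the genus is locally a matrix algebra, hence maximal and
  equal to \<open>R\<close>; so it suffices to certify that \<open>out\<close> contains the multiples of \<open>R\<close> by all products of
  elements chosen from a list of the given primes.
\<close>

text \<open>No map out of the even Clifford algebra is ever built for the candidate. It is compared
  with a promised suborder \<open>S'\<close> of \<open>R\<close>: the isomorphism given for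
  \<open>S'\<close> yields a local basis of \<open>S'\<close> with the same table to any precision,
  so two finite tables inside one algebra are compared. Completions serve only to reach finite
  levels and to return; the estimates take place in the localisation at the prime, a valuation ring
  inside K.

  The precision must be expressed by data that a certificate can contain. An element
  \<open>D\<close> carrying \<open>R\<close> into the candidate bounds the basis of
  \<open>S'\<close>, which lies in \<open>R\<close>; the same \<open>D\<close> is required to clear
  the dual basis. Put \<open>E = 4 * D\<close>, where 4 is the trace of 1 and the denominator of the
  Casimir scalar. Dual vectors, basis vectors of the other order and the normalising scalar each
  cost a bounded power of \<open>E\<close>. The argument spends at most nine factors, one is spare,
  and an element \<open>z\<close> of the prime must survive: hence \<open>(4 * D) ^ 10 * z\<close>.

  Certificates consist of positive statements only, so that they can be enumerated; that an element
  is nonzero, or a unit at a prime, is witnessed by an equation.\<close>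

abbreviation "aint \<equiv> algebraic_int"

section \<open>Algebraic integers\<close>

interpretation zmod: Modules.module "%(z::int) (x::'a::comm_ring_1). of_int z * x"
 by unfold_locales (auto simp: algebra_simps)

text \<open>Determinant trick: the generators form an eigenvector with eigenvalue \<open>x\<close>
  of an integer matrix, whose characteristic polynomial is monic. The nonzero \<open>g0\<close>
  keeps the eigenvector from vanishing.\<close>

lemma aint_if_stable:
 fixes x :: "'a::field_char_0"
 assumes fin: "finite G" and g0: "g0 \<in> G" "g0 ~= 0"
  and stable: "!!g. g \<in> G ==> x * g \<in> zmod.span G"
 shows "aint x"
proof -
 obtain gs where gs: "set gs = G" "distinct gs"
  using finite_distinct_list[OF fin] by blast
 define n where "n = length gs"
 have "\<exists>c. x * g = (\<Sum>h\<in>G. of_int (c h) * h)" if "g \<in> G" for g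
  using stable[OF that] unfolding zmod.span_finite[OF fin] by auto
 then obtain c where c: "!!g. g \<in> G ==> x * g = (\<Sum>h\<in>G. of_int (c g h) * h)" by metis
 define A where "A = mat n n (%(i, j). c (gs ! i) (gs ! j))"
 define v where "v = vec n (%i. gs ! i)"
 have A: "A \<in> carrier_mat n n" by (simp add: A_def)
 let ?A = "map_mat (of_int :: int => 'a) A"
 have A': "?A \<in> carrier_mat n n" using A by simp
 have "?A *\<^sub>v v = x \<cdot>\<^sub>v v"
 proof (rule eq_vecI)
  fix i assume i: "i < dim_vec (x \<cdot>\<^sub>v v)"
  hence i: "i < n" by (simp add: v_def)
  have "(?A *\<^sub>v v) $ i = (\<Sum>j<n. of_int (c (gs ! i) (gs ! j)) * gs ! j)"
   using i by (simp add: A_def v_def scalar_prod_def lessThan_atLeast0)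
  also have "\<dots> = (\<Sum>h\<in>G. of_int (c (gs ! i) h) * h)"
   using sum.reindex_bij_betw[OF bij_betw_nth[OF gs(2) refl gs(1)[symmetric]],
    of "%h. of_int (c (gs ! i) h) * h"] by (simp add: n_def lessThan_atLeast0)
  also have "\<dots> = x * gs ! i" using c[of "gs ! i"] gs(1) i by (auto simp: n_def)
  finally show "(?A *\<^sub>v v) $ i = (x \<cdot>\<^sub>v v) $ i" using i by (simp add: v_def)
 qed (use A in \<open>simp add: v_def\<close>)
 moreover have "v ~= 0\<^sub>v n"
 proof
  assume v0: "v = 0\<^sub>v n"
  obtain i where "i < n" "gs ! i = g0" using g0(1) gs(1) by (auto simp: n_def in_set_conv_nth)
  thus False using v0 g0(2) by (metis index_vec index_zero_vec(1) v_def)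
 qed
 ultimately have "eigenvalue ?A x"
  using A by (auto simp: eigenvalue_def eigenvector_def v_def intro!: exI[of _ v])
 hence "poly (char_poly ?A) x = 0" using eigenvalue_root_char_poly[OF A'] by blast
 hence "poly (map_poly of_int (char_poly A)) x = 0"
  by (simp add: of_int_hom.char_poly_hom[OF A])
 moreover have "lead_coeff (char_poly A) = 1" using degree_monic_char_poly[OF A] by simp
 ultimately show ?thesis unfolding algebraic_int_altdef_ipoly by blast
qed

lemma aint_power_eq:
 fixes x :: "'a::field_char_0"
 assumes "aint x"
 obtains n a where "n > 0" "x ^ n = (\<Sum>i<n. of_int (a i) * x ^ i)"
proof -
 from assms obtain p where p: "poly (map_poly of_int p) x = 0" "lead_coeff p = 1"
  unfolding algebraic_int_altdef_ipoly by blast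
 define n where "n = degree p"
 have "(\<Sum>i\<le>n. of_int (coeff p i) * x ^ i) = 0"
  using p(1) by (simp add: poly_altdef n_def coeff_map_poly)
 hence "(\<Sum>i<n. of_int (coeff p i) * x ^ i) + x ^ n = 0"
  using p(2) by (simp add: lessThan_Suc_atMost[symmetric] n_def)
 hence e: "x ^ n = (\<Sum>i<n. of_int (- coeff p i) * x ^ i)"
  by (simp add: sum_negf eq_neg_iff_add_eq_0 add.commute)
 have "n > 0" using e by (cases "n = 0") auto
 with e show thesis using that[of n "%i. - coeff p i"] by blast
qed

lemma zmod_span_mult:
 assumes "!!g. g \<in> G ==> x * g \<in> zmod.span H" "y \<in> zmod.span G"
 shows "x * y \<in> zmod.span H"
 using assms(2)
proof (induction rule: zmod.span_induct_alt)
 case (step c g y)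
 have "x * (of_int c * g + y) = of_int c * (x * g) + x * y" by (simp add: algebra_simps)
 then show ?case using step assms(1) zmod.span_add zmod.span_scale by metis
qed (simp add: zmod.span_zero)

text \<open>A module stable under two integers at once is what makes their sum and product integral.
  A further integer \<open>x\<close> with a monic equation of degree \<open>n\<close> is adjoined by
  multiplying the old generators with the powers of \<open>x\<close> below \<open>n\<close>; the
  equation brings \<open>x ^ n\<close> back.\<close>

lemma algebraic_ints_common_module:
 fixes C :: "'a::field_char_0 set"
 assumes "finite C" "!!c. c \<in> C ==> aint c"
 obtains G where "finite G" "1 \<in> G" "!!c g. c \<in> C ==> g \<in> G ==> c * g \<in> zmod.span G"
proof -
 have "\<exists>G. finite G & 1 \<in> G & (\<forall>c\<in>C. \<forall>g\<in>G. c * g \<in> zmod.span G)"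
  using assms
 proof (induction C rule: finite_induct)
  case empty
  show ?case by (rule exI[of _ "{1}"]) auto
 next
  case (insert x C)
  then obtain G where G: "finite G" "1 \<in> G" "\<forall>c\<in>C. \<forall>g\<in>G. c * g \<in> zmod.span G" by auto
  obtain n a where n: "n > 0" "x ^ n = (\<Sum>i<n. of_int (a i) * x ^ i)"
   using aint_power_eq insert.prems by blast
  define H where "H = (%(i, g). x ^ i * g) ` ({..<n} \<times> G)"
  have H: "x ^ i * g \<in> H" if "i < n" "g \<in> G" for i g using that by (auto simp: H_def)
  have "c * h \<in> zmod.span H" if c: "c \<in> insert x C" and h: "h \<in> H" for c h
  proof -
   from h obtain i g where ig: "i < n" "g \<in> G" "h = x ^ i * g" by (auto simp: H_def)
   show ?thesis
   proof (cases "c = x")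
    case True
    show ?thesis
    proof (cases "Suc i < n")
     case True
     have "c * h = x ^ Suc i * g" using \<open>c = x\<close> ig by simp
     then show ?thesis using H[OF True ig(2)] zmod.span_base by metis
    next
     case False
     hence "Suc i = n" using ig by simp
     hence "c * h = x ^ n * g" using \<open>c = x\<close> ig by auto
     also have "\<dots> = (\<Sum>i<n. of_int (a i) * (x ^ i * g))"
      unfolding n(2) by (simp add: sum_distrib_right mult.assoc)
     also have "\<dots> \<in> zmod.span H"
      by (intro zmod.span_sum zmod.span_scale zmod.span_base H) (use ig in auto)
     finally show ?thesis .
    qed
   next
    case False
    hence "c * g \<in> zmod.span G" using c G(3) ig by auto
    hence "x ^ i * (c * g) \<in> zmod.span H"
     by (rule zmod_span_mult[rotated]) (use ig H zmod.span_base in blast)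
    then show ?thesis using ig by (simp add: mult_ac)
   qed
  qed
  moreover have "1 \<in> H" using H[of 0 1] n G by simp
  moreover have "finite H" using G by (simp add: H_def)
  ultimately show ?case by blast
 qed
 thus thesis using that by blast
qed

lemma aint_add_mult:
 fixes x y :: "'a::field_char_0"
 assumes "aint x" "aint y"
 shows "aint (x + y)" "aint (x * y)"
proof -
 obtain G where G: "finite G" "1 \<in> G" "!!c g. c \<in> {x, y} ==> g \<in> G ==> c * g \<in> zmod.span G"
  using algebraic_ints_common_module[of "{x, y}"] assms by blast
 have "(x + y) * g \<in> zmod.span G" if "g \<in> G" for g
  using G(3)[of x g] G(3)[of y g] that zmod.span_add by (fastforce simp: distrib_right)
 thus "aint (x + y)" using aint_if_stable[OF G(1,2), of "x + y"] by simp
 have "x * y * g \<in> zmod.span G" if "g \<in> G" for g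
  unfolding mult.assoc by (rule zmod_span_mult[of G x G "y * g"]) (use G(3) that in auto)
 thus "aint (x * y)" using aint_if_stable[OF G(1,2), of "x * y"] by simp
qed

lemma aint_uminus_diff:
 fixes x y :: "'a::field_char_0"
 shows "aint x ==> aint (- x)"
  "aint x ==> aint y ==> aint (x - y)"
proof -
 have m: "aint (- 1 :: 'a)" by (metis int_imp_algebraic_int Ints_1 Ints_minus)
 show 1: "aint (- x)" if "aint x" for x :: 'a
  using aint_add_mult(2)[OF m that] by simp
 show "aint x ==> aint y ==> aint (x - y)"
  using aint_add_mult(1)[of x "- y"] 1[of y] by simp
qed

lemma aint_of_int: "aint (of_int n :: 'a::field_char_0)"
 "aint (0 :: 'a::field_char_0)" "aint (1 :: 'a::field_char_0)"
 by (simp_all add: int_imp_algebraic_int)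

lemma aint_sum:
 fixes f :: "'b => 'a::field_char_0"
 shows "(!!i. i \<in> A ==> aint (f i)) ==> aint (sum f A)"
 by (induction A rule: infinite_finite_induct) (auto simp: aint_of_int aint_add_mult)

lemma aint_power:
 fixes x :: "'a::field_char_0"
 shows "aint x ==> aint (x ^ n)"
 by (induction n) (auto simp: aint_of_int aint_add_mult)


text \<open>These are the intermediate values of Horner's scheme, integral although the leading
  coefficient is arbitrary. Multiplication by such a tail preserves the span of the powers below
  \<open>n\<close>: on powers below \<open>i\<close> the degree stays below \<open>n\<close>, on the
  others the equation trades the tail for the terms below \<open>i\<close>.\<close>

lemma aint_horner:
 fixes x :: "'a::field_char_0" and a :: "nat => int"
 assumes root: "(\<Sum>k\<le>n. of_int (a k) * x ^ k) = 0" and n: "n > 0" and i: "i \<le> n"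
 shows "aint (\<Sum>k=i..n. of_int (a k) * x ^ (k - i))"
proof -
 let ?b = "\<Sum>k=i..n. of_int (a k) * x ^ (k - i)"
 define G where "G = (%j. x ^ j) ` {..<n}"
 have G: "x ^ j \<in> zmod.span G" if "j < n" for j
  using that by (intro zmod.span_base) (auto simp: G_def)
 have "?b * g \<in> zmod.span G" if "g \<in> G" for g
 proof -
  obtain j where j: "j < n" "g = x ^ j" using \<open>g \<in> G\<close> by (auto simp: G_def)
  show ?thesis
  proof (cases "j < i")
   case True
   have "?b * g = (\<Sum>k=i..n. of_int (a k) * x ^ (k - i + j))"
    unfolding j sum_distrib_right by (rule sum.cong) (simp_all only: power_add mult.assoc)
   also have "\<dots> \<in> zmod.span G"
    by (intro zmod.span_sum zmod.span_scale G) (use True j in auto)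
   finally show ?thesis .
  next
   case False
   have "?b * x ^ i = (\<Sum>k=i..n. of_int (a k) * x ^ k)"
    unfolding sum_distrib_right by (rule sum.cong) (auto simp: mult.assoc power_add[symmetric])
   moreover have "{..n} = {..<i} \<union> {i..n}" using i by auto
   hence "(\<Sum>k\<le>n. of_int (a k) * x ^ k) =
     (\<Sum>k<i. of_int (a k) * x ^ k) + (\<Sum>k=i..n. of_int (a k) * x ^ k)"
    by (simp add: sum.union_disjoint disjoint_iff)
   ultimately have b: "?b * x ^ i = (\<Sum>k<i. of_int (- a k) * x ^ k)"
    using root by (simp add: sum_negf eq_neg_iff_add_eq_0 add.commute)
   have "?b * g = ?b * x ^ i * x ^ (j - i)"
    using False by (simp only: j mult.assoc power_add[symmetric]) simp
   also have "\<dots> = (\<Sum>k<i. of_int (- a k) * x ^ (k + (j - i)))"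
    unfolding b unfolding sum_distrib_right by (rule sum.cong) (simp_all only: power_add mult.assoc)
   also have "\<dots> \<in> zmod.span G"
    by (intro zmod.span_sum zmod.span_scale G) (use False j in auto)
   finally show ?thesis .
  qed
 qed
 moreover have "1 \<in> G" using n by (auto simp: G_def image_iff intro!: bexI[of _ 0])
 ultimately show ?thesis by (intro aint_if_stable[of G 1]) (auto simp: G_def)
qed

section \<open>Number fields as rational vector spaces, and primitive integer equations\<close>

lemma vector_space_rat_scale: "vector_space (rat_scale :: rat => 'k => 'k::number_field)"
 by unfold_locales (auto simp: algebra_simps of_rat_add of_rat_mult)

interpretation ratvs: vector_space "rat_scale :: rat => 'k => 'k::number_field"
 by (rule vector_space_rat_scale)

lemma poly_map_poly_eq_sum:
 fixes x :: "'a::comm_ring_1"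
 assumes "h 0 = 0" "degree r \<le> N"
 shows "poly (map_poly h r) x = (\<Sum>i\<le>N. h (coeff r i) * x ^ i)"
proof -
 have "degree (map_poly h r) \<le> N" using assms(2) degree_map_poly_le[of h r] by linarith
 moreover have "h (coeff r i) = 0" if "i > degree (map_poly h r)" for i
  using coeff_eq_0[OF that] by (simp add: coeff_map_poly assms(1))
 ultimately have "(\<Sum>i\<le>N. h (coeff r i) * x ^ i) =
   (\<Sum>i\<le>degree (map_poly h r). h (coeff r i) * x ^ i)"
  by (intro sum.mono_neutral_right) auto
 thus ?thesis by (simp add: poly_altdef coeff_map_poly assms(1))
qed

text \<open>More powers than the dimension allows are dependent; clearing denominators and dividing
  by the content gives the equation. Content 1 means that no prime contains all coefficients, which
  later makes the localisations valuation rings.\<close>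

lemma number_field_primitive_root:
 fixes x :: "'k::number_field"
 obtains p :: "int poly" where "content p = 1" "degree p > 0"
  "(\<Sum>k\<le>degree p. of_int (coeff p k) * x ^ k) = 0"
proof -
 obtain S :: "'k set" where S: "finite S" "!!x. \<exists>q :: 'k => rat. x = (\<Sum>s\<in>S. of_rat (q s) * s)"
  using finite_dim_over_rat by blast
 have "ratvs.span S = UNIV"
  using S by (auto simp: ratvs.span_finite[OF S(1)] image_iff)
 have "\<exists>r :: rat poly. r ~= 0 & poly (map_poly of_rat r) x = 0"
 \<comment> \<open>Dependence concerns the set of powers, so coinciding powers are treated apart;
   for them a difference of two monomials serves.\<close>
 proof (cases "inj_on (%i. x ^ i) {..card S}")
  case False
  then obtain i j where ij: "x ^ i = x ^ j" "i ~= j" by (auto simp: inj_on_def)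
  have "monom (1::rat) i - monom 1 j ~= 0" using ij(2) by (metis monom_eq_iff' right_minus_eq zero_neq_one)
  moreover have "poly (map_poly of_rat (monom (1::rat) i - monom 1 j)) x = 0"
  proof -
   have "poly (map_poly of_rat (monom (1::rat) i - monom 1 j)) x =
     (\<Sum>k\<le>max i j. of_rat (coeff (monom (1::rat) i - monom 1 j) k) * x ^ k)"
    by (rule poly_map_poly_eq_sum)
     (auto intro!: degree_diff_le order_trans[OF degree_monom_le])
   also have "\<dots> = (\<Sum>k\<le>max i j. (if k = i then x ^ i else 0) - (if k = j then x ^ j else 0))"
    by (rule sum.cong) (auto simp: of_rat_diff)
   also have "\<dots> = x ^ i - x ^ j" unfolding sum_subtractf by (subst (1 2) sum.delta) auto
   finally show ?thesis using ij(1) by simp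
  qed
  ultimately show ?thesis by blast
 next
  case True
  define T where "T = (%i. x ^ i) ` {..card S}"
  have "ratvs.dependent T"
  proof (rule ccontr)
   assume "\<not> ratvs.dependent T"
   hence "card T \<le> card S"
    using ratvs.independent_span_bound[OF S(1), of T] \<open>ratvs.span S = UNIV\<close> by auto
   thus False by (simp add: T_def card_image[OF True])
  qed
  then obtain u v where u: "(\<Sum>v\<in>T. of_rat (u v) * v) = 0" "v \<in> T" "u v ~= 0"
   by (auto simp: ratvs.dependent_finite T_def)
  define r where "r = (\<Sum>i\<le>card S. monom (u (x ^ i)) i)"
  have "coeff r i = u (x ^ i)" if "i \<le> card S" for i
   using that by (simp add: r_def coeff_sum)
  note cr = this
  hence "r ~= 0" using u(2,3) by (auto simp: T_def)
  moreover have "degree r \<le> card S" unfolding r_def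
   by (intro degree_sum_le) (auto intro!: order_trans[OF degree_monom_le])
  hence "poly (map_poly of_rat r) x = (\<Sum>i\<le>card S. of_rat (u (x ^ i)) * x ^ i)"
   by (subst poly_map_poly_eq_sum[of _ _ "card S"]) (auto simp: cr)
  hence "poly (map_poly of_rat r) x = 0"
   using u(1) by (simp add: T_def sum.reindex[OF True])
  ultimately show ?thesis by blast
 qed
 then obtain r :: "rat poly" where r: "r ~= 0" "poly (map_poly of_rat r) x = 0" by blast
 obtain d :: int where d: "d ~= 0" "!!i. \<exists>z. of_int d * coeff r i = of_int z"
 proof -
  have "\<exists>d :: int. d ~= 0 & (\<forall>i<m. \<exists>z. of_int d * coeff r i = of_int z)" for m
  proof (induction m)
   case (Suc m)
   then obtain d :: int where d: "d ~= 0" "\<forall>i<m. \<exists>z. of_int d * coeff r i = of_int z" by blast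
   obtain a b where ab: "coeff r m = of_int a / of_int b" "b > 0"
    using quotient_of_div quotient_of_denom_pos by (metis surj_pair)
   have "\<exists>z. of_int (d * b) * coeff r i = of_int z" if "i < Suc m" for i
   proof (cases "i = m")
    case True
    thus ?thesis using ab by (auto intro!: exI[of _ "d * a"])
   next
    case False
    hence "i < m" using that by simp
    then obtain z where "of_int d * coeff r i = of_int z" using d by blast
    thus ?thesis by (intro exI[of _ "z * b"]) (auto simp: mult_ac)
   qed
   thus ?case using d ab by (intro exI[of _ "d * b"]) auto
  qed (auto intro: exI[of _ 1])
  then obtain d :: int where d: "d ~= 0" "\<forall>i<Suc (degree r). \<exists>z. of_int d * coeff r i = of_int z" by blast
  have "\<exists>z. of_int d * coeff r i = of_int z" for i
   using d(2) by (cases "i \<le> degree r") (auto simp: coeff_eq_0 intro: exI[of _ 0])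
  with d(1) that show thesis by blast
 qed
 obtain z where z: "!!i. of_int d * coeff r i = of_int (z i)" using d(2) by metis
 define P where "P = (\<Sum>i\<le>degree r. monom (z i) i)"
 have cP: "coeff P i = z i" for i
 proof (cases "i \<le> degree r")
  case False
  hence "z i = 0" using z[of i] by (simp add: coeff_eq_0)
  thus ?thesis using False by (simp add: P_def coeff_sum)
 qed (simp add: P_def coeff_sum)
 have "of_int (coeff P i) = (of_rat (of_int d * coeff r i) :: 'k)" for i
  by (simp only: cP z of_rat_of_int_eq)
 moreover have "degree P \<le> degree r" unfolding P_def
  by (intro degree_sum_le) (auto intro!: order_trans[OF degree_monom_le])
 ultimately have "poly (map_poly of_int P) x = of_int d * poly (map_poly of_rat r) x"
  using poly_map_poly_eq_sum[of of_int P "degree r" x, OF of_int_0]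
   poly_map_poly_eq_sum[of of_rat r "degree r" x, OF of_rat_0 order_refl]
  by (simp add: sum_distrib_left of_rat_mult mult.assoc)
 hence P: "poly (map_poly of_int P) x = 0" using r by simp
 have "P ~= 0"
 proof
  assume "P = 0"
  hence "coeff r i = 0" for i using z[of i] cP[of i] d by simp
  thus False using r by (simp add: poly_eq_iff)
 qed
 define p where "p = primitive_part P"
 have c: "content p = 1" using \<open>P ~= 0\<close> by (simp add: p_def)
 have cPp: "coeff P k = content P * coeff p k" for k
  using content_times_primitive_part[of P] by (metis coeff_smult p_def)
 have dpP: "degree p = degree P" unfolding p_def by (rule degree_primitive_part)
 have "of_int (content P) * (\<Sum>k\<le>degree p. of_int (coeff p k) * x ^ k) =
   (\<Sum>k\<le>degree P. of_int (coeff P k) * x ^ k)"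
  unfolding sum_distrib_left dpP
  by (rule sum.cong[OF refl]) (simp only: cPp of_int_mult mult.assoc)
 also have "\<dots> = poly (map_poly of_int P) x"
  by (rule poly_map_poly_eq_sum[symmetric]) simp_all
 finally have "of_int (content P) * (\<Sum>k\<le>degree p. of_int (coeff p k) * x ^ k) = poly (map_poly of_int P) x" .
 hence s: "(\<Sum>k\<le>degree p. of_int (coeff p k) * x ^ k) = 0"
  using P \<open>P ~= 0\<close> by simp
 have "degree p > 0"
 proof (rule ccontr)
  assume "\<not> degree p > 0"
  hence d0: "degree p = 0" by simp
  hence "coeff p 0 = 0" using s by simp
  hence "p = 0" using d0 by (metis leading_coeff_0_iff)
  thus False using c by simp
 qed
 with c s that show thesis by blast
qed


section \<open>Rings of integers and their prime ideals\<close>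

lemma ring_on_simps [simp]:
 "carrier (ring_on S) = S" "mult (ring_on S) = (*)" "one (ring_on S) = 1"
 "zero (ring_on S) = 0" "add (ring_on S) = (+)"
 by (simp_all add: ring_on_def)

lemma ring_ring_on:
 assumes "0 \<in> S" "1 \<in> S" "!!x y. x \<in> S ==> y \<in> S ==> x + y \<in> S"
  "!!x y. x \<in> S ==> y \<in> S ==> x * y \<in> S" "!!x. x \<in> S ==> - x \<in> S"
 shows "ring (ring_on S)"
proof (rule ringI)
 show "abelian_group (ring_on S)"
  by (rule abelian_groupI) (use assms in \<open>auto simp: add_ac intro: exI[of _ "- x" for x] bexI[of _ "- x" for x]\<close>)
 show "Group.monoid (ring_on S)" by (rule monoidI) (use assms in \<open>auto simp: mult.assoc\<close>)
qed (auto simp: algebra_simps)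

lemma a_inv_ring_on:
 assumes "ring (ring_on S)" "!!x. x \<in> S ==> - x \<in> S" "x \<in> S"
 shows "\<ominus>\<^bsub>ring_on S\<^esub> x = - x"
proof -
 interpret ring "ring_on S" by fact
 show ?thesis using minus_equality[of "- x" x] assms by simp
qed

lemma ideal_ring_on_iff:
 assumes "ring (ring_on S)" "!!x. x \<in> S ==> - x \<in> S" "1 \<in> S"
 shows "ideal I (ring_on S) \<longleftrightarrow> I \<subseteq> S & 0 \<in> I & (\<forall>x\<in>I. \<forall>y\<in>I. x + y \<in> I) &
  (\<forall>a\<in>S. \<forall>x\<in>I. a * x \<in> I & x * a \<in> I)"
proof
 assume "ideal I (ring_on S)"
 then interpret ideal I "ring_on S" .
 show "I \<subseteq> S & 0 \<in> I & (\<forall>x\<in>I. \<forall>y\<in>I. x + y \<in> I) & (\<forall>a\<in>S. \<forall>x\<in>I. a * x \<in> I & x * a \<in> I)"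
  using a_subset additive_subgroup.a_closed[OF additive_subgroup_axioms] I_l_closed I_r_closed additive_subgroup.zero_closed[OF additive_subgroup_axioms]
  by auto
next
 assume I: "I \<subseteq> S & 0 \<in> I & (\<forall>x\<in>I. \<forall>y\<in>I. x + y \<in> I) & (\<forall>a\<in>S. \<forall>x\<in>I. a * x \<in> I & x * a \<in> I)"
 interpret ring "ring_on S" by fact
 have m: "- x \<in> I" if "x \<in> I" for x
  using I that assms(2)[OF assms(3)] by (metis mult_minus1)
 show "ideal I (ring_on S)"
 proof (rule idealI[OF assms(1)])
  show "subgroup I (add_monoid (ring_on S))"
   by (rule add.subgroupI) (use I m a_inv_ring_on[OF assms(1,2)] in \<open>auto simp: a_inv_def[symmetric]\<close>)
 qed (use I in auto)
qed

abbreviation algints :: "'k::number_field set" where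
 "algints \<equiv> {x. aint x}"

lemma ring_integer_ring: "ring (integer_ring :: 'k::number_field ring)"
 unfolding integer_ring_def
 by (rule ring_ring_on) (auto simp: aint_of_int aint_add_mult aint_uminus_diff)

lemma cring_integer_ring: "cring (integer_ring :: 'k::number_field ring)"
proof (rule cringI)
 interpret ring "integer_ring :: 'k ring" by (rule ring_integer_ring)
 show "abelian_group (integer_ring :: 'k ring)" by (rule is_abelian_group)
 show "comm_monoid (integer_ring :: 'k ring)"
  by (rule monoid_comm_monoidI) (auto simp: integer_ring_def mult.commute)
qed (auto simp: integer_ring_def algebra_simps)

lemma ideal_integer_ring_iff:
 "ideal I (integer_ring :: 'k::number_field ring) \<longleftrightarrow> I \<subseteq> algints & 0 \<in> I &
  (\<forall>x\<in>I. \<forall>y\<in>I. x + y \<in> I) & (\<forall>a. aint a --> (\<forall>x\<in>I. a * x \<in> I))"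
 unfolding integer_ring_def
 by (subst ideal_ring_on_iff)
  (use ring_integer_ring in \<open>auto simp: integer_ring_def aint_of_int aint_uminus_diff mult.commute\<close>)

text \<open>The Horner tail at \<open>n - 1\<close> consists of the two top terms, so the leading
  coefficient of an integer equation is a denominator.\<close>

lemma number_field_denominator:
 fixes x :: "'k::number_field"
 obtains n :: int where "n ~= 0" "aint (of_int n * x)"
proof -
 obtain p :: "int poly" where p: "content p = 1" "degree p > 0"
  "(\<Sum>k\<le>degree p. of_int (coeff p k) * x ^ k) = 0"
  using number_field_primitive_root .
 define n where "n = degree p"
 have "aint (\<Sum>k=n-1..n. of_int (coeff p k) * x ^ (k - (n-1)))"
  by (rule aint_horner) (use p in \<open>auto simp: n_def\<close>)
 moreover have "{n-1..n} = {n-1, n}" "n - 1 ~= n" using p(2) by (auto simp: n_def)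
 ultimately have "aint (of_int (coeff p (n-1)) + of_int (coeff p n) * x)"
  using p(2) by (simp add: n_def)
 from aint_uminus_diff(2)[OF this aint_of_int(1)[of "coeff p (n-1)"]]
 have "aint (of_int (coeff p n) * x)" by simp
 moreover have "coeff p n ~= 0" using p(2) by (auto simp: n_def)
 ultimately show thesis using that by blast
qed

locale prime_of_K =
 fixes \<pp> :: "'k::number_field set"
 assumes nonzero_prime: "nonzero_prime \<pp>"
begin

lemma ideal: "ideal \<pp> integer_ring"
 using nonzero_prime by (auto simp: nonzero_prime_def primeideal_def)

lemma algint: "x \<in> \<pp> ==> aint x" and zero: "0 \<in> \<pp>"
 and add: "x \<in> \<pp> ==> y \<in> \<pp> ==> x + y \<in> \<pp>"
 and mult: "aint a ==> x \<in> \<pp> ==> a * x \<in> \<pp>"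
 using ideal unfolding ideal_integer_ring_iff by auto

lemma prime: "aint a ==> aint b ==> a * b \<in> \<pp> ==> a \<in> \<pp> \<or> b \<in> \<pp>"
proof -
 have "primeideal \<pp> (integer_ring :: 'k ring)" using nonzero_prime by (simp add: nonzero_prime_def)
 from primeideal.I_prime[OF this] show "aint a ==> aint b ==> a * b \<in> \<pp> ==> a \<in> \<pp> \<or> b \<in> \<pp>"
  by (simp add: integer_ring_def)
qed

lemma one_notin: "1 \<notin> \<pp>"
proof
 assume "1 \<in> \<pp>"
 hence "\<pp> = carrier integer_ring" using mult[of _ 1] algint by (auto simp: integer_ring_def)
 moreover have "primeideal \<pp> (integer_ring :: 'k ring)" using nonzero_prime by (simp add: nonzero_prime_def)
 ultimately show False using primeideal.I_notcarr by blast
qed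

lemma uminus: "x \<in> \<pp> ==> - x \<in> \<pp>"
 using mult[of "- 1" x] aint_of_int(1)[of "- 1"] by simp

lemma sum: "(!!i. i \<in> A ==> f i \<in> \<pp>) ==> sum f A \<in> \<pp>"
 by (induction A rule: infinite_finite_induct) (auto simp: zero add)

lemma power_mem: "aint a ==> a ^ n \<in> \<pp> ==> a \<in> \<pp>"
 by (induction n) (auto simp: one_notin dest: prime[OF _ aint_power])

text \<open>The integer is the constant term of an equation of least degree for a nonzero
  \<open>t\<close> in the prime: it is a multiple of \<open>t\<close>, and it is nonzero because the
  equation could otherwise be divided by \<open>t\<close>.\<close>

lemma exists_int: obtains n :: int where "n ~= 0" "of_int n \<in> \<pp>"
proof -
 obtain t where t: "t \<in> \<pp>" "t ~= 0" using nonzero_prime zero by (auto simp: nonzero_prime_def)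
 define Q where "Q = (%(n, a :: nat => int). (\<Sum>k\<le>n. of_int (a k) * t ^ k) = 0 & (\<exists>k\<le>n. a k ~= 0))"
 obtain n a where na: "t ^ n = (\<Sum>i<n. of_int (a i) * t ^ i)"
  using aint_power_eq[OF algint[OF t(1)]] by metis
 have "Q (n, %k. if k = n then - 1 else a k)"
 proof -
  have "(\<Sum>k\<le>n. of_int (if k = n then - 1 else a k) * t ^ k) =
    (\<Sum>k<n. of_int (a k) * t ^ k) - t ^ n"
   by (simp add: lessThan_Suc_atMost[symmetric])
  thus ?thesis using na by (auto simp: Q_def)
 qed
 then obtain m b where mb: "Q (m, b)" "!!m' b'. Q (m', b') ==> m \<le> m'"
  using arg_min_nat_lemma[of Q _ fst] by (metis fst_conv surj_pair)
 have "b 0 ~= 0"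
 proof
  assume b0: "b 0 = 0"
  show False
  proof (cases m)
   case 0
   thus False using mb(1) b0 by (auto simp: Q_def)
  next
   case (Suc m')
   have "(\<Sum>k\<le>Suc m'. of_int (b k) * t ^ k) = t * (\<Sum>k\<le>m'. of_int (b (Suc k)) * t ^ k)"
    unfolding sum.atMost_Suc_shift by (simp add: b0 sum_distrib_left mult_ac)
   moreover obtain k where "k \<le> Suc m'" "b k ~= 0" using mb(1) Suc by (auto simp: Q_def)
   hence "\<exists>k\<le>m'. b (Suc k) ~= 0" using b0 by (cases k) auto
   ultimately have "Q (m', %k. b (Suc k))" using mb(1) Suc t(2) by (simp add: Q_def)
   thus False using mb(2) Suc by fastforce
  qed
 qed
 moreover have "of_int (b 0) \<in> \<pp>"
 proof -
  have "(\<Sum>k\<le>m. of_int (b k) * t ^ k) = of_int (b 0) + (\<Sum>k<m. of_int (b (Suc k)) * t ^ k * t)"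
  proof (cases m)
   case (Suc l)
   show ?thesis unfolding Suc sum.atMost_Suc_shift lessThan_Suc_atMost
    by (simp only: power_0 power_Suc2 mult_1_right mult.assoc)
  qed simp
  hence "of_int (b 0) = - (\<Sum>k<m. of_int (b (Suc k)) * t ^ k * t)"
   using mb(1) by (simp add: Q_def eq_neg_iff_add_eq_0)
  also have "\<dots> \<in> \<pp>"
   by (intro uminus sum mult aint_add_mult aint_of_int aint_power
     algint[OF t(1)] t(1))
  finally show ?thesis .
 qed
 ultimately show thesis using that by blast
qed


text \<open>The generator of the contraction of the prime to the integers, found as the least
  positive integer in it and checked by division with remainder.\<close>

lemma exists_prime_int: obtains q :: int where "q > 1" "!!n. of_int n \<in> \<pp> \<longleftrightarrow> q dvd n"
proof -
 obtain n :: int where n: "n ~= 0" "of_int n \<in> \<pp>" using exists_int .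
 define Q where "Q = (%k. k > 0 & of_nat k \<in> \<pp>)"
 have "of_int \<bar>n\<bar> \<in> \<pp>" using n uminus[of "of_int n"] by (cases "n \<ge> 0") auto
 hence "Q (nat \<bar>n\<bar>)" using n by (simp add: Q_def)
 define q where "q = (LEAST k. Q k)"
 have q: "Q q" unfolding q_def by (rule LeastI) fact
 have qmin: "q \<le> k" if "Q k" for k unfolding q_def by (rule Least_le) fact
 have "of_int n \<in> \<pp> \<longleftrightarrow> int q dvd n" for n
 proof
  assume "of_int n \<in> \<pp>"
  hence "of_int n + of_int (- (n div int q)) * of_int (int q) \<in> \<pp>"
   by (intro add mult aint_of_int) (use q in \<open>simp_all add: Q_def\<close>)
  also have "of_int n + of_int (- (n div int q)) * of_int (int q) = (of_int (n - (n div int q) * int q) :: 'k)"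
   by simp
  also have "\<dots> = of_int (n mod int q)" by (simp add: minus_div_mult_eq_mod)
  finally have "of_nat (nat (n mod int q)) \<in> \<pp>" using q by (simp add: Q_def)
  moreover have "nat (n mod int q) < q" using q by (simp add: Q_def nat_less_iff)
  moreover have "n mod int q \<ge> 0" using q by (simp add: Q_def)
  ultimately have "nat (n mod int q) = 0" using qmin[of "nat (n mod int q)"] by (fastforce simp: Q_def)
  thus "int q dvd n" using \<open>n mod int q \<ge> 0\<close> by (simp add: dvd_eq_mod_eq_0)
 next
  assume "int q dvd n"
  then obtain k where "n = k * int q" by (metis dvd_def mult.commute)
  thus "of_int n \<in> \<pp>" using mult[OF aint_of_int(1)[of k], of "of_nat q"] q by (simp add: Q_def)
 qed
 moreover have "q ~= 1" using q one_notin by (auto simp: Q_def)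
 ultimately show thesis using that[of "int q"] q by (auto simp: Q_def)
qed

text \<open>Nonzero primes are maximal, shown without counting residues. In a monic equation of
  \<open>a\<close> let \<open>d i\<close> be the first coefficient outside the prime. Cancelling
  \<open>a ^ i\<close> modulo the prime shows that \<open>d i\<close> is congruent to a multiple of
  \<open>a\<close>, and \<open>d i\<close> itself is invertible modulo \<open>q\<close>.\<close>

lemma inverse_mod:
 assumes "aint a" "a \<notin> \<pp>"
 obtains u w where "aint u" "w \<in> \<pp>" "a * u + w = 1"
proof -
 obtain q :: int where q: "q > 1" "!!n. of_int n \<in> \<pp> \<longleftrightarrow> q dvd n"
  using exists_prime_int by metis
 obtain n c where na: "a ^ n = (\<Sum>i<n. of_int (c i) * a ^ i)"
  using aint_power_eq[OF assms(1)] by metis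
 define d where "d = (%k. if k = n then 1 else - c k)"
 have s0: "(\<Sum>k\<le>n. of_int (d k) * a ^ k) = 0"
 proof -
  have "(\<Sum>k\<le>n. of_int (d k) * a ^ k) = a ^ n + (\<Sum>k<n. of_int (- c k) * a ^ k)"
   by (simp add: lessThan_Suc_atMost[symmetric] d_def)
  thus ?thesis using na by (simp add: sum_negf)
 qed
 define i where "i = (LEAST k. of_int (d k) \<notin> \<pp>)"
 have "of_int (d n) \<notin> \<pp>" using one_notin by (simp add: d_def)
 hence i: "of_int (d i) \<notin> \<pp>" "i \<le> n" and lt: "!!k. k < i ==> of_int (d k) \<in> \<pp>"
  unfolding i_def by (rule LeastI, rule Least_le) (use not_less_Least in auto)
 let ?s = "\<Sum>k=i..n. of_int (d k) * a ^ (k - i)"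
 have "{..n} = {..<i} \<union> {i..n}" using i by auto
 hence "(\<Sum>k<i. of_int (d k) * a ^ k) + (\<Sum>k=i..n. of_int (d k) * a ^ k) = 0"
  using s0 by (simp add: sum.union_disjoint disjoint_iff)
 moreover have "(\<Sum>k=i..n. of_int (d k) * a ^ k) = a ^ i * ?s"
  unfolding sum_distrib_left by (rule sum.cong) (auto simp: power_add[symmetric])
 ultimately have "a ^ i * ?s = - (\<Sum>k<i. a ^ k * of_int (d k))"
  by (simp add: eq_neg_iff_add_eq_0 add.commute mult.commute)
 also have "\<dots> \<in> \<pp>" using lt by (intro uminus sum mult aint_power assms) auto
 finally have mem: "a ^ i * ?s \<in> \<pp>" .
 have "aint ?s"
  by (intro aint_sum aint_add_mult aint_of_int aint_power assms)
 hence "?s \<in> \<pp>" using prime[OF aint_power[OF assms(1)] _ mem] power_mem[OF assms(1)] assms(2) by blast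
 moreover have "{i..n} = insert i {Suc i..n}" using i by auto
 hence "?s = of_int (d i) + a * (\<Sum>k=Suc i..n. of_int (d k) * a ^ (k - Suc i))"
  by (simp add: sum_distrib_left) (rule sum.cong, auto simp: Suc_diff_Suc mult_ac simp flip: power_Suc)
 ultimately obtain r where r: "aint r" "of_int (d i) + a * r \<in> \<pp>"
  using that by (metis (no_types, lifting) aint_sum aint_add_mult(2) aint_of_int(1)
    aint_power assms(1))
 \<comment> \<open>Write \<open>q = g * h\<close> with \<open>g\<close> the common divisor. The
   prime contains \<open>g\<close> or \<open>h\<close>; it cannot contain \<open>g\<close>, which
   divides \<open>d i\<close>, so \<open>q\<close> divides \<open>h\<close> and \<open>g\<close> is
   a unit.\<close>
 have "coprime (d i) q"
 proof -
  define g where "g = gcd (d i) q"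
  obtain h where h: "q = g * h" by (metis dvd_def g_def gcd_dvd2)
  have "of_int g * of_int h \<in> \<pp>" using q(2)[of q] by (simp add: h flip: of_int_mult)
  hence "of_int g \<in> \<pp> \<or> of_int h \<in> \<pp>" using prime aint_of_int(1) by blast
  moreover have "of_int g \<notin> \<pp>"
   using i(1) unfolding q(2) by (metis dvd_trans g_def gcd_dvd1)
  ultimately have "q dvd h" using q(2) by blast
  hence "g * h dvd 1 * h" by (simp add: h)
  moreover have "h ~= 0" using h q(1) by auto
  ultimately have "g dvd 1" by (metis dvd_mult_cancel_right)
  thus ?thesis by (simp add: g_def coprime_iff_gcd_eq_1 is_unit_gcd)
 qed
 then obtain x y where xy: "x * d i + y * q = 1" using bezout_int[of "d i" q] by (auto simp: coprime_iff_gcd_eq_1)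
 have "a * (- (of_int x * r)) + (of_int x * (of_int (d i) + a * r) + of_int y * of_int q) = of_int (x * d i + y * q)"
  by (simp add: algebra_simps)
 hence "a * (- (of_int x * r)) + (of_int x * (of_int (d i) + a * r) + of_int y * of_int q) = 1"
  by (simp only: xy of_int_1)
 moreover have "of_int x * (of_int (d i) + a * r) + of_int y * of_int q \<in> \<pp>"
  by (intro add mult aint_of_int r) (simp add: q)
 moreover have "aint (- (of_int x * r))"
  by (intro aint_uminus_diff aint_add_mult aint_of_int r)
 ultimately show thesis using that by blast
qed

end

section \<open>Valuation subrings\<close>

text \<open>Valuation rings without a valuation: by \<open>not_in_V\<close>, one of two elements is
  always a multiple of the other, and this replaces the comparison of values. Properness allows a
  nonzero element to be scaled out of \<open>V\<close>.\<close>

locale valuation_subring =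
 fixes V P :: "'k::field set"
 assumes V_1: "1 \<in> V" and V_add: "x \<in> V ==> y \<in> V ==> x + y \<in> V"
  and V_mult: "x \<in> V ==> y \<in> V ==> x * y \<in> V" and V_minus: "x \<in> V ==> - x \<in> V"
  and P_sub: "x \<in> P ==> x \<in> V" and P_add: "x \<in> P ==> y \<in> P ==> x + y \<in> P"
  and P_mult: "x \<in> V ==> y \<in> P ==> x * y \<in> P" and one_notin_P: "1 \<notin> P"
  and zero_P: "0 \<in> P"
  and not_in_V: "x \<notin> V ==> inverse x \<in> P"
  and unit: "x \<in> V ==> x \<notin> P ==> inverse x \<in> V"
  and V_proper: "V ~= UNIV"
begin

lemma V_0: "0 \<in> V" by (rule P_sub[OF zero_P])

lemma V_sum: "(!!i. i \<in> A ==> f i \<in> V) ==> sum f A \<in> V"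
 by (induction A rule: infinite_finite_induct) (auto simp: V_0 V_add)

lemma P_sum: "(!!i. i \<in> A ==> f i \<in> P) ==> sum f A \<in> P"
 by (induction A rule: infinite_finite_induct) (auto simp: zero_P P_add)

lemma V_diff: "x \<in> V ==> y \<in> V ==> x - y \<in> V"
 using V_add[of x "- y"] V_minus by simp

lemma V_power: "x \<in> V ==> x ^ n \<in> V"
 by (induction n) (auto simp: V_1 V_mult)

lemma P_minus: "x \<in> P ==> - x \<in> P"
 using P_mult[OF V_minus[OF V_1], of x] by simp

lemma V_of_nat: "of_nat n \<in> V"
 by (induction n) (auto simp: V_0 V_1 V_add)

text \<open>An element of least value among finitely many, kept up to date as elements are
  added.\<close>

lemma exists_dominating:
 assumes "finite I" "I ~= {}"
 shows "\<exists>j\<in>I. \<forall>i\<in>I. \<exists>v\<in>V. w i = v * w j"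
 using assms
proof (induction I rule: finite_ne_induct)
 case (singleton x)
 show ?case by (auto intro!: bexI[of _ 1] V_1)
next
 case (insert x F)
 then obtain j where j: "j \<in> F" "\<forall>i\<in>F. \<exists>v\<in>V. w i = v * w j" by blast
 show ?case
 proof (cases "\<exists>v\<in>V. w x = v * w j")
  case True
  thus ?thesis using j by blast
 next
  case False
  have "\<exists>v\<in>V. w j = v * w x"
  proof (cases "w j = 0")
   case False
   have "w x / w j \<notin> V" using \<open>\<not> (\<exists>v\<in>V. w x = v * w j)\<close> False by auto
   hence n: "w j / w x \<in> V" using not_in_V P_sub by force
   have "w x ~= 0"
   proof
    assume "w x = 0"
    hence "w x = 0 * w j" by simp
    with \<open>\<not> (\<exists>v\<in>V. w x = v * w j)\<close> V_0 show False by blast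
   qed
   thus ?thesis using n by (intro bexI[of _ "w j / w x"]) auto
  qed (auto intro!: bexI[of _ 0] V_0)
  then obtain u where u: "u \<in> V" "w j = u * w x" by blast
  have "\<exists>v\<in>V. w i = v * w x" if i: "i \<in> F" for i
  proof -
   obtain v where v: "v \<in> V" "w i = v * w j" using bspec[OF j(2) i] by (elim bexE)
   hence "w i = (v * u) * w x" by (simp only: u(2) mult.assoc)
   thus ?thesis using V_mult[OF v(1) u(1)] by (rule bexI)
  qed
  moreover have "\<exists>v\<in>V. w x = v * w x" by (rule bexI[of _ 1]) (simp_all add: V_1)
  ultimately have "\<forall>i\<in>insert x F. \<exists>v\<in>V. w i = v * w x" by simp
  thus ?thesis by (intro bexI[of _ x] insertI1)
 qed
qed

text \<open>An ultrametric form of Nakayama's lemma: a largest entry outside \<open>V\<close> would make \<open>1\<close> an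
 element of \<open>P\<close>.\<close>

lemma nakayama:
 assumes fin: "finite I" and r: "!!i. i \<in> I ==> r i \<in> V"
  and p: "!!i j. i \<in> I ==> j \<in> I ==> p i j \<in> P"
  and w: "!!i. i \<in> I ==> w i = r i + (\<Sum>j\<in>I. p i j * w j)" and i: "i \<in> I"
 shows "w i \<in> V"
proof -
 obtain j where j: "j \<in> I" "\<forall>i\<in>I. \<exists>v\<in>V. w i = v * w j"
  using exists_dominating[OF fin, of w] i by blast
 then obtain v where v: "!!i. i \<in> I ==> v i \<in> V" "!!i. i \<in> I ==> w i = v i * w j" by metis
 have "w j \<in> V"
 proof (rule ccontr)
  assume n: "w j \<notin> V"
  hence inv: "inverse (w j) \<in> P" and nz: "w j ~= 0" using not_in_V V_0 by auto
  have "1 = inverse (w j) * w j" using nz by simp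
  also have "\<dots> = inverse (w j) * (r j + (\<Sum>k\<in>I. p j k * v k * w j))"
   by (subst w[OF j(1)]) (simp add: v(2) mult.assoc)
  also have "\<dots> = r j * inverse (w j) + (\<Sum>k\<in>I. v k * p j k)"
   unfolding distrib_left sum_distrib_left using nz
   by (intro arg_cong2[of _ _ _ _ "(+)"] sum.cong) (simp_all add: field_simps)
  also have "\<dots> \<in> P" by (intro P_add P_mult P_sum r v p inv j) auto
  finally show False using one_notin_P by simp
 qed
 thus ?thesis using v[OF i] V_mult by simp
qed

text \<open>A nonzero entry could be rescaled to an element \<open>t\<close> outside
  \<open>V\<close>; the rescaled system is still homogeneous, and \<open>nakayama\<close> with
  right-hand side 0 forbids this.\<close>

lemma nakayama_zero:
 assumes fin: "finite I"
  and p: "!!i j. i \<in> I ==> j \<in> I ==> p i j \<in> P"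
  and w: "!!i. i \<in> I ==> w i = (\<Sum>j\<in>I. p i j * w j)" and i: "i \<in> I"
 shows "w i = 0"
proof (rule ccontr)
 assume n: "w i ~= 0"
 obtain t where t: "t \<notin> V" using V_proper by auto
 have "t / w i * w i \<in> V"
 proof (rule nakayama[of I "%_. 0" p "%j. t / w i * w j", OF fin V_0 p _ i])
  fix k assume "k \<in> I"
  show "t / w i * w k = 0 + (\<Sum>j\<in>I. p k j * (t / w i * w j))"
   by (subst w[OF \<open>k \<in> I\<close>]) (simp add: sum_distrib_left mult_ac)
 qed
 thus False using n t by simp
qed

end

section \<open>The localisation at a nonzero prime is a valuation ring\<close>

definition (in prime_of_K) local_ring :: "'k set" where
 "local_ring = {x. \<exists>a b. aint a & aint b & b \<notin> \<pp> & b * x = a}"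

definition (in prime_of_K) local_max :: "'k set" where
 "local_max = {x. \<exists>a b. a \<in> \<pp> & aint b & b \<notin> \<pp> & b * x = a}"

lemma (in prime_of_K) local_ringI: "aint b ==> b \<notin> \<pp> ==> aint (b * x) ==> x \<in> local_ring"
 unfolding local_ring_def by auto

lemma (in prime_of_K) local_maxI: "aint b ==> b \<notin> \<pp> ==> b * x \<in> \<pp> ==> x \<in> local_max"
 unfolding local_max_def by auto

lemma (in prime_of_K) local_ringE:
 assumes "x \<in> local_ring"
 obtains b where "aint b" "b \<notin> \<pp>" "aint (b * x)"
 using assms unfolding local_ring_def by auto

lemma (in prime_of_K) local_maxE:
 assumes "x \<in> local_max"
 obtains b where "aint b" "b \<notin> \<pp>" "b * x \<in> \<pp>"
 using assms unfolding local_max_def by auto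

lemma (in prime_of_K) mult_notin:
 "aint a ==> aint b ==> a \<notin> \<pp> ==> b \<notin> \<pp> ==> a * b \<notin> \<pp>"
 using prime by blast

text \<open>The valuation property, obtained without factoring ideals. The Horner tails
  \<open>b i\<close> of a primitive equation all lie in the prime: one outside it, with
  \<open>x * b i\<close> integral, would put \<open>x\<close> into the local ring. If all
  \<open>x * b (Suc i)\<close> were in the prime as well, so would be every coefficient. One that is
  not serves as denominator of \<open>inverse x\<close>, with numerator
  \<open>b (Suc i)\<close>.\<close>

lemma (in prime_of_K) not_in_local_ring:
 assumes "x \<notin> local_ring"
 shows "inverse x \<in> local_max"
proof -
 have x0: "x ~= 0"
  using assms local_ringI[of 1 x] one_notin by (auto simp: aint_of_int)
 obtain p :: "int poly" where p: "content p = 1" "degree p > 0"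
  "(\<Sum>k\<le>degree p. of_int (coeff p k) * x ^ k) = 0"
  using number_field_primitive_root .
 obtain q :: int where q: "q > 1" "!!n. of_int n \<in> \<pp> \<longleftrightarrow> q dvd n"
  using exists_prime_int by metis
 define n where "n = degree p"
 define b where "b = (%i. \<Sum>k=i..n. of_int (coeff p k) * x ^ (k - i))"
 have b_int: "aint (b i)" if "i \<le> n" for i
  unfolding b_def by (rule aint_horner) (use p that in \<open>auto simp: n_def\<close>)
 have b_rec: "b i = of_int (coeff p i) + x * b (Suc i)" if "i \<le> n" for i
 proof -
  have "{i..n} = insert i {Suc i..n}" using that by auto
  moreover have "(\<Sum>k=Suc i..n. of_int (coeff p k) * x ^ (k - i)) = x * b (Suc i)"
   unfolding b_def sum_distrib_left
   by (rule sum.cong[OF refl]) (simp add: Suc_diff_le[symmetric] mult_ac flip: power_Suc)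
  ultimately show ?thesis unfolding b_def by simp
 qed
 have xb_int: "aint (x * b (Suc i))" if "i \<le> n" for i
  using b_rec[OF that] aint_uminus_diff(2)[OF b_int[OF that] aint_of_int(1)[of "coeff p i"]]
  by simp
 have b0: "b 0 = 0" unfolding b_def using p(3) by (simp add: n_def atMost_atLeast0)
 have bp: "b i \<in> \<pp>" if i: "i \<le> n" for i
 proof (rule ccontr)
  assume c: "b i \<notin> \<pp>"
  then obtain j where "i = Suc j" using b0 zero by (cases i) auto
  hence "aint (b i * x)" using xb_int[of j] i by (simp add: mult.commute)
  thus False using assms local_ringI[OF b_int[OF i] c] by simp
 qed
 have "b (Suc n) = 0" by (simp add: b_def)
 have "\<exists>i<n. x * b (Suc i) \<notin> \<pp>"
 proof (rule ccontr)
  assume "\<not> ?thesis"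
  hence xb: "x * b (Suc i) \<in> \<pp>" if "i \<le> n" for i
   using that \<open>b (Suc n) = 0\<close> zero by (cases "i = n") auto
  have "of_int (coeff p i) \<in> \<pp>" if "i \<le> n" for i
  proof -
   have "of_int (coeff p i) = b i + - (x * b (Suc i))" using b_rec[OF that] by simp
   thus ?thesis using add[OF bp[OF that] uminus[OF xb[OF that]]] by simp
  qed
  hence "q dvd coeff p i" for i
   using q by (cases "i \<le> n") (auto simp: n_def coeff_eq_0)
  hence "[:q:] dvd p" by (simp add: const_poly_dvd_iff)
  hence "q dvd content p" by (simp add: const_poly_dvd_iff_dvd_content)
  thus False using p(1) q(1) by simp
 qed
 then obtain i where i: "i < n" "x * b (Suc i) \<notin> \<pp>" by blast
 show ?thesis
  by (rule local_maxI[of "x * b (Suc i)"]) (use i x0 bp[of "Suc i"] xb_int[of i] in \<open>auto simp: field_simps\<close>)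
qed

sublocale prime_of_K \<subseteq> loc: valuation_subring local_ring local_max
proof
 note int = aint_add_mult aint_uminus_diff aint_of_int
 show "1 \<in> local_ring" by (rule local_ringI[of 1]) (auto simp: int one_notin)
 show "x + y \<in> local_ring" if xy: "x \<in> local_ring" "y \<in> local_ring" for x y
 proof -
  obtain b c where b: "aint b" "b \<notin> \<pp>" "aint (b * x)"
   and c: "aint c" "c \<notin> \<pp>" "aint (c * y)"
   using xy local_ringE by metis
  have "b * c * (x + y) = c * (b * x) + b * (c * y)" by (simp add: algebra_simps)
  also have "aint \<dots>" using b c by (simp add: int(1) int(2)[of "b * x" "c * y"] int(2)[of c "b * x"] int(2)[of b "c * y"])
  finally show ?thesis using b c by (intro local_ringI[of "b * c"]) (auto simp: int mult_notin)
 qed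
 show "x * y \<in> local_ring" if xy: "x \<in> local_ring" "y \<in> local_ring" for x y
 proof -
  obtain b c where b: "aint b" "b \<notin> \<pp>" "aint (b * x)"
   and c: "aint c" "c \<notin> \<pp>" "aint (c * y)"
   using xy local_ringE by metis
  have "b * c * (x * y) = (b * x) * (c * y)" by (simp add: algebra_simps)
  also have "aint \<dots>" using b c by (simp add: int(1) int(2)[of "b * x" "c * y"] int(2)[of c "b * x"] int(2)[of b "c * y"])
  finally show ?thesis using b c by (intro local_ringI[of "b * c"]) (auto simp: int mult_notin)
 qed
 show "- x \<in> local_ring" if xy: "x \<in> local_ring" for x
 proof -
  obtain b where b: "aint b" "b \<notin> \<pp>" "aint (b * x)"
   using xy local_ringE by metis
  thus ?thesis by (intro local_ringI[of b]) (auto simp: int)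
 qed
 show "x \<in> local_ring" if xy: "x \<in> local_max" for x
  using xy algint by (auto elim!: local_maxE intro!: local_ringI)
 show "x + y \<in> local_max" if xy: "x \<in> local_max" "y \<in> local_max" for x y
 proof -
  obtain b c where b: "aint b" "b \<notin> \<pp>" "b * x \<in> \<pp>"
   and c: "aint c" "c \<notin> \<pp>" "c * y \<in> \<pp>"
   using xy local_maxE by metis
  have "b * c * (x + y) = c * (b * x) + b * (c * y)" by (simp add: algebra_simps)
  also have "\<dots> \<in> \<pp>" using b c by (intro add mult[of c "b * x"] mult[of b "c * y"])
  finally show ?thesis using b c by (intro local_maxI[of "b * c"]) (auto simp: int mult_notin)
 qed
 show "x * y \<in> local_max" if xy: "x \<in> local_ring" "y \<in> local_max" for x y
 proof -
  obtain b c where b: "aint b" "b \<notin> \<pp>" "aint (b * x)"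
   and c: "aint c" "c \<notin> \<pp>" "c * y \<in> \<pp>"
   using xy local_ringE local_maxE by metis
  have "b * c * (x * y) = (b * x) * (c * y)" by (simp add: algebra_simps)
  also have "\<dots> \<in> \<pp>" using b c by (intro mult[of "b * x" "c * y"])
  finally show ?thesis using b c by (intro local_maxI[of "b * c"]) (auto simp: int mult_notin)
 qed
 show "1 \<notin> local_max" by (auto elim!: local_maxE)
 show "0 \<in> local_max" by (rule local_maxI[of 1]) (auto simp: int one_notin zero)
 show "inverse x \<in> local_max" if xy: "x \<notin> local_ring" for x by (rule not_in_local_ring[OF xy])
 show "inverse x \<in> local_ring" if xy: "x \<in> local_ring" "x \<notin> local_max" for x
 proof -
  obtain b where b: "aint b" "b \<notin> \<pp>" "aint (b * x)"
   using xy local_ringE by metis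
  have n: "b * x \<notin> \<pp>" using local_maxI[OF b(1,2)] xy by blast
  hence "x ~= 0" using zero by auto
  hence e: "b * x * inverse x = b" by simp
  show ?thesis by (rule local_ringI[OF b(3) n]) (simp only: e b(1))
 qed
 show "local_ring ~= UNIV"
 proof
  assume u: "local_ring = UNIV"
  obtain n :: int where n: "n ~= 0" "of_int n \<in> \<pp>" using exists_int .
  have "inverse (of_int n) \<in> local_ring" using u by simp
  then obtain b where b: "aint b" "b \<notin> \<pp>" "aint (b * inverse (of_int n))"
   by (rule local_ringE)
  have "b * inverse (of_int n) * of_int n \<in> \<pp>" by (rule mult[OF b(3) n(2)])
  thus False using b n by (simp add: mult.assoc)
 qed
qed

lemma (in prime_of_K) algint_local: "aint a ==> a \<in> local_ring"
 by (rule local_ringI[of 1]) (auto simp: one_notin aint_of_int)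

lemma (in prime_of_K) prime_local: "a \<in> \<pp> ==> a \<in> local_max"
 by (rule local_maxI[of 1]) (auto simp: one_notin aint_of_int)

lemma (in prime_of_K) algint_notin_local_max: "aint a ==> a \<notin> \<pp> ==> a \<notin> local_max"
proof
 assume a: "aint a" "a \<notin> \<pp>" "a \<in> local_max"
 then obtain b where "aint b" "b \<notin> \<pp>" "b * a \<in> \<pp>" by (auto elim: local_maxE)
 thus False using a prime by blast
qed

text \<open>The archimedean property of the valuation, without a uniformiser. In a monic equation of
  \<open>g\<close>, the tail from the first coefficient not divisible by \<open>q\<close> is outside
  the prime, so \<open>q\<close> divides a power of \<open>g\<close> locally. A denominator of
  \<open>inverse m\<close> is a power of \<open>q\<close> times an integer that is a local
  unit.\<close>

lemma (in prime_of_K) power_divides: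
 assumes g: "g \<in> \<pp>" and m: "m ~= 0"
 obtains k where "g ^ k / m \<in> local_ring"
proof -
 obtain q :: int where q: "q > 1" "!!n. of_int n \<in> \<pp> \<longleftrightarrow> q dvd n"
  using exists_prime_int by metis
 note int = aint_add_mult aint_uminus_diff aint_of_int aint_power
 have ga: "aint g" using g algint by blast
 have "\<exists>i. g ^ i / of_int q \<in> local_ring"
 proof -
  obtain n c where na: "g ^ n = (\<Sum>i<n. of_int (c i) * g ^ i)"
   using aint_power_eq[OF ga] by metis
  define d where "d = (%k. if k = n then 1 else - c k)"
  have s0: "(\<Sum>k\<le>n. of_int (d k) * g ^ k) = 0"
  proof -
   have "(\<Sum>k\<le>n. of_int (d k) * g ^ k) = g ^ n + (\<Sum>k<n. of_int (- c k) * g ^ k)"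
    by (simp add: lessThan_Suc_atMost[symmetric] d_def)
   thus ?thesis using na by (simp add: sum_negf)
  qed
  define i where "i = (LEAST k. \<not> q dvd d k)"
  have "\<not> q dvd d n" using q by (simp add: d_def)
  hence i: "\<not> q dvd d i" "i \<le> n" and lt: "!!k. k < i ==> q dvd d k"
   unfolding i_def by (rule LeastI, rule Least_le) (use not_less_Least in auto)
  let ?s = "\<Sum>k=i..n. of_int (d k) * g ^ (k - i)"
  have "{..n} = {..<i} \<union> {i..n}" using i by auto
  hence "(\<Sum>k<i. of_int (d k) * g ^ k) + (\<Sum>k=i..n. of_int (d k) * g ^ k) = 0"
   using s0 by (simp add: sum.union_disjoint disjoint_iff)
  moreover have "(\<Sum>k=i..n. of_int (d k) * g ^ k) = g ^ i * ?s"
   unfolding sum_distrib_left by (rule sum.cong) (auto simp: power_add[symmetric])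
  ultimately have e: "g ^ i * ?s = - (\<Sum>k<i. of_int (d k) * g ^ k)"
   by (simp add: eq_neg_iff_add_eq_0 add.commute)
  also have "\<dots> = of_int q * - (\<Sum>k<i. of_int (d k div q) * g ^ k)"
  proof -
   have t: "of_int (d k) * g ^ k = of_int q * (of_int (d k div q) * g ^ k)" if "k < i" for k
   proof -
    have "q * (d k div q) = d k" using lt[OF that] by simp
    hence e: "of_int (d k) = (of_int q * of_int (d k div q) :: 'k)"
     unfolding of_int_mult[symmetric] by (rule arg_cong[OF sym])
    show ?thesis by (subst e) (rule mult.assoc)
   qed
   show ?thesis unfolding mult_minus_right sum_distrib_left
    by (intro arg_cong[of _ _ uminus] sum.cong refl t) simp
  qed
  finally have e: "g ^ i * ?s / of_int q = - (\<Sum>k<i. of_int (d k div q) * g ^ k)"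
   using q by (simp add: field_simps)
  have sn: "?s \<notin> \<pp>"
  proof
   assume "?s \<in> \<pp>"
   have "{i..n} = insert i {Suc i..n}" using i by auto
   hence "?s = of_int (d i) + (\<Sum>k=Suc i..n. of_int (d k) * g ^ (k - i))" by simp
   hence "of_int (d i) = ?s + - (\<Sum>k=Suc i..n. of_int (d k) * g ^ (k - i))" by simp
   moreover have "(\<Sum>k=Suc i..n. of_int (d k) * g ^ (k - i)) \<in> \<pp>"
   proof (rule sum)
    fix k assume "k \<in> {Suc i..n}"
    hence "g ^ (k - i) = g ^ (k - Suc i) * g" by (simp add: Suc_diff_le[symmetric] flip: power_Suc2)
    thus "of_int (d k) * g ^ (k - i) \<in> \<pp>"
     using g ga by (simp only: mult.assoc[symmetric]) (auto intro!: mult simp: int)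
   qed
   ultimately have "of_int (d i) \<in> \<pp>" using \<open>?s \<in> \<pp>\<close> add uminus by metis
   thus False using q i by blast
  qed
  have "aint ?s" by (intro aint_sum int ga)
  moreover have "?s * (g ^ i / of_int q) = - (\<Sum>k<i. of_int (d k div q) * g ^ k)"
   using e by (simp add: mult.commute)
  moreover have "aint (- (\<Sum>k<i. of_int (d k div q) * g ^ k))"
   by (intro aint_sum int ga)
  ultimately have "g ^ i / of_int q \<in> local_ring" using sn local_ringI by metis
  thus ?thesis by blast
 qed
 then obtain i where i: "g ^ i / of_int q \<in> local_ring" by blast
 obtain N :: int where N: "N ~= 0" "aint (of_int N * inverse m)"
  using number_field_denominator by blast
 have "\<not> is_unit q" using q(1) by simp
 then obtain e N' where N': "N = q ^ e * N'" "\<not> q dvd N'"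
  using multiplicity_decompose'[of N q] N(1) by metis
 have "(g ^ i / of_int q) ^ e \<in> local_ring" by (rule loc.V_power[OF i])
 moreover have "inverse (of_int N') \<in> local_ring"
  using N' q loc.unit algint_local algint_notin_local_max aint_of_int(1) by metis
 moreover have "of_int N * inverse m \<in> local_ring" using N(2) by (rule algint_local)
 ultimately have "(g ^ i / of_int q) ^ e * inverse (of_int N') * (of_int N * inverse m) \<in> local_ring"
  by (rule loc.V_mult[OF loc.V_mult])
 also have "(g ^ i / of_int q) ^ e * inverse (of_int N') * (of_int N * inverse m) = g ^ (i * e) / m"
 proof -
  have "N' ~= 0" "of_int N = (of_int q ^ e * of_int N' :: 'k)" using N(1) N'(1) by auto
  thus ?thesis using q(1) m by (simp add: power_divide power_mult[symmetric] field_simps)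
 qed
 finally show thesis by (rule that)
qed

section \<open>Quaternion algebras and their trace form\<close>

context quaternion_algebra
begin

lemma linearI_smul:
 assumes "!!x y. f (x + y) = f x + f y" "!!c x. f (smul c x) = smul c (f x)"
 shows "Vector_Spaces.linear smul smul f"
 using assms vector_space_axioms by (simp add: Vector_Spaces.linear_iff)

definition basis4 :: "(nat => 'b) => bool" where
 "basis4 e \<longleftrightarrow> inj_on e {..<4} & independent (e ` {..<4}) & span (e ` {..<4}) = UNIV"

definition crd :: "(nat => 'b) => nat => 'b => 'k" where
 "crd e k x = representation (e ` {..<4}) x (e k)"

lemma crd_expand:
 assumes "basis4 e" shows "x = (\<Sum>k<4. smul (crd e k x) (e k))"
proof -
 have "(\<Sum>b\<in>e ` {..<4}. smul (representation (e ` {..<4}) x b) b) = x"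
  using assms by (intro sum_representation_eq) (auto simp: basis4_def)
 thus ?thesis using assms by (simp add: basis4_def sum.reindex crd_def)
qed

lemma crd_add: "basis4 e ==> crd e k (x + y) = crd e k x + crd e k y"
 and crd_smul: "basis4 e ==> crd e k (smul c x) = c * crd e k x"
 unfolding crd_def basis4_def by (simp_all add: representation_add representation_scale)

lemma crd_zero: "basis4 e ==> crd e k 0 = 0"
 using crd_smul[of e k 0 0] by simp

lemma crd_sum: "basis4 e ==> crd e k (sum f A) = (\<Sum>i\<in>A. crd e k (f i))"
 by (induction A rule: infinite_finite_induct) (simp_all add: crd_add crd_zero)

lemma crd_basis: "basis4 e ==> k < 4 ==> l < 4 ==> crd e k (e l) = (if k = l then 1 else 0)"
 unfolding crd_def basis4_def by (subst representation_basis) (auto simp: inj_on_def)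

lemma crd_unique:
 assumes "basis4 e" "x = (\<Sum>l<4. smul (c l) (e l))" "k < 4"
 shows "crd e k x = c k"
proof -
 have "crd e k x = (\<Sum>l<4. c l * (if k = l then 1 else 0))"
  unfolding assms(2) crd_sum[OF assms(1)] crd_smul[OF assms(1)]
  by (rule sum.cong) (use crd_basis[OF assms(1,3)] in auto)
 thus ?thesis using assms(3) by (simp add: if_distrib cong: if_cong)
qed

lemma crd_eqI:
 assumes "basis4 e" "!!k. k < 4 ==> crd e k x = crd e k y" shows "x = y"
 by (subst crd_expand[OF assms(1), of x], subst crd_expand[OF assms(1), of y])
  (rule sum.cong, use assms(2) in auto)

lemma basis4I_span:
 assumes "span (e ` {..<4}) = UNIV" shows "basis4 e"
proof -
 have le: "4 \<le> card (e ` S)" if "finite S" "span (e ` S) = UNIV" for S :: "nat set"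
  using dim_le_card[of UNIV "e ` S"] dim_4 that by auto
 have c: "card (e ` {..<4}) = 4"
  using le[of "{..<4}"] assms card_image_le[of "{..<4::nat}" e] by simp
 hence inj: "inj_on e {..<4}" by (intro eq_card_imp_inj_on) auto
 moreover have "independent (e ` {..<4})"
 proof
  assume "dependent (e ` {..<4})"
  then obtain b where b: "b \<in> e ` {..<4}" "b \<in> span (e ` {..<4} - {b})"
   by (auto simp: dependent_def)
  have "span (e ` {..<4} - {b}) = UNIV"
   using span_redundant[OF b(2)] b(1) assms by (simp add: insert_absorb)
  hence "4 \<le> card (e ` {..<4} - {b})"
   using dim_le_card[of UNIV "e ` {..<4} - {b}"] dim_4 by simp
  thus False using c b(1) by (simp add: card_Diff_singleton)
 qed
 ultimately show ?thesis using assms by (simp add: basis4_def)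
qed

lemma exists_basis4: "\<exists>e. basis4 e"
proof -
 obtain B where B: "independent B" "UNIV \<subseteq> span B" "card B = dim UNIV"
  using basis_exists[of UNIV] by blast
 hence "card B = 4" using dim_4 by simp
 hence "finite B" by (metis card.infinite zero_neq_numeral)
 then obtain bs where bs: "set bs = B" "distinct bs" using finite_distinct_list by blast
 have "length bs = 4" using bs \<open>card B = 4\<close> distinct_card by metis
 hence "(!) bs ` {..<4} = B" using bs by (auto simp: set_conv_nth)
 thus ?thesis using basis4I_span[of "(!) bs"] B(2) by auto
qed

lemma finite_dim_basis4:
 assumes "basis4 e" shows "finite_dimensional_vector_space smul (e ` {..<4})"
 using assms by unfold_locales (auto simp: basis4_def)

lemma mult_sum_right: "x * (\<Sum>i\<in>A. smul (c i) (f i)) = (\<Sum>i\<in>A. smul (c i) (x * f i))"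
 by (simp add: sum_distrib_left smul_mult_right)

lemma mult_sum_left: "(\<Sum>i\<in>A. smul (c i) (f i)) * x = (\<Sum>i\<in>A. smul (c i) (f i * x))"
 by (simp add: sum_distrib_right smul_mult_left)

text \<open>Trace of left multiplication, which is twice the reduced trace. It needs no involution,
  and \<open>tr 1 = 4\<close> is invertible in K. The choice of the basis is immaterial by
  \<open>tr_eq\<close>.\<close>

definition tr :: "'b => 'k" where
 "tr x = (\<Sum>k<4. crd (SOME e. basis4 e) k (x * (SOME e. basis4 e) k))"

lemma tr_eq:
 assumes e: "basis4 e" shows "tr x = (\<Sum>k<4. crd e k (x * e k))"
proof -
 define b where "b = (SOME e. basis4 e)"
 have b: "basis4 b" unfolding b_def using exists_basis4 by (rule someI_ex)
 have "(\<Sum>k<4. crd e k (x * e k)) = (\<Sum>k<4. \<Sum>i<4. crd b i (e k) * crd e k (x * b i))"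
  by (subst (2) crd_expand[OF b]) (simp add: mult_sum_right crd_sum[OF e] crd_smul[OF e])
 also have "\<dots> = (\<Sum>i<4. \<Sum>k<4. crd e k (x * b i) * crd b i (e k))"
  by (subst sum.swap) (simp add: mult.commute)
 also have "\<dots> = (\<Sum>i<4. crd b i (\<Sum>k<4. smul (crd e k (x * b i)) (e k)))"
  by (simp add: crd_sum[OF b] crd_smul[OF b])
 also have "\<dots> = tr x" unfolding crd_expand[OF e, symmetric] by (simp add: tr_def b_def)
 finally show ?thesis by simp
qed

lemma tr_add: "tr (x + y) = tr x + tr y" and tr_smul: "tr (smul c x) = c * tr x"
proof -
 obtain e where e: "basis4 e" using exists_basis4 by blast
 show "tr (x + y) = tr x + tr y" "tr (smul c x) = c * tr x"
  unfolding tr_eq[OF e] by (simp_all add: distrib_right crd_add[OF e] sum.distrib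
    smul_mult_left crd_smul[OF e] sum_distrib_left)
qed

lemma tr_zero: "tr 0 = 0" using tr_smul[of 0 0] by simp

lemma tr_diff: "tr (x - y) = tr x - tr y"
 using tr_add[of "x - y" y] by simp

lemma tr_sum: "tr (sum f A) = (\<Sum>i\<in>A. tr (f i))"
 by (induction A rule: infinite_finite_induct) (simp_all add: tr_add tr_zero)

lemma tr_one: "tr 1 = 4"
proof -
 obtain e where e: "basis4 e" using exists_basis4 by blast
 show ?thesis unfolding tr_eq[OF e] by (simp add: crd_basis[OF e])
qed

lemma tr_commute: "tr (x * y) = tr (y * x)"
proof -
 obtain e where e: "basis4 e" using exists_basis4 by blast
 have *: "tr (x * y) = (\<Sum>k<4. \<Sum>l<4. crd e l (y * e k) * crd e k (x * e l))" for x y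
  unfolding tr_eq[OF e] mult.assoc
  by (rule sum.cong[OF refl], subst crd_expand[OF e, of "y * e _"])
   (simp add: mult_sum_right crd_sum[OF e] crd_smul[OF e])
 show ?thesis unfolding * by (subst sum.swap) (simp add: mult.commute)
qed

text \<open>The radical of the trace form is a two-sided ideal that misses 1, hence zero by
  simplicity.\<close>

lemma tr_nondegenerate:
 assumes "!!y. tr (x * y) = 0" shows "x = 0"
proof -
 define I where "I = {x. \<forall>y. tr (x * y) = 0}"
 have "ideal I (ring_on (UNIV :: 'b set))"
 proof (subst ideal_ring_on_iff)
  show "ring (ring_on (UNIV :: 'b set))" by (rule ring_ring_on) auto
  have "tr (a * x * y) = 0" if "x \<in> I" for a x y
   using that tr_commute[of a "x * y"] by (auto simp: I_def mult.assoc)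
  thus "I \<subseteq> UNIV & 0 \<in> I & (\<forall>x\<in>I. \<forall>y\<in>I. x + y \<in> I) & (\<forall>a\<in>UNIV. \<forall>x\<in>I. a * x \<in> I & x * a \<in> I)"
   by (auto simp: I_def distrib_right tr_add tr_zero mult.assoc)
 qed auto
 moreover have "1 \<notin> I" using tr_one by (auto simp: I_def intro!: exI[of _ 1])
 ultimately have "I = {0}" using simple[of I] by auto
 thus ?thesis using assms by (auto simp: I_def)
qed

definition dual4 :: "(nat => 'b) => (nat => 'b) => bool" where
 "dual4 e a \<longleftrightarrow> basis4 e & (\<forall>k<4. \<forall>l<4. tr (a k * e l) = (if k = l then 1 else 0))"

lemma dual4_basis: "dual4 e a ==> basis4 e" by (simp add: dual4_def)

lemma dual4_tr:
 assumes "dual4 e a" "k < 4" shows "tr (a k * x) = crd e k x"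
proof -
 have e: "basis4 e" using assms by (simp add: dual4_def)
 have "tr (a k * x) = (\<Sum>l<4. crd e l x * tr (a k * e l))"
  by (subst crd_expand[OF e, of x]) (simp add: mult_sum_right tr_sum tr_smul)
 also have "\<dots> = (\<Sum>l<4. crd e l x * (if k = l then 1 else 0))"
  by (rule sum.cong) (use assms in \<open>auto simp: dual4_def\<close>)
 finally show ?thesis using assms(2) by (simp add: if_distrib cong: if_cong)
qed

lemma tr_eqI:
 assumes "basis4 e" "!!k. k < 4 ==> tr (x * e k) = tr (y * e k)" shows "x = y"
proof -
 have "tr ((x - y) * z) = 0" for z
  by (subst crd_expand[OF assms(1), of z])
   (simp add: mult_sum_right tr_sum tr_smul left_diff_distrib tr_diff assms(2))
 from tr_nondegenerate[OF this] show ?thesis by simp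
qed

text \<open>By nondegeneracy the traces against \<open>e\<close> determine an element, so by
  dimension every vector of traces occurs.\<close>

lemma exists_dual4:
 assumes e: "basis4 e" shows "\<exists>a. dual4 e a"
proof -
 interpret fd: finite_dimensional_vector_space smul "e ` {..<4}" by (rule finite_dim_basis4[OF e])
 define f where "f = (%x. \<Sum>l<4. smul (tr (x * e l)) (e l))"
 have crd_f: "crd e k (f x) = tr (x * e k)" if "k < 4" for k x
  by (rule crd_unique[OF e _ that]) (simp add: f_def)
 have "Vector_Spaces.linear smul smul f"
  by (rule linearI_smul) (simp_all add: f_def distrib_right tr_add scale_left_distrib sum.distrib
    smul_mult_left tr_smul scale_sum_right)
 moreover have "inj f"
  by (rule injI, rule tr_eqI[OF e]) (metis crd_f)
 ultimately have "surj f" by (rule fd.linear_inj_imp_surj)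
 hence "\<exists>x. f x = e k" for k by (metis surjD)
 then obtain a where a: "!!k. f (a k) = e k" by metis
 have "tr (a k * e l) = (if k = l then 1 else 0)" if "k < 4" "l < 4" for k l
  using crd_f[OF that(2), of "a k"] crd_basis[OF e that(2,1)] by (auto simp: a)
 hence "dual4 e a" using e unfolding dual4_def by blast
 thus ?thesis by (intro exI[of _ a])
qed

lemma dual4_expand: "dual4 e a ==> x = (\<Sum>k<4. smul (tr (a k * x)) (e k))"
 by (subst crd_expand[OF dual4_basis, of e a x]) (auto simp: dual4_tr intro!: sum.cong)

lemma dual4_expand': 
 assumes "dual4 e a" shows "x = (\<Sum>k<4. smul (tr (e k * x)) (a k))"
proof (rule tr_eqI[OF dual4_basis[OF assms]])
 fix l :: nat assume l: "l < 4"
 have "tr ((\<Sum>k<4. smul (tr (e k * x)) (a k)) * e l) = (\<Sum>k<4. tr (e k * x) * (if k = l then 1 else 0))"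
  unfolding mult_sum_left tr_sum tr_smul
  by (rule sum.cong) (use assms l in \<open>auto simp: dual4_def\<close>)
 thus "tr (x * e l) = tr ((\<Sum>k<4. smul (tr (e k * x)) (a k)) * e l)"
  using l by (simp add: tr_commute[of x] if_distrib cong: if_cong)
qed

text \<open>Structure constants: the coefficient of \<open>e l\<close> in \<open>e i * e k\<close>.
  Written as traces, they also describe right multiplication by \<open>e i\<close> on the dual
  basis, by the transposed matrix.\<close>

definition sc :: "(nat => 'b) => (nat => 'b) => nat => nat => nat => 'k" where
 "sc e a i k l = tr (a l * (e i * e k))"

lemma sc_mult: "dual4 e a ==> e i * e k = (\<Sum>l<4. smul (sc e a i k l) (e l))"
 unfolding sc_def by (rule dual4_expand)

lemma sc_mult': 
 assumes "dual4 e a" shows "a l * e i = (\<Sum>k<4. smul (sc e a i k l) (a k))"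
proof -
 have "tr (e k * (a l * e i)) = sc e a i k l" for k
  using tr_commute[of "e k" "a l * e i"] by (simp add: sc_def mult.assoc)
 thus ?thesis using dual4_expand'[OF assms, of "a l * e i"] by simp
qed

text \<open>Left multiplication by \<open>e' i\<close> acts on the first factor of
  \<open>e' k * y * a k\<close>, right multiplication by \<open>e i\<close> on the last one, both
  through structure constants. Where the two tables agree, the sum intertwines the multiplications
  for every \<open>y\<close>.\<close>

lemma intertwine:
 assumes "dual4 e a" "dual4 e' a'"
 shows "e' i * (\<Sum>k<4. e' k * y * a k) - (\<Sum>k<4. e' k * y * a k) * e i =
  (\<Sum>k<4. \<Sum>l<4. smul (sc e' a' i k l - sc e a i k l) (e' l * y * a k))"
proof -
 have "e' i * (\<Sum>k<4. e' k * y * a k) = (\<Sum>k<4. (e' i * e' k) * (y * a k))"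
  by (simp add: sum_distrib_left mult.assoc)
 also have "\<dots> = (\<Sum>k<4. \<Sum>l<4. smul (sc e' a' i k l) (e' l * y * a k))"
  by (subst sc_mult[OF assms(2)]) (simp add: mult_sum_left mult.assoc)
 finally have 1: "e' i * (\<Sum>k<4. e' k * y * a k) = (\<Sum>k<4. \<Sum>l<4. smul (sc e' a' i k l) (e' l * y * a k))" .
 have "(\<Sum>k<4. e' k * y * a k) * e i = (\<Sum>l<4. e' l * y * (a l * e i))"
  by (simp add: sum_distrib_right mult.assoc)
 also have "\<dots> = (\<Sum>l<4. \<Sum>k<4. smul (sc e a i k l) (e' l * y * a k))"
  by (subst sc_mult'[OF assms(1)]) (simp add: mult_sum_right mult.assoc)
 also have "\<dots> = (\<Sum>k<4. \<Sum>l<4. smul (sc e a i k l) (e' l * y * a k))" by (rule sum.swap)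
 finally show ?thesis unfolding 1 by (simp add: scale_left_diff_distrib sum_subtractf)
qed

lemma central_smul:
 assumes "basis4 e" "!!i. i < 4 ==> e i * w = w * e i"
 obtains c where "w = smul c 1"
proof -
 have "w * x = x * w" for x
  by (subst (1 2) crd_expand[OF assms(1), of x]) (simp add: mult_sum_left mult_sum_right assms(2))
 hence "w \<in> range (%c. smul c 1)" using central by auto
 thus thesis using that by auto
qed

text \<open>Expanding one of the factors \<open>a k\<close> turns both sums into a contraction with
  the inverse Gram matrix \<open>tr (a l * a k)\<close>, which is symmetric.\<close>

lemma dual4_swap:
 assumes "dual4 e a"
 shows "(\<Sum>k<4. a k * z * e k) = (\<Sum>k<4. e k * z * a k)"
proof -
 have "(\<Sum>k<4. a k * z * e k) = (\<Sum>k<4. \<Sum>l<4. smul (tr (a l * a k)) (e l * z * e k))"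
  by (rule sum.cong[OF refl], subst dual4_expand[OF assms, of "a _"]) (simp add: mult_sum_left)
 also have "\<dots> = (\<Sum>l<4. \<Sum>k<4. smul (tr (a k * a l)) (e l * z * e k))"
  by (subst sum.swap) (simp add: tr_commute)
 also have "\<dots> = (\<Sum>l<4. e l * z * a l)"
  by (rule sum.cong[OF refl], subst (2) dual4_expand[OF assms, of "a _"]) (simp add: mult_sum_right)
 finally show ?thesis .
qed

text \<open>With a single basis \<open>intertwine\<close> has no error term, so the sum is central
  and therefore a scalar, which its trace determines. The case \<open>z = 1\<close> is normalised by
  counting the four dual pairs, and the 4 in the result is \<open>tr 1\<close>.\<close>

lemma casimir:
 assumes d: "dual4 e a"
 shows "(\<Sum>k<4. e k * z * a k) = smul (tr z / 4) 1"
proof -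
 have *: "\<exists>c. (\<Sum>k<4. e k * z * a k) = smul c 1" for z
 proof -
  have "e i * (\<Sum>k<4. e k * z * a k) = (\<Sum>k<4. e k * z * a k) * e i" for i
   using intertwine[OF d d, of i z] by simp
  thus ?thesis by (metis central_smul[OF dual4_basis[OF d]])
 qed
 obtain c1 where c1: "(\<Sum>k<4. e k * a k) = smul c1 1" using *[of 1] by auto
 have "4 = (\<Sum>k<4::nat. tr (a k * e k))"
  using d by (simp add: dual4_def)
 also have "\<dots> = tr (\<Sum>k<4. e k * a k)" by (simp add: tr_sum tr_commute)
 finally have "c1 = 1" by (simp add: c1 tr_smul tr_one)
 obtain c where c: "(\<Sum>k<4. e k * z * a k) = smul c 1" using * by blast
 have "4 * c = tr (\<Sum>k<4. e k * z * a k)" by (simp add: c tr_smul tr_one)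
 also have "\<dots> = (\<Sum>k<4. tr (z * (a k * e k)))"
  unfolding tr_sum by (rule sum.cong[OF refl]) (metis mult.assoc tr_commute)
 also have "\<dots> = tr (z * (\<Sum>k<4. a k * e k))" by (simp add: sum_distrib_left tr_sum)
 also have "(\<Sum>k<4. a k * e k) = (\<Sum>k<4. e k * a k)" using dual4_swap[OF d, of 1] by simp
 also have "tr (z * (\<Sum>k<4. e k * a k)) = tr z" by (simp add: c1 \<open>c1 = 1\<close>)
 finally have "tr z = 4 * c" by simp
 hence "c = tr z / 4" by simp
 thus ?thesis using c by simp
qed

end

section \<open>Conjugating nearby orders\<close>

context quaternion_algebra
begin

definition lam :: "'k set => (nat => 'b) => 'b set" where
 "lam V e = {\<Sum>k<4. smul (c k) (e k) | c. \<forall>k<4. c k \<in> V}"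

lemma lam_iff:
 assumes "basis4 e" shows "x \<in> lam V e \<longleftrightarrow> (\<forall>k<4. crd e k x \<in> V)"
proof
 assume "x \<in> lam V e"
 then obtain c where "x = (\<Sum>k<4. smul (c k) (e k))" "\<forall>k<4. c k \<in> V" by (auto simp: lam_def)
 thus "\<forall>k<4. crd e k x \<in> V" using crd_unique[OF assms] by metis
qed (auto simp: lam_def intro: crd_expand[OF assms])

end

text \<open>\<open>E\<close> bounds all denominators relative to the lattice of \<open>e\<close>:
  those of its dual basis, of \<open>e'\<close>, and of 1/4. The tables agree modulo
  \<open>E ^ 10 * z\<close>; the powers of \<open>E\<close> are spent on denominators, and
  \<open>z\<close> in \<open>P\<close> makes the remaining errors small enough for Nakayama's lemma.
  Bounds for the dual basis of \<open>e'\<close> are derived from these.\<close>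

locale nearby_orders = quaternion_algebra smul + valuation_subring V P
 for smul :: "'k::number_field => 'b::ring_1 => 'b" and V P +
 fixes e a e' a' :: "nat => 'b" and E z :: 'k
 assumes dual: "dual4 e a" and dual': "dual4 e' a'"
  and sc_V: "i < 4 ==> k < 4 ==> l < 4 ==> sc e a i k l \<in> V"
  and sc'_V: "i < 4 ==> k < 4 ==> l < 4 ==> sc e' a' i k l \<in> V"
  and near: "i < 4 ==> k < 4 ==> l < 4 ==>
   \<exists>v\<in>V. sc e' a' i k l - sc e a i k l = E ^ 10 * z * v"
  and z: "z \<in> P" and E: "E \<in> V" "E ~= 0" "E / 4 \<in> V"
  and Ea: "k < 4 ==> smul E (a k) \<in> lam V e"
  and Ee': "k < 4 ==> smul E (e' k) \<in> lam V e"
  and e_0: "e 0 = 1" and e'_0: "e' 0 = 1"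
begin

lemmas basis = dual4_basis[OF dual]
lemmas basis' = dual4_basis[OF dual']

abbreviation "S \<equiv> lam V e"
abbreviation "S' \<equiv> lam V e'"

lemma lam_add: "basis4 f ==> x \<in> lam V f ==> y \<in> lam V f ==> x + y \<in> lam V f"
 by (auto simp: lam_iff crd_add V_add)

lemma lam_smul: "basis4 f ==> v \<in> V ==> x \<in> lam V f ==> smul v x \<in> lam V f"
 by (auto simp: lam_iff crd_smul V_mult)

lemma lam_sum: "basis4 f ==> (!!i. i \<in> A ==> g i \<in> lam V f) ==> sum g A \<in> lam V f"
 by (auto simp: lam_iff crd_sum intro!: V_sum)

lemma lam_base: "basis4 f ==> k < 4 ==> f k \<in> lam V f"
 by (auto simp: lam_iff crd_basis V_0 V_1)

lemma lam_mult:
 assumes d: "dual4 f b" and sc: "!!i k l. i < 4 ==> k < 4 ==> l < 4 ==> sc f b i k l \<in> V"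
  and x: "x \<in> lam V f" and y: "y \<in> lam V f"
 shows "x * y \<in> lam V f"
proof -
 note f = dual4_basis[OF d]
 have m: "f i * f k \<in> lam V f" if "i < 4" "k < 4" for i k
  by (subst sc_mult[OF d]) (use that in \<open>auto intro!: lam_sum lam_smul lam_base f sc\<close>)
 have "x * y = (\<Sum>i<4. smul (crd f i x) (f i * y))"
  by (subst crd_expand[OF f, of x]) (simp add: mult_sum_left)
 also have "\<dots> = (\<Sum>i<4. smul (crd f i x) (\<Sum>k<4. smul (crd f k y) (f i * f k)))"
  by (rule sum.cong[OF refl], subst crd_expand[OF f, of y]) (simp add: mult_sum_right)
 also have "\<dots> \<in> lam V f"
 proof -
  have "crd f i x \<in> V" "crd f i y \<in> V" if "i < 4" for i
   using x y that by (simp_all add: lam_iff[OF f])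
  thus ?thesis by (intro lam_sum lam_smul m f) simp_all
 qed
 finally show ?thesis .
qed

lemmas S_add = lam_add[OF basis] and S_smul = lam_smul[OF basis] and S_sum = lam_sum[OF basis]
lemmas S'_add = lam_add[OF basis'] and S'_smul = lam_smul[OF basis'] and S'_sum = lam_sum[OF basis']
lemmas S_mult = lam_mult[OF dual sc_V]

lemma one_S: "1 \<in> S" using lam_base[OF basis, of 0] by (simp add: e_0)

text \<open>The fractional multiples \<open>E ^ (- j) S\<close>, and their products with \<open>m = E ^ 10 * z\<close>.\<close>

definition L :: "nat => 'b set" where "L j = {x. smul (E ^ j) x \<in> S}"
definition mL :: "nat => 'b set" where "mL j = (%s. smul (E ^ 10 * z) s) ` L j"

lemma L_add: "x \<in> L j ==> y \<in> L j ==> x + y \<in> L j"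
 by (simp add: L_def scale_right_distrib S_add)
lemma L_smul: "v \<in> V ==> x \<in> L j ==> smul v x \<in> L j"
 using S_smul[of v "smul (E ^ j) x"] by (simp add: L_def mult.commute)
lemma L_zero: "0 \<in> L j" using lam_sum[OF basis, of "{}"] by (simp add: L_def)
lemma L_sum: "(!!i. i \<in> A ==> f i \<in> L j) ==> sum f A \<in> L j"
 by (induction A rule: infinite_finite_induct) (simp_all add: L_add L_zero)
lemma L_mono: "x \<in> L i ==> i \<le> j ==> x \<in> L j"
 using S_smul[OF V_power[OF E(1), of "j - i"], of "smul (E ^ i) x"]
 by (simp add: L_def flip: power_add)
lemma L_mult: "x \<in> L i ==> y \<in> L j ==> x * y \<in> L (i + j)"
 using S_mult[of "smul (E ^ i) x" "smul (E ^ j) y"]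
 by (simp add: L_def smul_mult_left smul_mult_right power_add mult.commute)
lemma L_div: "E ^ i * v \<in> V ==> x \<in> L j ==> smul v x \<in> L (i + j)"
 using S_smul[of "E ^ i * v" "smul (E ^ j) x"] by (simp add: L_def power_add mult_ac)
lemma L_S: "x \<in> S ==> x \<in> L 0" by (simp add: L_def)

lemma mL_add: "x \<in> mL j ==> y \<in> mL j ==> x + y \<in> mL j"
 by (auto simp: mL_def image_iff simp flip: scale_right_distrib intro: L_add bexI)
lemma mL_zero: "0 \<in> mL j"
 unfolding mL_def by (rule image_eqI[OF _ L_zero]) simp
lemma mL_sum: "(!!i. i \<in> A ==> f i \<in> mL j) ==> sum f A \<in> mL j"
 by (induction A rule: infinite_finite_induct) (simp_all add: mL_add mL_zero)
lemma mL_mono: "x \<in> mL i ==> i \<le> j ==> x \<in> mL j"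
 unfolding mL_def using L_mono by blast
lemma mL_mult_left: "x \<in> L i ==> y \<in> mL j ==> x * y \<in> mL (i + j)"
 by (auto simp: mL_def smul_mult_right intro: L_mult)
lemma mL_mult_right: "x \<in> mL i ==> y \<in> L j ==> x * y \<in> mL (i + j)"
 by (auto simp: mL_def smul_mult_left intro: L_mult)
lemma mL_div: "E ^ i * v \<in> V ==> x \<in> mL j ==> smul v x \<in> mL (i + j)"
proof -
 assume v: "E ^ i * v \<in> V" and "x \<in> mL j"
 then obtain s where "s \<in> L j" "x = smul (E ^ 10 * z) s" by (auto simp: mL_def)
 thus ?thesis unfolding mL_def using L_div[OF v, of s j]
  by (intro image_eqI[of _ _ "smul v s"]) (auto simp: mult_ac)
qed
lemma mL_I: "s \<in> L j ==> smul (E ^ 10 * z) s \<in> mL j" unfolding mL_def by (rule imageI)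

lemma e_L: "k < 4 ==> e k \<in> L 0" by (rule L_S[OF lam_base[OF basis]])
lemma e'_L: "k < 4 ==> e' k \<in> L 1" using Ee' by (simp add: L_def)
lemma a_L: "k < 4 ==> a k \<in> L 1" using Ea by (simp add: L_def)



section \<open>Gram matrices of the two bases and their inverses\<close>

definition "G k l = tr (e k * e l)"
definition "G' k l = tr (e' k * e' l)"
definition "A k l = tr (a k * a l)"
definition "W k l = tr (a' k * a' l)"

lemma tr_V: "x \<in> S ==> tr x \<in> V"
proof -
 assume x: "x \<in> S"
 have "x * e k \<in> S" if "k < 4" for k using S_mult[OF _ _ _ x lam_base[OF basis that]] by blast
 thus ?thesis unfolding tr_eq[OF basis] by (intro V_sum) (auto simp: lam_iff[OF basis])
qed

text \<open>The trace of a product is a polynomial in the structure constants with integral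
  coefficients, so the Gram matrices inherit the full precision of the tables.\<close>

lemma gram_near: 
 assumes "k < 4" "l < 4" shows "\<exists>v\<in>V. G' k l - G k l = E ^ 10 * z * v"
proof -
 have g: "tr (f k * f l) = (\<Sum>i<4. \<Sum>j<4. sc f b k l j * sc f b j i i)" if "dual4 f b" for f b
 proof -
  have "tr (f k * f l) = (\<Sum>i<4. tr (b i * (f k * f l * f i)))"
   by (subst tr_eq[OF dual4_basis[OF that]], rule sum.cong) (simp_all add: dual4_tr[OF that])
  also have "\<dots> = (\<Sum>i<4. \<Sum>j<4. sc f b k l j * sc f b j i i)"
   by (rule sum.cong[OF refl], subst sc_mult[OF that])
    (simp add: mult_sum_left mult_sum_right tr_sum tr_smul sc_def)
  finally show ?thesis .
 qed
 let ?c = "sc e a" and ?c' = "sc e' a'"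
 have "\<exists>v\<in>V. ?c' k l j * ?c' j i i - ?c k l j * ?c j i i = E ^ 10 * z * v" if ij: "i < 4" "j < 4" for i j
 proof -
  obtain v w where v: "v \<in> V" "?c' k l j - ?c k l j = E ^ 10 * z * v"
   and w: "w \<in> V" "?c' j i i - ?c j i i = E ^ 10 * z * w"
   using near[OF assms ij(2)] near[OF ij(2,1,1)] by metis
  have "?c' k l j * ?c' j i i - ?c k l j * ?c j i i =
    ?c' k l j * (?c' j i i - ?c j i i) + (?c' k l j - ?c k l j) * ?c j i i"
   by (simp add: algebra_simps)
  also have "\<dots> = E ^ 10 * z * (?c' k l j * w + v * ?c j i i)"
   unfolding v w by (simp add: algebra_simps)
  finally show ?thesis using v w assms ij
   by (intro bexI[of _ "?c' k l j * w + v * ?c j i i"]) (auto intro!: V_add V_mult sc_V sc'_V)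
 qed
 then obtain v where v: "!!i j. i < 4 ==> j < 4 ==> v i j \<in> V"
  "!!i j. i < 4 ==> j < 4 ==> ?c' k l j * ?c' j i i - ?c k l j * ?c j i i = E ^ 10 * z * v i j"
  by metis
 have "G' k l - G k l = (\<Sum>i<4. \<Sum>j<4. E ^ 10 * z * v i j)"
  unfolding G_def G'_def g[OF dual] g[OF dual'] sum_subtractf[symmetric]
  by (intro sum.cong refl v) auto
 thus ?thesis by (intro bexI[of _ "\<Sum>i<4. \<Sum>j<4. v i j"])
  (auto simp: sum_distrib_left intro!: V_sum v)
qed

lemma A_V: "k < 4 ==> l < 4 ==> E * A k l \<in> V"
proof -
 assume k: "k < 4" and l: "l < 4"
 have "crd e k (smul E (a l)) \<in> V" using Ea[OF l] k by (auto simp: lam_iff[OF basis])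
 thus ?thesis using dual4_tr[OF dual k, of "smul E (a l)"]
  by (simp add: A_def smul_mult_right tr_smul)
qed

lemma a_A: "a k = (\<Sum>l<4. smul (A k l) (e l))"
 by (subst dual4_expand[OF dual, of "a k"]) (simp add: A_def tr_commute)

lemma a'_W: "a' k = (\<Sum>l<4. smul (W k l) (e' l))"
 by (subst dual4_expand[OF dual', of "a' k"]) (simp add: W_def tr_commute)

lemma A_G: "k < 4 ==> j < 4 ==> (\<Sum>l<4. A k l * G l j) = (if k = j then 1 else 0)"
proof -
 assume kj: "k < 4" "j < 4"
 have "tr (a k * e j) = (\<Sum>l<4. A k l * G l j)"
  by (subst a_A) (simp add: mult_sum_left tr_sum tr_smul G_def)
 thus ?thesis using dual kj by (simp add: dual4_def)
qed

lemma G'_W: "l < 4 ==> k < 4 ==> (\<Sum>j<4. G' l j * W j k) = (if l = k then 1 else 0)"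
proof -
 assume lk: "l < 4" "k < 4"
 have "tr (a' k * e' l) = (\<Sum>j<4. W k j * G' j l)"
  by (subst a'_W) (simp add: mult_sum_left tr_sum tr_smul G'_def)
 also have "\<dots> = (\<Sum>j<4. G' l j * W j k)"
  by (rule sum.cong[OF refl]) (simp add: W_def G'_def tr_commute mult.commute)
 finally have "(\<Sum>j<4. G' l j * W j k) = tr (a' k * e' l)" by simp
 also have "\<dots> = (if k = l then 1 else 0)" using dual' lk by (simp add: dual4_def)
 finally show ?thesis by (simp add: eq_commute)
qed

text \<open>\<open>A\<close> and \<open>W\<close> are the inverses of the Gram matrices
  \<open>G\<close> and \<open>G'\<close>; with \<open>Q = A (G' - G)\<close> they are related by
  \<open>W = A - Q W\<close>.\<close>

definition "Q i j = (\<Sum>l<4. A i l * (G' l j - G l j))"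

lemma W_eq: "i < 4 ==> k < 4 ==> W i k = A i k - (\<Sum>j<4. Q i j * W j k)"
proof -
 assume ik: "i < 4" "k < 4"
 have q: "Q i j = (\<Sum>l<4. A i l * G' l j) - (\<Sum>l<4. A i l * G l j)" for j
  unfolding Q_def sum_subtractf[symmetric] by (rule sum.cong[OF refl]) (rule right_diff_distrib)
 have 1: "(\<Sum>j<4. (\<Sum>l<4. A i l * G l j) * W j k) = W i k"
 proof -
  have "(\<Sum>j<4. (\<Sum>l<4. A i l * G l j) * W j k) = (\<Sum>j<4. if i = j then W j k else 0)"
  proof (rule sum.cong[OF refl])
   fix j :: nat assume "j \<in> {..<4}"
   hence "(\<Sum>l<4. A i l * G l j) = (if i = j then 1 else 0)" using A_G ik by simp
   thus "(\<Sum>l<4. A i l * G l j) * W j k = (if i = j then W j k else 0)" by simp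
  qed
  thus ?thesis using ik by simp
 qed
 have 2: "(\<Sum>j<4. (\<Sum>l<4. A i l * G' l j) * W j k) = A i k"
 proof -
  have "(\<Sum>j<4. (\<Sum>l<4. A i l * G' l j) * W j k) = (\<Sum>j<4. \<Sum>l<4. A i l * (G' l j * W j k))"
   unfolding sum_distrib_right mult.assoc by (rule refl)
  also have "\<dots> = (\<Sum>l<4. A i l * (\<Sum>j<4. G' l j * W j k))"
   unfolding sum_distrib_left by (rule sum.swap)
  also have "\<dots> = (\<Sum>l<4. if l = k then A i l else 0)"
  proof (rule sum.cong[OF refl])
   fix l :: nat assume "l \<in> {..<4}"
   hence "(\<Sum>j<4. G' l j * W j k) = (if l = k then 1 else 0)" using G'_W ik by simp
   thus "A i l * (\<Sum>j<4. G' l j * W j k) = (if l = k then A i l else 0)" by simp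
  qed
  also have "\<dots> = A i k" using ik by simp
  finally show ?thesis .
 qed
 show ?thesis unfolding q left_diff_distrib sum_subtractf 1 2 by simp
qed

lemma E_powers: "E ^ 10 = E ^ 9 * E" "E ^ 9 = E ^ 8 * E" "E ^ 10 = E * (E ^ 2 * E ^ 7)"
 by (simp_all add: power_numeral_reduce)

lemma Q_V: "i < 4 ==> j < 4 ==> \<exists>v\<in>V. Q i j = E ^ 9 * z * v"
proof -
 assume ij: "i < 4" "j < 4"
 have "\<forall>l\<in>{..<4}. \<exists>v. v \<in> V & G' l j - G l j = E ^ 10 * z * v" using gram_near ij(2) by blast
 from bchoice[OF this] obtain v where v: "!!l. l < 4 ==> v l \<in> V"
  "!!l. l < 4 ==> G' l j - G l j = E ^ 10 * z * v l" by auto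
 have "Q i j = (\<Sum>l<4. E ^ 9 * z * (E * A i l * v l))"
  unfolding Q_def by (rule sum.cong) (simp_all only: v E_powers(1) mult_ac lessThan_iff)
 hence "Q i j = E ^ 9 * z * (\<Sum>l<4. E * A i l * v l)" by (simp only: sum_distrib_left)
 moreover have "(\<Sum>l<4. E * A i l * v l) \<in> V"
  by (rule V_sum) (simp add: V_mult[OF A_V[OF ij(1)] v(1)])
 ultimately show ?thesis by (rule bexI)
qed

text \<open>This bounds the dual basis of \<open>e'\<close>: every column of \<open>E W\<close>
  solves a linear system with coefficients in \<open>P\<close> and right-hand side in
  \<open>V\<close>.\<close>

lemma W_V: "i < 4 ==> k < 4 ==> E * W i k \<in> V"
proof -
 assume i: "i < 4" and k: "k < 4"
 show ?thesis
 proof (rule nakayama[of "{..<4}" "%i. E * A i k" "%i j. - Q i j" "%i. E * W i k"])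
  show "- Q i j \<in> P" if "i \<in> {..<4}" "j \<in> {..<4}" for i j
  proof -
   have "i < 4" "j < 4" using that by auto
   from Q_V[OF this] obtain v where "v \<in> V" "Q i j = E ^ 9 * v * z" by (auto simp: mult_ac)
   thus ?thesis using P_minus P_mult[OF V_mult[OF V_power[OF E(1)]] z] by simp
  qed
  show "E * W i k = E * A i k + (\<Sum>j<4. - Q i j * (E * W j k))" if "i \<in> {..<4}" for i
   by (subst W_eq) (use that k in \<open>simp_all add: right_diff_distrib sum_negf sum_distrib_left mult_ac\<close>)
 qed (use i k in \<open>auto intro: A_V\<close>)
qed

text \<open>The difference is \<open>Q W\<close>. One factor \<open>E\<close> was lost to the
  denominator of \<open>A\<close> in \<open>Q\<close>, a second one is lost here to that of
  \<open>W\<close>.\<close>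

lemma AW_V: "k < 4 ==> l < 4 ==> \<exists>v\<in>V. A k l - W k l = E ^ 8 * z * v"
proof -
 assume kl: "k < 4" "l < 4"
 have "\<forall>j\<in>{..<4}. \<exists>v. v \<in> V & Q k j = E ^ 9 * z * v" using Q_V kl(1) by blast
 from bchoice[OF this] obtain v where v: "!!j. j < 4 ==> v j \<in> V"
  "!!j. j < 4 ==> Q k j = E ^ 9 * z * v j" by auto
 have "A k l - W k l = (\<Sum>j<4. Q k j * W j l)" using W_eq[OF kl] by simp
 also have "\<dots> = (\<Sum>j<4. E ^ 8 * z * (v j * (E * W j l)))"
  by (rule sum.cong) (simp_all only: v E_powers(2) mult_ac lessThan_iff)
 finally have "A k l - W k l = E ^ 8 * z * (\<Sum>j<4. v j * (E * W j l))" by (simp only: sum_distrib_left)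
 moreover have "(\<Sum>j<4. v j * (E * W j l)) \<in> V"
  by (rule V_sum) (simp add: V_mult[OF v(1) W_V] kl)
 ultimately show ?thesis by (rule bexI)
qed

lemma a'_L: "k < 4 ==> a' k \<in> L 2"
proof -
 assume k: "k < 4"
 have "smul E (a' k) = (\<Sum>l<4. smul (E * W k l) (e' l))" by (subst a'_W) (simp add: scale_sum_right)
 also have "\<dots> \<in> L 1" by (intro L_sum L_smul W_V k e'_L) auto
 finally show ?thesis by (simp add: L_def power2_eq_square mult.commute numeral_2_eq_2)
qed

text \<open>Coordinates with respect to \<open>e'\<close> are traces against \<open>a'\<close>, and
  \<open>a'\<close> is expanded in \<open>e'\<close> through \<open>W\<close>. One factor
  \<open>E\<close> clears \<open>W\<close>, the other clears \<open>e'\<close>.\<close>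

lemma S_in_S': "x \<in> S ==> smul (E ^ 2) x \<in> S'"
proof -
 assume x: "x \<in> S"
 have t: "E * tr (e' l * x) \<in> V" if "l < 4" for l
 proof -
  have "smul E (e' l) * x \<in> S" using S_mult[OF _ _ _ Ee'[OF that] x] by blast
  from tr_V[OF this] show ?thesis by (simp add: smul_mult_left tr_smul)
 qed
 have "crd e' k (smul (E ^ 2) x) = (\<Sum>l<4. (E * W k l) * (E * tr (e' l * x)))" if "k < 4" for k
  unfolding dual4_tr[OF dual' that, symmetric]
  by (subst a'_W) (simp add: mult_sum_left smul_mult_right tr_sum tr_smul power2_eq_square
    sum_distrib_left mult_ac)
 thus ?thesis unfolding lam_iff[OF basis'] using W_V t by (auto intro!: V_sum V_mult[OF W_V t])
qed

lemma mL_PS: "x \<in> mL j ==> j \<le> 9 ==> \<exists>s\<in>S. x = smul z s"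
proof -
 assume "x \<in> mL j" "j \<le> 9"
 then obtain s where s: "s \<in> L 9" "x = smul (E ^ 10 * z) s" using mL_mono mL_def by blast
 have "x = smul z (smul E (smul (E ^ 9) s))" by (simp only: s(2) E_powers(1) scale_scale mult_ac)
 moreover have "smul E (smul (E ^ 9) s) \<in> S"
  using S_smul[OF E(1), of "smul (E ^ 9) s"] s(1) by (simp only: L_def mem_Collect_eq)
 ultimately show ?thesis by (rule bexI)
qed

text \<open>Two of the ten factors pay for the passage from \<open>S\<close> to \<open>S'\<close>,
  one is spare, and seven remain for the error; inside \<open>S\<close> it would be nine.\<close>

lemma mL_PS': "x \<in> mL j ==> j \<le> 7 ==> \<exists>s\<in>S'. x = smul z s"
proof -
 assume "x \<in> mL j" "j \<le> 7"
 then obtain s where s: "s \<in> L 7" "x = smul (E ^ 10 * z) s" using mL_mono mL_def by blast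
 have "x = smul z (smul E (smul (E ^ 2) (smul (E ^ 7) s)))"
  by (simp only: s(2) E_powers(3) scale_scale mult_ac)
 moreover have "smul E (smul (E ^ 2) (smul (E ^ 7) s)) \<in> S'"
  using S'_smul[OF E(1) S_in_S', of "smul (E ^ 7) s"] s(1) by (simp only: L_def mem_Collect_eq)
 ultimately show ?thesis by (rule bexI)
qed

lemma intertwine_L: 
 assumes "dual4 f b" "dual4 f' b'" "i < 4"
  and "!!k l. k < 4 ==> l < 4 ==> \<exists>v\<in>V. sc f' b' i k l - sc f b i k l = E ^ 10 * z * v"
  and "!!k l. k < 4 ==> l < 4 ==> f' l * y * b k \<in> L j"
 shows "f' i * (\<Sum>k<4. f' k * y * b k) - (\<Sum>k<4. f' k * y * b k) * f i \<in> mL j"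
proof (subst intertwine[OF assms(1,2)], intro mL_sum)
 fix k l :: nat assume kl: "k \<in> {..<4}" "l \<in> {..<4}"
 then obtain v where v: "v \<in> V" "sc f' b' i k l - sc f b i k l = E ^ 10 * z * v" using assms(4) by auto
 have "smul (E ^ 10 * z) (smul v (f' l * y * b k)) \<in> mL j"
  by (intro mL_I L_smul v assms(5)) (use kl in auto)
 thus "smul (sc f' b' i k l - sc f b i k l) (f' l * y * b k) \<in> mL j" using v by simp
qed

text \<open>\<open>V\<close> need not be complete, so Nakayama's lemma replaces the geometric
  series: in coordinates \<open>v = (1 + z s) v - z s v\<close> is a system with coefficients in
  \<open>P\<close>. The homogeneous case gives injectivity, hence a solution of
  \<open>(1 + z s) u = 1\<close>; the inhomogeneous case puts its coordinates into
  \<open>V\<close>.\<close>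

lemma invertible_one_add:
 assumes "s \<in> S" obtains u where "u \<in> S" "(1 + smul z s) * u = 1"
proof -
 have p: "- z * crd e k (s * e l) \<in> P" if "k < 4" "l < 4" for k l
 proof -
  have "s * e l \<in> S" using S_mult[OF _ _ _ assms lam_base[OF basis that(2)]] by blast
  hence "- crd e k (s * e l) \<in> V" using that by (auto simp: lam_iff[OF basis] V_minus)
  from P_mult[OF this z] show ?thesis by (simp add: mult.commute)
 qed
 have c: "crd e k v = crd e k ((1 + smul z s) * v) + (\<Sum>l<4. (- z * crd e k (s * e l)) * crd e l v)" for k v
 proof -
  have "s * v = (\<Sum>l<4. smul (crd e l v) (s * e l))"
   by (subst crd_expand[OF basis, of v]) (simp add: mult_sum_right)
  hence "crd e k (s * v) = (\<Sum>l<4. crd e l v * crd e k (s * e l))"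
   by (simp add: crd_sum[OF basis] crd_smul[OF basis])
  thus ?thesis
   by (simp add: distrib_right crd_add[OF basis] smul_mult_left crd_smul[OF basis]
     sum_negf sum_distrib_left mult_ac)
 qed
 interpret fd: finite_dimensional_vector_space smul "e ` {..<4}" by (rule finite_dim_basis4[OF basis])
 let ?f = "%v. (1 + smul z s) * v"
 have lin: "Vector_Spaces.linear smul smul ?f" by (rule linearI_smul) (simp_all add: distrib_left smul_mult_right)
 interpret f: Vector_Spaces.linear smul smul ?f by (rule lin)
 have "inj ?f"
 proof (rule f.inj_iff_eq_0[THEN iffD2], intro allI impI)
  fix v assume v: "?f v = 0"
  have cv: "crd e k v = (\<Sum>l<4. (- z * crd e k (s * e l)) * crd e l v)" for k
   using c[of k v] unfolding v crd_zero[OF basis] by simp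
  have "crd e k v = 0" if "k < 4" for k
   by (rule nakayama_zero[of "{..<4}" "%k l. - z * crd e k (s * e l)" "%k. crd e k v", OF _ _ cv])
    (use p that in auto)
  thus "v = 0" by (intro crd_eqI[OF basis]) (simp add: crd_zero[OF basis])
 qed
 hence "surj ?f" by (rule fd.linear_inj_imp_surj[OF lin])
 then obtain u where u: "?f u = 1" by (metis surjD)
 have "crd e k u \<in> V" if "k < 4" for k
  by (rule nakayama[of "{..<4}" "%k. crd e k 1" "%k l. - z * crd e k (s * e l)" "%k. crd e k u",
     OF _ _ _ c[of _ u, unfolded u]])
   (use p that one_S in \<open>auto simp: lam_iff[OF basis]\<close>)
 hence "u \<in> S" by (simp add: lam_iff[OF basis])
 with u that show thesis by blast
qed

text \<open>Left multiplication by \<open>y\<close> is injective, hence surjective by finite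
  dimension.\<close>

lemma right_inverse_imp_left:
 assumes "x * y = (1::'b)" shows "y * x = 1"
proof -
 interpret fd: finite_dimensional_vector_space smul "e ` {..<4}" by (rule finite_dim_basis4[OF basis])
 have lin: "Vector_Spaces.linear smul smul (%v. y * v)" by (rule linearI_smul) (simp_all add: distrib_left smul_mult_right)
 have "inj (%v. y * v)" by (rule injI) (metis assms mult.assoc mult_1_left)
 hence "surj (%v. y * v)" by (rule fd.linear_inj_imp_surj[OF lin])
 then obtain w where "y * w = 1" by (metis surjD)
 moreover have "w = x" by (metis assms calculation mult.assoc mult_1_left mult_1_right)
 ultimately show ?thesis by simp
qed

text \<open>An intertwiner \<open>x\<close> and one in the opposite direction, \<open>x'\<close>,
  multiply to a scalar plus an error. The difficulty is to choose their parameters so that this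
  scalar is not too divisible, since the inverse of \<open>x\<close> contains its reciprocal; a sum
  over a basis shows that some basis vector will do.\<close>

theorem conjugate:
 obtains x \<xi> where "x * \<xi> = 1" "\<xi> * x = 1"
  "!!s. s \<in> S ==> x * s * \<xi> \<in> S'" "!!s. s \<in> S' ==> \<xi> * s * x \<in> S"
proof -
 \<comment> \<open>\<open>F l\<close> is the intertwiner from \<open>e'\<close> back to
   \<open>e\<close> with parameter \<open>e' l\<close>, and \<open>t l\<close> is four times the
   scalar to be expected in \<open>x * x'\<close> for \<open>y = smul E (a' l)\<close>.\<close>
 define F where "F l = (\<Sum>k<4. e k * e' l * a' k)" for l
 define t where "t l = tr (smul E (a' l) * F l)" for l
 \<comment> \<open>Summation over \<open>l\<close> produces the Casimir sums of the
   \<open>a' k\<close>, scalars that vanish unless \<open>k = 0\<close>, because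
   \<open>e' 0 = 1\<close> makes \<open>tr (a' k)\<close> a Kronecker delta. With
   \<open>e 0 = 1\<close> only 1/4 remains, and its trace is 1.\<close>
 have "(\<Sum>l<4. t l) = E"
 proof -
  have "(\<Sum>l<4. F l * a' l) = (\<Sum>l<4. \<Sum>k<4. e k * (e' l * a' k * a' l))"
   by (simp add: F_def sum_distrib_right mult.assoc)
  also have "\<dots> = (\<Sum>k<4. e k * (\<Sum>l<4. e' l * a' k * a' l))"
   by (subst sum.swap) (simp add: sum_distrib_left)
  also have "\<dots> = (\<Sum>k<4::nat. if k = 0 then smul (1 / 4) 1 else 0)"
  proof (rule sum.cong[OF refl])
   fix k :: nat assume "k \<in> {..<4}"
   hence "tr (a' k * e' 0) = (if k = 0 then 1 else 0)" using dual' by (simp add: dual4_def)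
   hence "tr (a' k) = (if k = 0 then 1 else 0)" by (simp add: e'_0)
   thus "e k * (\<Sum>l<4. e' l * a' k * a' l) = (if k = 0 then smul (1 / 4) 1 else 0)"
    unfolding casimir[OF dual'] by (simp add: smul_mult_right e_0)
  qed
  also have "\<dots> = smul (1 / 4) 1" by simp
  finally have s: "(\<Sum>l<4. F l * a' l) = smul (1 / 4) 1" .
  have "(\<Sum>l<4. t l) = E * tr (\<Sum>l<4. F l * a' l)"
   unfolding tr_sum sum_distrib_left t_def
   by (rule sum.cong[OF refl]) (simp add: smul_mult_left tr_smul tr_commute)
  thus ?thesis by (simp add: s tr_smul tr_one)
 qed
 \<comment> \<open>If every \<open>t l / E\<close> were in \<open>P\<close>, so would be their sum
   1.\<close>
 have "\<exists>l<4. t l ~= 0 & E / t l \<in> V"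
 proof (rule ccontr)
  assume n: "\<not> ?thesis"
  have "t l / E \<in> P" if "l < 4" for l
  proof (cases "t l = 0")
   case False
   hence "E / t l \<notin> V" using n that by blast
   from not_in_V[OF this] show ?thesis by simp
  qed (simp add: zero_P)
  hence "(\<Sum>l<4. t l / E) \<in> P" by (intro P_sum) auto
  moreover have "(\<Sum>l<4. t l / E) = 1"
   using \<open>(\<Sum>l<4. t l) = E\<close> E by (simp flip: sum_divide_distrib)
  ultimately show False using one_notin_P by simp
 qed
 then obtain l0 where l0: "l0 < 4" "t l0 ~= 0" "E / t l0 \<in> V" by blast
 define y where "y = smul E (a' l0)"
 define x where "x = (\<Sum>k<4. e' k * y * a k)"
 define x' where "x' = F l0"
 have yL: "y \<in> L 1" using a'_L[OF l0(1)] by (simp add: y_def L_def numeral_2_eq_2)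
 have xL: "x \<in> L 3" unfolding x_def
 proof (rule L_sum)
  fix k :: nat assume "k \<in> {..<4}"
  thus "e' k * y * a k \<in> L 3" using L_mult[OF L_mult[OF e'_L yL] a_L, of k k] by (simp add: eval_nat_numeral)
 qed
 have x'L: "x' \<in> L 3" unfolding x'_def F_def
 proof (rule L_sum)
  fix k :: nat assume "k \<in> {..<4}"
  thus "e k * e' l0 * a' k \<in> L 3"
   using L_mult[OF L_mult[OF e_L e'_L[OF l0(1)]] a'_L, of k k] by (simp add: eval_nat_numeral)
 qed
 have err: "e' i * x - x * e i \<in> mL 3" if "i < 4" for i
  unfolding x_def
 proof (rule intertwine_L[OF dual dual' that near[OF that]])
  fix k l :: nat assume "k < 4" "l < 4"
  thus "e' l * y * a k \<in> L 3" using L_mult[OF L_mult[OF e'_L yL] a_L, of l k] by (simp add: eval_nat_numeral)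
 qed
 have err': "e i * x' - x' * e' i \<in> mL 3" if i: "i < 4" for i
  unfolding x'_def F_def
 proof (rule intertwine_L[OF dual' dual i])
  fix k l :: nat assume kl: "k < 4" "l < 4"
  show "e l * e' l0 * a' k \<in> L 3"
   using L_mult[OF L_mult[OF e_L[OF kl(2)] e'_L[OF l0(1)]] a'_L[OF kl(1)]] by (simp add: eval_nat_numeral)
  obtain v where "v \<in> V" "sc e' a' i k l - sc e a i k l = E ^ 10 * z * v" using near[OF i kl] by blast
  thus "\<exists>v\<in>V. sc e a i k l - sc e' a' i k l = E ^ 10 * z * v"
   by (intro bexI[of _ "- v"]) (auto simp: V_minus algebra_simps)
 qed
 \<comment> \<open>Expanding \<open>a\<close> in \<open>e\<close> through \<open>A\<close> and
   \<open>a'\<close> in \<open>e'\<close> through \<open>W\<close> leaves two kinds of terms. Errors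
   of \<open>x'\<close> lie in \<open>mL 4\<close>. Those with \<open>A - W\<close> carry
   \<open>E ^ 8\<close> instead of \<open>E ^ 10\<close>; the two missing factors are added to the
   four of \<open>x' * e' l\<close>.\<close>
 have d1: "a k * x' - x' * a' k \<in> mL 6" if k: "k < 4" for k
 proof -
  have "a k * x' - x' * a' k = (\<Sum>l<4. smul (A k l) (e l * x' - x' * e' l)) +
    (\<Sum>l<4. smul (A k l - W k l) (x' * e' l))"
   by (subst a_A, subst a'_W) (simp add: mult_sum_left mult_sum_right scale_right_diff_distrib
     scale_left_diff_distrib sum_subtractf)
  also have "\<dots> \<in> mL 6"
  proof (intro mL_add mL_sum)
   fix l :: nat assume "l \<in> {..<4}" hence l: "l < 4" by simp
   have "smul (A k l) (e l * x' - x' * e' l) \<in> mL (1 + 3)"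
    by (rule mL_div[OF _ err'[OF l]]) (simp add: A_V k l)
   thus "smul (A k l) (e l * x' - x' * e' l) \<in> mL 6" by (rule mL_mono) simp
   obtain v where v: "v \<in> V" "A k l - W k l = E ^ 8 * z * v" using AW_V[OF k l] by blast
   have "smul (v / E ^ 2) (x' * e' l) \<in> L (2 + (3 + 1))"
    by (rule L_div) (use E v L_mult[OF x'L e'_L[OF l]] in auto)
   hence "smul (v / E ^ 2) (x' * e' l) \<in> L 6" by simp
   from mL_I[OF this] have "smul (E ^ 10 * z * (v / E ^ 2)) (x' * e' l) \<in> mL 6"
    by (simp only: scale_scale)
   moreover have "A k l - W k l = E ^ 10 * z * (v / E ^ 2)"
    using E by (simp add: v field_simps flip: power_add)
   ultimately show "smul (A k l - W k l) (x' * e' l) \<in> mL 6" by (simp only:)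
  qed
  finally show ?thesis .
 qed
 define \<delta> where "\<delta> = (\<Sum>k<4. e' k * y * (a k * x' - x' * a' k))"
 have \<delta>: "\<delta> \<in> mL 8" unfolding \<delta>_def
 proof (rule mL_sum)
  fix k :: nat assume "k \<in> {..<4}" hence k: "k < 4" by simp
  show "e' k * y * (a k * x' - x' * a' k) \<in> mL 8"
   using mL_mult_left[OF L_mult[OF e'_L[OF k] yL] d1[OF k]] by (simp add: eval_nat_numeral)
 qed
 have "x * x' = (\<Sum>k<4. e' k * (y * x') * a' k) + \<delta>"
  unfolding x_def \<delta>_def by (simp add: sum_distrib_right right_diff_distrib sum_subtractf mult.assoc)
 also have "(\<Sum>k<4. e' k * (y * x') * a' k) = smul (t l0 / 4) 1"
  unfolding casimir[OF dual'] by (simp add: t_def y_def x'_def)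
 finally have xx': "x * x' = smul (t l0 / 4) 1 + \<delta>" .
 \<comment> \<open>Dividing by the scalar \<open>t l0 / 4\<close> costs one more factor
   \<open>E\<close>, so \<open>smul \<theta> (x * x')\<close> differs from 1 by an element of
   \<open>mL 9\<close>, which is as much as \<open>mL_PS\<close> allows.\<close>
 define \<theta> where "\<theta> = 4 / t l0"
 have E\<theta>: "E ^ 1 * \<theta> \<in> V" using V_mult[OF V_of_nat[of 4] l0(3)] by (simp add: \<theta>_def mult.commute)
 have "smul \<theta> \<delta> \<in> mL (1 + 8)" by (rule mL_div[OF E\<theta> \<delta>])
 then obtain s where s: "s \<in> S" "smul \<theta> \<delta> = smul z s" using mL_PS[of _ 9] by auto
 obtain u where u: "u \<in> S" "(1 + smul z s) * u = 1" using invertible_one_add[OF s(1)] .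
 define \<xi> where "\<xi> = smul \<theta> x' * u"
 have "smul \<theta> (x * x') = 1 + smul z s"
  unfolding xx' using l0 by (simp add: scale_right_distrib s(2)) (simp add: \<theta>_def)
 hence x\<xi>: "x * \<xi> = 1" using u(2) unfolding \<xi>_def
  by (metis mult.assoc smul_mult_left smul_mult_right)
 note \<xi>x = right_inverse_imp_left[OF x\<xi>]
 have \<xi>L: "\<xi> \<in> L 4"
  unfolding \<xi>_def using L_mult[OF L_div[OF E\<theta> x'L] L_S[OF u(1)]] by simp
 \<comment> \<open>The error 3 of the intertwiner and the size 4 of \<open>\<xi>\<close> exhaust the
   allowance of seven. Conjugation thus takes \<open>e i\<close> to \<open>e' i\<close> up to
   \<open>z\<close> times an element of \<open>S'\<close>.\<close>
 have "\<exists>s\<in>S'. e' i = x * e i * \<xi> + smul z s" if i: "i < 4" for i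
 proof -
  have "(e' i * x - x * e i) * \<xi> \<in> mL 7" using mL_mult_right[OF err[OF i] \<xi>L] by simp
  then obtain s where "s \<in> S'" "(e' i * x - x * e i) * \<xi> = smul z s" using mL_PS' by blast
  moreover have "(e' i * x - x * e i) * \<xi> = e' i - x * e i * \<xi>"
   using x\<xi> by (simp add: left_diff_distrib mult.assoc)
  ultimately show ?thesis by (intro bexI[of _ s]) (auto simp: algebra_simps)
 qed
 then obtain \<sigma> where \<sigma>: "!!i. i < 4 ==> \<sigma> i \<in> S'" "!!i. i < 4 ==> e' i = x * e i * \<xi> + smul z (\<sigma> i)" by metis
 have fwd: "x * s * \<xi> \<in> S'" if s: "s \<in> S" for s
 proof -
  have "x * s * \<xi> = (\<Sum>i<4. smul (crd e i s) (x * e i * \<xi>))"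
   by (subst crd_expand[OF basis, of s]) (simp add: mult_sum_left mult_sum_right)
  also have "\<dots> = (\<Sum>i<4. smul (crd e i s) (e' i + smul (- z) (\<sigma> i)))"
  proof (rule sum.cong[OF refl])
   fix i :: nat assume "i \<in> {..<4}"
   hence "x * e i * \<xi> = e' i + smul (- z) (\<sigma> i)" using \<sigma>(2)[of i] by (simp add: algebra_simps)
   thus "smul (crd e i s) (x * e i * \<xi>) = smul (crd e i s) (e' i + smul (- z) (\<sigma> i))" by simp
  qed
  also have "\<dots> \<in> S'"
   using s by (intro S'_sum S'_smul S'_add lam_base[OF basis'] V_minus P_sub[OF z] \<sigma>)
    (auto simp: lam_iff[OF basis])
  finally show ?thesis .
 qed
 \<comment> \<open>For the inverse conjugation there is only a self-referential equation:
   \<open>\<xi> * e' i * x\<close> is \<open>e i\<close> plus \<open>z\<close> times a combination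
   of the same four elements. Nakayama's lemma resolves it, one coordinate \<open>k\<close> at a
   time.\<close>
 have w: "crd e k (\<xi> * e' i * x) \<in> V" if ik: "i < 4" "k < 4" for i k
 proof (rule nakayama[of "{..<4}" "%i. crd e k (e i)" "%i j. z * crd e' j (\<sigma> i)" "%i. crd e k (\<xi> * e' i * x)"])
  fix i :: nat assume "i \<in> {..<4}" hence i: "i < 4" by simp
  have "\<xi> * e' i * x = (\<xi> * x) * e i * (\<xi> * x) + smul z (\<xi> * \<sigma> i * x)"
   by (subst \<sigma>(2)[OF i]) (simp add: distrib_left distrib_right smul_mult_left smul_mult_right mult.assoc)
  also have "\<xi> * \<sigma> i * x = (\<Sum>j<4. smul (crd e' j (\<sigma> i)) (\<xi> * e' j * x))"
   by (subst crd_expand[OF basis', of "\<sigma> i"]) (simp add: mult_sum_left mult_sum_right)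
  finally show "crd e k (\<xi> * e' i * x) = crd e k (e i) + (\<Sum>j<4. z * crd e' j (\<sigma> i) * crd e k (\<xi> * e' j * x))"
   by (simp add: \<xi>x crd_add[OF basis] crd_smul[OF basis] crd_sum[OF basis] sum_distrib_left mult.assoc)
  show "crd e k (e i) \<in> V" using lam_base[OF basis i] ik by (auto simp: lam_iff[OF basis])
  fix j :: nat assume "j \<in> {..<4}"
  hence "crd e' j (\<sigma> i) \<in> V" using \<sigma>(1)[OF i] by (auto simp: lam_iff[OF basis'])
  from P_mult[OF this z] show "z * crd e' j (\<sigma> i) \<in> P" by (simp only: mult.commute)
 qed (use ik in auto)
 have bwd: "\<xi> * s * x \<in> S" if s: "s \<in> S'" for s
 proof -
  have "\<xi> * s * x = (\<Sum>i<4. smul (crd e' i s) (\<xi> * e' i * x))"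
   by (subst crd_expand[OF basis', of s]) (simp add: mult_sum_left mult_sum_right)
  also have "\<dots> \<in> S"
   using s w by (intro S_sum S_smul) (auto simp: lam_iff[OF basis] lam_iff[OF basis'])
  finally show ?thesis .
 qed
 show thesis by (rule that[OF x\<xi> \<xi>x fwd bwd])
qed

end

section \<open>Completions\<close>

text \<open>Two-sided ideals in a ring that may be noncommutative, so that completions of orders and
  of the ring of integers are treated together.\<close>

locale filtered_ring =
 fixes S :: "'b::ring_1 set" and J :: "nat => 'b set"
 assumes S_zero: "0 \<in> S" and S_one: "1 \<in> S" and S_add: "x \<in> S ==> y \<in> S ==> x + y \<in> S"
  and S_mult: "x \<in> S ==> y \<in> S ==> x * y \<in> S" and S_minus: "x \<in> S ==> - x \<in> S"
  and J_sub: "x \<in> J n ==> x \<in> S" and J_zero: "0 \<in> J n" and J_add: "x \<in> J n ==> y \<in> J n ==> x + y \<in> J n"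
  and J_left: "a \<in> S ==> x \<in> J n ==> a * x \<in> J n" and J_right: "a \<in> S ==> x \<in> J n ==> x * a \<in> J n"
  and J_Suc: "x \<in> J (Suc n) ==> x \<in> J n"
begin

abbreviation "C \<equiv> completion (ring_on S) J"

definition cs :: "nat => 'b => 'b set" where "cs n s = J n +>\<^bsub>ring_on S\<^esub> s"

lemma J_minus: "x \<in> J n ==> - x \<in> J n"
 using J_left[of "- 1" x n] S_minus[OF S_one] by simp

lemma J_diff: "x \<in> J n ==> y \<in> J n ==> x - y \<in> J n"
 using J_add[OF _ J_minus, of x n y] by simp

lemma S_diff: "x \<in> S ==> y \<in> S ==> x - y \<in> S"
 using S_add[OF _ S_minus, of x y] by simp

lemma mem_cs: "t \<in> cs n s \<longleftrightarrow> t - s \<in> J n"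
 unfolding cs_def a_r_coset_def' by (auto simp: algebra_simps intro!: bexI[of _ "t - s"])

lemma cs_self: "s \<in> cs n s" by (simp add: mem_cs J_zero)

lemma cs_eq_iff: "cs n s = cs n t \<longleftrightarrow> s - t \<in> J n"
proof
 assume "cs n s = cs n t"
 thus "s - t \<in> J n" using cs_self[of s n] mem_cs by blast
next
 assume st: "s - t \<in> J n"
 have "u - s \<in> J n \<longleftrightarrow> u - t \<in> J n" for u
  using J_add[OF _ st, of "u - s"] J_diff[OF _ st, of "u - t"] by auto
 thus "cs n s = cs n t" by (auto simp: mem_cs)
qed

lemma carrier_C: "x \<in> carrier C \<longleftrightarrow> (\<forall>n. (\<exists>s\<in>S. x n = cs n s) & x (Suc n) \<subseteq> x n)"
 by (auto simp: completion_def FactRing_def A_RCOSETS_def' cs_def)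

lemma C_ex: "x \<in> carrier C ==> \<exists>s\<in>S. s \<in> x n"
 using cs_self by (fastforce simp: carrier_C)

lemma C_rep: "x \<in> carrier C ==> s \<in> x n ==> s \<in> S & x n = cs n s"
proof -
 assume x: "x \<in> carrier C" "s \<in> x n"
 have "\<exists>t\<in>S. x n = cs n t" using x(1) unfolding carrier_C by blast
 then obtain t where t: "t \<in> S" "x n = cs n t" by blast
 have d: "s - t \<in> J n" using x(2) t by (simp add: mem_cs)
 have "s = (s - t) + t" by simp
 hence "s \<in> S" using S_add[OF J_sub[OF d] t(1)] by simp
 moreover have "cs n s = cs n t" using d by (simp only: cs_eq_iff)
 ultimately show ?thesis using t(2) by simp
qed

lemma C_mono: "x \<in> carrier C ==> m \<le> n ==> x n \<subseteq> x m"
 by (rule lift_Suc_antimono_le[of x]) (auto simp: carrier_C)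

lemma rcoset_mult_cs: "s \<in> S ==> t \<in> S ==> rcoset_mult (ring_on S) (J n) (cs n s) (cs n t) = cs n (s * t)"
proof -
 assume st: "s \<in> S" "t \<in> S"
 have "cs n (a * b) = cs n (s * t)" if ab: "a \<in> cs n s" "b \<in> cs n t" for a b
 proof -
  have d: "a - s \<in> J n" "b - t \<in> J n" using ab by (auto simp: mem_cs)
  have "b = (b - t) + t" by simp
  hence "b \<in> S" using S_add[OF J_sub[OF d(2)] st(2)] by simp
  hence "(a - s) * b + s * (b - t) \<in> J n" using d st by (intro J_add J_left J_right)
  thus ?thesis by (simp add: cs_eq_iff algebra_simps)
 qed
 moreover have "s \<in> cs n s" "t \<in> cs n t" by (rule cs_self)+
 ultimately have "(\<Union>a\<in>cs n s. \<Union>b\<in>cs n t. cs n (a * b)) = cs n (s * t)" by blast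
 thus ?thesis by (simp add: rcoset_mult_def cs_def)
qed

lemma set_add_cs: "cs n s <+>\<^bsub>ring_on S\<^esub> cs n t = cs n (s + t)"
proof (intro Set.set_eqI iffI)
 fix u assume "u \<in> cs n s <+>\<^bsub>ring_on S\<^esub> cs n t"
 then obtain a b where ab: "a - s \<in> J n" "b - t \<in> J n" "u = a + b"
  by (auto simp: set_add_def' mem_cs)
 show "u \<in> cs n (s + t)" using J_add[OF ab(1,2)] ab(3) by (simp add: mem_cs algebra_simps)
next
 fix u assume "u \<in> cs n (s + t)"
 hence "u - t \<in> cs n s" by (simp add: mem_cs algebra_simps)
 thus "u \<in> cs n s <+>\<^bsub>ring_on S\<^esub> cs n t" using cs_self[of t n]
  unfolding set_add_def' by (intro UN_I[of "u - t"] UN_I[of t]) auto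
qed

lemma C_mult: "x \<in> carrier C ==> y \<in> carrier C ==> s \<in> x n ==> t \<in> y n ==> (x \<otimes>\<^bsub>C\<^esub> y) n = cs n (s * t)"
 using C_rep[of x s n] C_rep[of y t n] rcoset_mult_cs[of s t n]
 by (simp add: completion_def FactRing_def)

lemma C_add: "x \<in> carrier C ==> y \<in> carrier C ==> s \<in> x n ==> t \<in> y n ==> (x \<oplus>\<^bsub>C\<^esub> y) n = cs n (s + t)"
 using C_rep[of x s n] C_rep[of y t n] set_add_cs[of n s t]
 by (simp add: completion_def FactRing_def)

lemma C_one: "\<one>\<^bsub>C\<^esub> n = cs n 1" and C_zero: "\<zero>\<^bsub>C\<^esub> n = cs n 0"
proof -
 show "\<one>\<^bsub>C\<^esub> n = cs n 1" by (simp add: completion_def FactRing_def cs_def)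
 have "cs n 0 = J n" by (auto simp: mem_cs)
 thus "\<zero>\<^bsub>C\<^esub> n = cs n 0" by (simp add: completion_def FactRing_def)
qed

lemma cs_Suc: "cs (Suc n) s \<subseteq> cs n s" by (auto simp: mem_cs J_Suc)

lemma carrierI: 
 assumes "!!n. s n \<in> S" "!!n. x n = cs n (s n)" "!!n. s (Suc n) \<in> x n" shows "x \<in> carrier C"
proof -
 have "x (Suc n) \<subseteq> x n" for n
 proof -
  have "cs n (s (Suc n)) = cs n (s n)" using assms(2,3)[of n] by (simp add: mem_cs cs_eq_iff)
  thus ?thesis using cs_Suc[of n "s (Suc n)"] assms(2) by simp
 qed
 thus ?thesis using assms by (auto simp: carrier_C)
qed

lemma C_closed: 
 assumes "x \<in> carrier C" "y \<in> carrier C"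
 shows "x \<otimes>\<^bsub>C\<^esub> y \<in> carrier C" "x \<oplus>\<^bsub>C\<^esub> y \<in> carrier C"
proof -
 obtain s t where s: "!!n. s n \<in> x n" and t: "!!n. t n \<in> y n" using C_ex assms by metis
 have S: "s n \<in> S" "t n \<in> S" for n using C_rep assms s t by blast+
 have s': "s (Suc n) \<in> x n" "t (Suc n) \<in> y n" for n
  using s[of "Suc n"] t[of "Suc n"] assms by (auto simp: carrier_C)
 have "s (Suc n) * t (Suc n) \<in> (x \<otimes>\<^bsub>C\<^esub> y) n" "s (Suc n) + t (Suc n) \<in> (x \<oplus>\<^bsub>C\<^esub> y) n" for n
  using C_mult[OF assms s'] C_add[OF assms s'] cs_self by simp_all
 note m = this
 show "x \<otimes>\<^bsub>C\<^esub> y \<in> carrier C"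
  by (rule carrierI[of "%n. s n * t n"])
   (use S C_mult[OF assms s t] m in \<open>auto intro: S_mult\<close>)
 show "x \<oplus>\<^bsub>C\<^esub> y \<in> carrier C"
  by (rule carrierI[of "%n. s n + t n"])
   (use S C_add[OF assms s t] m in \<open>auto intro: S_add\<close>)
qed

definition const :: "'b => nat => 'b set" where "const s = (%n. cs n s)"

lemma const_carrier: "s \<in> S ==> const s \<in> carrier C"
 by (rule carrierI[of "%_. s"]) (auto simp: const_def cs_self)

lemma const_one: "\<one>\<^bsub>C\<^esub> = const 1" and const_zero: "\<zero>\<^bsub>C\<^esub> = const 0"
 by (auto simp: const_def C_one C_zero)

text \<open>Cosets of one ideal coincide as soon as they meet, so an identity in the completion is
  checked on one common representative per level.\<close>

lemma C_eqI:
 assumes "x \<in> carrier C" "y \<in> carrier C" "!!n. \<exists>s. s \<in> x n & s \<in> y n" shows "x = y"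
proof
 fix n
 obtain s where "s \<in> x n" "s \<in> y n" using assms(3) by blast
 thus "x n = y n" using C_rep assms by metis
qed

lemma mem_mult: "x \<in> carrier C ==> y \<in> carrier C ==> s \<in> x n ==> t \<in> y n ==> s * t \<in> (x \<otimes>\<^bsub>C\<^esub> y) n"
 and mem_add: "x \<in> carrier C ==> y \<in> carrier C ==> s \<in> x n ==> t \<in> y n ==> s + t \<in> (x \<oplus>\<^bsub>C\<^esub> y) n"
 by (simp_all add: C_mult C_add cs_self)

lemma ring_C: "ring C"
proof (rule ringI)
 have one: "1 \<in> \<one>\<^bsub>C\<^esub> n" and zero: "0 \<in> \<zero>\<^bsub>C\<^esub> n" for n by (simp_all add: C_one C_zero cs_self)
 have oneC: "\<one>\<^bsub>C\<^esub> \<in> carrier C" and zeroC: "\<zero>\<^bsub>C\<^esub> \<in> carrier C"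
  by (simp_all add: const_one const_zero const_carrier S_one S_zero)
 show "abelian_group C"
 proof (rule abelian_groupI)
  fix x y assume xy: "x \<in> carrier C" "y \<in> carrier C"
  thus "x \<oplus>\<^bsub>C\<^esub> y \<in> carrier C" by (rule C_closed)
  show "x \<oplus>\<^bsub>C\<^esub> y = y \<oplus>\<^bsub>C\<^esub> x"
  proof (rule C_eqI)
   fix n obtain s t where "s \<in> x n" "t \<in> y n" using C_ex xy by metis
   thus "\<exists>s. s \<in> (x \<oplus>\<^bsub>C\<^esub> y) n & s \<in> (y \<oplus>\<^bsub>C\<^esub> x) n"
    using mem_add[OF xy, of s n t] mem_add[OF xy(2,1), of t n s] by (metis add.commute)
  qed (use xy in \<open>auto intro: C_closed\<close>)
  fix z assume z: "z \<in> carrier C"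
  show "(x \<oplus>\<^bsub>C\<^esub> y) \<oplus>\<^bsub>C\<^esub> z = x \<oplus>\<^bsub>C\<^esub> (y \<oplus>\<^bsub>C\<^esub> z)"
  proof (rule C_eqI)
   fix n obtain s t u where stu: "s \<in> x n" "t \<in> y n" "u \<in> z n" using C_ex xy z by metis
   have "(s + t) + u \<in> ((x \<oplus>\<^bsub>C\<^esub> y) \<oplus>\<^bsub>C\<^esub> z) n" "s + (t + u) \<in> (x \<oplus>\<^bsub>C\<^esub> (y \<oplus>\<^bsub>C\<^esub> z)) n"
    by (intro mem_add C_closed xy z stu)+
   thus "\<exists>s. s \<in> ((x \<oplus>\<^bsub>C\<^esub> y) \<oplus>\<^bsub>C\<^esub> z) n & s \<in> (x \<oplus>\<^bsub>C\<^esub> (y \<oplus>\<^bsub>C\<^esub> z)) n" by (metis add.assoc)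
  qed (intro C_closed xy z)+
 next
  fix x assume x: "x \<in> carrier C"
  show "\<zero>\<^bsub>C\<^esub> \<oplus>\<^bsub>C\<^esub> x = x"
  proof (rule C_eqI)
   fix n obtain s where "s \<in> x n" using C_ex x by metis
   thus "\<exists>s. s \<in> (\<zero>\<^bsub>C\<^esub> \<oplus>\<^bsub>C\<^esub> x) n & s \<in> x n" using mem_add[OF zeroC x zero, of s n] by auto
  qed (intro C_closed zeroC x)+
  obtain s where s: "!!n. s n \<in> x n" using C_ex x by metis
  have S: "s n \<in> S" "s (Suc n) - s n \<in> J n" for n
   using C_rep[OF x s] s[of "Suc n"] x by (auto simp: carrier_C mem_cs) (metis C_rep mem_cs s subsetD x)
  have y: "(%n. cs n (- s n)) \<in> carrier C"
   by (rule carrierI[of "%n. - s n"]) (use S J_minus[OF S(2)] in \<open>auto simp: mem_cs S_minus\<close>)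
  moreover have "(%n. cs n (- s n)) \<oplus>\<^bsub>C\<^esub> x = \<zero>\<^bsub>C\<^esub>"
  proof (rule C_eqI)
   fix n
   have "- s n + s n \<in> ((%n. cs n (- s n)) \<oplus>\<^bsub>C\<^esub> x) n" by (intro mem_add y x s) (rule cs_self)
   thus "\<exists>t. t \<in> ((%n. cs n (- s n)) \<oplus>\<^bsub>C\<^esub> x) n & t \<in> \<zero>\<^bsub>C\<^esub> n" using zero by auto
  qed (intro C_closed zeroC x y)+
  ultimately show "\<exists>y\<in>carrier C. y \<oplus>\<^bsub>C\<^esub> x = \<zero>\<^bsub>C\<^esub>" by blast
 qed (rule zeroC)
 show "Group.monoid C"
 proof (rule monoidI)
  fix x y assume xy: "x \<in> carrier C" "y \<in> carrier C"
  thus "x \<otimes>\<^bsub>C\<^esub> y \<in> carrier C" by (rule C_closed)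
  fix z assume z: "z \<in> carrier C"
  show "(x \<otimes>\<^bsub>C\<^esub> y) \<otimes>\<^bsub>C\<^esub> z = x \<otimes>\<^bsub>C\<^esub> (y \<otimes>\<^bsub>C\<^esub> z)"
  proof (rule C_eqI)
   fix n obtain s t u where stu: "s \<in> x n" "t \<in> y n" "u \<in> z n" using C_ex xy z by metis
   have "(s * t) * u \<in> ((x \<otimes>\<^bsub>C\<^esub> y) \<otimes>\<^bsub>C\<^esub> z) n" "s * (t * u) \<in> (x \<otimes>\<^bsub>C\<^esub> (y \<otimes>\<^bsub>C\<^esub> z)) n"
    by (intro mem_mult C_closed xy z stu)+
   thus "\<exists>s. s \<in> ((x \<otimes>\<^bsub>C\<^esub> y) \<otimes>\<^bsub>C\<^esub> z) n & s \<in> (x \<otimes>\<^bsub>C\<^esub> (y \<otimes>\<^bsub>C\<^esub> z)) n" by (metis mult.assoc)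
  qed (intro C_closed xy z)+
 next
  fix x assume x: "x \<in> carrier C"
  show "\<one>\<^bsub>C\<^esub> \<otimes>\<^bsub>C\<^esub> x = x"
  proof (rule C_eqI)
   fix n obtain s where "s \<in> x n" using C_ex x by metis
   thus "\<exists>s. s \<in> (\<one>\<^bsub>C\<^esub> \<otimes>\<^bsub>C\<^esub> x) n & s \<in> x n" using mem_mult[OF oneC x one, of s n] by auto
  qed (intro C_closed oneC x)+
  show "x \<otimes>\<^bsub>C\<^esub> \<one>\<^bsub>C\<^esub> = x"
  proof (rule C_eqI)
   fix n obtain s where "s \<in> x n" using C_ex x by metis
   thus "\<exists>s. s \<in> (x \<otimes>\<^bsub>C\<^esub> \<one>\<^bsub>C\<^esub>) n & s \<in> x n" using mem_mult[OF x oneC _ one, of s n] by auto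
  qed (intro C_closed oneC x)+
 qed (rule oneC)
 fix x y z assume x: "x \<in> carrier C" and y: "y \<in> carrier C" and z: "z \<in> carrier C"
 show "(x \<oplus>\<^bsub>C\<^esub> y) \<otimes>\<^bsub>C\<^esub> z = x \<otimes>\<^bsub>C\<^esub> z \<oplus>\<^bsub>C\<^esub> y \<otimes>\<^bsub>C\<^esub> z"
 proof (rule C_eqI)
  fix n obtain s t u where stu: "s \<in> x n" "t \<in> y n" "u \<in> z n" using C_ex x y z by metis
  have "(s + t) * u \<in> ((x \<oplus>\<^bsub>C\<^esub> y) \<otimes>\<^bsub>C\<^esub> z) n" "s * u + t * u \<in> (x \<otimes>\<^bsub>C\<^esub> z \<oplus>\<^bsub>C\<^esub> y \<otimes>\<^bsub>C\<^esub> z) n"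
   by (intro mem_mult mem_add C_closed x y z stu)+
  thus "\<exists>s. s \<in> ((x \<oplus>\<^bsub>C\<^esub> y) \<otimes>\<^bsub>C\<^esub> z) n & s \<in> (x \<otimes>\<^bsub>C\<^esub> z \<oplus>\<^bsub>C\<^esub> y \<otimes>\<^bsub>C\<^esub> z) n" by (metis distrib_right)
 qed (intro C_closed x y z)+
 show "z \<otimes>\<^bsub>C\<^esub> (x \<oplus>\<^bsub>C\<^esub> y) = z \<otimes>\<^bsub>C\<^esub> x \<oplus>\<^bsub>C\<^esub> z \<otimes>\<^bsub>C\<^esub> y"
 proof (rule C_eqI)
  fix n obtain s t u where stu: "s \<in> x n" "t \<in> y n" "u \<in> z n" using C_ex x y z by metis
  have "u * (s + t) \<in> (z \<otimes>\<^bsub>C\<^esub> (x \<oplus>\<^bsub>C\<^esub> y)) n" "u * s + u * t \<in> (z \<otimes>\<^bsub>C\<^esub> x \<oplus>\<^bsub>C\<^esub> z \<otimes>\<^bsub>C\<^esub> y) n"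
   by (intro mem_mult mem_add C_closed x y z stu)+
  thus "\<exists>s. s \<in> (z \<otimes>\<^bsub>C\<^esub> (x \<oplus>\<^bsub>C\<^esub> y)) n & s \<in> (z \<otimes>\<^bsub>C\<^esub> x \<oplus>\<^bsub>C\<^esub> z \<otimes>\<^bsub>C\<^esub> y) n" by (metis distrib_left)
 qed (intro C_closed x y z)+
qed

end

text \<open>A relation between representatives instead of a map: conjugation takes an order only
  into a localisation of the other one, so images exist only approximately at each level. Totality,
  surjectivity and \<open>Rel_iff\<close> make the relation a bijection of the quotients at level
  \<open>n\<close>.\<close>

locale filtered_correspondence = A: filtered_ring S J + B: filtered_ring S' J'
 for S :: "'b::ring_1 set" and J and S' :: "'c::ring_1 set" and J' +
 fixes Rel :: "nat => 'b => 'c => bool"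
 assumes Rel_sub: "Rel n s t ==> s \<in> S & t \<in> S'"
  and total: "s \<in> S ==> \<exists>t. Rel n s t" and surj: "t \<in> S' ==> \<exists>s. Rel n s t"
  and Rel_iff: "Rel n s t ==> Rel n s' t' ==> s - s' \<in> J n \<longleftrightarrow> t - t' \<in> J' n"
  and Rel_Suc: "Rel (Suc n) s t ==> Rel n s t"
  and Rel_add: "Rel n s t ==> Rel n s' t' ==> Rel n (s + s') (t + t')"
  and Rel_mult: "Rel n s t ==> Rel n s' t' ==> Rel n (s * s') (t * t')"
  and Rel_one: "Rel n 1 1"
begin

definition h :: "(nat => 'b set) => nat => 'c set" where
 "h x n = {t. \<exists>s\<in>x n. Rel n s t}"

lemma h_eq:
 assumes x: "x \<in> carrier A.C" "s \<in> x n" and r: "Rel n s t"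
 shows "h x n = B.cs n t"
proof (intro Set.set_eqI iffI)
 fix u assume "u \<in> h x n"
 then obtain s' where s': "s' \<in> x n" "Rel n s' u" by (auto simp: h_def)
 have "x n = A.cs n s" using A.C_rep[OF x] by blast
 hence "s' - s \<in> J n" using s' by (simp add: A.mem_cs)
 thus "u \<in> B.cs n t" using Rel_iff[OF s'(2) r] by (simp add: B.mem_cs)
next
 fix u assume u: "u \<in> B.cs n t"
 hence d: "u - t \<in> J' n" by (simp add: B.mem_cs)
 have "u = (u - t) + t" by simp
 hence "u \<in> S'" using B.S_add[OF B.J_sub[OF d]] Rel_sub[OF r] by metis
 then obtain s' where s': "Rel n s' u" using surj by blast
 hence "s' - s \<in> J n" using Rel_iff[OF s' r] d by simp
 hence "s' \<in> x n" using A.C_rep[OF x] by (simp add: A.mem_cs)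
 thus "u \<in> h x n" using s' by (auto simp: h_def)
qed

lemma h_carrier:
 assumes x: "x \<in> carrier A.C" shows "h x \<in> carrier B.C"
proof -
 obtain s where s: "!!n. s n \<in> x n" using A.C_ex x by metis
 have "\<exists>t. Rel n (s n) t" for n using total A.C_rep[OF x s] by blast
 then obtain t where t: "!!n. Rel n (s n) (t n)" by metis
 show ?thesis
 proof (rule B.carrierI[of t])
  show "t n \<in> S'" "h x n = B.cs n (t n)" for n using Rel_sub[OF t] h_eq[OF x s t] by auto
  fix n
  have "s (Suc n) \<in> x n" using s[of "Suc n"] A.C_mono[OF x, of n "Suc n"] by auto
  thus "t (Suc n) \<in> h x n" using Rel_Suc[OF t] by (auto simp: h_def)
 qed
qed

lemma Rel_mem: "x \<in> carrier A.C ==> \<exists>s t. s \<in> x n & t \<in> h x n & Rel n s t"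
 using A.C_ex[of x n] total[of _ n] unfolding h_def by blast

lemma h_hom: 
 assumes x: "x \<in> carrier A.C" and y: "y \<in> carrier A.C"
 shows "h (x \<otimes>\<^bsub>A.C\<^esub> y) = h x \<otimes>\<^bsub>B.C\<^esub> h y" "h (x \<oplus>\<^bsub>A.C\<^esub> y) = h x \<oplus>\<^bsub>B.C\<^esub> h y"
proof -
 show "h (x \<otimes>\<^bsub>A.C\<^esub> y) = h x \<otimes>\<^bsub>B.C\<^esub> h y"
 proof
  fix n
  obtain s t where s: "s \<in> x n" "t \<in> h x n" "Rel n s t" using Rel_mem[OF x] by blast
  obtain s' t' where s': "s' \<in> y n" "t' \<in> h y n" "Rel n s' t'" using Rel_mem[OF y] by blast
  show "h (x \<otimes>\<^bsub>A.C\<^esub> y) n = (h x \<otimes>\<^bsub>B.C\<^esub> h y) n"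
   using h_eq[OF A.C_closed(1)[OF x y] A.mem_mult[OF x y s(1) s'(1)] Rel_mult[OF s(3) s'(3)]]
    B.C_mult[OF h_carrier[OF x] h_carrier[OF y] s(2) s'(2)] by simp
 qed
 show "h (x \<oplus>\<^bsub>A.C\<^esub> y) = h x \<oplus>\<^bsub>B.C\<^esub> h y"
 proof
  fix n
  obtain s t where s: "s \<in> x n" "t \<in> h x n" "Rel n s t" using Rel_mem[OF x] by blast
  obtain s' t' where s': "s' \<in> y n" "t' \<in> h y n" "Rel n s' t'" using Rel_mem[OF y] by blast
  show "h (x \<oplus>\<^bsub>A.C\<^esub> y) n = (h x \<oplus>\<^bsub>B.C\<^esub> h y) n"
   using h_eq[OF A.C_closed(2)[OF x y] A.mem_add[OF x y s(1) s'(1)] Rel_add[OF s(3) s'(3)]]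
    B.C_add[OF h_carrier[OF x] h_carrier[OF y] s(2) s'(2)] by simp
 qed
qed

lemma h_one: "h \<one>\<^bsub>A.C\<^esub> = \<one>\<^bsub>B.C\<^esub>"
proof
 fix n
 have 1: "1 \<in> \<one>\<^bsub>A.C\<^esub> n" unfolding A.C_one by (rule A.cs_self)
 have 2: "\<one>\<^bsub>A.C\<^esub> \<in> carrier A.C" unfolding A.const_one by (rule A.const_carrier[OF A.S_one])
 from h_eq[OF 2 1 Rel_one] show "h \<one>\<^bsub>A.C\<^esub> n = \<one>\<^bsub>B.C\<^esub> n" by (simp add: B.C_one)
qed

lemma h_inj: "inj_on h (carrier A.C)"
proof (rule inj_onI)
 fix x y assume xy: "x \<in> carrier A.C" "y \<in> carrier A.C" "h x = h y"
 show "x = y"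
 proof (rule A.C_eqI[OF xy(1,2)])
  fix n
  obtain s t where s: "s \<in> x n" "t \<in> h x n" "Rel n s t" using Rel_mem[OF xy(1)] by blast
  then obtain s' where s': "s' \<in> y n" "Rel n s' t" using xy(3) by (auto simp: h_def)
  have "s - s' \<in> J n" using Rel_iff[OF s(3) s'(2)] B.J_zero by simp
  hence "s \<in> y n" using A.C_rep[OF xy(2) s'(1)] by (simp add: A.mem_cs)
  thus "\<exists>s. s \<in> x n & s \<in> y n" using s(1) by blast
 qed
qed

text \<open>The conditions are symmetric, so the inverse of \<open>h\<close> comes from the same
  construction.\<close>

lemma converse: "filtered_correspondence S' J' S J (%n t s. Rel n s t)"
proof -
 have "filtered_ring S' J'" "filtered_ring S J" by unfold_locales
 thus ?thesis
 proof (rule filtered_correspondence.intro[OF _ _ filtered_correspondence_axioms.intro])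
  show "Rel n t s ==> s \<in> S' & t \<in> S" for n s t using Rel_sub[of n t s] by simp
  show "Rel n t s ==> Rel n t' s' ==> s - s' \<in> J' n \<longleftrightarrow> t - t' \<in> J n" for n s t s' t'
   using Rel_iff[of n t s t' s'] by simp
  show "Rel n 1 1" for n by (rule Rel_one)
  show "\<exists>t. Rel n t s" if "s \<in> S'" for n s by (rule surj[OF that])
  show "\<exists>t. Rel n s t" if "s \<in> S" for n s by (rule total[OF that])
  show "Rel n t s" if "Rel (Suc n) t s" for n s t by (rule Rel_Suc[OF that])
  show "Rel n (t + t') (s + s')" if "Rel n t s" "Rel n t' s'" for n s t s' t' by (rule Rel_add[OF that])
  show "Rel n (t * t') (s * s')" if "Rel n t s" "Rel n t' s'" for n s t s' t' by (rule Rel_mult[OF that])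
 qed
qed

lemma h_iso: "h \<in> ring_iso A.C B.C"
proof -
 interpret inv: filtered_correspondence S' J' S J "%n t s. Rel n s t" by (rule converse)
 have h_inv: "h (inv.h y) = y" if y: "y \<in> carrier B.C" for y
 proof (rule B.C_eqI)
  fix n
  obtain t s where s: "t \<in> y n" "s \<in> inv.h y n" "Rel n s t" using inv.Rel_mem[OF y] by blast
  thus "\<exists>s. s \<in> h (inv.h y) n & s \<in> y n" by (auto simp: h_def)
 qed (use y in \<open>auto intro: h_carrier inv.h_carrier\<close>)
 have "h ` carrier A.C = carrier B.C"
 proof (intro subset_antisym subsetI)
  fix y assume y: "y \<in> carrier B.C"
  show "y \<in> h ` carrier A.C" by (rule image_eqI[of _ _ "inv.h y"]) (simp_all add: h_inv y inv.h_carrier)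
 qed (auto intro: h_carrier)
 hence "bij_betw h (carrier A.C) (carrier B.C)" by (rule bij_betw_imageI[OF h_inj])
 moreover have "h \<in> Ring.ring_hom A.C B.C" by (rule ring_hom_memI) (simp_all add: h_carrier h_hom h_one)
 ultimately show ?thesis unfolding ring_iso_def by simp
qed

end

section \<open>Lattices and orders\<close>

locale number_field_space = vector_space smul
 for smul :: "'k::number_field => 'b::ring_1 => 'b"
begin

definition O_submodule :: "'b set => bool" where
 "O_submodule M \<longleftrightarrow> 0 \<in> M & (\<forall>x\<in>M. \<forall>y\<in>M. x + y \<in> M) & (\<forall>(a::'k) x. aint a --> x \<in> M --> smul a x \<in> M)"

lemma O_span_minimal:
 assumes "S \<subseteq> M" "O_submodule M" shows "O_span smul S \<subseteq> M"
proof
 fix x assume "x \<in> O_span smul S"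
 then obtain F c where x: "finite F" "F \<subseteq> S" "\<forall>x\<in>F. aint (c x)" "x = (\<Sum>x\<in>F. smul (c x) x)"
  by (auto simp: O_span_def)
 have "(\<Sum>x\<in>F. smul (c x) x) \<in> M"
  using x(1-3) assms by (induction F rule: finite_induct) (auto simp: O_submodule_def)
 thus "x \<in> M" using x(4) by simp
qed

lemma O_span_base: "x \<in> S ==> x \<in> O_span smul S"
 unfolding O_span_def by (rule CollectI, intro exI[of _ "{x}"] exI[of _ "%_. 1"]) (auto simp: aint_of_int)

lemma O_submodule_O_span: "O_submodule (O_span smul S)"
 unfolding O_submodule_def
proof (intro conjI ballI allI impI)
 show "0 \<in> O_span smul S" unfolding O_span_def by (rule CollectI, intro exI[of _ "{}"]) auto
next
 fix x y assume "x \<in> O_span smul S" "y \<in> O_span smul S"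
 then obtain F c G d where x: "finite F" "F \<subseteq> S" "\<forall>x\<in>F. aint (c x)" "x = (\<Sum>x\<in>F. smul (c x) x)"
  and y: "finite G" "G \<subseteq> S" "\<forall>x\<in>G. aint (d x)" "y = (\<Sum>x\<in>G. smul (d x) x)"
  by (auto simp: O_span_def)
 let ?c = "%x. if x \<in> F then c x else 0" and ?d = "%x. if x \<in> G then d x else 0"
 have "x = (\<Sum>x\<in>F \<union> G. smul (?c x) x)" unfolding x(4)
  by (rule sum.mono_neutral_cong_left) (use x y in auto)
 moreover have "y = (\<Sum>x\<in>F \<union> G. smul (?d x) x)" unfolding y(4)
  by (rule sum.mono_neutral_cong_left) (use x y in auto)
 ultimately have "x + y = (\<Sum>x\<in>F \<union> G. smul (?c x + ?d x) x)"
  by (simp add: scale_left_distrib sum.distrib)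
 moreover have "\<forall>x\<in>F \<union> G. aint (?c x + ?d x)"
  using x y by (auto intro: aint_add_mult simp: aint_of_int)
 ultimately show "x + y \<in> O_span smul S" unfolding O_span_def using x y
  by (intro CollectI exI[of _ "F \<union> G"] exI[of _ "%x. ?c x + ?d x"]) auto
next
 fix a :: 'k and x assume a: "aint a" and "x \<in> O_span smul S"
 then obtain F c where x: "finite F" "F \<subseteq> S" "\<forall>x\<in>F. aint (c x)" "x = (\<Sum>x\<in>F. smul (c x) x)"
  by (auto simp: O_span_def)
 have "smul a x = (\<Sum>x\<in>F. smul (a * c x) x)" by (simp add: x(4) scale_sum_right)
 thus "smul a x \<in> O_span smul S" unfolding O_span_def using x a
  by (intro CollectI exI[of _ F] exI[of _ "%x. a * c x"]) (auto intro: aint_add_mult)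
qed

lemma O_submodule_sum: "O_submodule M ==> (!!i. i \<in> A ==> f i \<in> M) ==> sum f A \<in> M"
 by (induction A rule: infinite_finite_induct) (auto simp: O_submodule_def)

lemma O_submodule_minus: "O_submodule M ==> x \<in> M ==> - x \<in> M"
 using aint_of_int(1)[of "- 1"] by (force simp: O_submodule_def dest: spec[of _ "- 1"])

lemma is_latticeD: "is_lattice smul M ==> O_submodule M"
 using O_submodule_O_span by (auto simp: is_lattice_def)

end

lemma number_field_space_self: "number_field_space ((*) :: 'k::number_field => 'k => 'k)"
 by unfold_locales (auto simp: algebra_simps)

text \<open>Spans are the form in which membership in an ideal is certified later.\<close>

lemma genideal_eq_O_span:
 assumes "X \<subseteq> (algints :: 'k::number_field set)"
 shows "genideal integer_ring X = O_span (*) X"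
proof -
 interpret K: number_field_space "(*) :: 'k => 'k => 'k" by (rule number_field_space_self)
 interpret R: ring "integer_ring :: 'k ring" by (rule ring_integer_ring)
 have carr: "carrier (integer_ring :: 'k ring) = algints" by (simp add: integer_ring_def)
 have sub: "O_span (*) X \<subseteq> algints"
  by (rule K.O_span_minimal[OF assms]) (auto simp: K.O_submodule_def aint_of_int aint_add_mult)
 have "ideal (O_span (*) X) integer_ring"
  using K.O_submodule_O_span[of X] sub unfolding ideal_integer_ring_iff K.O_submodule_def by blast
 hence "genideal integer_ring X \<subseteq> O_span (*) X"
  by (rule R.genideal_minimal) (use K.O_span_base in blast)
 moreover have "ideal (genideal integer_ring X) integer_ring" "X \<subseteq> genideal integer_ring X"
  using R.genideal_ideal[of X] R.genideal_self[of X] assms by (auto simp: carr)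
 hence "O_span (*) X \<subseteq> genideal integer_ring X"
  by (intro K.O_span_minimal) (auto simp: K.O_submodule_def ideal_integer_ring_iff)
 ultimately show ?thesis by blast
qed

section \<open>Powers of a prime ideal\<close>

context prime_of_K
begin

abbreviation pw :: "nat => 'k set" where "pw n \<equiv> ideal_power integer_ring \<pp> n"

lemma pw_Suc: "pw (Suc n) = ideal_prod integer_ring \<pp> (pw n)"
 by (simp add: ideal_power_def)

lemma pw_ideal: "ideal (pw n) integer_ring"
proof (induction n)
 interpret R: cring "integer_ring :: 'k ring" by (rule cring_integer_ring)
 case 0
 show ?case using R.oneideal by (simp add: ideal_power_def)
next
 interpret R: cring "integer_ring :: 'k ring" by (rule cring_integer_ring)
 case (Suc n)
 show ?case unfolding pw_Suc by (rule R.ideal_prod_is_ideal[OF ideal Suc])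
qed

lemma pw_sub: "x \<in> pw n ==> aint x" and pw_zero: "0 \<in> pw n"
 and pw_add: "x \<in> pw n ==> y \<in> pw n ==> x + y \<in> pw n"
 and pw_mult: "aint a ==> x \<in> pw n ==> a * x \<in> pw n"
 using pw_ideal[of n] unfolding ideal_integer_ring_iff by auto

lemma pw_0: "pw 0 = algints" by (simp add: ideal_power_def integer_ring_def)

lemma pw_prod: "a \<in> \<pp> ==> b \<in> pw n ==> a * b \<in> pw (Suc n)"
 unfolding pw_Suc using ideal_prod.prod[of a \<pp> b "pw n" integer_ring] by (simp add: integer_ring_def)

lemma pw_Suc_induct:
 assumes "x \<in> pw (Suc n)" "!!a b. a \<in> \<pp> ==> b \<in> pw n ==> Q (a * b)" "!!x y. Q x ==> Q y ==> Q (x + y)"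
 shows "Q x"
 using assms(1) unfolding pw_Suc
 by (induction rule: ideal_prod.induct) (use assms(2,3) in \<open>auto simp: integer_ring_def\<close>)

lemma pw_Suc_sub: "x \<in> pw (Suc n) ==> x \<in> pw n"
 by (erule pw_Suc_induct) (auto intro: pw_mult pw_add algint)

lemma pw_1: "pw (Suc 0) = \<pp>"
proof (intro subset_antisym subsetI)
 fix x assume "x \<in> pw (Suc 0)"
 thus "x \<in> \<pp>"
 proof (rule pw_Suc_induct)
  fix a b assume "a \<in> \<pp>" "b \<in> pw 0"
  thus "a * b \<in> \<pp>" using mult[of b a] by (simp add: pw_0 mult.commute)
 qed (rule add)
next
 fix x assume "x \<in> \<pp>"
 thus "x \<in> pw (Suc 0)" using pw_prod[of x 1 0] by (simp add: pw_0 aint_of_int)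
qed

lemma pw_power: "w \<in> \<pp> ==> w ^ n \<in> pw n"
 by (induction n) (auto simp: pw_0 aint_of_int intro: pw_prod)

text \<open>From \<open>b * u = 1 - w\<close>, multiplication by the geometric sum improves the
  inverse modulo the prime to an inverse modulo its \<open>n\<close>-th power.\<close>

lemma inverse_mod_pw:
 assumes "aint b" "b \<notin> \<pp>"
 obtains c w where "aint c" "w \<in> pw n" "b * c + w = 1"
proof -
 obtain u w where u: "aint u" "w \<in> \<pp>" "b * u + w = 1" using inverse_mod[OF assms] .
 have "b * u = 1 - w" using u(3) by (simp add: eq_diff_eq)
 hence "b * (u * (\<Sum>i<n. w ^ i)) = 1 - w ^ n"
  unfolding one_diff_power_eq[of w n] by (simp only: mult.assoc[symmetric])
 hence "b * (u * (\<Sum>i<n. w ^ i)) + w ^ n = 1" by simp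
 moreover have "aint (u * (\<Sum>i<n. w ^ i))"
  by (intro aint_add_mult aint_sum aint_power u algint[OF u(2)])
 ultimately show thesis using that pw_power[OF u(2)] by blast
qed

lemma pw_local:
 assumes "!!x. x \<in> \<pp> ==> \<exists>v\<in>local_ring. x = \<pi> * v"
 shows "x \<in> pw n ==> \<exists>v\<in>local_ring. x = \<pi> ^ n * v"
proof (induction n arbitrary: x)
 case 0
 thus ?case using algint_local by (auto simp: pw_0)
next
 case (Suc n)
 show ?case using Suc.prems
 proof (rule pw_Suc_induct)
  fix a b assume "a \<in> \<pp>" "b \<in> pw n"
  then obtain v w where "v \<in> local_ring" "a = \<pi> * v" "w \<in> local_ring" "b = \<pi> ^ n * w" using assms Suc.IH by metis
  thus "\<exists>v\<in>local_ring. a * b = \<pi> ^ Suc n * v" by (intro bexI[of _ "v * w"]) (auto intro: loc.V_mult)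
 next
  fix x y assume "\<exists>v\<in>local_ring. x = \<pi> ^ Suc n * v" "\<exists>v\<in>local_ring. y = \<pi> ^ Suc n * v"
  then obtain v w where "v \<in> local_ring" "x = \<pi> ^ Suc n * v" "w \<in> local_ring" "y = \<pi> ^ Suc n * w" by blast
  thus "\<exists>v\<in>local_ring. x + y = \<pi> ^ Suc n * v"
   by (intro bexI[of _ "v + w"]) (auto intro: loc.V_add simp: distrib_left)
 qed
qed

lemma filtered_pw: "filtered_ring algints pw"
 by unfold_locales
  (auto simp: aint_of_int aint_add_mult aint_uminus_diff
   intro: pw_sub pw_zero pw_add pw_mult pw_Suc_sub, metis pw_mult mult.commute)

lemma O_completion_eq: "O_completion \<pp> = completion (ring_on algints) pw"
 by (simp add: O_completion_def integer_ring_def)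

end

section \<open>Completions of orders and conjugation\<close>

locale local_orders = quaternion_algebra smul + prime_of_K \<pp>
 for smul :: "'k::number_field => 'b::ring_1 => 'b" and \<pp> :: "'k set"
begin

sublocale number_field_space smul by unfold_locales

abbreviation N :: "'b set => nat => 'b set" where "N S n \<equiv> ideal_power_order smul \<pp> S n"

lemma orderD:
 assumes "is_order smul S"
 shows "O_submodule S" "0 \<in> S" "1 \<in> S" "x \<in> S ==> y \<in> S ==> x + y \<in> S" "x \<in> S ==> y \<in> S ==> x * y \<in> S"
  "aint a ==> x \<in> S ==> smul a x \<in> S" "x \<in> S ==> - x \<in> S"
 using assms is_latticeD O_submodule_minus unfolding is_order_def O_submodule_def by auto

lemma N_submodule: "O_submodule (N S n)"
 unfolding ideal_power_order_def by (rule O_submodule_O_span)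

lemma N_base: "a \<in> pw n ==> x \<in> S ==> smul a x \<in> N S n"
 unfolding ideal_power_order_def by (rule O_span_base) blast

lemma N_minimal: 
 assumes "x \<in> N S n" "O_submodule M" "!!a x. a \<in> pw n ==> x \<in> S ==> smul a x \<in> M" shows "x \<in> M"
proof -
 have "N S n \<subseteq> M" unfolding ideal_power_order_def by (rule O_span_minimal[OF _ assms(2)]) (use assms(3) in auto)
 thus ?thesis using assms(1) by blast
qed

lemma N_smul: "aint a ==> x \<in> N S n ==> smul a x \<in> N S n"
 and N_add: "x \<in> N S n ==> y \<in> N S n ==> x + y \<in> N S n" and N_zero: "0 \<in> N S n"
 using N_submodule by (auto simp: O_submodule_def)

lemma filtered_order:
 assumes S: "is_order smul S" shows "filtered_ring S (N S)"
proof
 note o = orderD[OF S]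
 show sub: "x \<in> S" if "x \<in> N S n" for x n
  by (rule N_minimal[OF that o(1)]) (auto intro: o pw_sub)
 show "a * x \<in> N S n" if a: "a \<in> S" and x: "x \<in> N S n" for a x n
 proof (rule N_minimal[OF x, of "{x. a * x \<in> N S n}", simplified])
  show "O_submodule {x. a * x \<in> N S n}"
   by (auto simp: O_submodule_def N_zero distrib_left N_add smul_mult_right N_smul)
  show "!!b x. b \<in> pw n ==> x \<in> S ==> a * smul b x \<in> N S n"
   by (auto simp: smul_mult_right intro: N_base o a)
 qed
 show "x * a \<in> N S n" if a: "a \<in> S" and x: "x \<in> N S n" for a x n
 proof (rule N_minimal[OF x, of "{x. x * a \<in> N S n}", simplified])
  show "O_submodule {x. x * a \<in> N S n}"
   by (auto simp: O_submodule_def N_zero distrib_right N_add smul_mult_left N_smul)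
  show "!!b x. b \<in> pw n ==> x \<in> S ==> smul b x * a \<in> N S n"
   by (auto simp: smul_mult_left intro: N_base o a)
 qed
 show "x \<in> N S n" if "x \<in> N S (Suc n)" for x n
  by (rule N_minimal[OF that N_submodule]) (auto intro: N_base pw_Suc_sub)
qed (use orderD[OF S] N_add N_zero in auto)

text \<open>\<open>b\<close> is invertible modulo the \<open>n\<close>-th power of the prime, so
  \<open>t\<close> is recovered as \<open>smul c (smul b t) + smul w t\<close>.\<close>

lemma N_local:
 assumes S: "is_order smul S" and t: "t \<in> S" and b: "aint b" "b \<notin> \<pp>" "smul b t \<in> N S n"
 shows "t \<in> N S n"
proof -
 obtain c w where c: "aint c" "w \<in> pw n" "b * c + w = 1" using inverse_mod_pw[OF b(1,2)] .
 have "smul c (smul b t) + smul w t \<in> N S n" by (intro N_add N_smul N_base c b t)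
 also have "smul c (smul b t) + smul w t = smul (b * c + w) t"
  by (simp add: scale_left_distrib mult.commute)
 finally show ?thesis by (simp add: c)
qed

lemma order_completion_simps:
 "carrier (order_completion smul \<pp> S) = carrier (completion (ring_on S) (N S))"
 "mult (order_completion smul \<pp> S) = mult (completion (ring_on S) (N S))"
 "one (order_completion smul \<pp> S) = one (completion (ring_on S) (N S))"
 "zero (order_completion smul \<pp> S) = zero (completion (ring_on S) (N S))"
 "add (order_completion smul \<pp> S) = add (completion (ring_on S) (N S))"
 "module.smult (order_completion smul \<pp> S) =
   (%a x n. \<Union>c\<in>a n. \<Union>r\<in>x n. N S n +>\<^bsub>ring_on S\<^esub> smul c r)"
 by (simp_all add: order_completion_def ring.defs module.defs)

text \<open>The scalar action is a union over all representatives of both arguments; they all give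
  the same coset.\<close>

lemma smult_eq:
 assumes S: "is_order smul S" and a: "a \<in> carrier (O_completion \<pp>)" "c \<in> a n"
  and x: "x \<in> carrier (order_completion smul \<pp> S)" "s \<in> x n"
 shows "module.smult (order_completion smul \<pp> S) a x n = filtered_ring.cs S (N S) n (smul c s)"
proof -
 interpret O: filtered_ring algints pw by (rule filtered_pw)
 interpret S: filtered_ring S "N S" by (rule filtered_order[OF S])
 have a': "a \<in> carrier O.C" using a by (simp add: O_completion_eq)
 have x': "x \<in> carrier S.C" using x by (simp add: order_completion_simps)
 have "S.cs n (smul d r) = S.cs n (smul c s)" if d: "d \<in> a n" and r: "r \<in> x n" for d r
 proof -
  have 1: "d - c \<in> pw n" using O.C_rep[OF a' a(2)] d by (simp add: O.mem_cs)
  have 2: "r - s \<in> N S n" using S.C_rep[OF x' x(2)] r by (simp add: S.mem_cs)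
  have "aint c" "r \<in> S" using O.C_rep[OF a' a(2)] S.C_rep[OF x' r] by auto
  hence "smul (d - c) r + smul c (r - s) \<in> N S n" by (intro N_add N_base N_smul 1 2)
  thus ?thesis by (simp add: S.cs_eq_iff scale_left_diff_distrib scale_right_diff_distrib)
 qed
 thus ?thesis using a(2) x(2) unfolding order_completion_simps S.cs_def by blast
qed

text \<open>Only the localisations are conjugate, so an image must be multiplied by some
  \<open>b\<close> outside the prime to lie in the other order. Elements that such a multiplication
  brings into \<open>N S' n\<close> form \<open>U n\<close>, and representatives are related when
  they agree modulo \<open>U n\<close> after conjugation.\<close>

theorem algebra_iso_if_conjugate:
 assumes S: "is_order smul S" and S': "is_order smul S'" and x: "x * \<xi> = 1" "\<xi> * x = 1"
  and fwd: "!!s. s \<in> S ==> \<exists>b. aint b & b \<notin> \<pp> & smul b (x * s * \<xi>) \<in> S'"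
  and bwd: "!!s. s \<in> S' ==> \<exists>b. aint b & b \<notin> \<pp> & smul b (\<xi> * s * x) \<in> S"
 shows "algebra_iso (O_completion \<pp>) (order_completion smul \<pp> S) (order_completion smul \<pp> S')"
proof -
 note o = orderD[OF S] and o' = orderD[OF S']
 interpret A: filtered_ring S "N S" by (rule filtered_order[OF S])
 interpret B: filtered_ring S' "N S'" by (rule filtered_order[OF S'])
 interpret O: filtered_ring algints pw by (rule filtered_pw)
 note int = aint_add_mult
 define U where "U n = {t. \<exists>b. aint b & b \<notin> \<pp> & smul b t \<in> N S' n}" for n
 have U_I: "t \<in> U n" if "aint b" "b \<notin> \<pp>" "smul b t \<in> N S' n" for b t n
  using that by (auto simp: U_def)
 have U_add: "s + t \<in> U n" if st: "s \<in> U n" "t \<in> U n" for s t n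
 proof -
  obtain b c where b: "aint b" "b \<notin> \<pp>" "smul b s \<in> N S' n"
   and c: "aint c" "c \<notin> \<pp>" "smul c t \<in> N S' n" using st by (auto simp: U_def)
  have "smul c (smul b s) + smul b (smul c t) \<in> N S' n" by (intro N_add N_smul b c)
  hence "smul (b * c) (s + t) \<in> N S' n" by (simp add: scale_right_distrib mult.commute)
  thus ?thesis using b c by (intro U_I[of "b * c"]) (simp_all add: int mult_notin)
 qed
 have U_smul: "smul a t \<in> U n" if at: "aint a" "t \<in> U n" for a t n
 proof -
  obtain b where b: "aint b" "b \<notin> \<pp>" "smul b t \<in> N S' n" using at(2) by (auto simp: U_def)
  have "smul a (smul b t) \<in> N S' n" by (rule N_smul[OF at(1) b(3)])
  thus ?thesis using b(1,2) by (intro U_I[of b]) (simp_all add: mult.commute)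
 qed
 have U_diff: "s - t \<in> U n" if "s \<in> U n" "t \<in> U n" for s t n
  using U_add[OF that(1) U_smul[OF aint_of_int(1)[of "-1"] that(2)]] by simp
 have U_mult: "s * t \<in> U n & t * s \<in> U n" if s: "s \<in> U n" and t: "aint c" "c \<notin> \<pp>" "smul c t \<in> S'" for s t c n
 proof -
  obtain b where b: "aint b" "b \<notin> \<pp>" "smul b s \<in> N S' n" using s by (auto simp: U_def)
  have "smul b s * smul c t \<in> N S' n" "smul c t * smul b s \<in> N S' n" using B.J_left B.J_right b t by blast+
  hence "smul (b * c) (s * t) \<in> N S' n" "smul (b * c) (t * s) \<in> N S' n"
   by (simp_all add: smul_mult_left smul_mult_right mult.commute)
  moreover have "aint (b * c)" "b * c \<notin> \<pp>" using b t by (simp_all add: int mult_notin)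
  ultimately show ?thesis using U_I by blast
 qed
 have U_S': "t \<in> N S' n" if "t \<in> U n" "t \<in> S'" for t n
  using that N_local[OF S'] by (auto simp: U_def)
 have NU: "t \<in> U n" if "t \<in> N S' n" for t n
  by (rule U_I[of 1]) (use that in \<open>simp_all add: one_notin aint_of_int\<close>)
 have U_Suc: "t \<in> U n" if "t \<in> U (Suc n)" for t n
  using that B.J_Suc by (auto simp: U_def)
 have conj_U: "x * s * \<xi> \<in> U n" if s: "s \<in> N S n" for s n
 proof (rule N_minimal[OF s, of "{s. x * s * \<xi> \<in> U n}", simplified])
  show "O_submodule {s. x * s * \<xi> \<in> U n}"
   by (auto simp: O_submodule_def distrib_left distrib_right smul_mult_left smul_mult_right
     NU[OF N_zero] intro!: U_add U_smul)
  fix a s assume a: "a \<in> pw n" and s: "s \<in> S"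
  obtain b where b: "aint b" "b \<notin> \<pp>" "smul b (x * s * \<xi>) \<in> S'" using fwd[OF s] by blast
  have "smul a (smul b (x * s * \<xi>)) \<in> N S' n" by (rule N_base[OF a b(3)])
  thus "x * smul a s * \<xi> \<in> U n"
   by (intro U_I[OF b(1,2)]) (simp add: smul_mult_left smul_mult_right mult.commute)
 qed
 have conj_U_inv: "s \<in> N S n" if s: "s \<in> S" and u: "x * s * \<xi> \<in> U n" for s n
 proof -
  obtain b where b: "aint b" "b \<notin> \<pp>" "smul b (x * s * \<xi>) \<in> N S' n" using u by (auto simp: U_def)
  have "\<exists>c. aint c & c \<notin> \<pp> & smul c (\<xi> * t * x) \<in> N S n" if t: "t \<in> N S' n" for t
  proof (rule N_minimal[OF t, of "{t. \<exists>c. aint c & c \<notin> \<pp> & smul c (\<xi> * t * x) \<in> N S n}", simplified])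
   show "O_submodule {t. \<exists>c. aint c & c \<notin> \<pp> & smul c (\<xi> * t * x) \<in> N S n}"
    unfolding O_submodule_def mem_Collect_eq
   proof (intro conjI ballI allI impI)
    show "\<exists>c. aint c & c \<notin> \<pp> & smul c (\<xi> * 0 * x) \<in> N S n"
     using one_notin by (intro exI[of _ 1]) (simp add: aint_of_int N_zero)
   next
    fix s t assume "s \<in> {t. \<exists>c. aint c & c \<notin> \<pp> & smul c (\<xi> * t * x) \<in> N S n}"
     "t \<in> {t. \<exists>c. aint c & c \<notin> \<pp> & smul c (\<xi> * t * x) \<in> N S n}"
    then obtain c d where c: "aint c" "c \<notin> \<pp>" "smul c (\<xi> * s * x) \<in> N S n"
     and d: "aint d" "d \<notin> \<pp>" "smul d (\<xi> * t * x) \<in> N S n" by blast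
    have "smul d (smul c (\<xi> * s * x)) + smul c (smul d (\<xi> * t * x)) \<in> N S n" by (intro N_add N_smul c d)
    hence "smul (c * d) (\<xi> * (s + t) * x) \<in> N S n"
     by (simp add: scale_right_distrib distrib_left distrib_right mult.commute)
    thus "\<exists>c. aint c & c \<notin> \<pp> & smul c (\<xi> * (s + t) * x) \<in> N S n"
     using c d by (intro exI[of _ "c * d"]) (simp_all add: int mult_notin)
   next
    fix a :: 'k and t assume a: "aint a" and "\<exists>c. aint c & c \<notin> \<pp> & smul c (\<xi> * t * x) \<in> N S n"
    then obtain c where c: "aint c" "c \<notin> \<pp>" "smul c (\<xi> * t * x) \<in> N S n" by blast
    have "smul a (smul c (\<xi> * t * x)) \<in> N S n" by (rule N_smul[OF a c(3)])
    thus "\<exists>c. aint c & c \<notin> \<pp> & smul c (\<xi> * smul a t * x) \<in> N S n"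
     using c by (intro exI[of _ c]) (simp add: smul_mult_left smul_mult_right mult.commute)
   qed
   fix a t assume a: "a \<in> pw n" and t: "t \<in> S'"
   obtain c where c: "aint c" "c \<notin> \<pp>" "smul c (\<xi> * t * x) \<in> S" using bwd[OF t] by blast
   have "smul a (smul c (\<xi> * t * x)) \<in> N S n" by (rule N_base[OF a c(3)])
   thus "\<exists>c. aint c & c \<notin> \<pp> & smul c (\<xi> * smul a t * x) \<in> N S n"
    using c by (intro exI[of _ c]) (simp add: smul_mult_left smul_mult_right mult.commute)
  qed
  from this[OF b(3)] obtain c where c: "aint c" "c \<notin> \<pp>" "smul c (\<xi> * smul b (x * s * \<xi>) * x) \<in> N S n" by blast
  have "\<xi> * (x * s * \<xi>) * x = (\<xi> * x) * s * (\<xi> * x)" by (simp only: mult.assoc)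
  hence "smul (c * b) s \<in> N S n" using c(3) by (simp add: x smul_mult_left smul_mult_right)
  thus ?thesis using b c by (intro N_local[OF S s, of "c * b"]) (simp_all add: int mult_notin)
 qed
 define Rel where "Rel n s t \<longleftrightarrow> s \<in> S & t \<in> S' & t - x * s * \<xi> \<in> U n" for n s t
 interpret filtered_correspondence S "N S" S' "N S'" Rel
 proof
  show "s \<in> S & t \<in> S'" if "Rel n s t" for n s t using that by (simp add: Rel_def)
  \<comment> \<open>With \<open>c\<close> inverse to \<open>b\<close> modulo the \<open>n\<close>-th
    power, multiplying the conjugate by \<open>b\<close> and then by \<open>c\<close> gives an
    element of \<open>S'\<close> that differs from it by an element of \<open>U n\<close>.\<close>
  show "\<exists>t. Rel n s t" if s: "s \<in> S" for n s
  proof -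
   obtain b where b: "aint b" "b \<notin> \<pp>" "smul b (x * s * \<xi>) \<in> S'" using fwd[OF s] by blast
   obtain c w where c: "aint c" "w \<in> pw n" "b * c + w = 1" using inverse_mod_pw[OF b(1,2)] .
   let ?y = "x * s * \<xi>"
   have "smul c (smul b ?y) - ?y = - smul w ?y"
   proof -
    have "?y = smul (b * c + w) ?y" by (simp add: c)
    also have "\<dots> = smul c (smul b ?y) + smul w ?y" by (simp add: scale_left_distrib mult.commute)
    finally show ?thesis by (metis add_diff_cancel_left' diff_diff_eq2 minus_diff_eq add.commute)
   qed
   moreover have "smul w (smul b ?y) \<in> N S' n" by (rule N_base[OF c(2) b(3)])
   hence "smul w ?y \<in> U n" by (intro U_I[OF b(1,2)]) (simp add: mult.commute)
   hence "- smul w ?y \<in> U n" using U_smul[OF aint_of_int(1)[of "-1"]] by fastforce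
   ultimately have "Rel n s (smul c (smul b ?y))" unfolding Rel_def using s o'(6)[OF c(1) b(3)] by simp
   thus ?thesis by blast
  qed
  show "\<exists>s. Rel n s t" if t: "t \<in> S'" for n t
  proof -
   obtain b where b: "aint b" "b \<notin> \<pp>" "smul b (\<xi> * t * x) \<in> S" using bwd[OF t] by blast
   obtain c w where c: "aint c" "w \<in> pw n" "b * c + w = 1" using inverse_mod_pw[OF b(1,2)] .
   let ?s = "smul c (smul b (\<xi> * t * x))"
   have "x * (\<xi> * t * x) * \<xi> = (x * \<xi>) * t * (x * \<xi>)" by (simp only: mult.assoc)
   hence "x * ?s * \<xi> = smul (b * c) t" by (simp add: smul_mult_left smul_mult_right x mult.commute)
   moreover have "smul (b * c) t + smul w t = t" by (simp add: c flip: scale_left_distrib)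
   hence "t - smul (b * c) t = smul w t" by (metis add_diff_cancel_left')
   ultimately have "t - x * ?s * \<xi> \<in> U n" using NU[OF N_base[OF c(2) t]] by simp
   hence "Rel n ?s t" unfolding Rel_def using t o(6)[OF c(1) b(3)] by simp
   thus ?thesis by blast
  qed
  show "s - s' \<in> N S n \<longleftrightarrow> t - t' \<in> N S' n" if r: "Rel n s t" "Rel n s' t'" for n s t s' t'
  proof -
   have 1: "(t - x * s * \<xi>) - (t' - x * s' * \<xi>) \<in> U n"
    using U_diff[of "t - x * s * \<xi>" n "t' - x * s' * \<xi>"] r by (simp add: Rel_def)
   have 2: "(t - x * s * \<xi>) - (t' - x * s' * \<xi>) = (t - t') - x * (s - s') * \<xi>"
    by (simp add: algebra_simps)
   have S: "s - s' \<in> S" "t - t' \<in> S'" using r A.S_diff B.S_diff by (auto simp: Rel_def)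
   have "x * (s - s') * \<xi> \<in> U n \<longleftrightarrow> t - t' \<in> U n"
    using U_add[OF 1, of "x * (s - s') * \<xi>"] U_diff[OF _ 1, of "t - t'"] unfolding 2 by auto
   thus ?thesis using conj_U conj_U_inv[OF S(1)] U_S'[OF _ S(2)] NU by blast
  qed
  show "Rel n s t" if "Rel (Suc n) s t" for n s t using that U_Suc by (simp add: Rel_def)
  show "Rel n (s + s') (t + t')" if r: "Rel n s t" "Rel n s' t'" for n s t s' t'
  proof -
   have "(t - x * s * \<xi>) + (t' - x * s' * \<xi>) \<in> U n"
    using U_add[of "t - x * s * \<xi>" n "t' - x * s' * \<xi>"] r by (simp add: Rel_def)
   thus ?thesis using r o o' by (auto simp: Rel_def algebra_simps)
  qed
  show "Rel n (s * s') (t * t')" if r: "Rel n s t" "Rel n s' t'" for n s t s' t'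
  proof -
   have t': "t' \<in> S'" and s: "s \<in> S" using r by (auto simp: Rel_def)
   obtain b where b: "aint b" "b \<notin> \<pp>" "smul b (x * s * \<xi>) \<in> S'" using fwd[OF s] by blast
   have "(t - x * s * \<xi>) * t' \<in> U n"
    using U_mult[of _ n 1 t'] r t' by (auto simp: Rel_def one_notin aint_of_int)
   moreover have "(x * s * \<xi>) * (t' - x * s' * \<xi>) \<in> U n"
    using U_mult[OF _ b] r by (auto simp: Rel_def)
   ultimately have "(t - x * s * \<xi>) * t' + (x * s * \<xi>) * (t' - x * s' * \<xi>) \<in> U n" by (rule U_add)
   moreover have "(x * s * \<xi>) * (x * s' * \<xi>) = x * (s * s') * \<xi>"
   proof -
    have "(x * s * \<xi>) * (x * s' * \<xi>) = x * s * (\<xi> * x) * s' * \<xi>" by (simp only: mult.assoc)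
    thus ?thesis by (simp add: x mult.assoc)
   qed
   ultimately have "t * t' - x * (s * s') * \<xi> \<in> U n" by (simp add: left_diff_distrib right_diff_distrib)
   thus ?thesis using r o(5) o'(5) by (auto simp: Rel_def)
  qed
  show "Rel n 1 1" for n using NU[OF N_zero] o(3) o'(3) by (simp add: Rel_def x)
 qed
 have "h \<in> ring_iso (order_completion smul \<pp> S) (order_completion smul \<pp> S')"
  using h_iso by (simp add: ring_iso_def Ring.ring_hom_def order_completion_simps)
 moreover have "h (module.smult (order_completion smul \<pp> S) a X) = module.smult (order_completion smul \<pp> S') a (h X)"
  if a: "a \<in> carrier (O_completion \<pp>)" and X: "X \<in> carrier (order_completion smul \<pp> S)" for a X
 proof
  fix n
  have a': "a \<in> carrier O.C" using a by (simp add: O_completion_eq)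
  have X': "X \<in> carrier A.C" using X by (simp add: order_completion_simps)
  have hX: "h X \<in> carrier (order_completion smul \<pp> S')" using h_carrier[OF X'] by (simp add: order_completion_simps)
  obtain c where c: "c \<in> a n" "aint c" using O.C_ex[OF a'] O.C_rep[OF a'] by blast
  have aX: "module.smult (order_completion smul \<pp> S) a X \<in> carrier A.C"
  proof -
   obtain d where d: "!!n. d n \<in> a n" "!!n. aint (d n)" using O.C_ex[OF a'] by (metis mem_Collect_eq)
   obtain s where s: "!!n. s n \<in> X n" "!!n. s n \<in> S" using A.C_ex[OF X'] by metis
   have m: "d (Suc n) \<in> a n" "s (Suc n) \<in> X n" for n
    using d(1)[of "Suc n"] s(1)[of "Suc n"] O.C_mono[OF a', of n "Suc n"] A.C_mono[OF X', of n "Suc n"] by auto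
   show ?thesis
    by (rule A.carrierI[of "%n. smul (d n) (s n)"])
     (use smult_eq[OF S a d(1) X s(1)] smult_eq[OF S a m(1) X m(2)] o(6)[OF d(2) s(2)] in
      \<open>(simp; fail | metis A.cs_self)+\<close>)
  qed
  obtain s t where s: "s \<in> X n" "t \<in> h X n" "Rel n s t" using Rel_mem[OF X'] by blast
  have "smul c (t - x * s * \<xi>) \<in> U n" using U_smul[OF c(2)] s(3) by (simp add: Rel_def)
  hence "Rel n (smul c s) (smul c t)" using s(3) o(6)[OF c(2)] o'(6)[OF c(2)]
   by (simp add: Rel_def scale_right_diff_distrib smul_mult_left smul_mult_right)
  moreover have "smul c s \<in> module.smult (order_completion smul \<pp> S) a X n"
   using smult_eq[OF S a c(1) X s(1)] A.cs_self by simp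
  ultimately show "h (module.smult (order_completion smul \<pp> S) a X) n = module.smult (order_completion smul \<pp> S') a (h X) n"
   using h_eq[OF aX] smult_eq[OF S' a c(1) hX s(2)] by simp
 qed
 ultimately show ?thesis unfolding algebra_iso_def by blast
qed

end

section \<open>Even Clifford algebras\<close>

locale tensor_ring = cring A for A :: "('a, 'm) ring_scheme" (structure)
begin

abbreviation "T \<equiv> tensor_algebra A 3"

definition conv :: "(nat list => 'a) => (nat list => 'a) => nat list => 'a" where
 "conv s t w = (\<Oplus>i\<in>{..length w}. s (take i w) \<otimes> t (drop i w))"

definition vals :: "(nat list => 'a) => bool" where "vals t \<longleftrightarrow> (\<forall>w. t w \<in> carrier A)"

lemma valsD: "vals t ==> t w \<in> carrier A" by (simp add: vals_def)

lemma T_simps: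
 "mult T = conv" "one T = (%w. if w = [] then \<one> else \<zero>)" "zero T = (%w. \<zero>)"
 "add T = (%s t w. s w \<oplus> t w)" "module.smult T = (%a t w. a \<otimes> t w)"
 "carrier T = {t. vals t & finite {w. t w ~= \<zero>} & (\<forall>w. t w ~= \<zero> --> set w \<subseteq> {..<3})}"
 by (auto simp: tensor_algebra_def conv_def vals_def fun_eq_iff)

lemma conv_Nil: "vals s ==> vals t ==> conv s t [] = s [] \<otimes> t []"
 by (simp add: conv_def valsD)

text \<open>Splitting off the first letter turns the convolution into a recursion.\<close>

lemma conv_Cons:
 assumes "vals s" "vals t"
 shows "conv s t (x # w) = s [] \<otimes> t (x # w) \<oplus> conv (%u. s (x # u)) t w"
proof -
 have "conv s t (x # w) = (\<Oplus>i\<in>{..Suc (length w)}. s (take i (x # w)) \<otimes> t (drop i (x # w)))"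
  by (simp add: conv_def)
 also have "\<dots> = (\<Oplus>i\<in>{..length w}. s (take (Suc i) (x # w)) \<otimes> t (drop (Suc i) (x # w))) \<oplus>
   s (take 0 (x # w)) \<otimes> t (drop 0 (x # w))"
  by (rule finsum_Suc2) (use assms in \<open>auto simp: valsD\<close>)
 also have "\<dots> = s [] \<otimes> t (x # w) \<oplus> conv (%u. s (x # u)) t w"
  unfolding conv_def by (subst a_comm) (use assms in \<open>auto simp: valsD intro!: finsum_closed\<close>)
 finally show ?thesis .
qed

lemma vals_conv: "vals s ==> vals t ==> vals (conv s t)"
 unfolding vals_def conv_def by (auto intro!: finsum_closed)

lemma conv_closed: "vals s ==> vals t ==> conv s t w \<in> carrier A"
 by (rule valsD[OF vals_conv])

lemma conv_zero: "vals t ==> conv (%_. \<zero>) t w = \<zero>"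
 unfolding conv_def by (simp add: valsD finsum_zero cong: finsum_cong)

lemma conv_cong_zero: "(!!i. i \<le> length w ==> s (take i w) \<otimes> t (drop i w) = \<zero>) ==> conv s t w = \<zero>"
 unfolding conv_def by (subst finsum_cong'[of _ _ "%_. \<zero>"]) (auto simp: finsum_zero)

lemma conv_add_left: 
 assumes "vals s" "vals s'" "vals t" shows "conv (%w. s w \<oplus> s' w) t w = conv s t w \<oplus> conv s' t w"
proof -
 have "conv (%w. s w \<oplus> s' w) t w = (\<Oplus>i\<in>{..length w}. s (take i w) \<otimes> t (drop i w) \<oplus> s' (take i w) \<otimes> t (drop i w))"
  unfolding conv_def by (rule finsum_cong') (use assms in \<open>auto simp: valsD l_distr\<close>)
 thus ?thesis unfolding conv_def using assms by (subst (asm) finsum_addf) (auto simp: valsD)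
qed

lemma conv_add_right: 
 assumes "vals s" "vals t" "vals t'" shows "conv s (%w. t w \<oplus> t' w) w = conv s t w \<oplus> conv s t' w"
proof -
 have "conv s (%w. t w \<oplus> t' w) w = (\<Oplus>i\<in>{..length w}. s (take i w) \<otimes> t (drop i w) \<oplus> s (take i w) \<otimes> t' (drop i w))"
  unfolding conv_def by (rule finsum_cong') (use assms in \<open>auto simp: valsD r_distr\<close>)
 thus ?thesis unfolding conv_def using assms by (subst (asm) finsum_addf) (auto simp: valsD)
qed

lemma conv_smult_left: 
 assumes "vals s" "vals t" "a \<in> carrier A" shows "conv (%w. a \<otimes> s w) t w = a \<otimes> conv s t w"
proof -
 have "conv (%w. a \<otimes> s w) t w = (\<Oplus>i\<in>{..length w}. a \<otimes> (s (take i w) \<otimes> t (drop i w)))"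
  unfolding conv_def by (rule finsum_cong') (use assms in \<open>auto simp: valsD m_assoc\<close>)
 thus ?thesis unfolding conv_def using assms by (subst (asm) finsum_rdistr[symmetric]) (auto simp: valsD)
qed

text \<open>Induction on the word with both left factors arbitrary: by \<open>conv_Cons\<close> the
  first letter is either absorbed by \<open>s\<close>, by \<open>t\<close>, or passed on, and the
  shifted functions satisfy the induction hypothesis.\<close>

lemma conv_assoc: 
 "vals s ==> vals t ==> vals u ==> conv (conv s t) u w = conv s (conv t u) w"
proof (induction w arbitrary: s t)
 case Nil
 thus ?case by (simp add: conv_Nil vals_conv valsD m_assoc)
next
 case (Cons x w)
 let ?s = "%v. s (x # v)" and ?t = "%v. t (x # v)"
 have v: "vals ?s" "vals ?t" using Cons.prems by (auto simp: vals_def)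
 have a: "s [] \<in> carrier A" using Cons.prems by (simp add: valsD)
 have "conv (conv s t) u (x # w) = conv s t [] \<otimes> u (x # w) \<oplus> conv (%v. conv s t (x # v)) u w"
  by (rule conv_Cons) (use Cons.prems in \<open>auto intro: vals_conv\<close>)
 also have "(%v. conv s t (x # v)) = (%v. s [] \<otimes> ?t v \<oplus> conv ?s t v)"
  using Cons.prems by (simp add: conv_Cons)
 also have "conv (%v. s [] \<otimes> ?t v \<oplus> conv ?s t v) u w = conv (%v. s [] \<otimes> ?t v) u w \<oplus> conv (conv ?s t) u w"
  by (rule conv_add_left) (use Cons.prems v a in \<open>auto simp: vals_def intro: conv_closed\<close>)
 also have "conv (%v. s [] \<otimes> ?t v) u w = s [] \<otimes> conv ?t u w"
  by (rule conv_smult_left[OF v(2) Cons.prems(3) a])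
 also have "conv (conv ?s t) u w = conv ?s (conv t u) w" by (rule Cons.IH[OF v(1) Cons.prems(2,3)])
 also have "conv s t [] \<otimes> u (x # w) \<oplus> (s [] \<otimes> conv ?t u w \<oplus> conv ?s (conv t u) w) =
   s [] \<otimes> (t [] \<otimes> u (x # w) \<oplus> conv ?t u w) \<oplus> conv ?s (conv t u) w"
  using Cons.prems v by (simp add: conv_Nil valsD conv_closed vals_conv m_assoc r_distr a_assoc)
 also have "\<dots> = s [] \<otimes> conv t u (x # w) \<oplus> conv ?s (conv t u) w"
  using Cons.prems by (simp add: conv_Cons)
 also have "\<dots> = conv s (conv t u) (x # w)"
  by (rule conv_Cons[symmetric]) (use Cons.prems in \<open>auto intro: vals_conv\<close>)
 finally show ?case .
qed

lemma conv_one_left: "vals t ==> conv (%w. if w = [] then \<one> else \<zero>) t w = t w"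
proof (cases w)
 case (Cons x v)
 assume t: "vals t"
 have "vals (%w. if w = [] then \<one> else \<zero>)" by (simp add: vals_def)
 from conv_Cons[OF this t] show ?thesis using t Cons by (simp add: conv_zero valsD)
qed (simp add: conv_Nil vals_def)

lemma conv_one_right: "vals t ==> conv t (%w. if w = [] then \<one> else \<zero>) w = t w"
proof (induction w arbitrary: t)
 case Nil
 thus ?case by (simp add: conv_Nil vals_def)
next
 case (Cons x w)
 have o: "vals (%w. if w = [] then \<one> else \<zero>)" by (simp add: vals_def)
 have "vals (%v. t (x # v))" using Cons.prems by (simp add: vals_def)
 from Cons.IH[OF this] show ?case using conv_Cons[OF Cons.prems o] Cons.prems by (simp add: valsD)
qed

lemma conv_carrier: "s \<in> carrier T ==> t \<in> carrier T ==> conv s t \<in> carrier T"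
proof -
 assume s: "s \<in> carrier T" and t: "t \<in> carrier T"
 have *: "\<exists>u v. w = u @ v & s u ~= \<zero> & t v ~= \<zero>" if "conv s t w ~= \<zero>" for w
 proof (rule ccontr)
  assume n: "\<not> ?thesis"
  have "conv s t w = \<zero>"
  proof (rule conv_cong_zero)
   fix i
   have "s (take i w) = \<zero> \<or> t (drop i w) = \<zero>" using n by (metis append_take_drop_id)
   thus "s (take i w) \<otimes> t (drop i w) = \<zero>" using s t by (auto simp: T_simps valsD)
  qed
  thus False using that by simp
 qed
 have "{w. conv s t w ~= \<zero>} \<subseteq> (%(u, v). u @ v) ` ({w. s w ~= \<zero>} \<times> {w. t w ~= \<zero>})"
  using * by (auto simp: image_iff)
 moreover have "finite ((%(u, v). u @ v) ` ({w. s w ~= \<zero>} \<times> {w. t w ~= \<zero>}))"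
  using s t by (simp add: T_simps)
 ultimately have "finite {w. conv s t w ~= \<zero>}" by (rule finite_subset)
 moreover have "set w \<subseteq> {..<3}" if "conv s t w ~= \<zero>" for w
  using *[OF that] s t by (fastforce simp: T_simps)
 ultimately show ?thesis using s t by (simp add: T_simps vals_conv)
qed

lemma ring_T: "ring T"
proof (rule ringI)
 show "abelian_group T"
 proof (rule abelian_groupI)
  fix s t assume st: "s \<in> carrier T" "t \<in> carrier T"
  have "{w. s w \<oplus> t w ~= \<zero>} \<subseteq> {w. s w ~= \<zero>} \<union> {w. t w ~= \<zero>}" by auto
  from finite_subset[OF this] show "s \<oplus>\<^bsub>T\<^esub> t \<in> carrier T" using st
   by (auto simp: T_simps vals_def) (metis lessThan_iff r_zero subsetD valsD vals_def zero_closed)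
  show "s \<oplus>\<^bsub>T\<^esub> t = t \<oplus>\<^bsub>T\<^esub> s" using st by (auto simp: T_simps valsD a_comm)
  fix u assume "u \<in> carrier T"
  thus "(s \<oplus>\<^bsub>T\<^esub> t) \<oplus>\<^bsub>T\<^esub> u = s \<oplus>\<^bsub>T\<^esub> (t \<oplus>\<^bsub>T\<^esub> u)" using st by (auto simp: T_simps valsD a_assoc)
 next
  fix s assume s: "s \<in> carrier T"
  thus "\<zero>\<^bsub>T\<^esub> \<oplus>\<^bsub>T\<^esub> s = s" by (auto simp: T_simps valsD)
  have "\<ominus> x = \<zero> \<longleftrightarrow> x = \<zero>" if "x \<in> carrier A" for x using that by (metis minus_minus minus_zero)
  hence "{w. \<ominus> s w ~= \<zero>} = {w. s w ~= \<zero>}" using s by (auto simp: T_simps valsD)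
  hence "(%w. \<ominus> s w) \<in> carrier T" using s by (auto simp: T_simps vals_def)
  moreover have "(%w. \<ominus> s w) \<oplus>\<^bsub>T\<^esub> s = \<zero>\<^bsub>T\<^esub>" using s by (auto simp: T_simps valsD l_neg)
  ultimately show "\<exists>t\<in>carrier T. t \<oplus>\<^bsub>T\<^esub> s = \<zero>\<^bsub>T\<^esub>" by blast
 qed (auto simp: T_simps vals_def)
 show "Group.monoid T"
 proof (rule monoidI)
  show "\<one>\<^bsub>T\<^esub> \<in> carrier T" by (auto simp: T_simps vals_def)
 qed (simp_all add: conv_carrier T_simps(1), auto simp: T_simps conv_assoc conv_one_left conv_one_right fun_eq_iff)
 fix s t u assume stu: "s \<in> carrier T" "t \<in> carrier T" "u \<in> carrier T"
 show "(s \<oplus>\<^bsub>T\<^esub> t) \<otimes>\<^bsub>T\<^esub> u = s \<otimes>\<^bsub>T\<^esub> u \<oplus>\<^bsub>T\<^esub> t \<otimes>\<^bsub>T\<^esub> u" using stu by (auto simp: T_simps conv_add_left fun_eq_iff)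
 show "u \<otimes>\<^bsub>T\<^esub> (s \<oplus>\<^bsub>T\<^esub> t) = u \<otimes>\<^bsub>T\<^esub> s \<oplus>\<^bsub>T\<^esub> u \<otimes>\<^bsub>T\<^esub> t" using stu by (auto simp: T_simps conv_add_right fun_eq_iff)
qed

definition mono :: "nat list => 'a => nat list => 'a" where "mono v a = (%w. if w = v then a else \<zero>)"

lemma mono_carrier: "a \<in> carrier A ==> set v \<subseteq> {..<3} ==> mono v a \<in> carrier T"
 by (auto simp: mono_def T_simps vals_def)

lemma vals_mono: "a \<in> carrier A ==> vals (mono v a)"
 by (auto simp: mono_def vals_def)

lemma conv_mono: 
 assumes a: "a \<in> carrier A" shows "b \<in> carrier A ==> conv (mono u a) (mono v b) = mono (u @ v) (a \<otimes> b)"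
proof
 fix w assume b: "b \<in> carrier A"
 show "conv (mono u a) (mono v b) w = mono (u @ v) (a \<otimes> b) w"
 proof (induction u arbitrary: w)
  case Nil
  have 0: "(%w. mono [] a (x # w)) = (%_. \<zero>)" for x by (auto simp: mono_def)
  show ?case
   by (cases w) (simp_all add: conv_Nil conv_Cons vals_mono a b 0 conv_zero, auto simp: mono_def a b)
 next
  case (Cons y u)
  have 0: "(%w. mono (y # u) a (x # w)) = (if x = y then mono u a else (%_. \<zero>))" for x by (auto simp: mono_def)
  show ?case
   by (cases w) (simp_all add: conv_Nil conv_Cons vals_mono a b 0 conv_zero Cons, auto simp: mono_def a b)
 qed
qed

section \<open>Products of two basis vectors and their relations in the even Clifford
  algebra\<close>

context
 fixes f :: "nat => nat => 'a"
 assumes f: "!!i j. i \<le> j ==> j < 3 ==> f i j \<in> carrier A"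
begin

abbreviation "I \<equiv> clifford_ideal A f"
abbreviation "cl t \<equiv> I +>\<^bsub>T\<^esub> t"
abbreviation "E \<equiv> even_clifford A f"

lemma qf_eval_closed: "(!!i. i < 3 ==> v i \<in> carrier A) ==> qf_eval A f v \<in> carrier A"
 unfolding qf_eval_def by (auto intro!: finsum_closed f)

lemma smult_carrier: "a \<in> carrier A ==> t \<in> carrier T ==> a \<odot>\<^bsub>T\<^esub> t \<in> carrier T"
proof -
 assume a: "a \<in> carrier A" and t: "t \<in> carrier T"
 have "{w. a \<otimes> t w ~= \<zero>} \<subseteq> {w. t w ~= \<zero>}" using a by auto
 moreover have "t w ~= \<zero>" if "a \<otimes> t w ~= \<zero>" for w using that a by auto
 ultimately show ?thesis using a t finite_subset[of "{w. a \<otimes> t w ~= \<zero>}" "{w. t w ~= \<zero>}"]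
  unfolding T_simps vals_def by blast
qed

lemma tensor_vec_carrier: "(!!i. i < 3 ==> v i \<in> carrier A) ==> tensor_vec A 3 v \<in> carrier T"
proof -
 assume v: "!!i. i < 3 ==> v i \<in> carrier A"
 have "{w. tensor_vec A 3 v w ~= \<zero>} \<subseteq> (%i. [i]) ` {..<3}"
  by (auto simp: tensor_vec_def length_Suc_conv split: if_splits)
 from finite_subset[OF this] show ?thesis using v
  by (auto simp: T_simps vals_def tensor_vec_def length_Suc_conv split: if_splits)
qed

lemma I_eq: "I = genideal T {tensor_vec A 3 v \<otimes>\<^bsub>T\<^esub> tensor_vec A 3 v \<ominus>\<^bsub>T\<^esub> qf_eval A f v \<odot>\<^bsub>T\<^esub> \<one>\<^bsub>T\<^esub> |
  v. v \<in> {..<3} \<rightarrow>\<^sub>E carrier A}"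
 by (simp add: clifford_ideal_def Let_def)

lemma I_ideal: "ideal I T" and I_rel: "(!!i. i < 3 ==> v i \<in> carrier A) ==> v \<in> extensional {..<3} ==>
  tensor_vec A 3 v \<otimes>\<^bsub>T\<^esub> tensor_vec A 3 v \<ominus>\<^bsub>T\<^esub> qf_eval A f v \<odot>\<^bsub>T\<^esub> \<one>\<^bsub>T\<^esub> \<in> I"
proof -
 interpret T: ring T by (rule ring_T)
 have sub: "{tensor_vec A 3 v \<otimes>\<^bsub>T\<^esub> tensor_vec A 3 v \<ominus>\<^bsub>T\<^esub> qf_eval A f v \<odot>\<^bsub>T\<^esub> \<one>\<^bsub>T\<^esub> |
  v. v \<in> {..<3} \<rightarrow>\<^sub>E carrier A} \<subseteq> carrier T"
  by (auto simp: PiE_def Pi_def intro!: T.minus_closed T.m_closed tensor_vec_carrier smult_carrier qf_eval_closed)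
 show "ideal I T" unfolding I_eq by (rule T.genideal_ideal[OF sub])
 show "(!!i. i < 3 ==> v i \<in> carrier A) ==> v \<in> extensional {..<3} ==>
  tensor_vec A 3 v \<otimes>\<^bsub>T\<^esub> tensor_vec A 3 v \<ominus>\<^bsub>T\<^esub> qf_eval A f v \<odot>\<^bsub>T\<^esub> \<one>\<^bsub>T\<^esub> \<in> I"
  using T.genideal_self[OF sub] unfolding I_eq by (auto simp: PiE_def Pi_def)
qed

lemma cl_eqI: "s \<in> carrier T ==> t \<in> carrier T ==> s \<ominus>\<^bsub>T\<^esub> t \<in> I ==> cl s = cl t"
proof -
 interpret T: ring T by (rule ring_T)
 interpret I: ideal I T by (rule I_ideal)
 assume "s \<in> carrier T" "t \<in> carrier T" "s \<ominus>\<^bsub>T\<^esub> t \<in> I"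
 thus "cl s = cl t" using T.quotient_eq_iff_same_a_r_cos[OF I_ideal] by blast
qed

definition even_T :: "(nat list => 'a) => bool" where
 "even_T t \<longleftrightarrow> t \<in> carrier T & (\<forall>w. t w ~= \<zero> --> even (length w))"

lemma E_simps:
 "carrier E = {cl t | t. even_T t}" "mult E = rcoset_mult T I" "add E = set_add T" "one E = cl \<one>\<^bsub>T\<^esub>"
 "module.smult E = (%a X. \<Union>t\<in>X. cl (a \<odot>\<^bsub>T\<^esub> t))"
 by (auto simp: even_clifford_def Let_def ring.defs module.defs FactRing_def even_T_def)

text \<open>The scalar action is a union over a coset. It is well defined because it is
  multiplication by the degree zero element \<open>mono [] a\<close>, and the Clifford ideal is
  stable under that.\<close>

lemma E_ops:
 assumes "s \<in> carrier T" "t \<in> carrier T"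
 shows "cl s \<otimes>\<^bsub>E\<^esub> cl t = cl (s \<otimes>\<^bsub>T\<^esub> t)" "cl s \<oplus>\<^bsub>E\<^esub> cl t = cl (s \<oplus>\<^bsub>T\<^esub> t)"
  "a \<in> carrier A ==> a \<odot>\<^bsub>E\<^esub> cl s = cl (a \<odot>\<^bsub>T\<^esub> s)"
proof -
 interpret T: ring T by (rule ring_T)
 interpret I: ideal I T by (rule I_ideal)
 show "cl s \<otimes>\<^bsub>E\<^esub> cl t = cl (s \<otimes>\<^bsub>T\<^esub> t)" "cl s \<oplus>\<^bsub>E\<^esub> cl t = cl (s \<oplus>\<^bsub>T\<^esub> t)"
  using assms by (simp_all add: E_simps I.rcoset_mult_add I.a_rcos_sum)
 assume a: "a \<in> carrier A"
 have "cl (a \<odot>\<^bsub>T\<^esub> u) = cl (a \<odot>\<^bsub>T\<^esub> s)" if u: "u \<in> cl s" for u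
 proof -
  obtain d where d: "d \<in> I" "u = d \<oplus>\<^bsub>T\<^esub> s" using u by (auto simp: a_r_coset_def')
  have dT: "d \<in> carrier T" using d(1) I.a_subset by blast
  have m: "mono [] a \<in> carrier T" by (rule mono_carrier[OF a]) simp
  have sm: "a \<odot>\<^bsub>T\<^esub> t = mono [] a \<otimes>\<^bsub>T\<^esub> t" if t: "t \<in> carrier T" for t
  proof
   fix w
   have v: "vals t" using t by (simp add: T_simps)
   have "(%v. mono [] a (x # v)) = (%_. \<zero>)" for x by (auto simp: mono_def)
   thus "(a \<odot>\<^bsub>T\<^esub> t) w = (mono [] a \<otimes>\<^bsub>T\<^esub> t) w"
    by (cases w) (simp_all add: T_simps conv_Nil conv_Cons vals_mono a v conv_zero, simp_all add: mono_def valsD[OF v] a)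
  qed
  have uT: "u \<in> carrier T" using d dT assms by simp
  have "a \<odot>\<^bsub>T\<^esub> u = mono [] a \<otimes>\<^bsub>T\<^esub> (d \<oplus>\<^bsub>T\<^esub> s)" using sm[OF uT] by (simp only: d(2))
  also have "\<dots> = mono [] a \<otimes>\<^bsub>T\<^esub> d \<oplus>\<^bsub>T\<^esub> a \<odot>\<^bsub>T\<^esub> s"
   unfolding sm[OF assms(1)] using m dT assms by (simp add: T.r_distr)
  finally have "a \<odot>\<^bsub>T\<^esub> u = mono [] a \<otimes>\<^bsub>T\<^esub> d \<oplus>\<^bsub>T\<^esub> a \<odot>\<^bsub>T\<^esub> s" .
  moreover have "mono [] a \<otimes>\<^bsub>T\<^esub> d \<in> I" by (rule I.I_l_closed[OF d(1) m])
  moreover have s': "a \<odot>\<^bsub>T\<^esub> s \<in> carrier T" by (rule smult_carrier[OF a assms(1)])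
  ultimately have "a \<odot>\<^bsub>T\<^esub> u \<ominus>\<^bsub>T\<^esub> a \<odot>\<^bsub>T\<^esub> s \<in> I"
   using m dT by (simp add: a_minus_def T.a_assoc T.r_neg)
  thus ?thesis by (intro cl_eqI smult_carrier a uT assms(1))
 qed
 moreover have "s \<in> cl s" using I.a_rcos_self[OF assms(1)] .
 ultimately show "a \<odot>\<^bsub>E\<^esub> cl s = cl (a \<odot>\<^bsub>T\<^esub> s)" unfolding E_simps by blast
qed

definition gen :: "nat => nat => (nat list => 'a) set" where "gen i j = cl (mono [i, j] \<one>)"

lemma mono_T: "i < 3 ==> mono [i] \<one> \<in> carrier T" "i < 3 ==> j < 3 ==> mono [i, j] \<one> \<in> carrier T"
  "a \<in> carrier A ==> mono [] a \<in> carrier T"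
 by (auto intro: mono_carrier)

lemma smult_mono: "a \<in> carrier A ==> b \<in> carrier A ==> a \<odot>\<^bsub>T\<^esub> mono w b = mono w (a \<otimes> b)"
 by (auto simp: T_simps mono_def)

lemma one_mono: "\<one>\<^bsub>T\<^esub> = mono [] \<one>" by (auto simp: T_simps mono_def)

lemma smult_one: "a \<in> carrier A ==> a \<odot>\<^bsub>T\<^esub> \<one>\<^bsub>T\<^esub> = mono [] a"
 by (simp add: one_mono smult_mono)

lemma E_smult_one: "a \<in> carrier A ==> a \<odot>\<^bsub>E\<^esub> \<one>\<^bsub>E\<^esub> = cl (mono [] a)"
 using E_ops(3)[of "\<one>\<^bsub>T\<^esub>" "\<one>\<^bsub>T\<^esub>" a] mono_T(3)[OF one_closed] smult_one[of a]
 by (metis E_simps(4) one_mono)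

lemma qf_eval_expand:
 assumes v: "!!i. i < 3 ==> v i \<in> carrier A"
 shows "qf_eval A f v = (f 0 0 \<otimes> (v 0 \<otimes> v 0) \<oplus> (f 0 1 \<otimes> (v 0 \<otimes> v 1) \<oplus> f 0 2 \<otimes> (v 0 \<otimes> v 2))) \<oplus>
  ((f 1 1 \<otimes> (v 1 \<otimes> v 1) \<oplus> f 1 2 \<otimes> (v 1 \<otimes> v 2)) \<oplus> f 2 2 \<otimes> (v 2 \<otimes> v 2))"
proof -
 have s: "{..<3::nat} = {0, 1, 2}" "{0..<3::nat} = {0, 1, 2}" "{1..<3::nat} = {1, 2}" "{2..<3::nat} = {2}" by auto
 show ?thesis unfolding qf_eval_def s(1) using v f
  by (simp add: s[simplified] Pi_def)
qed

lemma mono_i_eq: "i < 3 ==> tensor_vec A 3 (\<lambda>k\<in>{..<3}. if k = i then \<one> else \<zero>) = mono [i] \<one>"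
 by (rule ext, rename_tac w, case_tac w) (auto simp: tensor_vec_def mono_def)

lemma conv_mono_T: "a \<in> carrier A ==> b \<in> carrier A ==> mono u a \<otimes>\<^bsub>T\<^esub> mono v b = mono (u @ v) (a \<otimes> b)"
 by (simp add: T_simps conv_mono)

text \<open>The defining relation for the \<open>i\<close>-th basis vector.\<close>

lemma gen_diag_I: 
 assumes i: "i < 3" shows "mono [i, i] \<one> \<ominus>\<^bsub>T\<^esub> mono [] (f i i) \<in> I"
proof -
 let ?v = "\<lambda>k\<in>{..<3}. if k = i then \<one> else \<zero>"
 have q: "qf_eval A f ?v = f i i"
 proof -
  consider "i = 0" | "i = 1" | "i = 2" using i by linarith
  thus ?thesis by cases (subst qf_eval_expand, use f in auto)+
 qed
 have "tensor_vec A 3 ?v \<otimes>\<^bsub>T\<^esub> tensor_vec A 3 ?v \<ominus>\<^bsub>T\<^esub> qf_eval A f ?v \<odot>\<^bsub>T\<^esub> \<one>\<^bsub>T\<^esub> \<in> I"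
  by (rule I_rel) auto
 thus ?thesis using i f by (simp add: q mono_i_eq[OF i] conv_mono_T smult_one)
qed

lemma gen_diag: "i < 3 ==> gen i i = f i i \<odot>\<^bsub>E\<^esub> \<one>\<^bsub>E\<^esub>"
 unfolding gen_def using f gen_diag_I by (simp add: E_smult_one cl_eqI mono_T)

text \<open>Polarisation: the defining relation for a sum of two basis vectors, with the relations
  of both cancelled. The cancellation is carried out in the full quotient ring, which has the same
  addition.\<close>

lemma gen_anticommute:
 assumes i: "i < j" and j: "j < 3" shows "gen i j \<oplus>\<^bsub>E\<^esub> gen j i = f i j \<odot>\<^bsub>E\<^esub> \<one>\<^bsub>E\<^esub>"
proof -
 interpret T: ring T by (rule ring_T)
 interpret J: ideal I T by (rule I_ideal)
 interpret Q: ring "T Quot I" by (rule J.quotient_is_ring)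
 let ?v = "\<lambda>k\<in>{..<3}. if k = i \<or> k = j then \<one> else \<zero>"
 have i3: "i < 3" using i j by simp
 note fc = f[of i i] f[of i j] f[of j j]
 have fA: "f i i \<in> carrier A" "f i j \<in> carrier A" "f j j \<in> carrier A" using fc i j by auto
 have q: "qf_eval A f ?v = f i i \<oplus> f i j \<oplus> f j j"
 proof -
  consider "i = 0" "j = 1" | "i = 0" "j = 2" | "i = 1" "j = 2" using i j by linarith
  thus ?thesis by cases (subst qf_eval_expand, use f in \<open>auto simp: a_assoc\<close>)+
 qed
 have tv: "tensor_vec A 3 ?v = mono [i] \<one> \<oplus>\<^bsub>T\<^esub> mono [j] \<one>"
  by (rule ext, rename_tac w, case_tac w) (use i j in \<open>auto simp: tensor_vec_def mono_def T_simps\<close>)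
 note m = mono_T(1)[OF i3] mono_T(1)[OF j] mono_T(2)[OF i3 i3] mono_T(2)[OF i3 j] mono_T(2)[OF j i3] mono_T(2)[OF j j]
  mono_T(3)[OF fA(1)] mono_T(3)[OF fA(2)] mono_T(3)[OF fA(3)]
 have sq: "tensor_vec A 3 ?v \<otimes>\<^bsub>T\<^esub> tensor_vec A 3 ?v =
   (mono [i, i] \<one> \<oplus>\<^bsub>T\<^esub> mono [j, i] \<one>) \<oplus>\<^bsub>T\<^esub> (mono [i, j] \<one> \<oplus>\<^bsub>T\<^esub> mono [j, j] \<one>)"
  unfolding tv using m by (simp add: T.r_distr T.l_distr conv_mono_T)
 have q1: "qf_eval A f ?v \<odot>\<^bsub>T\<^esub> \<one>\<^bsub>T\<^esub> = mono [] (f i i) \<oplus>\<^bsub>T\<^esub> mono [] (f i j) \<oplus>\<^bsub>T\<^esub> mono [] (f j j)"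
  unfolding q using fA by (subst smult_one) (auto simp: T_simps mono_def)
 have "cl (tensor_vec A 3 ?v \<otimes>\<^bsub>T\<^esub> tensor_vec A 3 ?v) = cl (qf_eval A f ?v \<odot>\<^bsub>T\<^esub> \<one>\<^bsub>T\<^esub>)"
 proof (rule cl_eqI)
  show "tensor_vec A 3 ?v \<otimes>\<^bsub>T\<^esub> tensor_vec A 3 ?v \<ominus>\<^bsub>T\<^esub> qf_eval A f ?v \<odot>\<^bsub>T\<^esub> \<one>\<^bsub>T\<^esub> \<in> I" by (rule I_rel) auto
 qed (unfold sq q1, use m in auto)
 hence "cl ((mono [i, i] \<one> \<oplus>\<^bsub>T\<^esub> mono [j, i] \<one>) \<oplus>\<^bsub>T\<^esub> (mono [i, j] \<one> \<oplus>\<^bsub>T\<^esub> mono [j, j] \<one>)) =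
   cl (mono [] (f i i) \<oplus>\<^bsub>T\<^esub> mono [] (f i j) \<oplus>\<^bsub>T\<^esub> mono [] (f j j))" unfolding sq q1 .
 hence e: "(cl (mono [i, i] \<one>) \<oplus>\<^bsub>E\<^esub> gen j i) \<oplus>\<^bsub>E\<^esub> (gen i j \<oplus>\<^bsub>E\<^esub> cl (mono [j, j] \<one>)) =
   cl (mono [] (f i i)) \<oplus>\<^bsub>E\<^esub> cl (mono [] (f i j)) \<oplus>\<^bsub>E\<^esub> cl (mono [] (f j j))"
  using m by (simp add: gen_def E_ops)
 have c: "cl (mono [i, i] \<one>) = cl (mono [] (f i i))" "cl (mono [j, j] \<one>) = cl (mono [] (f j j))"
  by (rule cl_eqI[OF m(3) m(7) gen_diag_I[OF i3]], rule cl_eqI[OF m(6) m(9) gen_diag_I[OF j]])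
 have add: "x \<oplus>\<^bsub>E\<^esub> y = x \<oplus>\<^bsub>T Quot I\<^esub> y" for x y by (simp add: E_simps FactRing_def)
 have carr: "cl t \<in> carrier (T Quot I)" if "t \<in> carrier T" for t
  using that by (auto simp: FactRing_def A_RCOSETS_def')
 have C: "cl (mono [] (f i i)) \<in> carrier (T Quot I)" "cl (mono [] (f i j)) \<in> carrier (T Quot I)"
  "cl (mono [] (f j j)) \<in> carrier (T Quot I)" "gen i j \<in> carrier (T Quot I)" "gen j i \<in> carrier (T Quot I)"
  unfolding gen_def by (intro carr m)+
 have "(cl (mono [] (f i i)) \<oplus>\<^bsub>T Quot I\<^esub> cl (mono [] (f j j))) \<oplus>\<^bsub>T Quot I\<^esub> (gen i j \<oplus>\<^bsub>T Quot I\<^esub> gen j i) =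
   (cl (mono [] (f i i)) \<oplus>\<^bsub>T Quot I\<^esub> cl (mono [] (f j j))) \<oplus>\<^bsub>T Quot I\<^esub> cl (mono [] (f i j))"
  using e C unfolding c add by (simp add: Q.a_ac)
 hence "gen i j \<oplus>\<^bsub>T Quot I\<^esub> gen j i = cl (mono [] (f i j))"
  using C by (metis Q.r_neg1 Q.a_closed)
 thus ?thesis using fA by (simp add: E_smult_one add)
qed

text \<open>The relation for the \<open>j\<close>-th basis vector, placed between the
  \<open>i\<close>-th and the \<open>l\<close>-th one.\<close>

lemma gen_mult:
 assumes i: "i < 3" and j: "j < 3" and l: "l < 3" shows "gen i j \<otimes>\<^bsub>E\<^esub> gen j l = f j j \<odot>\<^bsub>E\<^esub> gen i l"
proof -
 interpret T: ring T by (rule ring_T)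
 interpret J: ideal I T by (rule I_ideal)
 have fA: "f j j \<in> carrier A" using f j by simp
 note m = mono_T(1)[OF i] mono_T(1)[OF l] mono_T(2)[OF j j] mono_T(3)[OF fA]
 have "mono [i] \<one> \<otimes>\<^bsub>T\<^esub> (mono [j, j] \<one> \<ominus>\<^bsub>T\<^esub> mono [] (f j j)) \<otimes>\<^bsub>T\<^esub> mono [l] \<one> \<in> I"
  by (intro J.I_r_closed J.I_l_closed gen_diag_I j m)
 also have "mono [i] \<one> \<otimes>\<^bsub>T\<^esub> (mono [j, j] \<one> \<ominus>\<^bsub>T\<^esub> mono [] (f j j)) \<otimes>\<^bsub>T\<^esub> mono [l] \<one> =
   mono [i, j, j, l] \<one> \<ominus>\<^bsub>T\<^esub> mono [i, l] (f j j)"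
 proof -
  have "mono [i] \<one> \<otimes>\<^bsub>T\<^esub> mono [j, j] \<one> \<otimes>\<^bsub>T\<^esub> mono [l] \<one> = mono [i, j, j, l] \<one>"
   "mono [i] \<one> \<otimes>\<^bsub>T\<^esub> mono [] (f j j) \<otimes>\<^bsub>T\<^esub> mono [l] \<one> = mono [i, l] (f j j)"
   using fA by (simp_all add: conv_mono_T)
  thus ?thesis using m unfolding a_minus_def by (simp add: T.r_distr T.l_distr T.r_minus T.l_minus)
 qed
 finally have "cl (mono [i, j, j, l] \<one>) = cl (mono [i, l] (f j j))"
  using i j l fA by (intro cl_eqI mono_carrier) auto
 moreover have "gen i j \<otimes>\<^bsub>E\<^esub> gen j l = cl (mono [i, j, j, l] \<one>)"
  unfolding gen_def E_ops(1)[OF mono_T(2)[OF i j] mono_T(2)[OF j l]] by (simp add: conv_mono_T)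
 moreover have "f j j \<odot>\<^bsub>E\<^esub> gen i l = cl (mono [i, l] (f j j))"
  unfolding gen_def E_ops(3)[OF mono_T(2)[OF i l] mono_T(2)[OF i l] fA] using fA by (simp add: smult_mono)
 ultimately show ?thesis by simp
qed

lemma gen_carrier: "i < 3 ==> j < 3 ==> gen i j \<in> carrier E"
 unfolding gen_def E_simps by (rule CollectI, rule exI[of _ "mono [i, j] \<one>"]) (auto simp: even_T_def mono_T, auto simp: mono_def split: if_splits)

text \<open>An even word splits into pairs of letters, so scalars, sums and left multiplication by
  the elements \<open>gen i j\<close> exhaust the even subalgebra.\<close>

lemma E_induct:
 assumes X: "X \<in> carrier E" and scalar: "!!a. a \<in> carrier A ==> P (a \<odot>\<^bsub>E\<^esub> \<one>\<^bsub>E\<^esub>)"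
  and add: "!!X Y. X \<in> carrier E ==> Y \<in> carrier E ==> P X ==> P Y ==> P (X \<oplus>\<^bsub>E\<^esub> Y)"
  and mult: "!!i j X. i < 3 ==> j < 3 ==> X \<in> carrier E ==> P X ==> P (gen i j \<otimes>\<^bsub>E\<^esub> X)"
 shows "P X"
proof -
 have even_mono: "even_T (mono w a)" if "a \<in> carrier A" "set w \<subseteq> {..<3}" "even (length w)" for w a
  using that mono_carrier[OF that(1,2)] unfolding even_T_def by (simp add: mono_def)
 have carr: "cl t \<in> carrier E" if "even_T t" for t using that by (auto simp: E_simps)
 have mono: "P (cl (mono w a))" if "a \<in> carrier A" "set w \<subseteq> {..<3}" "even (length w)" for w a
  using that
 proof (induction w rule: induct_list012)
  case 1
  thus ?case using scalar by (simp add: E_smult_one)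
 next
  case (3 i j w)
  have "P (gen i j \<otimes>\<^bsub>E\<^esub> cl (mono w a))"
   by (rule mult) (use 3 carr[OF even_mono] in auto)
  moreover have "gen i j \<otimes>\<^bsub>E\<^esub> cl (mono w a) = cl (mono (i # j # w) a)"
   unfolding gen_def using 3 by (subst E_ops) (auto simp: mono_T mono_carrier conv_mono_T)
  ultimately show ?case by simp
 qed simp
 \<comment> \<open>Induction on the size of the support, removing one word at a time.\<close>
 have "P (cl t)" if "even_T t" "card {w. t w ~= \<zero>} = n" for t n
  using that
 proof (induction n arbitrary: t)
  case 0
  hence "{w. t w ~= \<zero>} = {}" by (auto simp: even_T_def T_simps)
  hence "t = mono [] \<zero>" by (auto simp: mono_def)
  thus ?case using mono[of \<zero> "[]"] by simp
 next
  case (Suc n)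
  have fin: "finite {w. t w ~= \<zero>}" and v: "vals t" using Suc.prems by (auto simp: even_T_def T_simps)
  obtain w where w: "t w ~= \<zero>" using Suc.prems(2) by (metis (mono_tags, lifting) Collect_empty_eq card.empty nat.distinct(1))
  let ?t = "t(w := \<zero>)"
  have s: "{u. ?t u ~= \<zero>} = {u. t u ~= \<zero>} - {w}" by auto
  have "finite {u. ?t u ~= \<zero>}" unfolding s using fin by simp
  hence e: "even_T ?t" using Suc.prems(1) unfolding even_T_def T_simps
   by (auto simp: vals_def)
  have "card {u. ?t u ~= \<zero>} = n" unfolding s using Suc.prems(2) fin w by simp
  hence "P (cl ?t)" by (rule Suc.IH[OF e])
  have wp: "set w \<subseteq> {..<3}" "even (length w)" using Suc.prems(1) w by (auto simp: even_T_def T_simps)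
  have "P (cl (mono w (t w)) \<oplus>\<^bsub>E\<^esub> cl ?t)"
   using \<open>P (cl ?t)\<close> mono[OF valsD[OF v] wp] by (intro add carr e even_mono valsD[OF v] wp)
  moreover have "mono w (t w) \<oplus>\<^bsub>T\<^esub> ?t = t" using v by (auto simp: T_simps mono_def valsD)
  moreover have "cl (mono w (t w)) \<oplus>\<^bsub>E\<^esub> cl ?t = cl (mono w (t w) \<oplus>\<^bsub>T\<^esub> ?t)"
   by (rule E_ops) (use e even_mono[OF valsD[OF v] wp] in \<open>auto simp: even_T_def\<close>)
  ultimately show ?case by simp
 qed
 moreover obtain t where "X = cl t" "even_T t" using X by (auto simp: E_simps)
 ultimately show ?thesis by blast
qed

end

end

section \<open>Local structure of orders\<close>

lemma (in number_field_space) O_span_finite: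
 assumes "finite F" "x \<in> O_span smul F"
 obtains c where "!!f. f \<in> F ==> aint (c f)" "x = (\<Sum>f\<in>F. smul (c f) f)"
proof -
 obtain G c where x: "finite G" "G \<subseteq> F" "\<forall>x\<in>G. aint (c x)" "x = (\<Sum>x\<in>G. smul (c x) x)"
  using assms(2) by (auto simp: O_span_def)
 show thesis
 proof (rule that[of "%f. if f \<in> G then c f else 0"])
  show "x = (\<Sum>f\<in>F. smul (if f \<in> G then c f else 0) f)" unfolding x(4)
   by (rule sum.mono_neutral_cong_left) (use assms(1) x(2) in auto)
 qed (use x(3) in \<open>auto simp: aint_of_int\<close>)
qed

context local_orders
begin

abbreviation Lam :: "(nat => 'b) => 'b set" where "Lam e \<equiv> lam local_ring e"

lemma Lam_add: "basis4 f ==> x \<in> Lam f ==> y \<in> Lam f ==> x + y \<in> Lam f"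
 by (auto simp: lam_iff crd_add loc.V_add)

lemma Lam_smul: "basis4 f ==> v \<in> local_ring ==> x \<in> Lam f ==> smul v x \<in> Lam f"
 by (auto simp: lam_iff crd_smul loc.V_mult)

lemma Lam_sum: "basis4 f ==> (!!i. i \<in> A ==> g i \<in> Lam f) ==> sum g A \<in> Lam f"
 by (auto simp: lam_iff crd_sum intro!: loc.V_sum)

lemma Lam_base: "basis4 f ==> k < 4 ==> f k \<in> Lam f"
 by (auto simp: lam_iff crd_basis loc.V_0 loc.V_1)

lemma Lam_submodule: "basis4 f ==> O_submodule (Lam f)"
 by (auto simp: O_submodule_def intro: Lam_add Lam_smul algint_local) (simp add: lam_iff crd_zero loc.V_0)

lemma clear_denominator:
 assumes "x \<in> Lam e"
 obtains b c where "aint b" "b \<notin> \<pp>" "!!k. k < 4 ==> aint (c k)"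
  "smul b x = (\<Sum>k<4. smul (c k) (e k))"
proof -
 obtain v where v: "x = (\<Sum>k<4. smul (v k) (e k))" "!!k. k < 4 ==> v k \<in> local_ring"
  using assms by (auto simp: lam_def)
 have "\<exists>b. aint b & b \<notin> \<pp> & aint (b * v k)" if "k < 4" for k
  using v(2)[OF that] by (auto elim!: local_ringE)
 then obtain b where b: "!!k. k < 4 ==> aint (b k) & b k \<notin> \<pp> & aint (b k * v k)" by metis
 have P: "aint (\<Prod>k\<in>A. b k) & (\<Prod>k\<in>A. b k) \<notin> \<pp>" if "finite A" "A \<subseteq> {..<4}" for A
  using that by (induction A rule: finite_induct)
   (use b in \<open>auto simp: aint_of_int one_notin intro: aint_add_mult dest: mult_notin\<close>)
 have "aint ((\<Prod>k<4. b k) * v k)" if "k < 4" for k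
 proof -
  have "(\<Prod>k<4. b k) * v k = (\<Prod>k\<in>{..<4} - {k}. b k) * (b k * v k)"
   using that by (subst prod.remove[of _ k]) auto
  moreover have "aint ((\<Prod>k\<in>{..<4} - {k}. b k) * (b k * v k))"
   by (rule aint_add_mult(2)) (use P[of "{..<4} - {k}"] b[OF that] in auto)
  ultimately show ?thesis by (simp only:)
 qed
 thus thesis using P[of "{..<4}"]
  by (intro that[of "\<Prod>k<4. b k" "%k. (\<Prod>k<4. b k) * v k"]) (simp_all add: v(1) scale_sum_right)
qed

lemma N_repr:
 assumes F: "finite F" "S = O_span smul F" and t: "t \<in> N S n"
 obtains \<alpha> where "!!f. f \<in> F ==> \<alpha> f \<in> pw n" "t = (\<Sum>f\<in>F. smul (\<alpha> f) f)"
proof -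
 let ?M = "{t. \<exists>\<alpha>. (\<forall>f\<in>F. \<alpha> f \<in> pw n) & t = (\<Sum>f\<in>F. smul (\<alpha> f) f)}"
 have "t \<in> ?M"
 proof (rule N_minimal[OF t])
  show "O_submodule ?M" unfolding O_submodule_def mem_Collect_eq
  proof (intro conjI ballI allI impI)
   show "\<exists>\<alpha>. (\<forall>f\<in>F. \<alpha> f \<in> pw n) & 0 = (\<Sum>f\<in>F. smul (\<alpha> f) f)"
    by (intro exI[of _ "%_. 0"]) (simp add: pw_zero)
  next
   fix x y assume "x \<in> ?M" "y \<in> ?M"
   then obtain \<alpha> \<alpha>' where "\<forall>f\<in>F. \<alpha> f \<in> pw n" "x = (\<Sum>f\<in>F. smul (\<alpha> f) f)"
    "\<forall>f\<in>F. \<alpha>' f \<in> pw n" "y = (\<Sum>f\<in>F. smul (\<alpha>' f) f)" by blast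
   thus "\<exists>\<alpha>. (\<forall>f\<in>F. \<alpha> f \<in> pw n) & x + y = (\<Sum>f\<in>F. smul (\<alpha> f) f)"
    by (intro exI[of _ "%f. \<alpha> f + \<alpha>' f"]) (simp add: pw_add scale_left_distrib sum.distrib)
  next
   fix a :: 'k and x assume a: "aint a" and "\<exists>\<alpha>. (\<forall>f\<in>F. \<alpha> f \<in> pw n) & x = (\<Sum>f\<in>F. smul (\<alpha> f) f)"
   then obtain \<alpha> where "\<forall>f\<in>F. \<alpha> f \<in> pw n" "x = (\<Sum>f\<in>F. smul (\<alpha> f) f)" by blast
   thus "\<exists>\<alpha>. (\<forall>f\<in>F. \<alpha> f \<in> pw n) & smul a x = (\<Sum>f\<in>F. smul (\<alpha> f) f)"
    by (intro exI[of _ "%f. a * \<alpha> f"]) (simp add: a pw_mult scale_sum_right)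
  qed
  fix a x assume a: "a \<in> pw n" and "x \<in> S"
  then obtain c where c: "!!f. f \<in> F ==> aint (c f)" "x = (\<Sum>f\<in>F. smul (c f) f)"
   using O_span_finite[OF F(1)] F(2) by metis
  have "\<forall>f\<in>F. a * c f \<in> pw n" using pw_mult[OF c(1) a] by (simp add: mult.commute)
  thus "smul a x \<in> ?M"
   by (intro CollectI exI[of _ "%f. a * c f"]) (simp add: c(2) scale_sum_right)
 qed
 thus thesis using that by blast
qed

text \<open>Nakayama's lemma for the localisation of \<open>S\<close>, once for an arbitrary linear functional and once
 for the coordinates.\<close>

lemma local_span:
 assumes S: "is_order smul S" and e: "!!k. k < 4 ==> e k \<in> S"
  and gen: "!!s. s \<in> S ==> \<exists>c. (\<forall>k<4. aint (c k)) & s - (\<Sum>k<4. smul (c k) (e k)) \<in> N S (Suc 0)"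
 shows "basis4 e & S \<subseteq> Lam e"
proof -
 obtain F where F: "finite F" "S = O_span smul F" and sp: "span S = UNIV"
  using S by (auto simp: is_order_def is_lattice_def)
 have FS: "f \<in> S" if "f \<in> F" for f using that F(2) O_span_base by blast
 have "\<exists>c p. (\<forall>k<4. aint (c k)) & (\<forall>g\<in>F. p g \<in> \<pp>) &
   f = (\<Sum>k<4. smul (c k) (e k)) + (\<Sum>g\<in>F. smul (p g) g)" if f: "f \<in> F" for f
 proof -
  obtain c where c: "\<forall>k<4. aint (c k)" "f - (\<Sum>k<4. smul (c k) (e k)) \<in> N S (Suc 0)"
   using gen[OF FS[OF f]] by blast
  obtain p where p: "!!g. g \<in> F ==> p g \<in> pw (Suc 0)" "f - (\<Sum>k<4. smul (c k) (e k)) = (\<Sum>g\<in>F. smul (p g) g)"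
   using N_repr[OF F c(2)] by blast
  have "f = (\<Sum>k<4. smul (c k) (e k)) + (\<Sum>g\<in>F. smul (p g) g)" unfolding p(2)[symmetric] by simp
  thus ?thesis using c(1) p(1) pw_1 by blast
 qed
 then obtain c p where c: "!!f k. f \<in> F ==> k < 4 ==> aint (c f k)"
  and p: "!!f g. f \<in> F ==> g \<in> F ==> p f g \<in> \<pp>"
  and fe: "!!f. f \<in> F ==> f = (\<Sum>k<4. smul (c f k) (e k)) + (\<Sum>g\<in>F. smul (p f g) g)" by metis
 have span: "span (e ` {..<4}) = UNIV"
 proof (rule ccontr)
  assume n: "span (e ` {..<4}) ~= UNIV"
  obtain B where B: "B \<subseteq> e ` {..<4}" "independent B" "e ` {..<4} \<subseteq> span B"
   using maximal_independent_subset by blast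
  let ?B = "extend_basis B"
  have B': "independent ?B" "span ?B = UNIV" "B \<subseteq> ?B"
   using independent_extend_basis[OF B(2)] span_extend_basis[OF B(2)] extend_basis_superset[OF B(2)] by auto
  have "?B ~= B"
  proof
   assume "?B = B"
   hence "span B = UNIV" using B'(2) by simp
   thus False using n span_mono[OF B(1)] by blast
  qed
  then obtain b where b: "b \<in> ?B" "b \<notin> B" using B'(3) by blast
  \<comment> \<open>A coordinate functional vanishing on all \<open>e k\<close>. Its values on the
    generators \<open>F\<close> then solve a homogeneous system with coefficients in the prime, so
    it vanishes on \<open>S\<close>, although \<open>S\<close> spans the algebra.\<close>
  define \<phi> where "\<phi> x = representation ?B x b" for x
  have add: "\<phi> (x + y) = \<phi> x + \<phi> y" and scale: "\<phi> (smul a x) = a * \<phi> x" for x y a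
   unfolding \<phi>_def using B' by (simp_all add: representation_add representation_scale)
  have sum: "\<phi> (sum h A) = (\<Sum>i\<in>A. \<phi> (h i))" for h :: "'b => 'b" and A
   using scale[of 0 0] by (induction A rule: infinite_finite_induct) (simp_all add: add)
  have sum': "\<phi> (sum h A) = (\<Sum>i\<in>A. \<phi> (h i))" for h :: "nat => 'b" and A
   using scale[of 0 0] by (induction A rule: infinite_finite_induct) (simp_all add: add)
  have "\<phi> x = 0" if "x \<in> span B" for x
  proof -
   have "representation ?B x = representation B x" by (rule representation_extend[OF B'(1) that B'(3)])
   thus ?thesis using representation_ne_zero b(2) by (auto simp: \<phi>_def)
  qed
  hence "\<phi> (e k) = 0" if "k < 4" for k using B(3) that by blast
  hence 0: "\<phi> f = (\<Sum>g\<in>F. p f g * \<phi> g)" if "f \<in> F" for f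
   by (subst fe[OF that]) (simp add: add sum sum' scale)
  have \<phi>F: "\<phi> f = 0" if "f \<in> F" for f
   by (rule loc.nakayama_zero[OF F(1) _ 0 that]) (use p prime_local in auto)
  have "\<phi> x = 0" if "x \<in> span S" for x
   using that
  proof (induction rule: span_induct_alt)
   case base
   show ?case using scale[of 0 0] by simp
  next
   case (step a s y)
   obtain d where "s = (\<Sum>f\<in>F. smul (d f) f)" using O_span_finite[OF F(1)] step(1) F(2) by metis
   thus ?case using \<phi>F step by (simp add: add scale sum)
  qed
  moreover have "\<phi> b = 1" unfolding \<phi>_def using representation_basis[OF B'(1) b(1)] by simp
  ultimately show False using sp by force
 qed
 hence b: "basis4 e" by (rule basis4I_span)
 have crd: "crd e k f \<in> local_ring" if k: "k < 4" and f: "f \<in> F" for k f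
 proof (rule loc.nakayama[OF F(1) _ _ _ f])
  fix i assume i: "i \<in> F"
  show "crd e k i = c i k + (\<Sum>g\<in>F. p i g * crd e k g)"
  proof -
   have "crd e k i = crd e k ((\<Sum>k<4. smul (c i k) (e k)) + (\<Sum>g\<in>F. smul (p i g) g))"
    using fe[OF i] by simp
   also have "\<dots> = c i k + crd e k (\<Sum>g\<in>F. smul (p i g) g)"
    unfolding crd_add[OF b] crd_unique[OF b refl k] ..
   finally show ?thesis by (simp add: crd_sum[OF b] crd_smul[OF b])
  qed
 qed (use c k algint_local p prime_local in auto)
 have "F \<subseteq> Lam e" using crd by (auto simp: lam_iff[OF b])
 hence "S \<subseteq> Lam e" unfolding F(2) by (rule O_span_minimal) (rule Lam_submodule[OF b])
 with b show ?thesis by blast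
qed

lemma N_Lam:
 assumes b: "basis4 e" and S: "S \<subseteq> Lam e" and m: "!!\<alpha>. \<alpha> \<in> pw n ==> \<exists>v\<in>local_ring. \<alpha> = m * v" and t: "t \<in> N S n"
 shows "\<exists>s\<in>Lam e. t = smul m s"
proof -
 have "t \<in> smul m ` Lam e"
 proof (rule N_minimal[OF t])
  show "O_submodule (smul m ` Lam e)" unfolding O_submodule_def
  proof (intro conjI ballI allI impI)
   have "smul m 0 \<in> smul m ` Lam e" using Lam_sum[OF b, of "{}"] by (intro imageI) simp
   thus "0 \<in> smul m ` Lam e" by simp
  next
   fix x y assume "x \<in> smul m ` Lam e" "y \<in> smul m ` Lam e"
   thus "x + y \<in> smul m ` Lam e" using Lam_add[OF b] by (auto simp flip: scale_right_distrib)
  next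
   fix a :: 'k and x assume "aint a" "x \<in> smul m ` Lam e"
   then obtain y where y: "x = smul m y" "smul a y \<in> Lam e" using Lam_smul[OF b] algint_local by blast
   have "smul a x = smul m (smul a y)" by (simp add: y mult.commute)
   thus "smul a x \<in> smul m ` Lam e" using y(2) by blast
  qed
  fix a x assume "a \<in> pw n" "x \<in> S"
  then obtain v where v: "v \<in> local_ring" "a = m * v" "x \<in> Lam e" using m S by blast
  hence "smul a x = smul m (smul v x)" by simp
  thus "smul a x \<in> smul m ` Lam e" using Lam_smul[OF b v(1,3)] by blast
 qed
 thus ?thesis by blast
qed

text \<open>A dominating generator \<open>\<pi>\<close> serves as a uniformiser, and some power of
  it is divisible by \<open>m\<close>. A positive level ensures that congruences at this level also
  hold modulo the prime.\<close>

lemma exists_level: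
 assumes p: "\<pp> = O_span (*) (set ps)" and m: "m ~= 0"
 obtains n where "n \<ge> 1" "!!\<alpha>. \<alpha> \<in> pw n ==> \<exists>v\<in>local_ring. \<alpha> = m * v"
proof -
 interpret K: number_field_space "(*) :: 'k => 'k => 'k" by (rule number_field_space_self)
 have "set ps ~= {}"
 proof
  assume "set ps = {}"
  hence "\<pp> = {0}" unfolding p O_span_def by auto
  thus False using nonzero_prime by (simp add: nonzero_prime_def)
 qed
 then obtain \<pi> where \<pi>: "\<pi> \<in> set ps" "\<forall>x\<in>set ps. \<exists>v\<in>local_ring. x = v * \<pi>"
  using loc.exists_dominating[of "set ps" "%x. x"] by blast
 have "O_span (*) (set ps) \<subseteq> {x. \<exists>v\<in>local_ring. x = \<pi> * v}"
 proof (rule K.O_span_minimal)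
  show "set ps \<subseteq> {x. \<exists>v\<in>local_ring. x = \<pi> * v}" using \<pi>(2) by (auto simp: mult.commute)
  show "K.O_submodule {x. \<exists>v\<in>local_ring. x = \<pi> * v}" unfolding K.O_submodule_def mem_Collect_eq
  proof (intro conjI ballI allI impI)
   show "\<exists>v\<in>local_ring. 0 = \<pi> * v" using loc.V_0 by (intro bexI[of _ 0]) auto
  next
   fix x y assume "x \<in> {x. \<exists>v\<in>local_ring. x = \<pi> * v}" "y \<in> {x. \<exists>v\<in>local_ring. x = \<pi> * v}"
   then obtain v v' where "v \<in> local_ring" "x = \<pi> * v" "v' \<in> local_ring" "y = \<pi> * v'" by blast
   thus "\<exists>v\<in>local_ring. x + y = \<pi> * v" by (intro bexI[of _ "v + v'"]) (auto simp: distrib_left loc.V_add)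
  next
   fix a x :: 'k assume "aint a" "\<exists>v\<in>local_ring. x = \<pi> * v"
   thus "\<exists>v\<in>local_ring. a * x = \<pi> * v" using algint_local loc.V_mult by (metis mult.left_commute)
  qed
 qed
 hence loc: "\<exists>v\<in>local_ring. x = \<pi> * v" if "x \<in> \<pp>" for x using that p by blast
 have \<pi>p: "\<pi> \<in> \<pp>" using \<pi>(1) K.O_span_base p by blast
 obtain k where k: "\<pi> ^ k / m \<in> local_ring" using power_divides[OF \<pi>p m] .
 show thesis
 proof (rule that[of "Suc k"])
  fix \<alpha> assume "\<alpha> \<in> pw (Suc k)"
  then obtain v where v: "v \<in> local_ring" "\<alpha> = \<pi> ^ Suc k * v" using pw_local[OF loc] by blast
  have "\<alpha> = m * (\<pi> ^ k / m * (\<pi> * v))" using m v(2) by simp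
  thus "\<exists>v\<in>local_ring. \<alpha> = m * v" using k v(1) algint_local[OF algint[OF \<pi>p]] loc.V_mult by blast
 qed simp
qed

lemma cring_O_completion: "cring (O_completion \<pp>)"
proof -
 interpret O: filtered_ring algints pw by (rule filtered_pw)
 interpret R: ring O.C by (rule O.ring_C)
 have comm: "x \<otimes>\<^bsub>O.C\<^esub> y = y \<otimes>\<^bsub>O.C\<^esub> x" if xy: "x \<in> carrier O.C" "y \<in> carrier O.C" for x y
 proof (rule O.C_eqI)
  fix n
  obtain s t where st: "s \<in> x n" "t \<in> y n" using O.C_ex[OF xy(1)] O.C_ex[OF xy(2)] by blast
  have "s * t \<in> (x \<otimes>\<^bsub>O.C\<^esub> y) n" by (rule O.mem_mult[OF xy st])
  moreover have "t * s \<in> (y \<otimes>\<^bsub>O.C\<^esub> x) n" by (rule O.mem_mult[OF xy(2,1) st(2,1)])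
  ultimately show "\<exists>s. s \<in> (x \<otimes>\<^bsub>O.C\<^esub> y) n & s \<in> (y \<otimes>\<^bsub>O.C\<^esub> x) n" by (auto simp: mult.commute)
 qed (rule O.C_closed(1)[OF xy] O.C_closed(1)[OF xy(2,1)])+
 thus ?thesis unfolding O_completion_eq by unfold_locales (rule comm)
qed

lemma O_embed_carrier: "aint c ==> O_embed \<pp> c \<in> carrier (O_completion \<pp>)"
 and O_embed_mem: "c \<in> O_embed \<pp> c n"
proof -
 interpret O: filtered_ring algints pw by (rule filtered_pw)
 have "O_embed \<pp> c = O.const c" unfolding O_embed_def O.const_def O.cs_def by (simp add: integer_ring_def)
 thus "aint c ==> O_embed \<pp> c \<in> carrier (O_completion \<pp>)" "c \<in> O_embed \<pp> c n"
  using O.const_carrier[of c] by (simp_all add: O_completion_eq O.const_def O.cs_self)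
qed

lemma O_completion_ex: 
 assumes "a \<in> carrier (O_completion \<pp>)" obtains c where "aint c" "c \<in> a n"
proof -
 interpret O: filtered_ring algints pw by (rule filtered_pw)
 show thesis using O.C_ex[of a n] assms that by (auto simp: O_completion_eq)
qed

lemma O_completion_one_zero: "1 \<in> \<one>\<^bsub>O_completion \<pp>\<^esub> n" "0 \<in> \<zero>\<^bsub>O_completion \<pp>\<^esub> n"
proof -
 interpret O: filtered_ring algints pw by (rule filtered_pw)
 show "1 \<in> \<one>\<^bsub>O_completion \<pp>\<^esub> n" "0 \<in> \<zero>\<^bsub>O_completion \<pp>\<^esub> n"
  by (simp_all add: O_completion_eq O.C_one O.C_zero O.cs_self)
qed

end

text \<open>\<open>apx n X s\<close>: the element \<open>s\<close> of \<open>S\<close> represents the element of the completion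
 corresponding to \<open>X\<close> modulo the \<open>n\<close>-th power of the prime.\<close>

locale approximation = local_orders smul \<pp> for smul :: "'k::number_field => 'b::ring_1 => 'b" and \<pp> +
 fixes S :: "'b set" and M :: "(nat => 'k set, 'm) module" and g
 assumes S: "is_order smul S" and g: "g \<in> ring_iso (order_completion smul \<pp> S) M"
  and g_smult: "!!a x. a \<in> carrier (O_completion \<pp>) ==> x \<in> carrier (order_completion smul \<pp> S) ==>
   g (module.smult (order_completion smul \<pp> S) a x) = module.smult M a (g x)"
begin

sublocale F: filtered_ring S "N S" by (rule filtered_order[OF S])

definition apx :: "nat => 'm => 'b => bool" where
 "apx n X s \<longleftrightarrow> (\<exists>x\<in>carrier F.C. g x = X & s \<in> x n)"

lemma g': "x \<in> carrier F.C ==> g x \<in> carrier M" "bij_betw g (carrier F.C) (carrier M)"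
 "x \<in> carrier F.C ==> y \<in> carrier F.C ==> g (x \<otimes>\<^bsub>F.C\<^esub> y) = g x \<otimes>\<^bsub>M\<^esub> g y"
 "x \<in> carrier F.C ==> y \<in> carrier F.C ==> g (x \<oplus>\<^bsub>F.C\<^esub> y) = g x \<oplus>\<^bsub>M\<^esub> g y"
 "g \<one>\<^bsub>F.C\<^esub> = \<one>\<^bsub>M\<^esub>"
 using g by (auto simp: ring_iso_def Ring.ring_hom_def order_completion_simps)

lemma apx_S: "apx n X s ==> s \<in> S" "apx n X s ==> X \<in> carrier M"
 using F.C_rep g'(1) by (auto simp: apx_def)

lemma apx_ex: "X \<in> carrier M ==> \<exists>s. apx n X s"
proof -
 assume "X \<in> carrier M"
 then obtain x where x: "x \<in> carrier F.C" "g x = X" using bij_betw_imp_surj_on[OF g'(2)] by (metis imageE)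
 obtain s where "s \<in> x n" using F.C_ex[OF x(1)] by blast
 thus ?thesis using x unfolding apx_def by blast
qed

lemma apx_const: "s \<in> S ==> \<exists>X. apx n X s"
proof -
 assume "s \<in> S"
 hence "apx n (g (F.const s)) s"
  unfolding apx_def using F.const_carrier[of s] by (intro bexI[of _ "F.const s"]) (auto simp: F.const_def F.cs_self)
 thus ?thesis by blast
qed

lemma apx_mono: "apx n X s ==> m \<le> n ==> apx m X s"
 unfolding apx_def using F.C_mono by blast

lemma apx_mult: "apx n X s ==> apx n Y t ==> apx n (X \<otimes>\<^bsub>M\<^esub> Y) (s * t)"
 and apx_add: "apx n X s ==> apx n Y t ==> apx n (X \<oplus>\<^bsub>M\<^esub> Y) (s + t)"
proof -
 assume "apx n X s" "apx n Y t"
 then obtain x y where x: "x \<in> carrier F.C" "g x = X" "s \<in> x n" and y: "y \<in> carrier F.C" "g y = Y" "t \<in> y n"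
  by (auto simp: apx_def)
 show "apx n (X \<otimes>\<^bsub>M\<^esub> Y) (s * t)" unfolding apx_def
  by (rule bexI[of _ "x \<otimes>\<^bsub>F.C\<^esub> y"]) (use x y F.mem_mult F.C_closed g'(3) in auto)
 show "apx n (X \<oplus>\<^bsub>M\<^esub> Y) (s + t)" unfolding apx_def
  by (rule bexI[of _ "x \<oplus>\<^bsub>F.C\<^esub> y"]) (use x y F.mem_add F.C_closed g'(4) in auto)
qed

lemma apx_one: "apx n \<one>\<^bsub>M\<^esub> 1"
 unfolding apx_def using F.const_carrier[OF orderD(3)[OF S]] F.const_one g'(5)
 by (intro bexI[of _ "\<one>\<^bsub>F.C\<^esub>"]) (simp_all add: F.const_def F.cs_self)

lemma apx_diff: "apx n X s ==> apx n X t ==> s - t \<in> N S n"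
proof -
 assume "apx n X s" "apx n X t"
 then obtain x y where x: "x \<in> carrier F.C" "g x = X" "s \<in> x n" and y: "y \<in> carrier F.C" "g y = X" "t \<in> y n"
  by (auto simp: apx_def)
 have "x = y" using bij_betw_imp_inj_on[OF g'(2)] x y by (auto dest: inj_onD)
 thus ?thesis using F.C_rep[OF y(1,3)] x(3) by (simp add: F.mem_cs)
qed

lemma apx_smult:
 assumes a: "a \<in> carrier (O_completion \<pp>)" "c \<in> a n" and X: "apx n X s"
 shows "apx n (a \<odot>\<^bsub>M\<^esub> X) (smul c s)"
proof -
 interpret O: filtered_ring algints pw by (rule filtered_pw)
 obtain x where x: "x \<in> carrier F.C" "g x = X" "s \<in> x n" using X by (auto simp: apx_def)
 have x': "x \<in> carrier (order_completion smul \<pp> S)" using x(1) by (simp add: order_completion_simps)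
 have a': "a \<in> carrier O.C" using a by (simp add: O_completion_eq)
 obtain d where d: "!!n. d n \<in> a n" "!!n. aint (d n)" using O.C_ex[OF a'] by (metis mem_Collect_eq)
 obtain t where t: "!!n. t n \<in> x n" "!!n. t n \<in> S" using F.C_ex[OF x(1)] by metis
 have m: "d (Suc n) \<in> a n" "t (Suc n) \<in> x n" for n
  using d(1)[of "Suc n"] t(1)[of "Suc n"] O.C_mono[OF a', of n "Suc n"] F.C_mono[OF x(1), of n "Suc n"] by auto
 let ?ax = "module.smult (order_completion smul \<pp> S) a x"
 have "?ax \<in> carrier F.C"
  by (rule F.carrierI[of "%n. smul (d n) (t n)"])
   (use smult_eq[OF S a(1) d(1) x' t(1)] smult_eq[OF S a(1) m(1) x' m(2)] orderD(6)[OF S d(2) t(2)] in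
    \<open>(simp; fail | metis F.cs_self)+\<close>)
 moreover have "smul c s \<in> ?ax n" using smult_eq[OF S a x' x(3)] F.cs_self by simp
 ultimately show ?thesis unfolding apx_def using g_smult[OF a(1) x'] x(2) by blast
qed

end

lemma (in local_orders) approximation_ex:
 assumes "is_order smul S" "algebra_iso (O_completion \<pp>) (order_completion smul \<pp> S) M"
 obtains g where "approximation smul \<pp> S M g"
proof -
 obtain g where "g \<in> ring_iso (order_completion smul \<pp> S) M" 
  "\<forall>a\<in>carrier (O_completion \<pp>). \<forall>x\<in>carrier (order_completion smul \<pp> S).
   g (module.smult (order_completion smul \<pp> S) a x) = module.smult M a (g x)"
  using assms(2) by (auto simp: algebra_iso_def)
 hence "approximation smul \<pp> S M g" using assms(1) by unfold_locales auto
 thus thesis by (rule that)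
qed

text \<open>Multiplication table of the even Clifford algebra of the form a x^2 + b y^2 + c z^2 + u
  yz + v xz + w xy, with \<open>q = [a, w, v, b, u, c]\<close>. Numbering the basis vectors of the
  form from 0, \<open>i\<close>, \<open>j\<close>, \<open>k\<close> stand for the products e1 e2, e2
  e0 and e0 e1. Differences are listed instead of equations, so that the table can be required
  modulo a precision.\<close>

definition clifford_relations ::
  "('k::number_field => 'b::ring_1 => 'b) => 'k list => 'b => 'b => 'b => 'b list" where
 "clifford_relations smul q i j k =
  [i * i - (smul (q ! 4) i - smul (q ! 3 * q ! 5) 1),
   j * j - (smul (q ! 2) j - smul (q ! 5 * q ! 0) 1),
   k * k - (smul (q ! 1) k - smul (q ! 0 * q ! 3) 1),
   j * k - smul (q ! 0) (smul (q ! 4) 1 - i),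
   k * i - smul (q ! 3) (smul (q ! 2) 1 - j),
   i * j - smul (q ! 5) (smul (q ! 1) 1 - k),
   k * j - (smul (q ! 0) i + smul (q ! 1) j + smul (q ! 2) k - smul (q ! 2 * q ! 1) 1),
   i * k - (smul (q ! 3) j + smul (q ! 4) k + smul (q ! 1) i - smul (q ! 1 * q ! 4) 1),
   j * i - (smul (q ! 5) k + smul (q ! 2) i + smul (q ! 4) j - smul (q ! 4 * q ! 2) 1)]"

definition form_coeffs :: "(nat => nat => 'a) => 'a list" where
 "form_coeffs f = [f 0 0, f 0 1, f 0 2, f 1 1, f 1 2, f 2 2]"

context local_orders
begin

lemma N_minus: "x \<in> N S n ==> - x \<in> N S n"
 by (rule O_submodule_minus[OF N_submodule])

lemma N_diff: "x \<in> N S n ==> y \<in> N S n ==> x - y \<in> N S n"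
 using N_add[OF _ N_minus] by fastforce

text \<open>\<open>E i j\<close> plays the role of the product of the \<open>i\<close>-th and the \<open>j\<close>-th basis vector.\<close>

lemma clifford_relation:
 assumes S: "is_order smul S" and E: "!!i j. i < 3 ==> j < 3 ==> E i j \<in> S"
  and G: "!!i j. i < 3 ==> j < 3 ==> aint (G i j)"
  and diag: "!!i. i < 3 ==> E i i - smul (G i i) 1 \<in> N S n"
  and anti: "!!i j. i < 3 ==> j < 3 ==> i ~= j ==> E i j + E j i - smul (G i j) 1 \<in> N S n"
  and mult: "!!i j l. i < 3 ==> j < 3 ==> l < 3 ==> E i j * E j l - smul (G j j) (E i l) \<in> N S n"
  and xyz: "x < 3" "y < 3" "z < 3" "x ~= y" "y ~= z" "z ~= x"
 shows "E y z * E y z - (smul (G y z) (E y z) - smul (G y y * G z z) 1) \<in> N S n"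
  and "E z x * E x y - smul (G x x) (smul (G y z) 1 - E y z) \<in> N S n"
  and "E x y * E z x - (smul (G x x) (E y z) + smul (G x y) (E z x) + smul (G z x) (E x y)
   - smul (G z x * G x y) 1) \<in> N S n"
proof -
 interpret F: filtered_ring S "N S" by (rule filtered_order[OF S])
 note s = smul_mult_left smul_mult_right scale_right_distrib scale_right_diff_distrib
 \<comment> \<open>Each relation is an explicit combination of errors in the diagonal, the polarised
   and the product relations, with multipliers from \<open>S\<close> and from the
   coefficients.\<close>
 have "E y z * (E y z + E z y - smul (G y z) 1) - (E y z * E z y - smul (G z z) (E y y))
   - smul (G z z) (E y y - smul (G y y) 1) \<in> N S n"
  by (intro N_diff N_smul F.J_left E G mult anti diag xyz)
 also have "E y z * (E y z + E z y - smul (G y z) 1) - (E y z * E z y - smul (G z z) (E y y))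
   - smul (G z z) (E y y - smul (G y y) 1) = E y z * E y z - (smul (G y z) (E y z) - smul (G y y * G z z) 1)"
  by (simp add: s algebra_simps)
 finally show "E y z * E y z - (smul (G y z) (E y z) - smul (G y y * G z z) 1) \<in> N S n" .
 have "(E z x * E x y - smul (G x x) (E z y)) + smul (G x x) (E y z + E z y - smul (G y z) 1) \<in> N S n"
  by (intro N_add N_smul G mult anti xyz)
 also have "(E z x * E x y - smul (G x x) (E z y)) + smul (G x x) (E y z + E z y - smul (G y z) 1) =
   E z x * E x y - smul (G x x) (smul (G y z) 1 - E y z)"
  by (simp add: s algebra_simps)
 finally show "E z x * E x y - smul (G x x) (smul (G y z) 1 - E y z) \<in> N S n" .
 \<comment> \<open>In \<open>E x y * E z x\<close> both factors are reversed, the second through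
   \<open>d\<close> and then the first, so that the inner indices of the remaining product
   \<open>E y x * E x z\<close> match.\<close>
 define d where "d = E z x + E x z - smul (G z x) 1"
 have d: "d \<in> N S n" unfolding d_def by (intro anti xyz)
 have "E x y * d - (E x y + E y x - smul (G x y) 1) * E x z + (E y x * E x z - smul (G x x) (E y z))
   - smul (G x y) d \<in> N S n"
  by (intro N_add N_diff N_smul F.J_left F.J_right d E G mult anti xyz xyz(6)[symmetric])
 also have "E x y * d - (E x y + E y x - smul (G x y) 1) * E x z + (E y x * E x z - smul (G x x) (E y z))
   - smul (G x y) d = E x y * E z x - (smul (G x x) (E y z) + smul (G x y) (E z x) + smul (G z x) (E x y)
   - smul (G z x * G x y) 1)"
  unfolding d_def by (simp add: s algebra_simps)
 finally show "E x y * E z x - (smul (G x x) (E y z) + smul (G x y) (E z x) + smul (G z x) (E x y)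
   - smul (G z x * G x y) 1) \<in> N S n" .
qed

end

text \<open>The products of two basis vectors are approximated at a level \<open>n\<close> where
  congruences become congruences modulo \<open>m\<close>. That 1 and three of the approximations
  form a local basis only has to be checked modulo the prime, by \<open>local_span\<close>.\<close>

lemma (in local_orders) clifford_basis:
 assumes S: "is_order smul S"
  and iso: "algebra_iso (O_completion \<pp>) (order_completion smul \<pp> S)
   (even_clifford (O_completion \<pp>) (%i j. O_embed \<pp> (f i j)))"
  and f: "integral_form f" and p: "\<pp> = O_span (*) (set ps)" and m: "m ~= 0"
 obtains e where "basis4 e" "e 0 = 1" "!!k. k < 4 ==> e k \<in> S" "S \<subseteq> Lam e"
  "!!x. x \<in> set (clifford_relations smul (form_coeffs f) (e 1) (e 2) (e 3)) ==> \<exists>s\<in>Lam e. x = smul m s"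
proof -
 let ?O = "O_completion \<pp>" and ?f = "%i j. O_embed \<pp> (f i j)"
 let ?E = "even_clifford ?O ?f"
 interpret T: tensor_ring ?O using cring_O_completion by (simp add: tensor_ring_def)
 obtain g where "approximation smul \<pp> S ?E g" using approximation_ex[OF S iso] .
 then interpret approximation smul \<pp> S ?E g .
 have fi: "aint (f i j)" if "i \<le> j" "j < 3" for i j using f that by (auto simp: integral_form_def)
 have fc: "?f i j \<in> carrier ?O" if "i \<le> j" "j < 3" for i j using fi[OF that] by (rule O_embed_carrier)
 have gen_c: "T.gen ?f i j \<in> carrier ?E" if "i < 3" "j < 3" for i j
  by (rule T.gen_carrier) (use fc that in auto)
 have gen_d: "T.gen ?f i i = ?f i i \<odot>\<^bsub>?E\<^esub> \<one>\<^bsub>?E\<^esub>" if "i < 3" for i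
  by (rule T.gen_diag) (use fc that in auto)
 have gen_a: "T.gen ?f i j \<oplus>\<^bsub>?E\<^esub> T.gen ?f j i = ?f i j \<odot>\<^bsub>?E\<^esub> \<one>\<^bsub>?E\<^esub>" if "i < j" "j < 3" for i j
  by (rule T.gen_anticommute) (use fc that in auto)
 have gen_m: "T.gen ?f i j \<otimes>\<^bsub>?E\<^esub> T.gen ?f j l = ?f j j \<odot>\<^bsub>?E\<^esub> T.gen ?f i l" if "i < 3" "j < 3" "l < 3" for i j l
  by (rule T.gen_mult) (use fc that in auto)
 obtain n where n: "n \<ge> 1" "!!\<alpha>. \<alpha> \<in> pw n ==> \<exists>v\<in>local_ring. \<alpha> = m * v" using exists_level[OF p m] by blast
 have "\<forall>i j. \<exists>s. i < 3 --> j < 3 --> apx n (T.gen ?f i j) s" using apx_ex gen_c by blast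
 then obtain E where E: "!!i j. i < 3 ==> j < 3 ==> apx n (T.gen ?f i j) (E i j)" by metis
 have ES: "E i j \<in> S" if "i < 3" "j < 3" for i j using apx_S(1)[OF E[OF that]] .
 \<comment> \<open>Coefficients of the form are meaningful for \<open>i \<le> j\<close> only;
   \<open>G\<close> is their symmetric extension.\<close>
 define G where "G i j = (if i \<le> j then f i j else f j i)" for i j
 have G: "aint (G i j)" if "i < 3" "j < 3" for i j using fi that by (auto simp: G_def)
 have diag: "E i i - smul (G i i) 1 \<in> N S n" if i: "i < 3" for i
  using apx_diff[OF E[OF i i, unfolded gen_d[OF i]] apx_smult[OF fc[OF order_refl i] O_embed_mem apx_one]]
  by (simp add: G_def)
 have anti': "E i j + E j i - smul (f i j) 1 \<in> N S n" if ij: "i < j" "j < 3" for i j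
  using apx_diff[OF apx_add[OF E[OF less_trans[OF ij] ij(2)] E[OF ij(2) less_trans[OF ij]], unfolded gen_a[OF ij]]
   apx_smult[OF fc[OF less_imp_le[OF ij(1)] ij(2)] O_embed_mem apx_one]] .
 have anti: "E i j + E j i - smul (G i j) 1 \<in> N S n" if "i < 3" "j < 3" "i ~= j" for i j
  using anti'[of i j] anti'[of j i] that by (cases "i < j") (auto simp: G_def add.commute)
 have mult: "E i j * E j l - smul (G j j) (E i l) \<in> N S n" if ijl: "i < 3" "j < 3" "l < 3" for i j l
  using apx_diff[OF apx_mult[OF E[OF ijl(1,2)] E[OF ijl(2,3)], unfolded gen_m[OF ijl]]
   apx_smult[OF fc[OF order_refl ijl(2)] O_embed_mem E[OF ijl(1,3)]]]
  by (simp add: G_def)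
 have rel: "E y z * E y z - (smul (G y z) (E y z) - smul (G y y * G z z) 1) \<in> N S n"
  "E z x * E x y - smul (G x x) (smul (G y z) 1 - E y z) \<in> N S n"
  "E x y * E z x - (smul (G x x) (E y z) + smul (G x y) (E z x) + smul (G z x) (E x y)
   - smul (G z x * G x y) 1) \<in> N S n"
  if xyz: "x < 3" "y < 3" "z < 3" "x ~= y" "y ~= z" "z ~= x" for x y z
  by (rule clifford_relation[OF S _ _ _ _ _ xyz]; use ES G diag anti mult in blast)+
 define e where "e = (%k::nat. if k = 0 then 1 else if k = 1 then E 1 2 else if k = 2 then E 2 0 else E 0 1)"
 have e: "e 0 = 1" "e 1 = E 1 2" "e 2 = E 2 0" "e 3 = E 0 1" by (simp_all add: e_def)
 have Gq: "G 0 0 = f 0 0" "G 0 1 = f 0 1" "G 2 0 = f 0 2" "G 1 1 = f 1 1" "G 1 2 = f 1 2" "G 2 2 = f 2 2"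
  by (simp_all add: G_def)
 have R: "x \<in> N S n" if "x \<in> set (clifford_relations smul (form_coeffs f) (e 1) (e 2) (e 3))" for x
  using that rel[of "0::nat" "1::nat" "2::nat"] rel[of "1::nat" "2::nat" "0::nat"] rel[of "2::nat" "0::nat" "1::nat"]
  unfolding clifford_relations_def e form_coeffs_def by (auto simp: Gq Gq[simplified])
 have N1: "N S n \<subseteq> N S (Suc 0)"
 proof -
  have "N S k \<subseteq> N S (Suc 0)" if "Suc 0 \<le> k" for k
   using that by (induction k rule: dec_induct) (use F.J_Suc in auto)
  thus ?thesis using n(1) by simp
 qed
 have eS: "e k \<in> S" if "k < 4" for k using ES orderD(3)[OF S] by (simp add: e_def)
 \<comment> \<open>Elements of \<open>S\<close> that are combinations of \<open>e\<close> modulo the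
   prime. The relations make \<open>Q\<close> closed under multiplication, so induction over the
   even Clifford algebra shows that \<open>Q\<close> is all of \<open>S\<close>.\<close>
 define Q where "Q = {t \<in> S. \<exists>c. (\<forall>k<4. aint (c k)) & t - (\<Sum>k<4. smul (c k) (e k)) \<in> N S (Suc 0)}"
 note o = orderD[OF S]
 have Q_N: "t \<in> Q" if "t \<in> N S (Suc 0)" for t
  using that F.J_sub unfolding Q_def by (auto intro!: exI[of _ "%_. 0"] simp: aint_of_int)
 have Q_add: "s + t \<in> Q" if st: "s \<in> Q" "t \<in> Q" for s t
 proof -
  obtain c d where c: "\<forall>k<4. aint (c k)" "s - (\<Sum>k<4. smul (c k) (e k)) \<in> N S (Suc 0)"
   and d: "\<forall>k<4. aint (d k)" "t - (\<Sum>k<4. smul (d k) (e k)) \<in> N S (Suc 0)"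
   using st by (auto simp: Q_def)
  have "(s - (\<Sum>k<4. smul (c k) (e k))) + (t - (\<Sum>k<4. smul (d k) (e k))) \<in> N S (Suc 0)"
   by (rule N_add[OF c(2) d(2)])
  hence "(s + t) - (\<Sum>k<4. smul (c k + d k) (e k)) \<in> N S (Suc 0)"
   by (simp add: scale_left_distrib sum.distrib algebra_simps)
  thus ?thesis using c d st o(4) unfolding Q_def
   by (intro CollectI conjI exI[of _ "%k. c k + d k"]) (auto intro: aint_add_mult)
 qed
 have Q_smul: "smul a s \<in> Q" if a: "aint a" and s: "s \<in> Q" for a s
 proof -
  obtain c where c: "\<forall>k<4. aint (c k)" "s - (\<Sum>k<4. smul (c k) (e k)) \<in> N S (Suc 0)"
   using s by (auto simp: Q_def)
  have "smul a (s - (\<Sum>k<4. smul (c k) (e k))) \<in> N S (Suc 0)" by (rule N_smul[OF a c(2)])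
  hence "smul a s - (\<Sum>k<4. smul (a * c k) (e k)) \<in> N S (Suc 0)"
   by (simp add: scale_right_diff_distrib scale_sum_right)
  thus ?thesis using c(1) a s o(6) unfolding Q_def
   by (intro CollectI conjI exI[of _ "%k. a * c k"]) (auto intro: aint_add_mult)
 qed
 have Q_sub: "O_submodule Q" using Q_N[OF N_zero] Q_add Q_smul by (simp add: O_submodule_def)
 have Q_e: "e k \<in> Q" if k: "k < 4" for k
 proof -
  have "(\<Sum>l<4. smul (if l = k then 1 else 0) (e l)) = (\<Sum>l<4. if l = k then e l else 0)"
   by (rule sum.cong) auto
  hence "e k - (\<Sum>l<4. smul (if l = k then 1 else 0) (e l)) \<in> N S (Suc 0)" using k N_zero by simp
  thus ?thesis unfolding Q_def using eS[OF k]
   by (intro CollectI conjI exI[of _ "%l. if l = k then 1 else 0"]) (auto simp: aint_of_int)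
 qed
 note Q_minus = O_submodule_minus[OF Q_sub]
 have Q_diff: "s - t \<in> Q" if "s \<in> Q" "t \<in> Q" for s t using Q_add[OF that(1) Q_minus[OF that(2)]] by simp
 have Q_cong: "s \<in> Q" if "s - t \<in> N S n" "t \<in> Q" for s t
  using Q_add[OF Q_N that(2), of "s - t"] that(1) N1 by auto
 have e4: "e k \<in> {1, E 1 2, E 2 0, E 0 1}" for k by (simp add: e_def)
 have Qg: "1 \<in> Q" "E 1 2 \<in> Q" "E 2 0 \<in> Q" "E 0 1 \<in> Q" using Q_e[of 0] Q_e[of 1] Q_e[of 2] Q_e[of 3] unfolding e by simp_all
 have Qs: "smul a s \<in> Q" if "aint a" "s \<in> {1, E 1 2, E 2 0, E 0 1}" for a s
  using that Qg Q_smul by blast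
 note GG = G[of 0 0] G[of 0 1] G[of 1 1] G[of 1 2] G[of 2 2] G[of 2 0]
 have gg: "aint (G i j * G k l)" if "i < 3" "j < 3" "k < 3" "l < 3" for i j k l
  using G that by (intro aint_add_mult) auto
 have Qmul: "E y z * E y z \<in> Q" "E z x * E x y \<in> Q" "E x y * E z x \<in> Q"
  if "(x, y, z) \<in> {(0,1,2), (1,2,0), (2,0,1)}" for x y z
 proof -
  have *: "x < 3" "y < 3" "z < 3" "x ~= y" "y ~= z" "z ~= x" "E y z \<in> Q" "E x y \<in> Q" "E z x \<in> Q"
   using that Qg by auto
  show "E y z * E y z \<in> Q"
   by (rule Q_cong[OF rel(1)[OF *(1-6)]]) (intro Q_diff Q_smul G gg * Qg)
  show "E z x * E x y \<in> Q"
   by (rule Q_cong[OF rel(2)[OF *(1-6)]]) (intro Q_diff Q_smul G gg * Qg)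
  show "E x y * E z x \<in> Q"
   by (rule Q_cong[OF rel(3)[OF *(1-6)]]) (intro Q_diff Q_add Q_smul G gg * Qg)
 qed
 have ee: "e k * e l \<in> Q" for k l
  using e4[of k] e4[of l] Qg Qmul[of 0 1 2] Qmul[of 1 2 0] Qmul[of 2 0 1] by auto
 have Q_mult: "s * t \<in> Q" if st: "s \<in> Q" "t \<in> Q" for s t
 proof -
  obtain c d where c: "\<forall>k<4. aint (c k)" "s - (\<Sum>k<4. smul (c k) (e k)) \<in> N S (Suc 0)"
   and d: "\<forall>k<4. aint (d k)" "t - (\<Sum>k<4. smul (d k) (e k)) \<in> N S (Suc 0)"
   using st by (auto simp: Q_def)
  let ?s = "\<Sum>k<4. smul (c k) (e k)" and ?t = "\<Sum>k<4. smul (d k) (e k)"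
  have sS: "?s \<in> S" using c(1) o(6) eS by (intro O_submodule_sum[OF o(1)]) auto
  have "(s - ?s) * t + ?s * (t - ?t) \<in> N S (Suc 0)"
   using st c(2) d(2) sS by (intro N_add F.J_left F.J_right) (auto simp: Q_def)
  moreover have "?s * ?t = (\<Sum>k<4. smul (c k) (e k * ?t))" by (rule mult_sum_left)
  hence "?s * ?t = (\<Sum>k<4. \<Sum>l<4. smul (c k * d l) (e k * e l))"
   unfolding mult_sum_right scale_sum_right by simp
  moreover have "(\<Sum>k<4. \<Sum>l<4. smul (c k * d l) (e k * e l)) \<in> Q"
   using c(1) d(1) by (intro O_submodule_sum[OF Q_sub] Q_smul aint_add_mult ee) auto
  ultimately show ?thesis using Q_add[OF Q_N, of "(s - ?s) * t + ?s * (t - ?t)" "?s * ?t"]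
   by (simp add: left_diff_distrib right_diff_distrib)
 qed
 have Q_E: "E i j \<in> Q" if ij: "i < 3" "j < 3" for i j
 proof -
  have 1: "E i i \<in> Q" if "i < 3" for i by (rule Q_cong[OF diag[OF that]]) (intro Q_smul G that Qg)
  have 2: "E j i \<in> Q" if "i < 3" "j < 3" "i ~= j" "E i j \<in> Q" for i j
  proof (rule Q_cong)
   show "E j i - (smul (G i j) 1 - E i j) \<in> N S n" using anti[OF that(1-3)] by (simp add: algebra_simps)
   show "smul (G i j) 1 - E i j \<in> Q" by (intro Q_diff Q_smul G that Qg)
  qed
  have "i \<in> {0, 1, 2}" "j \<in> {0, 1, 2}" using ij by auto
  thus ?thesis using 1[of 0] 1[of 1] 1[of 2] 2[of 1 2] 2[of 2 0] 2[of 0 1] Qg by auto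
 qed
 have Q_eq: "s \<in> Q" if s: "s \<in> S" for s
 proof -
  obtain X where X: "apx 1 X s" using apx_const[OF s] by blast
  \<comment> \<open>All approximations are treated at once: an arbitrary one differs from the one
    built from the parts by an element of \<open>N S (Suc 0)\<close>, which \<open>Q\<close>
    absorbs.\<close>
  have "\<forall>s. apx 1 X s --> s \<in> Q"
  proof (rule T.E_induct)
   fix a assume a: "a \<in> carrier ?O"
   obtain c where c: "aint c" "c \<in> a 1" using O_completion_ex[OF a] .
   have "s - smul c 1 \<in> N S (Suc 0)" if "apx 1 (a \<odot>\<^bsub>?E\<^esub> \<one>\<^bsub>?E\<^esub>) s" for s
    using apx_diff[OF that apx_smult[OF a c(2) apx_one]] by simp
   thus "\<forall>s. apx 1 (a \<odot>\<^bsub>?E\<^esub> \<one>\<^bsub>?E\<^esub>) s --> s \<in> Q"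
    using Q_add[OF Q_N Q_smul[OF c(1) Qg(1)]] by (metis diff_add_cancel)
  next
   fix X Y assume XY: "X \<in> carrier ?E" "Y \<in> carrier ?E" and IH: "\<forall>s. apx 1 X s --> s \<in> Q" "\<forall>s. apx 1 Y s --> s \<in> Q"
   obtain s t where st: "apx 1 X s" "apx 1 Y t" using apx_ex XY by blast
   have "r - (s + t) \<in> N S (Suc 0)" if "apx 1 (X \<oplus>\<^bsub>?E\<^esub> Y) r" for r
    using apx_diff[OF that apx_add[OF st]] by simp
   thus "\<forall>s. apx 1 (X \<oplus>\<^bsub>?E\<^esub> Y) s --> s \<in> Q"
    using Q_add[OF Q_N Q_add] IH st by (metis diff_add_cancel)
  next
   fix i j :: nat and X assume ij: "i < 3" "j < 3" and X: "X \<in> carrier ?E" and IH: "\<forall>s. apx 1 X s --> s \<in> Q"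
   obtain s where s: "apx 1 X s" using apx_ex X by blast
   have "r - E i j * s \<in> N S (Suc 0)" if "apx 1 (T.gen ?f i j \<otimes>\<^bsub>?E\<^esub> X) r" for r
    using apx_diff[OF that apx_mult[OF apx_mono[OF E[OF ij] n(1)] s]] by simp
   thus "\<forall>s. apx 1 (T.gen ?f i j \<otimes>\<^bsub>?E\<^esub> X) s --> s \<in> Q"
    using Q_add[OF Q_N Q_mult[OF Q_E[OF ij]]] IH s by (metis diff_add_cancel)
  qed (use apx_S(2)[OF X] fc in auto)
  thus ?thesis using X by blast
 qed
 have bL: "basis4 e & S \<subseteq> Lam e"
  by (rule local_span[OF S eS]) (use Q_eq in \<open>auto simp: Q_def\<close>)
 have "\<exists>s\<in>Lam e. x = smul m s"
  if "x \<in> set (clifford_relations smul (form_coeffs f) (e 1) (e 2) (e 3))" for x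
  using N_Lam[OF _ _ n(2) R[OF that]] bL by blast
 with bL e(1) eS show thesis by (intro that[of e]) auto
qed

section \<open>Maximality of matrix algebras\<close>

context cring
begin

definition munit :: "nat => nat => nat \<times> nat => 'a" where
 "munit a b = (\<lambda>q\<in>{..<2} \<times> {..<2}. if q = (a, b) then \<one> else \<zero>)"

abbreviation "M2 \<equiv> matrix_algebra R 2"

lemma M2_simps:
 "carrier M2 = {..<2} \<times> {..<2} \<rightarrow>\<^sub>E carrier R"
 "X \<otimes>\<^bsub>M2\<^esub> Y = (\<lambda>(i, j)\<in>{..<2} \<times> {..<2}. \<Oplus>k\<in>{..<2}. X (i, k) \<otimes> Y (k, j))"
 "\<one>\<^bsub>M2\<^esub> = (\<lambda>(i, j)\<in>{..<2} \<times> {..<2}. if i = j then \<one> else \<zero>)"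
 "X \<oplus>\<^bsub>M2\<^esub> Y = (\<lambda>p\<in>{..<2} \<times> {..<2}. X p \<oplus> Y p)"
 "c \<odot>\<^bsub>M2\<^esub> X = (\<lambda>p\<in>{..<2} \<times> {..<2}. c \<otimes> X p)"
 by (simp_all add: matrix_algebra_def Let_def)

lemma munit_carrier: "munit a b \<in> carrier M2"
 by (auto simp: munit_def M2_simps)

lemma munit_in: "i < 2 ==> j < 2 ==> munit a b (i, j) = (if i = a & j = b then \<one> else \<zero>)"
 by (simp add: munit_def)

lemma sum2: "h 0 \<in> carrier R ==> h 1 \<in> carrier R ==> (\<Oplus>k\<in>{..<2::nat}. h k) = h 0 \<oplus> h 1"
proof -
 assume h: "h 0 \<in> carrier R" "h 1 \<in> carrier R"
 have "{..<2::nat} = {0, 1}" by auto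
 thus ?thesis using h by simp
qed

text \<open>Zero is written as a multiple by the scalar zero, the form for which
  \<open>apx_smult\<close> supplies an approximation.\<close>

lemma munit_mult:
 assumes "a < 2" "b < 2" "c < 2" "d < 2"
 shows "munit a b \<otimes>\<^bsub>M2\<^esub> munit c d = (if b = c then munit a d else \<zero> \<odot>\<^bsub>M2\<^esub> munit a d)"
proof (rule extensionalityI[of _ "{..<2} \<times> {..<2}"])
 fix q :: "nat \<times> nat" assume q: "q \<in> {..<2} \<times> {..<2}"
 obtain i j where ij: "q = (i, j)" "i < 2" "j < 2" using q by auto
 have "(munit a b \<otimes>\<^bsub>M2\<^esub> munit c d) q = munit a b (i, 0) \<otimes> munit c d (0, j) \<oplus> munit a b (i, 1) \<otimes> munit c d (1, j)"
  using ij by (simp add: M2_simps sum2 munit_in)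
 also have "\<dots> = (if b = c then munit a d else \<zero> \<odot>\<^bsub>M2\<^esub> munit a d) q"
 proof -
  have "b = 0 \<or> b = 1" "c = 0 \<or> c = 1" using assms by auto
  thus ?thesis using ij by (auto simp: munit_in M2_simps)
 qed
 finally show "(munit a b \<otimes>\<^bsub>M2\<^esub> munit c d) q = (if b = c then munit a d else \<zero> \<odot>\<^bsub>M2\<^esub> munit a d) q" .
qed (auto simp: M2_simps munit_def)

lemma munit_one: "\<one>\<^bsub>M2\<^esub> = munit 0 0 \<oplus>\<^bsub>M2\<^esub> munit 1 1"
proof (rule extensionalityI[of _ "{..<2} \<times> {..<2}"])
 fix q :: "nat \<times> nat" assume q: "q \<in> {..<2} \<times> {..<2}"
 then obtain i j where q': "q = (i, j)" "i < 2" "j < 2" by auto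
 hence ij: "q = (i, j)" "i = 0 \<or> i = 1" "j = 0 \<or> j = 1" by auto
 show "\<one>\<^bsub>M2\<^esub> q = (munit 0 0 \<oplus>\<^bsub>M2\<^esub> munit 1 1) q" using ij by (auto simp: M2_simps munit_in)
qed (auto simp: M2_simps)

lemma munit_expand:
 assumes X: "X \<in> carrier M2"
 shows "X = (X (0,0) \<odot>\<^bsub>M2\<^esub> munit 0 0 \<oplus>\<^bsub>M2\<^esub> X (0,1) \<odot>\<^bsub>M2\<^esub> munit 0 1) \<oplus>\<^bsub>M2\<^esub>
  (X (1,0) \<odot>\<^bsub>M2\<^esub> munit 1 0 \<oplus>\<^bsub>M2\<^esub> X (1,1) \<odot>\<^bsub>M2\<^esub> munit 1 1)"
proof (rule extensionalityI[of _ "{..<2} \<times> {..<2}"])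
 fix q :: "nat \<times> nat" assume q: "q \<in> {..<2} \<times> {..<2}"
 then obtain i j where q': "q = (i, j)" "i < 2" "j < 2" by auto
 hence ij: "q = (i, j)" "i = 0 \<or> i = 1" "j = 0 \<or> j = 1" by auto
 have "X (i, j) \<in> carrier R" if "i < 2" "j < 2" for i j using X that by (auto simp: M2_simps)
 note c = this[of 0 0, simplified] this[of 0 1, simplified] this[of 1 0, simplified] this[of 1 1, simplified]
 show "X q = ((X (0,0) \<odot>\<^bsub>M2\<^esub> munit 0 0 \<oplus>\<^bsub>M2\<^esub> X (0,1) \<odot>\<^bsub>M2\<^esub> munit 0 1) \<oplus>\<^bsub>M2\<^esub>
  (X (1,0) \<odot>\<^bsub>M2\<^esub> munit 1 0 \<oplus>\<^bsub>M2\<^esub> X (1,1) \<odot>\<^bsub>M2\<^esub> munit 1 1)) q"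
  using ij c by (auto simp: M2_simps munit_in)
qed (use X in \<open>auto simp: M2_simps PiE_def\<close>)

end

lemma (in number_field_space) denominator_ex:
 assumes "is_lattice smul S"
 shows "\<exists>D. aint D & D ~= 0 & smul D x \<in> S"
proof -
 note S = is_latticeD[OF assms, unfolded O_submodule_def]
 have "x \<in> span S" using assms by (auto simp: is_lattice_def)
 thus ?thesis
 proof (induction rule: span_induct_alt)
  case base
  thus ?case using S by (intro exI[of _ 1]) (auto simp: aint_of_int)
 next
  case (step c s y)
  obtain D where D: "aint D" "D ~= 0" "smul D y \<in> S" using step by blast
  obtain d where d: "aint d" "d ~= 0" "aint (d * c)"
  proof -
   obtain m :: int where "m ~= 0" "aint (of_int m * c)" using number_field_denominator[of c] by blast
   thus thesis using that[of "of_int m"] by (simp add: aint_of_int)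
  qed
  have "smul D (smul (d * c) s) + smul d (smul D y) \<in> S" using S D d step(1) by blast
  hence "smul (d * D) (smul c s + y) \<in> S" by (simp add: scale_right_distrib mult_ac)
  thus ?case using D d by (intro exI[of _ "d * D"]) (auto intro: aint_add_mult)
 qed
qed

text \<open>Full rank of \<open>S\<close> gives a denominator for each generator, and finitely many
  generators have a common one.\<close>

lemma (in number_field_space) common_denominator:
 assumes "is_lattice smul S" "finite F"
 shows "\<exists>D. aint D & D ~= 0 & (\<forall>x\<in>O_span smul F. smul D x \<in> S)"
proof -
 note S = is_latticeD[OF assms(1), unfolded O_submodule_def]
 have "\<exists>D. aint D & D ~= 0 & (\<forall>x\<in>F. smul D x \<in> S)"
  using assms(2)
 proof (induction F)
  case empty
  show ?case by (intro exI[of _ 1]) (simp add: aint_of_int)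
 next
  case (insert x F)
  then obtain D where D: "aint D" "D ~= 0" "\<forall>x\<in>F. smul D x \<in> S" by blast
  obtain d where d: "aint d" "d ~= 0" "smul d x \<in> S" using denominator_ex[OF assms(1)] by blast
  have "smul D (smul d x) \<in> S" "!!y. y \<in> F ==> smul d (smul D y) \<in> S" using S D d by blast+
  thus ?case using D d by (intro exI[of _ "d * D"]) (auto intro: aint_add_mult simp: mult.commute)
 qed
 then obtain D where D: "aint D" "D ~= 0" "\<forall>x\<in>F. smul D x \<in> S" by blast
 have "O_span smul F \<subseteq> {x. smul D x \<in> S}"
 proof (rule O_span_minimal)
  have "smul D (smul a x) \<in> S" if "aint a" "smul D x \<in> S" for a x
  proof -
   have "smul a (smul D x) \<in> S" using S that by blast
   thus ?thesis by (simp add: mult.commute)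
  qed
  thus "O_submodule {x. smul D x \<in> S}" using S by (auto simp: O_submodule_def scale_right_distrib)
 qed (use D in auto)
 thus ?thesis using D by blast
qed

text \<open>If \<open>r\<close> is not locally in \<open>S\<close>, its dominating coordinate
  \<open>\<rho>\<close> lies outside the local ring. Compression by matrix units produces from
  \<open>r\<close> an element \<open>y = smul \<rho> x\<close> of \<open>R\<close> with
  \<open>x\<close> congruent to 1. The powers of \<open>y\<close> have unbounded denominators, while
  \<open>D\<close> bounds those of all elements of \<open>R\<close> relative to
  \<open>S\<close>.\<close>

lemma (in local_orders) matrix_maximal:
 assumes S: "is_order smul S" and R: "is_order smul R" and sub: "S \<subseteq> R"
  and iso: "algebra_iso (O_completion \<pp>) (order_completion smul \<pp> S) (matrix_algebra (O_completion \<pp>) 2)"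
  and r: "r \<in> R"
 shows "\<exists>b. aint b & b \<notin> \<pp> & smul b r \<in> S"
proof -
 let ?O = "O_completion \<pp>"
 interpret C: cring ?O by (rule cring_O_completion)
 obtain g where "approximation smul \<pp> S C.M2 g" using approximation_ex[OF S iso] .
 then interpret approximation smul \<pp> S C.M2 g .
 note o = orderD[OF S] and oR = orderD[OF R]
 have "\<forall>a b. \<exists>s. apx 1 (C.munit a b) s" using apx_ex C.munit_carrier by blast
 then obtain U where U: "!!a b. apx 1 (C.munit a b) (U a b)" by metis
 have US: "U a b \<in> S" for a b by (rule apx_S(1)[OF U])
 have um: "U a b * U c d - (if b = c then U a d else 0) \<in> N S (Suc 0)" if abcd: "a < 2" "b < 2" "c < 2" "d < 2" for a b c d
 proof -
  have "apx 1 (\<zero>\<^bsub>?O\<^esub> \<odot>\<^bsub>C.M2\<^esub> C.munit a d) (smul 0 (U a d))"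
   by (rule apx_smult[OF C.zero_closed O_completion_one_zero(2) U])
  hence "apx 1 (C.munit a b \<otimes>\<^bsub>C.M2\<^esub> C.munit c d) (if b = c then U a d else 0)"
   unfolding C.munit_mult[OF abcd] using U by simp
  from apx_diff[OF apx_mult[OF U U] this] show ?thesis by simp
 qed
 have u1: "U 0 0 + U 1 1 - 1 \<in> N S (Suc 0)"
  using apx_diff[OF apx_add[OF U[of 0 0] U[of 1 1]], of 1] apx_one[of 1] unfolding C.munit_one by simp
 define e where "e k = U (k div 2) (k mod 2)" for k
 have e4: "e 0 = U 0 0" "e (Suc 0) = U 0 1" "e 2 = U 1 0" "e 3 = U 1 1" by (simp_all add: e_def)
 have be: "basis4 e & S \<subseteq> Lam e"
 proof (rule local_span[OF S])
  fix s assume "s \<in> S"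
  then obtain X where X: "apx 1 X s" using apx_const by blast
  note XM = apx_S(2)[OF X]
  have "X (i, j) \<in> carrier ?O" if "i < 2" "j < 2" for i j using XM that by (auto simp: C.M2_simps)
  hence "\<forall>i j. \<exists>c. i < 2 --> j < 2 --> aint c & c \<in> X (i, j) 1" using O_completion_ex by metis
  then obtain c where c: "!!i j. i < 2 ==> j < 2 ==> aint (c i j) & c i j \<in> X (i, j) 1" by metis
  have cU: "apx 1 (X (i, j) \<odot>\<^bsub>C.M2\<^esub> C.munit i j) (smul (c i j) (U i j))" if ij: "i < 2" "j < 2" for i j
   by (rule apx_smult[OF _ _ U]) (use XM ij c in \<open>auto simp: C.M2_simps\<close>)
  have "apx 1 X ((smul (c 0 0) (U 0 0) + smul (c 0 1) (U 0 1)) + (smul (c 1 0) (U 1 0) + smul (c 1 1) (U 1 1)))"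
   by (subst C.munit_expand[OF XM]) (intro apx_add cU; simp)
  from apx_diff[OF X this]
  have "s - (\<Sum>k<4. smul (c (k div 2) (k mod 2)) (e k)) \<in> N S (Suc 0)"
   by (simp add: lessThan_nat_numeral e4 algebra_simps)
  thus "\<exists>c. (\<forall>k<4. aint (c k)) & s - (\<Sum>k<4. smul (c k) (e k)) \<in> N S (Suc 0)"
   using c by (intro exI[of _ "%k. c (k div 2) (k mod 2)"]) auto
 qed (simp add: e_def US)
 hence b: "basis4 e" and SL: "S \<subseteq> Lam e" by auto
 \<comment> \<open>The localised order times the maximal ideal, in coordinates.\<close>
 define PL where "PL = {x. \<forall>k<4. crd e k x \<in> local_max}"
 have PL_add: "x + y \<in> PL" if "x \<in> PL" "y \<in> PL" for x y using that by (simp add: PL_def crd_add[OF b] loc.P_add)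
 have PL_smul: "smul v x \<in> PL" if "v \<in> local_ring" "x \<in> PL" for v x
  using that by (simp add: PL_def crd_smul[OF b] loc.P_mult)
 have PL_smul': "smul v x \<in> PL" if "v \<in> local_max" "x \<in> Lam e" for v x
 proof -
  have "crd e k x * v \<in> local_max" if "k < 4" for k
   using \<open>x \<in> Lam e\<close> that \<open>v \<in> local_max\<close> by (intro loc.P_mult) (auto simp: lam_iff[OF b])
  thus ?thesis by (simp add: PL_def crd_smul[OF b] mult.commute)
 qed
 have PL_zero: "0 \<in> PL" by (simp add: PL_def crd_zero[OF b] loc.zero_P)
 have PL_sum: "sum h A \<in> PL" if "!!i. i \<in> A ==> h i \<in> PL" for h :: "nat => 'b" and A
  using that by (induction A rule: infinite_finite_induct) (auto simp: PL_zero PL_add)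
 have PL_sub: "O_submodule PL" using PL_add PL_smul PL_zero algint_local by (simp add: O_submodule_def)
 have N_PL: "x \<in> PL" if "x \<in> N S (Suc 0)" for x
  by (rule N_minimal[OF that PL_sub]) (use PL_smul' prime_local SL in \<open>auto simp: pw_1\<close>)
 have prod: "x * y = (\<Sum>k<4. \<Sum>l<4. smul (crd e k x * crd e l y) (e k * e l))" for x y
 proof -
  have "x * y = (\<Sum>k<4. smul (crd e k x) (e k)) * (\<Sum>l<4. smul (crd e l y) (e l))"
   using crd_expand[OF b] by simp
  also have "\<dots> = (\<Sum>k<4. smul (crd e k x) (e k * (\<Sum>l<4. smul (crd e l y) (e l))))" by (rule mult_sum_left)
  also have "\<dots> = (\<Sum>k<4. \<Sum>l<4. smul (crd e k x * crd e l y) (e k * e l))"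
   unfolding mult_sum_right scale_sum_right by simp
  finally show ?thesis .
 qed
 have ee: "e k * e l \<in> Lam e" for k l using SL o(5) US by (auto simp: e_def)
 have PL_right: "x * y \<in> PL" if "x \<in> Lam e" "y \<in> PL" for x y
  unfolding prod[of x y] using that ee
  by (intro PL_sum PL_smul' loc.P_mult) (auto simp: PL_def lam_iff[OF b])
 obtain j where j: "j < 4" and dom: "\<forall>k<4. \<exists>v\<in>local_ring. crd e k r = v * crd e j r"
  using loc.exists_dominating[OF finite_lessThan, of "4::nat" "%k. crd e k r"] by (auto simp: lessThan_empty_iff)
 define \<rho> where "\<rho> = crd e j r"
 show ?thesis
 proof (cases "\<rho> \<in> local_ring")
  case True
  have "crd e k r \<in> local_ring" if "k < 4" for k
  proof -
   obtain v where "v \<in> local_ring" "crd e k r = v * \<rho>" using dom \<open>k < 4\<close> \<rho>_def by blast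
   thus ?thesis using True by (simp add: loc.V_mult)
  qed
  hence "r \<in> Lam e" by (simp add: lam_iff[OF b])
  then obtain d c where d: "aint d" "d \<notin> \<pp>" "!!k. k < 4 ==> aint (c k)"
   "smul d r = (\<Sum>k<4. smul (c k) (e k))" using clear_denominator by blast
  have "smul d r \<in> S" unfolding d(4) by (rule O_submodule_sum[OF o(1)]) (use o(6)[OF d(3)] US in \<open>auto simp: e_def\<close>)
  thus ?thesis using d by blast
 next
  case False
  \<comment> \<open>Scaled by \<open>t\<close>, the element \<open>r\<close> has integral
    coordinates, and its coordinate at \<open>j\<close> is 1.\<close>
  define t where "t = inverse \<rho>"
  have \<rho>0: "\<rho> ~= 0" using False loc.V_0 by auto
  have tP: "t \<in> local_max" unfolding t_def by (rule loc.not_in_V[OF False])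
  define v where "v k = t * crd e k r" for k
  have vV: "v k \<in> local_ring" if k: "k < 4" for k
  proof -
   obtain u where "u \<in> local_ring" "crd e k r = u * \<rho>" using dom k \<rho>_def by blast
   thus ?thesis using \<rho>0 by (simp add: v_def t_def mult.left_commute[of "inverse \<rho>"])
  qed
  have vj: "v j = 1" using \<rho>0 by (simp add: v_def t_def \<rho>_def)
  have s0: "smul t r = (\<Sum>l<4. smul (v l) (e l))"
   by (subst crd_expand[OF b, of r]) (simp add: v_def scale_sum_right)
  define a c where "a = j div 2" and "c = j mod 2"
  have ac: "a < 2" "c < 2" using j by (auto simp: a_def c_def)
  \<comment> \<open>In a matrix algebra, summing \<open>U k a * x * U c k\<close> over
    \<open>k\<close> gives the \<open>(a, c)\<close> entry of \<open>x\<close> times the identity;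
    here this holds modulo the prime, with \<open>(a, c)\<close> the position coded by
    \<open>j\<close>.\<close>
  define \<Phi> where "\<Phi> x = U 0 a * x * U c 0 + U 1 a * x * U c 1" for x
  have \<Phi>1: "U k a * U a' c' * U c k - (if a = a' & c' = c then U k k else 0) \<in> N S (Suc 0)"
   if k: "k < 2" "a' < 2" "c' < 2" for k a' c'
  proof -
   have "(U k a * U a' c' - (if a = a' then U k c' else 0)) * U c k +
     (if a = a' then U k c' * U c k - (if c' = c then U k k else 0) else 0) \<in> N S (Suc 0)"
    using um[OF k(1) ac(1) k(2,3)] um[OF k(1,3) ac(2) k(1)] US N_zero by (intro N_add F.J_right) auto
   thus ?thesis by (auto simp: algebra_simps split: if_splits)
  qed
  have \<Phi>e: "\<Phi> (e l) - (if l = j then 1 else 0) \<in> PL" if l: "l < 4" for l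
  proof (rule N_PL)
   let ?a = "l div 2" and ?c = "l mod 2"
   have ac': "?a < 2" "?c < 2" using l by auto
   have lj: "l = j \<longleftrightarrow> a = ?a & ?c = c" unfolding a_def c_def by (metis div_mult_mod_eq)
   have "(U 0 a * U ?a ?c * U c 0 - (if a = ?a & ?c = c then U 0 0 else 0)) +
    (U 1 a * U ?a ?c * U c 1 - (if a = ?a & ?c = c then U 1 1 else 0)) +
    (if l = j then U 0 0 + U 1 1 - 1 else 0) \<in> N S (Suc 0)"
    using u1 N_zero ac' by (intro N_add \<Phi>1) auto
   thus "\<Phi> (e l) - (if l = j then 1 else 0) \<in> N S (Suc 0)"
    unfolding \<Phi>_def e_def lj by (auto simp: algebra_simps split: if_splits)
  qed
  have \<Phi>_smul: "\<Phi> (smul d x) = smul d (\<Phi> x)" and \<Phi>_add: "\<Phi> (x + y) = \<Phi> x + \<Phi> y" for d x y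
   by (simp_all add: \<Phi>_def smul_mult_left smul_mult_right scale_right_distrib algebra_simps)
  have \<Phi>_sum: "\<Phi> (sum h A) = (\<Sum>i\<in>A. \<Phi> (h i))" for h :: "nat => 'b" and A
   by (induction A rule: infinite_finite_induct) (simp_all add: \<Phi>_add, simp_all add: \<Phi>_def)
  define y where "y = \<Phi> r"
  have yR: "y \<in> R" unfolding y_def \<Phi>_def using sub US r by (intro oR(4) oR(5)) auto
  define x where "x = smul t y"
  have xy: "y = smul \<rho> x" using \<rho>0 by (simp add: x_def t_def)
  have "x = (\<Sum>l<4. smul (v l) (\<Phi> (e l)))" by (simp add: x_def y_def s0 \<Phi>_sum \<Phi>_smul flip: \<Phi>_smul)
  also have "\<dots> = (\<Sum>l<4. smul (v l) (\<Phi> (e l) - (if l = j then 1 else 0))) + (\<Sum>l<4. if l = j then 1 else 0)"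
   unfolding sum.distrib[symmetric] by (rule sum.cong) (auto simp: vj)
  also have "(\<Sum>l<4. if l = j then 1 else 0) = (1::'b)" using j by simp
  finally have x1: "x - 1 \<in> PL" using \<Phi>e vV by (auto intro!: PL_sum PL_smul)
  have "1 \<in> Lam e" using SL o(3) by blast
  have xL: "x \<in> Lam e"
   using Lam_add[OF b, of "x - 1" 1] x1 \<open>1 \<in> Lam e\<close> loc.P_sub by (auto simp: PL_def lam_iff[OF b])
  have xn: "x ^ n - 1 \<in> PL" for n
  proof (induction n)
   case (Suc n)
   have "x * (x ^ n - 1) + (x - 1) \<in> PL" by (intro PL_add PL_right xL Suc x1)
   thus ?case by (simp add: algebra_simps)
  qed (simp add: PL_zero)
  have yn: "y ^ n \<in> R" for n by (induction n) (simp_all add: oR yR)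
  have ynx: "y ^ n = smul (\<rho> ^ n) (x ^ n)" for n
   by (induction n) (simp_all add: xy smul_mult_left smul_mult_right)
  obtain Fr where Fr: "finite Fr" "R = O_span smul Fr" using R by (auto simp: is_order_def is_lattice_def)
  have "is_lattice smul S" using S by (simp add: is_order_def)
  from common_denominator[OF this Fr(1)] obtain D where D: "aint D" "D ~= 0" "!!x. x \<in> R ==> smul D x \<in> S"
   using Fr(2) by blast
  \<comment> \<open>If all coordinates of 1 were in the maximal ideal, so would be those of
    \<open>e 0 = e 0 * 1\<close>.\<close>
  obtain k where k: "k < 4" "crd e k 1 \<notin> local_max"
  proof (rule ccontr)
   assume "\<not> thesis"
   hence "1 \<in> PL" using that by (auto simp: PL_def)
   from PL_right[OF Lam_base[OF b, of 0] this] have "crd e 0 (e 0) \<in> local_max" by (simp add: PL_def)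
   thus False using loc.one_notin_P by (simp add: crd_basis[OF b])
  qed
  \<comment> \<open>Since \<open>x ^ n - 1\<close> lies in \<open>PL\<close>, the coordinate of
    \<open>x ^ n\<close> at \<open>k\<close> is a unit, and the bound for
    \<open>y ^ n = smul (\<rho> ^ n) (x ^ n)\<close> becomes a bound for \<open>\<rho> ^ n\<close>,
    uniform in \<open>n\<close>.\<close>
  have D\<rho>: "D * \<rho> ^ n \<in> local_ring" for n
  proof -
   have "smul D (y ^ n) \<in> Lam e" using D(3)[OF yn] SL by blast
   hence 1: "(D * \<rho> ^ n) * crd e k (x ^ n) \<in> local_ring"
    using k(1) by (simp add: ynx lam_iff[OF b] crd_smul[OF b])
   have P: "crd e k (x ^ n - 1) \<in> local_max" using xn k(1) by (simp add: PL_def)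
   have q: "crd e k (x ^ n) = crd e k (x ^ n - 1) + crd e k 1" using crd_add[OF b, of k "x ^ n - 1" 1] by simp
   have "crd e k 1 \<in> local_ring" using \<open>1 \<in> Lam e\<close> k(1) by (simp add: lam_iff[OF b])
   hence V: "crd e k (x ^ n) \<in> local_ring" unfolding q using loc.P_sub[OF P] by (rule_tac loc.V_add)
   have nP: "crd e k (x ^ n) \<notin> local_max"
   proof
    assume "crd e k (x ^ n) \<in> local_max"
    hence "crd e k (x ^ n) + - crd e k (x ^ n - 1) \<in> local_max" using P by (intro loc.P_add loc.P_minus)
    thus False using k(2) q by simp
   qed
   hence "crd e k (x ^ n) ~= 0" using loc.zero_P by auto
   thus ?thesis using loc.V_mult[OF 1 loc.unit[OF V nP]] by (simp add: mult.assoc)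
  qed
  obtain d where d: "aint d" "d \<notin> \<pp>" "d * t \<in> \<pp>" using tP by (auto elim!: local_maxE)
  define h where "h = d * t"
  have t0: "t ~= 0" using \<rho>0 by (simp add: t_def)
  have "d ~= 0" using d(2) zero by auto
  hence h0: "h ~= 0" using t0 by (simp add: h_def)
  obtain n where n: "h ^ n / (D * h) \<in> local_ring" using power_divides[of h "D * h"] d(3) D(2) h0 by (auto simp: h_def)
  \<comment> \<open>As \<open>h * \<rho> = d\<close>, the power \<open>d ^ n\<close> of a local unit
    would acquire the factor \<open>h\<close> from the prime.\<close>
  have "h * (h ^ n / (D * h) * (D * \<rho> ^ n)) = d ^ n"
   using h0 D(2) \<rho>0 by (simp add: h_def t_def field_simps power_mult_distrib)
  moreover have "(h ^ n / (D * h) * (D * \<rho> ^ n)) * h \<in> local_max"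
   by (rule loc.P_mult[OF loc.V_mult[OF n D\<rho>] prime_local]) (simp add: h_def d(3))
  ultimately have "d ^ n \<in> local_max" by (simp add: mult.commute)
  moreover have "aint (d ^ n)" "d ^ n \<notin> \<pp>"
   using d one_notin by (induction n) (auto simp: aint_of_int dest: mult_notin intro: aint_add_mult)
  ultimately show ?thesis using algint_notin_local_max by blast
 qed
qed

section \<open>Certificates\<close>

text \<open>The products of one element from each list; they generate the product of the ideals that
  the lists generate.\<close>

definition choices :: "'k::comm_monoid_mult list list => 'k list" where
 "choices ls = foldl (%G l. [\<gamma> * g. \<gamma> \<leftarrow> G, g \<leftarrow> l]) [1] ls"

lemma choices_Nil: "choices [] = [1]" by (simp add: choices_def)

lemma choices_snoc: "set (choices (ls @ [l])) = {\<gamma> * g | \<gamma> g. \<gamma> \<in> set (choices ls) & g \<in> set l}"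
 by (auto simp: choices_def)

lemma choices_append:
 "set (choices (ls @ ms)) = {x * y | x y. x \<in> set (choices ls) & y \<in> set (choices ms)}"
proof (induction ms rule: rev_induct)
 case (snoc m ms)
 have "set (choices (ls @ ms @ [m])) = {\<gamma> * g | \<gamma> g. \<gamma> \<in> set (choices (ls @ ms)) & g \<in> set m}"
  using choices_snoc[of "ls @ ms" m] by simp
 also have "\<dots> = {x * y | x y. x \<in> set (choices ls) & y \<in> set (choices (ms @ [m]))}"
  unfolding snoc choices_snoc
 proof (intro subset_antisym subsetI, goal_cases)
  case (1 z)
  then obtain x y g where "x \<in> set (choices ls)" "y \<in> set (choices ms)" "g \<in> set m" "z = x * y * g" by blast
  thus ?case by (intro CollectI exI[of _ x] exI[of _ "y * g"]) (auto simp: mult.assoc)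
 next
  case (2 z)
  then obtain x y g where "x \<in> set (choices ls)" "y \<in> set (choices ms)" "g \<in> set m" "z = x * (y * g)" by blast
  thus ?case by (intro CollectI exI[of _ "x * y"] exI[of _ g]) (auto simp: mult.assoc)
 qed
 finally show ?case .
qed (simp add: choices_Nil)

text \<open>This stands in for the factorisation of \<open>J\<close>. Among the ideals containing
  \<open>J\<close> for which the claim fails, Zorn's lemma gives a maximal one: a finite set of
  products inside the union of a chain already lies in a member. It is prime, since the lists found
  for two extensions by one element each can be concatenated; so it is a listed prime, and that
  single list contradicts its choice.\<close>

lemma exists_prime_products:
 fixes J :: "'k::number_field set"
 assumes J: "ideal J integer_ring" "J ~= {0}"
  and primes: "!!\<pp>. nonzero_prime \<pp> ==> J \<subseteq> \<pp> ==> \<pp> \<in> (%ps. O_span (*) (set ps)) ` set pss"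
 shows "\<exists>ls. set ls \<subseteq> set pss & set (choices ls) \<subseteq> J"
proof (rule ccontr)
 interpret K: number_field_space "(*) :: 'k => 'k => 'k" by (rule number_field_space_self)
 define good where "good I \<longleftrightarrow> (\<exists>ls. set ls \<subseteq> set pss & set (choices ls) \<subseteq> I)" for I
 assume "\<not> ?thesis"
 hence bad: "\<not> good J" by (simp add: good_def)
 define A where "A = {I. ideal I integer_ring & J \<subseteq> I & \<not> good I}"
 have "\<exists>M\<in>A. \<forall>X\<in>A. M \<subseteq> X --> X = M"
 proof (rule subset_Zorn_nonempty)
  show "A ~= {}" using bad J by (auto simp: A_def)
  fix C assume C: "C ~= {}" "subset.chain A C"
  hence CA: "!!I. I \<in> C ==> ideal I integer_ring & J \<subseteq> I & \<not> good I" by (auto simp: subset.chain_def A_def)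
  have lin: "I \<subseteq> I' \<or> I' \<subseteq> I" if "I \<in> C" "I' \<in> C" for I I' using C(2) that by (auto simp: subset.chain_def)
  have id: "I \<subseteq> algints" "0 \<in> I" "!!x y. x \<in> I ==> y \<in> I ==> x + y \<in> I"
   "!!a x. aint a ==> x \<in> I ==> a * x \<in> I" if "I \<in> C" for I
   using CA[OF that] unfolding ideal_integer_ring_iff by auto
  have "ideal (\<Union>C) integer_ring" unfolding ideal_integer_ring_iff
  proof (intro conjI ballI allI impI)
   show "\<Union>C \<subseteq> algints" "0 \<in> \<Union>C" using id(1,2) C(1) by blast+
  next
   fix x y assume "x \<in> \<Union>C" "y \<in> \<Union>C"
   then obtain I I' where "I \<in> C" "x \<in> I" "I' \<in> C" "y \<in> I'" by blast
   thus "x + y \<in> \<Union>C" using lin[of I I'] id(3) by blast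
  next
   fix a x :: 'k assume "aint a" "x \<in> \<Union>C"
   thus "a * x \<in> \<Union>C" using id(4) by blast
  qed
  moreover have "J \<subseteq> \<Union>C" using CA C(1) by blast
  moreover have "\<not> good (\<Union>C)"
  proof
   assume "good (\<Union>C)"
   then obtain ls where ls: "set ls \<subseteq> set pss" "set (choices ls) \<subseteq> \<Union>C" by (auto simp: good_def)
   obtain I where "I \<in> C" "set (choices ls) \<subseteq> I"
    using finite_subset_Union_chain[OF _ ls(2) C] by auto
   thus False using CA ls(1) by (auto simp: good_def)
  qed
  ultimately show "\<Union>C \<in> A" by (simp add: A_def)
 qed
 then obtain M where M: "M \<in> A" and max: "!!X. X \<in> A ==> M \<subseteq> X ==> X = M" by blast
 have iM: "ideal M integer_ring" "J \<subseteq> M" "\<not> good M" using M by (auto simp: A_def)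
 have idM: "M \<subseteq> algints" "0 \<in> M" "!!x y. x \<in> M ==> y \<in> M ==> x + y \<in> M"
   "!!a x. aint a ==> x \<in> M ==> a * x \<in> M"
  using iM(1) unfolding ideal_integer_ring_iff by auto
 have goodI: "good I" if "set ls \<subseteq> set pss" "set (choices ls) \<subseteq> I" for I ls using that by (auto simp: good_def)
 have one: "1 \<notin> M" using goodI[of "[]" M] iM(3) by (auto simp: choices_Nil)
 define ext where "ext a = {m + c * a | m c. m \<in> M & aint c}" for a
 have ext: "good (ext a)" if a: "aint a" "a \<notin> M" for a
 proof (rule ccontr)
  assume n: "\<not> good (ext a)"
  have "ideal (ext a) integer_ring" unfolding ideal_integer_ring_iff
  proof (intro conjI ballI allI impI)
   show "ext a \<subseteq> algints" using idM(1) a by (auto simp: ext_def intro!: aint_add_mult)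
   show "0 \<in> ext a" unfolding ext_def using idM(2) by (auto intro!: exI[of _ 0] simp: aint_of_int)
  next
   fix x y assume "x \<in> ext a" "y \<in> ext a"
   then obtain m c m' c' where "m \<in> M" "aint c" "x = m + c * a" "m' \<in> M" "aint c'" "y = m' + c' * a"
    by (auto simp: ext_def)
   thus "x + y \<in> ext a" unfolding ext_def using idM(3) aint_add_mult(1)
    by (intro CollectI exI[of _ "m + m'"] exI[of _ "c + c'"]) (auto simp: algebra_simps)
  next
   fix b x :: 'k assume b: "aint b" and "x \<in> ext a"
   then obtain m c where "m \<in> M" "aint c" "x = m + c * a" by (auto simp: ext_def)
   thus "b * x \<in> ext a" unfolding ext_def using idM(4) aint_add_mult(2) b
    by (intro CollectI exI[of _ "b * m"] exI[of _ "b * c"]) (auto simp: algebra_simps)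
  qed
  moreover have sub: "M \<subseteq> ext a"
  proof
   fix m assume "m \<in> M"
   thus "m \<in> ext a" unfolding ext_def
    by (intro CollectI exI[of _ m] exI[of _ 0]) (auto simp: aint_of_int)
  qed
  ultimately have "ext a = M" using n iM(2) by (intro max) (auto simp: A_def)
  moreover have "a \<in> ext a" unfolding ext_def using idM(2)
   by (intro CollectI exI[of _ 0] exI[of _ 1]) (auto simp: aint_of_int)
  ultimately show False using a by simp
 qed
 have "primeideal M integer_ring"
 proof (rule primeidealI[OF iM(1) cring_integer_ring])
  show "carrier integer_ring ~= M" using one by (auto simp: integer_ring_def aint_of_int)
  fix a b :: 'k assume ab: "a \<in> carrier integer_ring" "b \<in> carrier integer_ring" "a \<otimes>\<^bsub>integer_ring\<^esub> b \<in> M"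
  hence ai: "aint a" "aint b" "a * b \<in> M" by (auto simp: integer_ring_def)
  show "a \<in> M \<or> b \<in> M"
  proof (rule ccontr)
   assume "\<not> (a \<in> M \<or> b \<in> M)"
   hence g: "good (ext a)" "good (ext b)" using ext[OF ai(1)] ext[OF ai(2)] by auto
   obtain ls where l: "set ls \<subseteq> set pss" "set (choices ls) \<subseteq> ext a" using g(1) by (auto simp: good_def)
   obtain ms where m: "set ms \<subseteq> set pss" "set (choices ms) \<subseteq> ext b" using g(2) by (auto simp: good_def)
   have "x * y \<in> M" if xy: "x \<in> ext a" "y \<in> ext b" for x y
   proof -
    obtain m c m' c' where *: "m \<in> M" "aint c" "x = m + c * a" "m' \<in> M" "aint c'" "y = m' + c' * b"
     using xy by (auto simp: ext_def)
    have "aint m'" using idM(1) *(4) by blast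
    hence alg: "aint (m' + c' * b)" "aint (c * a)" "aint (c * c')"
     using *(2,5) ai(1,2) by (simp_all add: aint_add_mult)
    have "x * y = (m' + c' * b) * m + ((c * a) * m' + (c * c') * (a * b))" by (simp add: * algebra_simps)
    have "(m' + c' * b) * m \<in> M" "(c * a) * m' \<in> M" "(c * c') * (a * b) \<in> M"
     by (rule idM(4)[OF alg(1) *(1)] idM(4)[OF alg(2) *(4)] idM(4)[OF alg(3) ai(3)])+
    thus ?thesis unfolding \<open>x * y = _\<close> by (intro idM(3))
   qed
   hence "set (choices (ls @ ms)) \<subseteq> M" unfolding choices_append using l m by blast
   thus False using goodI[of "ls @ ms" M] l m iM(3) by simp
  qed
 qed
 moreover have "M ~= {0}"
 proof -
  have "0 \<in> J" using J(1) unfolding ideal_integer_ring_iff by blast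
  thus ?thesis using J(2) iM(2) by blast
 qed
 ultimately have "nonzero_prime M" by (simp add: nonzero_prime_def)
 then obtain ps where ps: "ps \<in> set pss" "M = O_span (*) (set ps)" using primes iM(2) by blast
 have "set (choices [ps]) \<subseteq> M" using K.O_span_base ps(2) by (auto simp: choices_def)
 thus False using goodI[of "[ps]" M] ps(1) iM(3) by simp
qed

text \<open>\<open>T\<close> is meant to hold the pairs of a position and a product of the choices
  made up to it. Demanding closure under the next choice confines all element choices to lists; a
  larger \<open>T\<close> does no harm, because every entry at the final position is
  checked.\<close>

definition chain_certificate ::
  "('k::number_field => 'b::ring_1 => 'b) => 'k list list => 'b list => 'b list => bool" where
 "chain_certificate smul pss gens out \<longleftrightarrow> (\<exists>ls T. (\<forall>l\<in>set ls. l \<in> set pss) & (0::nat, 1) \<in> set T &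
   (\<forall>t\<in>set T. (\<forall>l. fst t < length ls & l = ls ! fst t --> (\<forall>g\<in>set l. (Suc (fst t), snd t * g) \<in> set T)) &
    (fst t = length ls --> (\<forall>r\<in>set gens. smul (snd t) r \<in> O_span smul (set out)))))"

lemma chain_certificateI:
 fixes smul :: "'k::number_field => 'b::ring_1 => 'b"
 assumes ls: "set ls \<subseteq> set pss"
  and fin: "!!\<gamma> r. \<gamma> \<in> set (choices ls) ==> r \<in> set gens ==> smul \<gamma> r \<in> O_span smul (set out)"
 shows "chain_certificate smul pss gens out"
proof -
 define T where "T = concat (map (%i. map (Pair i) (choices (take i ls))) [0..<Suc (length ls)])"
 have T: "(i, \<gamma>) \<in> set T \<longleftrightarrow> i \<le> length ls & \<gamma> \<in> set (choices (take i ls))" for i \<gamma>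
  unfolding T_def by (auto simp del: upt_Suc)
 show ?thesis unfolding chain_certificate_def
 proof (intro exI[of _ ls] exI[of _ T] conjI ballI allI impI)
  show "(0, 1) \<in> set T" by (simp add: T choices_Nil)
 next
  fix t l g assume t: "t \<in> set T" and l: "fst t < length ls & l = ls ! fst t" and g: "g \<in> set l"
  obtain i \<gamma> where [simp]: "t = (i, \<gamma>)" by (cases t)
  have "take (Suc i) ls = take i ls @ [l]" using l by (simp add: take_Suc_conv_app_nth)
  thus "(Suc (fst t), snd t * g) \<in> set T" using t l g by (auto simp: T choices_snoc)
 next
  fix t r assume t: "t \<in> set T" "fst t = length ls" and r: "r \<in> set gens"
  have "(length ls, snd t) \<in> set T" using t by (metis prod.collapse)
  hence "snd t \<in> set (choices ls)" unfolding T by simp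
  thus "smul (snd t) r \<in> O_span smul (set out)" using fin r by blast
 qed (use ls in auto)
qed

text \<open>Nonzero primes are maximal, so a prime different from the listed ones contains none of
  their generating lists. An element outside it is chosen from each list, and the choices lead
  through \<open>T\<close> to a product that is a unit at the prime.\<close>

lemma (in prime_of_K) chain_certificateD:
 assumes cert: "chain_certificate smul pss gens out"
  and pss: "!!ps. ps \<in> set pss ==> set ps \<subseteq> algints & nonzero_prime (O_span (*) (set ps)) & \<pp> ~= O_span (*) (set ps)"
 obtains a where "aint a" "a \<notin> \<pp>" "!!r. r \<in> set gens ==> smul a r \<in> O_span smul (set out)"
proof -
 interpret K: number_field_space "(*) :: 'k => 'k => 'k" by (rule number_field_space_self)
 have ex: "\<exists>g\<in>set ps. aint g & g \<notin> \<pp>" if ps: "ps \<in> set pss" for ps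
 proof (rule ccontr)
  assume "\<not> ?thesis"
  hence "set ps \<subseteq> \<pp>" using pss[OF ps] by auto
  hence sub: "O_span (*) (set ps) \<subseteq> \<pp>"
   by (rule K.O_span_minimal) (auto simp: K.O_submodule_def zero add mult)
  then obtain b where b: "b \<in> \<pp>" "b \<notin> O_span (*) (set ps)" using pss[OF ps] by blast
  interpret Q: prime_of_K "O_span (*) (set ps)" using pss[OF ps] by unfold_locales auto
  obtain u w where "aint u" "w \<in> O_span (*) (set ps)" "b * u + w = 1"
   using Q.inverse_mod[OF algint[OF b(1)] b(2)] .
  hence "1 \<in> \<pp>" using sub add[OF mult[OF _ b(1), of u], of w] by (auto simp: mult.commute)
  thus False using one_notin by simp
 qed
 obtain ls T where lsT: "(\<forall>l\<in>set ls. l \<in> set pss) & (0::nat, 1) \<in> set T &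
   (\<forall>t\<in>set T. (\<forall>l. fst t < length ls & l = ls ! fst t --> (\<forall>g\<in>set l. (Suc (fst t), snd t * g) \<in> set T)) &
    (fst t = length ls --> (\<forall>r\<in>set gens. smul (snd t) r \<in> O_span smul (set out))))"
  using cert unfolding chain_certificate_def by - (erule exE, erule exE, rule that)
 have ls: "\<forall>l\<in>set ls. l \<in> set pss" "(0::nat, 1) \<in> set T"
  "!!t g. t \<in> set T ==> fst t < length ls ==> g \<in> set (ls ! fst t) ==> (Suc (fst t), snd t * g) \<in> set T"
  "!!t r. t \<in> set T ==> fst t = length ls ==> r \<in> set gens ==> smul (snd t) r \<in> O_span smul (set out)"
  subgoal using lsT by simp
  subgoal using lsT by simp
  subgoal using lsT[THEN conjunct2, THEN conjunct2] by simp
  subgoal using lsT[THEN conjunct2, THEN conjunct2] by simp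
  done
 have "\<exists>\<gamma>. aint \<gamma> & \<gamma> \<notin> \<pp> & (i, \<gamma>) \<in> set T" if "i \<le> length ls" for i
  using that
 proof (induction i)
  case 0
  thus ?case using ls(2) one_notin by (intro exI[of _ 1]) (auto simp: aint_of_int)
 next
  case (Suc i)
  then obtain \<gamma> where \<gamma>: "aint \<gamma>" "\<gamma> \<notin> \<pp>" "(i, \<gamma>) \<in> set T" by auto
  obtain g where g: "g \<in> set (ls ! i)" "aint g" "g \<notin> \<pp>" using ex ls(1) Suc.prems by (metis Suc_le_lessD nth_mem)
  have "(Suc i, \<gamma> * g) \<in> set T" using ls(3)[OF \<gamma>(3)] g(1) Suc.prems by simp
  thus ?case using \<gamma> g by (intro exI[of _ "\<gamma> * g"]) (simp add: mult_notin aint_add_mult)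
 qed
 from this[of "length ls"] obtain \<gamma> where "aint \<gamma>" "\<gamma> \<notin> \<pp>" "(length ls, \<gamma>) \<in> set T" by auto
 thus thesis using that[of \<gamma>] ls(4)[of "(length ls, \<gamma>)"] by simp
qed

section \<open>Local certificates: soundness and completeness\<close>

context quaternion_algebra
begin

text \<open>\<open>es\<close> together with 1 is to be a basis of the span of \<open>out\<close> at
  the prime, up to the factor \<open>a\<close>; that \<open>a\<close> is a unit there is expressed
  by \<open>a * u + w = 1\<close>. \<open>D\<close> carries \<open>gens\<close> into the span of
  \<open>out\<close>, and \<open>z\<close> is an element of the prime; inverses witness that both
  are nonzero. \<open>ds\<close> is \<open>a * D\<close> times the dual basis, so that its
  membership in the span bounds the denominators of that basis. The last clause is the Clifford
  table modulo \<open>(4 * D) ^ 10 * z\<close>.\<close>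

definition local_certificate :: "'b list => 'b list => 'k list => 'k list => bool" where
 "local_certificate gens out ps q \<longleftrightarrow> (\<exists>es ds a u w D D' z z'.
   length es = 3 & length ds = 4 & (\<forall>x\<in>set es. x \<in> O_span smul (set out)) &
   aint a & aint u & w \<in> O_span (*) (set ps) & a * u + w = 1 &
   (\<forall>g\<in>set out. smul a g \<in> O_span smul (set (1 # es))) &
   aint D & D * D' = 1 & z \<in> O_span (*) (set ps) & z * z' = 1 &
   (\<forall>g\<in>set gens. smul D g \<in> O_span smul (set out)) &
   (\<forall>d\<in>set ds. d \<in> O_span smul (set (1 # es))) &
   (\<forall>k<4. \<forall>l<4. tr (ds ! k * (1 # es) ! l) = (if k = l then a * D else 0)) &
   (\<forall>x\<in>set (clifford_relations smul q (es ! 0) (es ! 1) (es ! 2)).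
    \<exists>s. s \<in> O_span smul (set (1 # es)) & smul a x = smul ((4 * D) ^ 10 * z) s))"

text \<open>The coordinates, with respect to 1 and the three generators, of the products in
  \<open>clifford_relations\<close>; the final branches stand for index 3.\<close>

definition clifford_table :: "'k list => nat => nat => 'k list" where
 "clifford_table q i k =
  (if i = 1 then if k = 1 then [- (q ! 3 * q ! 5), q ! 4, 0, 0]
    else if k = 2 then [q ! 5 * q ! 1, 0, 0, - (q ! 5)]
    else [- (q ! 1 * q ! 4), q ! 1, q ! 3, q ! 4]
   else if i = 2 then if k = 1 then [- (q ! 4 * q ! 2), q ! 2, q ! 4, q ! 5]
    else if k = 2 then [- (q ! 5 * q ! 0), 0, q ! 2, 0]
    else [q ! 0 * q ! 4, - (q ! 0), 0, 0]
   else if k = 1 then [q ! 3 * q ! 2, 0, - (q ! 3), 0]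
    else if k = 2 then [- (q ! 2 * q ! 1), q ! 0, q ! 1, q ! 2]
    else [- (q ! 0 * q ! 3), 0, 0, q ! 1])"

lemma sum_upto4: "(\<Sum>l<4. h l) = h 0 + h 1 + h 2 + h (3::nat)"
 by (simp add: lessThan_nat_numeral ac_simps)

lemma clifford_table:
 assumes "e 0 = 1" "i \<in> {1, 2, 3}" "k \<in> {1, 2, 3}"
 shows "e i * e k - (\<Sum>l<4. smul (clifford_table q i k ! l) (e l)) \<in>
  set (clifford_relations smul q (e 1) (e 2) (e 3))"
 using assms(2,3) unfolding clifford_relations_def sum_upto4 assms(1)
 by (elim insertE emptyE) (simp_all add: clifford_table_def scale_right_diff_distrib algebra_simps)

end

context local_orders
begin

lemma algebra_iso_Lam:
 assumes S: "is_order smul S" and S': "is_order smul S'"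
  and e: "!!k. k < 4 ==> e k \<in> S" "S \<subseteq> Lam e" and e': "!!k. k < 4 ==> e' k \<in> S'" "S' \<subseteq> Lam e'"
  and x: "x * \<xi> = 1" "\<xi> * x = 1" "!!s. s \<in> Lam e ==> x * s * \<xi> \<in> Lam e'" "!!s. s \<in> Lam e' ==> \<xi> * s * x \<in> Lam e"
 shows "algebra_iso (O_completion \<pp>) (order_completion smul \<pp> S) (order_completion smul \<pp> S')"
proof (rule algebra_iso_if_conjugate[OF S S' x(1,2)])
 have *: "\<exists>b. aint b & b \<notin> \<pp> & smul b t \<in> M"
  if M: "is_order smul M" and f: "!!k. k < 4 ==> f k \<in> M" and t: "t \<in> Lam f" for M f t
 proof -
  obtain b c where b: "aint b" "b \<notin> \<pp>" "!!k. k < 4 ==> aint (c k)" "smul b t = (\<Sum>k<4. smul (c k) (f k))"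
   using clear_denominator[OF t] by blast
  have "smul b t \<in> M" unfolding b(4)
   by (rule O_submodule_sum[OF orderD(1)[OF M]]) (use orderD(6)[OF M b(3) f] in auto)
  thus ?thesis using b(1,2) by blast
 qed
 show "\<exists>b. aint b & b \<notin> \<pp> & smul b (x * s * \<xi>) \<in> S'" if "s \<in> S" for s
  by (rule *[OF S' e'(1)]) (use that e(2) x(3) in auto)
 show "\<exists>b. aint b & b \<notin> \<pp> & smul b (\<xi> * s * x) \<in> S" if "s \<in> S'" for s
  by (rule *[OF S e(1)]) (use that e'(2) x(4) in auto)
qed

text \<open>\<open>S'\<close> is the bridge to the Clifford algebra: its isomorphism yields a basis
  \<open>e'\<close> whose table agrees with that of the form modulo the same \<open>m\<close> as the
  certified basis \<open>e\<close>. Since \<open>D\<close> carries \<open>R\<close> into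
  \<open>S\<close> and \<open>S'\<close> lies in \<open>R\<close>, it bounds \<open>e'\<close> as
  well, so \<open>nearby_orders\<close> applies with \<open>E = 4 * D\<close>.\<close>

lemma local_certificate_sound:
 assumes R: "R = O_span smul (set gens)" "is_order smul R" and S: "S = O_span smul (set out)" "is_order smul S"
  and S': "is_order smul S'" "S' \<subseteq> R"
  and iso: "algebra_iso (O_completion \<pp>) (order_completion smul \<pp> S')
   (even_clifford (O_completion \<pp>) (%i j. O_embed \<pp> (f i j)))"
  and f: "integral_form f" and p: "\<pp> = O_span (*) (set ps)"
  and cert: "local_certificate gens out ps (form_coeffs f)"
 shows "algebra_iso (O_completion \<pp>) (order_completion smul \<pp> S') (order_completion smul \<pp> S)"
proof -
 obtain es ds a u w D D' z z' where len: "length es = 3" "length ds = 4" and esS: "\<forall>x\<in>set es. x \<in> S"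
  and a: "aint a" "aint u" "w \<in> \<pp>" "a * u + w = 1" and out: "\<forall>g\<in>set out. smul a g \<in> O_span smul (set (1 # es))"
  and D: "aint D" "D * D' = 1" and z: "z \<in> \<pp>" "z * z' = 1" and gens: "\<forall>g\<in>set gens. smul D g \<in> S"
  and ds: "\<forall>d\<in>set ds. d \<in> O_span smul (set (1 # es))"
  and dual: "\<forall>k<4. \<forall>l<4. tr (ds ! k * (1 # es) ! l) = (if k = l then a * D else 0)"
  and rel: "!!x. x \<in> set (clifford_relations smul (form_coeffs f) (es ! 0) (es ! 1) (es ! 2)) ==>
   \<exists>s. s \<in> O_span smul (set (1 # es)) & smul a x = smul ((4 * D) ^ 10 * z) s"
  using cert unfolding local_certificate_def S(1) p by blast
 define e where "e k = (1 # es) ! k" for k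
 have e: "e 0 = 1" "e 1 = es ! 0" "e 2 = es ! 1" "e 3 = es ! 2" by (simp_all add: e_def)
 have set_es: "set (1 # es) = e ` {..<4}"
  unfolding e_def set_conv_nth using len by (auto simp: image_iff)
 have aP: "a \<notin> \<pp>"
 proof
  assume "a \<in> \<pp>"
  hence "1 \<in> \<pp>" using add[OF mult[OF a(2)] a(3), of a] a(4) by (simp add: mult.commute)
  thus False using one_notin by simp
 qed
 have a0: "a ~= 0" using aP zero by auto
 have D0: "D ~= 0" and z0: "z ~= 0" using D z by auto
 have aV: "inverse a \<in> local_ring"
  by (rule loc.unit[OF algint_local[OF a(1)] algint_notin_local_max[OF a(1) aP]])
 have eS: "e k \<in> S" if k: "k < 4" for k
 proof -
  have "e k \<in> set (1 # es)" unfolding set_es using k by simp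
  thus ?thesis using esS orderD(3)[OF S(2)] by auto
 qed
 have spans: "O_span smul X \<subseteq> span X" for X
  unfolding O_span_def by (auto intro!: span_sum span_scale intro: span_base)
 have b: "basis4 e"
 proof (rule basis4I_span)
  have 1: "g \<in> span (e ` {..<4})" if g: "g \<in> S" for g
  proof -
   have "h \<in> span (e ` {..<4})" if "h \<in> set out" for h
   proof -
    have "smul a h \<in> span (e ` {..<4})" using out that spans unfolding set_es by blast
    from span_scale[OF this, of "inverse a"] show ?thesis using a0 by simp
   qed
   hence "span (set out) \<subseteq> span (e ` {..<4})" by (intro span_minimal) auto
   thus ?thesis using g spans unfolding S(1) by blast
  qed
  have "g \<in> span (e ` {..<4})" if "g \<in> set gens" for g
   using span_scale[OF 1, of "smul D g" "inverse D"] gens that D0 by simp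
  hence "span (set gens) \<subseteq> span (e ` {..<4})" by (intro span_minimal) auto
  moreover have "R \<subseteq> span (set gens)" using spans R(1) by blast
  moreover have "span R = UNIV" using R(2) by (simp add: is_order_def is_lattice_def)
  ultimately show "span (e ` {..<4}) = UNIV" by (metis span_mono span_span top.extremum_uniqueI subset_trans)
 qed
 have spL: "O_span smul (set (1 # es)) \<subseteq> Lam e"
  unfolding set_es by (rule O_span_minimal[OF _ Lam_submodule[OF b]]) (use Lam_base[OF b] in auto)
 have unit_a: "x \<in> Lam e" if "smul a x \<in> Lam e" for x
  using Lam_smul[OF b aV that] a0 by simp
 have SL: "S \<subseteq> Lam e" unfolding S(1)
  by (rule O_span_minimal[OF _ Lam_submodule[OF b]]) (use unit_a out spL in blast)
 define m where "m = (4 * D) ^ 10 * z"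
 have m0: "m ~= 0" using D0 z0 by (simp add: m_def)
 obtain e' where b': "basis4 e'" and e'0: "e' 0 = 1" and e'S: "!!k. k < 4 ==> e' k \<in> S'" and S'L: "S' \<subseteq> Lam e'"
  and rel': "!!x. x \<in> set (clifford_relations smul (form_coeffs f) (e' 1) (e' 2) (e' 3)) ==> \<exists>s\<in>Lam e'. x = smul m s"
  using clifford_basis[OF S'(1) iso f p m0] by blast
 have rel_e: "\<exists>s\<in>Lam e. x = smul m s" if x: "x \<in> set (clifford_relations smul (form_coeffs f) (e 1) (e 2) (e 3))" for x
 proof -
  obtain s where s: "s \<in> O_span smul (set (1 # es))" "smul a x = smul m s"
   using rel x unfolding e m_def by blast
  have "x = smul (inverse a) (smul a x)" using a0 by simp
  also have "\<dots> = smul m (smul (inverse a) s)" by (simp add: s(2) mult.commute)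
  finally have "x = smul m (smul (inverse a) s)" .
  thus ?thesis using Lam_smul[OF b aV, of s] s(1) spL by blast
 qed
 obtain c' where c': "dual4 e' c'" using exists_dual4[OF b'] by blast
 \<comment> \<open>\<open>ds\<close> is dual to \<open>e\<close> up to the factor
   \<open>a * D\<close>.\<close>
 define c where "c k = smul (inverse (a * D)) (ds ! k)" for k
 have "a * D ~= 0" using a0 D0 by simp
 hence "inverse (a * D) * (a * D) = 1" by (rule left_inverse)
 hence c: "dual4 e c"
  using b dual by (auto simp: dual4_def c_def e_def smul_mult_left tr_smul simp del: inverse_mult_distrib)
 have tab: "\<exists>v\<in>local_ring. sc h d i k l = clifford_table (form_coeffs f) i k ! l + m * v"
  if d: "dual4 h d" and h0: "h 0 = 1" and ik: "i \<in> {1, 2, 3}" "k \<in> {1, 2, 3}" and l: "l < 4"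
   and rl: "!!x. x \<in> set (clifford_relations smul (form_coeffs f) (h 1) (h 2) (h 3)) ==> \<exists>s\<in>Lam h. x = smul m s"
  for h d i k l
 proof -
  note bh = dual4_basis[OF d]
  obtain s where s: "s \<in> Lam h" "h i * h k - (\<Sum>l<4. smul (clifford_table (form_coeffs f) i k ! l) (h l)) = smul m s"
   using rl[OF clifford_table[where e = h, OF h0 ik]] by blast
  have "h i * h k = (\<Sum>l<4. smul (clifford_table (form_coeffs f) i k ! l) (h l)) + smul m s"
   using s(2) by (simp add: diff_eq_eq add.commute)
  hence "sc h d i k l = crd h l (\<Sum>l<4. smul (clifford_table (form_coeffs f) i k ! l) (h l)) + m * crd h l s"
   unfolding sc_def dual4_tr[OF d l] by (simp only: crd_add[OF bh] crd_smul[OF bh])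
  thus ?thesis using s(1) l unfolding crd_unique[OF bh refl l] lam_iff[OF bh] by blast
 qed
 \<comment> \<open>Products with \<open>e 0 = 1\<close> are exact in both bases, so only the nine
   products of \<open>clifford_table\<close> can differ.\<close>
 have sc_trivial: "sc h d i k l = (if l = (if i = 0 then k else i) then 1 else 0)"
  if d: "dual4 h d" and "h 0 = 1" "i = 0 \<or> k = 0" "i < 4" "k < 4" "l < 4" for h d i k l
  unfolding sc_def dual4_tr[OF d \<open>l < 4\<close>] using that by (auto simp: crd_basis[OF dual4_basis[OF d]])
 have scV: "sc h d i k l \<in> local_ring"
  if d: "dual4 h d" and h: "!!k. k < 4 ==> h k \<in> M" and M: "is_order smul M" "M \<subseteq> Lam h" and ikl: "i < 4" "k < 4" "l < 4"
  for h d i k l M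
  unfolding sc_def dual4_tr[OF d ikl(3)] using orderD(5)[OF M(1) h[OF ikl(1)] h[OF ikl(2)]] M(2) ikl(3)
  by (auto simp: lam_iff[OF dual4_basis[OF d]])
 have DR: "smul D r \<in> Lam e" if "r \<in> R" for r
 proof -
  have "R \<subseteq> {r. smul D r \<in> S}" unfolding R(1)
  proof (rule O_span_minimal)
   have "smul D (smul b x) \<in> S" if "aint b" "smul D x \<in> S" for b x
    using orderD(6)[OF S(2) that] by (simp add: mult.commute)
   thus "O_submodule {r. smul D r \<in> S}"
    using orderD[OF S(2)] by (auto simp: O_submodule_def scale_right_distrib)
  qed (use gens in auto)
  thus ?thesis using that SL by blast
 qed
 have four: "4 \<in> local_ring" using loc.V_of_nat[of 4] by simp
 interpret near: nearby_orders smul local_ring local_max e c e' c' "4 * D" z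
 proof
  show "dual4 e c" "dual4 e' c'" by (rule c c')+
  show "sc e c i k l \<in> local_ring" if "i < 4" "k < 4" "l < 4" for i k l by (rule scV[OF c eS S(2) SL that])
  show "sc e' c' i k l \<in> local_ring" if "i < 4" "k < 4" "l < 4" for i k l by (rule scV[OF c' e'S S'(1) S'L that])
  show "\<exists>v\<in>local_ring. sc e' c' i k l - sc e c i k l = (4 * D) ^ 10 * z * v" if ikl: "i < 4" "k < 4" "l < 4" for i k l
  proof (cases "i = 0 \<or> k = 0")
   case True
   thus ?thesis using sc_trivial[OF c e(1) True ikl] sc_trivial[OF c' e'0 True ikl] loc.V_0
    by (intro bexI[of _ 0]) auto
  next
   case False
   hence ik: "i \<in> {1, 2, 3}" "k \<in> {1, 2, 3}" using ikl by auto
   obtain v where v: "v \<in> local_ring" "sc e c i k l = clifford_table (form_coeffs f) i k ! l + m * v"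
    using tab[OF c e(1) ik ikl(3) rel_e] by blast
   obtain v' where v': "v' \<in> local_ring" "sc e' c' i k l = clifford_table (form_coeffs f) i k ! l + m * v'"
    using tab[OF c' e'0 ik ikl(3) rel'] by blast
   show ?thesis using loc.V_diff[OF v'(1) v(1)]
    by (intro bexI[of _ "v' - v"]) (simp_all add: v v' m_def right_diff_distrib)
  qed
  show "z \<in> local_max" by (rule prime_local[OF z(1)])
  show "4 * D \<in> local_ring" by (rule loc.V_mult[OF four algint_local[OF D(1)]])
  show "4 * D ~= 0" using D0 by simp
  show "4 * D / 4 \<in> local_ring" using algint_local[OF D(1)] by simp
  show "smul (4 * D) (c k) \<in> Lam e" if k: "k < 4" for k
  proof -
   have "smul (4 * D) (c k) = smul (4 * inverse a) (ds ! k)" using D0 a0 by (simp add: c_def field_simps)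
   moreover have "ds ! k \<in> Lam e" using ds len(2) k spL by (metis nth_mem subsetD)
   ultimately show ?thesis using Lam_smul[OF b loc.V_mult[OF four aV]] by simp
  qed
  show "smul (4 * D) (e' k) \<in> Lam e" if k: "k < 4" for k
   using Lam_smul[OF b four DR[of "e' k"]] e'S[OF k] S'(2) by auto
  show "e 0 = 1" "e' 0 = 1" by (rule e(1) e'0)+
 qed
 obtain x \<xi> where x: "x * \<xi> = 1" "\<xi> * x = 1" and fw: "!!s. s \<in> Lam e ==> x * s * \<xi> \<in> Lam e'"
  and bw: "!!s. s \<in> Lam e' ==> \<xi> * s * x \<in> Lam e" using near.conjugate by blast
 show ?thesis by (rule algebra_iso_Lam[OF S'(1) S(2) e'S S'L eS SL x(2,1) bw fw])
qed

lemma common_unit: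
 assumes "finite X" "X \<subseteq> Lam e"
 obtains a where "aint a" "a \<notin> \<pp>" "!!x. x \<in> X ==> smul a x \<in> O_span smul (e ` {..<4})"
proof -
 note O = O_submodule_O_span[of "e ` {..<4}", unfolded O_submodule_def]
 have "\<exists>a. aint a & a \<notin> \<pp> & (\<forall>x\<in>X. smul a x \<in> O_span smul (e ` {..<4}))"
  using assms
 proof (induction X)
  case empty
  show ?case using one_notin by (intro exI[of _ 1]) (simp add: aint_of_int)
 next
  case (insert x X)
  then obtain a where a: "aint a" "a \<notin> \<pp>" "\<forall>x\<in>X. smul a x \<in> O_span smul (e ` {..<4})" by auto
  obtain b c where b: "aint b" "b \<notin> \<pp>" "!!k. k < 4 ==> aint (c k)" "smul b x = (\<Sum>k<4. smul (c k) (e k))"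
   using clear_denominator[of x e] insert by blast
  have "smul b x \<in> O_span smul (e ` {..<4})" unfolding b(4)
   by (rule O_submodule_sum[OF O_submodule_O_span]) (use O b(3) O_span_base in auto)
  hence "smul a (smul b x) \<in> O_span smul (e ` {..<4})" using O a by blast
  hence x: "smul (a * b) x \<in> O_span smul (e ` {..<4})" unfolding scale_scale .
  have y: "smul (a * b) y \<in> O_span smul (e ` {..<4})" if "y \<in> X" for y
  proof -
   have "smul b (smul a y) \<in> O_span smul (e ` {..<4})" using O a b that by blast
   thus ?thesis by (simp add: mult.commute)
  qed
  have "aint (a * b)" "a * b \<notin> \<pp>" using a b by (simp_all add: mult_notin aint_add_mult)
  thus ?case using x y by blast
 qed
 thus thesis using that by blast
qed

text \<open>The precision \<open>m\<close> depends on \<open>D\<close> and the basis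
  \<open>e\<close> on \<open>m\<close>, so \<open>D\<close> has to bound the dual basis of
  \<open>e\<close> before \<open>e\<close> is known. The bound comes from a fixed basis
  \<open>\<beta>'\<close> inside \<open>S\<close>: up to a unit at the prime, the dual vectors of
  \<open>e\<close> have integral traces against \<open>S\<close>, hence are integral combinations of
  the dual basis \<open>\<gamma>\<close> of \<open>\<beta>'\<close>.\<close>

lemma local_certificate_complete:
 assumes R: "R = O_span smul (set gens)" and S: "S = O_span smul (set out)" "is_order smul S"
  and iso: "algebra_iso (O_completion \<pp>) (order_completion smul \<pp> S)
   (even_clifford (O_completion \<pp>) (%i j. O_embed \<pp> (f i j)))"
  and f: "integral_form f" and p: "\<pp> = O_span (*) (set ps)"
 shows "local_certificate gens out ps (form_coeffs f)"
proof -
 note o = orderD[OF S(2)]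
 have lat: "is_lattice smul S" using S(2) by (simp add: is_order_def)
 obtain D1 where D1: "aint D1" "D1 ~= 0" "\<forall>x\<in>R. smul D1 x \<in> S"
  using common_denominator[OF lat, of "set gens"] R by auto
 obtain \<beta> where \<beta>: "basis4 \<beta>" using exists_basis4 by blast
 obtain D2 where D2: "D2 ~= 0" "\<forall>x\<in>O_span smul (\<beta> ` {..<4}). smul D2 x \<in> S"
  using common_denominator[OF lat, of "\<beta> ` {..<4}"] by auto
 define \<beta>' where "\<beta>' k = smul D2 (\<beta> k)" for k
 have \<beta>'S: "\<beta>' k \<in> S" if "k < 4" for k using D2(2) O_span_base that by (simp add: \<beta>'_def)
 have b\<beta>': "basis4 \<beta>'"
 proof (rule basis4I_span)
  have "\<beta> k \<in> span (\<beta>' ` {..<4})" if "k < 4" for k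
  proof -
   have "\<beta>' k \<in> span (\<beta>' ` {..<4})" by (rule span_base) (simp add: that)
   from span_scale[OF this, of "inverse D2"] show ?thesis using D2(1) by (simp add: \<beta>'_def)
  qed
  hence "span (\<beta> ` {..<4}) \<subseteq> span (\<beta>' ` {..<4})" by (intro span_minimal) auto
  thus "span (\<beta>' ` {..<4}) = UNIV" using \<beta> by (auto simp: basis4_def)
 qed
 obtain \<gamma> where \<gamma>: "dual4 \<beta>' \<gamma>" using exists_dual4[OF b\<beta>'] by blast
 obtain D3 where D3: "aint D3" "D3 ~= 0" "\<forall>x\<in>O_span smul (\<gamma> ` {..<4}). smul D3 x \<in> S"
  using common_denominator[OF lat, of "\<gamma> ` {..<4}"] by auto
 define D where "D = D1 * D3"
 have D: "aint D" "D ~= 0" using D1 D3 by (simp_all add: D_def aint_add_mult)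
 have "\<exists>z\<in>\<pp>. z ~= 0"
 proof (rule ccontr)
  assume "\<not> ?thesis"
  hence "\<pp> = {0}" using zero by blast
  thus False using nonzero_prime by (simp add: nonzero_prime_def)
 qed
 then obtain z where z: "z \<in> \<pp>" "z ~= 0" by blast
 define m where "m = (4 * D) ^ 10 * z"
 have m0: "m ~= 0" using D z by (simp add: m_def)
 obtain e where b: "basis4 e" and e0: "e 0 = 1" and eS: "!!k. k < 4 ==> e k \<in> S" and SL: "S \<subseteq> Lam e"
  and rel: "!!x. x \<in> set (clifford_relations smul (form_coeffs f) (e 1) (e 2) (e 3)) ==> \<exists>s\<in>Lam e. x = smul m s"
  using clifford_basis[OF S(2) iso f p m0] by blast
 define es where "es = [e 1, e 2, e 3]"
 have es: "(1 # es) ! k = e k" if "k < 4" for k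
 proof -
  have "k = 0 \<or> k = 1 \<or> k = 2 \<or> k = 3" using that by auto
  thus ?thesis by (auto simp: es_def e0)
 qed
 have set_es: "set (1 # es) = e ` {..<4}"
  by (auto simp: es_def e0[symmetric] lessThan_nat_numeral)
 let ?L = "O_span smul (e ` {..<4})"
 note O = O_submodule_O_span[of "e ` {..<4}", unfolded O_submodule_def]
 have LS: "?L \<subseteq> S" by (rule O_span_minimal[OF _ o(1)]) (use eS in auto)
 define X where "X = set (clifford_relations smul (form_coeffs f) (e 1) (e 2) (e 3))"
 obtain s where s: "!!x. x \<in> X ==> s x \<in> Lam e & x = smul m (s x)" using rel unfolding X_def by metis
 have outS: "set out \<subseteq> S" using O_span_base S(1) by blast
 \<comment> \<open>\<open>a1\<close> also clears the quotients \<open>s x\<close> of the relations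
   by \<open>m\<close>, because the certificate asks for them in the global span.\<close>
 obtain a1 where a1: "aint a1" "a1 \<notin> \<pp>" "!!x. x \<in> set out \<union> s ` X ==> smul a1 x \<in> ?L"
 proof (rule common_unit)
  show "finite (set out \<union> s ` X)" by (simp add: X_def)
  show "set out \<union> s ` X \<subseteq> Lam e" using s SL outS by blast
 qed blast
 have a1S: "smul a1 x \<in> ?L" if "x \<in> S" for x
 proof -
  have "O_span smul (set out) \<subseteq> {x. smul a1 x \<in> ?L}"
  proof (rule O_span_minimal)
   have "smul a1 (smul b x) \<in> ?L" if "aint b" "smul a1 x \<in> ?L" for b x
   proof -
    have "smul b (smul a1 x) \<in> ?L" using O that by blast
    thus ?thesis by (simp add: mult.commute)
   qed
   thus "O_submodule {x. smul a1 x \<in> ?L}" using O by (auto simp: O_submodule_def scale_right_distrib)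
  qed (use a1 in auto)
  thus ?thesis using that S(1) by blast
 qed
 obtain c where c: "dual4 e c" using exists_dual4[OF b] by blast
 have crdL: "aint (crd e k x)" if "x \<in> ?L" "k < 4" for k x
 proof -
  have "?L \<subseteq> {x. aint (crd e k x)}"
   by (rule O_span_minimal)
    (use that in \<open>auto simp: O_submodule_def crd_basis[OF b] crd_zero[OF b] crd_add[OF b] crd_smul[OF b]
     aint_of_int intro: aint_add_mult\<close>)
  thus ?thesis using that by blast
 qed
 \<comment> \<open>One factor \<open>a1\<close> makes the traces of the dual vectors against
   \<open>S\<close> integral, the other brings the result from \<open>S\<close> into the span of
   \<open>e\<close>.\<close>
 define a where "a = a1 * a1"
 have a: "aint a" "a \<notin> \<pp>" using a1 by (simp_all add: a_def aint_add_mult mult_notin)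
 have D3c: "smul D3 (smul a1 (c k)) \<in> S" if k: "k < 4" for k
 proof -
  have t: "aint (tr (smul a1 (c k) * x))" if "x \<in> S" for x
   using crdL[OF a1S[OF that] k] by (simp add: smul_mult_left tr_smul dual4_tr[OF c k] crd_smul[OF b])
  have "smul a1 (c k) = (\<Sum>l<4. smul (tr (\<beta>' l * smul a1 (c k))) (\<gamma> l))" by (rule dual4_expand'[OF \<gamma>])
  moreover have "(\<Sum>l<4. smul (tr (\<beta>' l * smul a1 (c k))) (\<gamma> l)) \<in> O_span smul (\<gamma> ` {..<4})"
  proof (rule O_submodule_sum[OF O_submodule_O_span])
   fix l :: nat assume l: "l \<in> {..<4}"
   have "aint (tr (\<beta>' l * smul a1 (c k)))" using t[OF \<beta>'S, of l] l by (simp add: tr_commute)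
   moreover have "\<gamma> l \<in> O_span smul (\<gamma> ` {..<4})" using l by (intro O_span_base) auto
   ultimately show "smul (tr (\<beta>' l * smul a1 (c k))) (\<gamma> l) \<in> O_span smul (\<gamma> ` {..<4})"
    using O_submodule_O_span by (auto simp: O_submodule_def)
  qed
  ultimately show ?thesis using D3(3) by auto
 qed
 define ds where "ds = map (%k. smul (a * D) (c k)) [0..<4]"
 have dsk: "ds ! k = smul (a * D) (c k)" if "k < 4" for k using that by (simp add: ds_def)
 have dsL: "smul (a * D) (c k) \<in> ?L" if k: "k < 4" for k
 proof -
  have "smul D1 (smul a1 (smul D3 (smul a1 (c k)))) \<in> ?L" using a1S[OF D3c[OF k]] O D1(1) by blast
  thus ?thesis by (simp add: a_def D_def mult_ac)
 qed
 obtain u w where u: "aint u" "w \<in> \<pp>" "a * u + w = 1" using inverse_mod[OF a] .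
 show ?thesis unfolding local_certificate_def
 proof (intro exI conjI ballI allI impI)
  show "length es = 3" "length ds = 4" by (simp_all add: es_def ds_def)
  show "x \<in> O_span smul (set out)" if "x \<in> set es" for x
   using that eS[of 1] eS[of 2] eS[of 3] S(1) by (auto simp: es_def)
  show "aint a" "aint u" "w \<in> O_span (*) (set ps)" "a * u + w = 1" using a u p by auto
  show "smul a g \<in> O_span smul (set (1 # es))" if "g \<in> set out" for g
  proof -
   have "smul a1 (smul a1 g) \<in> ?L" using a1(3)[of g] that O a1(1) by blast
   thus ?thesis unfolding set_es by (simp add: a_def)
  qed
  show "aint D" "D * inverse D = 1" "z \<in> O_span (*) (set ps)" "z * inverse z = 1" using D z p by auto
  show "smul D g \<in> O_span smul (set out)" if "g \<in> set gens" for g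
  proof -
   have "smul D1 g \<in> S" using D1(3) that O_span_base R by blast
   from o(6)[OF D3(1) this] show ?thesis by (simp add: D_def S(1) mult.commute)
  qed
  show "d \<in> O_span smul (set (1 # es))" if "d \<in> set ds" for d
   using that dsL unfolding set_es by (auto simp: ds_def)
  show "tr (ds ! k * (1 # es) ! l) = (if k = l then a * D else 0)" if "k < 4" "l < 4" for k l
   using c that by (simp add: es dsk smul_mult_left tr_smul dual4_def)
  fix x assume "x \<in> set (clifford_relations smul (form_coeffs f) (es ! 0) (es ! 1) (es ! 2))"
  hence x: "x \<in> X" by (simp add: X_def es_def numeral_2_eq_2)
  have "smul a1 (smul a1 (s x)) \<in> ?L" using a1(3)[of "s x"] x O a1(1) by blast
  thus "smul a (s x) \<in> O_span smul (set (1 # es))" unfolding set_es by (simp add: a_def)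
  have "smul a x = smul a (smul m (s x))" using s[OF x] by simp
  thus "smul a x = smul ((4 * D) ^ 10 * z) (smul a (s x))" unfolding m_def by (simp add: mult.commute)
 qed
qed

end

section \<open>Computable functions and recursively enumerable sets\<close>

definition comp_on :: "nat => (nat list => nat) => bool" where
 "comp_on k F \<longleftrightarrow> (\<exists>P. \<forall>xs. length xs = k --> computes P xs (F xs))"

lemma comp_on_nth: "i < k ==> comp_on k (%xs. xs ! i)"
 unfolding comp_on_def by (rule exI[of _ "Proj i"]) (auto intro: computes.proj)

lemma comp_on_Comp:
 assumes "comp_on (length Gs) F" "!!G. G \<in> set Gs ==> comp_on k G"
 shows "comp_on k (%xs. F (map (%G. G xs) Gs))"
proof -
 obtain P where P: "!!ys. length ys = length Gs ==> computes P ys (F ys)"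
  using assms(1) by (auto simp: comp_on_def)
 obtain Q where Q: "!!G xs. G \<in> set Gs ==> length xs = k ==> computes (Q G) xs (G xs)"
  using assms(2) unfolding comp_on_def by metis
 have "computes (Comp P (map Q Gs)) xs (F (map (%G. G xs) Gs))" if "length xs = k" for xs
  by (rule computes.comp[where ys = "map (%G. G xs) Gs"])
   (auto simp: list_all2_conv_all_nth Q that intro: P)
 thus ?thesis unfolding comp_on_def by blast
qed

abbreviation comp1 :: "(nat => nat) => bool" where "comp1 f \<equiv> comp_on 1 (%xs. f (xs ! 0))"
abbreviation comp2 :: "(nat => nat => nat) => bool" where
 "comp2 f \<equiv> comp_on 2 (%xs. f (xs ! 0) (xs ! 1))"
abbreviation comp3 :: "(nat => nat => nat => nat) => bool" where
 "comp3 f \<equiv> comp_on 3 (%xs. f (xs ! 0) (xs ! 1) (xs ! 2))"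

lemma comp_on_app1: "comp1 f ==> comp_on k F ==> comp_on k (%xs. f (F xs))"
 using comp_on_Comp[of "[F]" "%xs. f (xs ! 0)" k] by simp

lemma comp_on_app2: "comp2 f ==> comp_on k F ==> comp_on k G ==> comp_on k (%xs. f (F xs) (G xs))"
 using comp_on_Comp[of "[F, G]" "%xs. f (xs ! 0) (xs ! 1)" k] by (auto simp: numeral_2_eq_2)

lemma comp_on_app3: "comp3 f ==> comp_on k F ==> comp_on k G ==> comp_on k H ==>
  comp_on k (%xs. f (F xs) (G xs) (H xs))"
 using comp_on_Comp[of "[F, G, H]" "%xs. f (xs ! 0) (xs ! 1) (xs ! 2)" k]
 by (auto simp: numeral_3_eq_3 numeral_2_eq_2)

lemma comp1_Suc: "comp1 Suc"
proof -
 have "computes Succ xs (Suc (xs ! 0))" if "length xs = 1" for xs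
  using that by (cases xs) (auto intro: computes.succ)
 thus ?thesis unfolding comp_on_def by blast
qed

lemma comp_on_const: "comp_on k (%_. c)"
proof (induction c)
 case 0
 show ?case unfolding comp_on_def by (rule exI[of _ Zero]) (auto intro: computes.zero)
qed (rule comp_on_app1[OF comp1_Suc])

lemma comp_on_primrec:
 assumes "comp_on k F" "comp_on (Suc (Suc k)) G"
 shows "comp_on (Suc k) (%xs. rec_nat (F (tl xs)) (%n y. G (n # y # tl xs)) (hd xs))"
proof -
 obtain P where P: "!!ys. length ys = k ==> computes P ys (F ys)"
  using assms(1) by (auto simp: comp_on_def)
 obtain Q where Q: "!!ys. length ys = Suc (Suc k) ==> computes Q ys (G ys)"
  using assms(2) by (auto simp: comp_on_def)
 have *: "computes (PrimRec P Q) (n # ys) (rec_nat (F ys) (%n y. G (n # y # ys)) n)"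
  if "length ys = k" for n ys
 proof (induction n)
  case 0
  show ?case using P[OF that] by (auto intro: computes.primrec_0)
 next
  case (Suc n)
  show ?case by (simp, rule computes.primrec_Suc[OF Suc Q]) (simp add: that)
 qed
 have "computes (PrimRec P Q) xs (rec_nat (F (tl xs)) (%n y. G (n # y # tl xs)) (hd xs))"
  if "length xs = Suc k" for xs
  using *[of "tl xs" "hd xs"] that by (cases xs) auto
 thus ?thesis unfolding comp_on_def by blast
qed

lemma comp_on_cong: "comp_on k F ==> (!!xs. length xs = k ==> F xs = F' xs) ==> comp_on k F'"
 unfolding comp_on_def by metis

lemma comp2_rec:
 assumes "comp1 f" "comp3 g"
 shows "comp2 (%n a. rec_nat (f a) (%i y. g i y a) n)"
proof -
 have 3: "Suc (Suc 1) = 3" "Suc 1 = 2" by simp_all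
 show ?thesis
  by (rule comp_on_cong[OF comp_on_primrec[OF assms(1) assms(2)[folded 3(1)], unfolded 3(2)]])
   (auto simp: numeral_2_eq_2 length_Suc_conv)
qed

lemma comp3_rec:
 assumes "comp2 f" "comp_on 4 (%xs. g (xs ! 0) (xs ! 1) (xs ! 2) (xs ! 3))"
 shows "comp3 (%n a b. rec_nat (f a b) (%i y. g i y a b) n)"
proof -
 have 3: "Suc (Suc 2) = 4" "Suc 2 = 3" by simp_all
 show ?thesis
  by (rule comp_on_cong[OF comp_on_primrec[OF assms(1) assms(2)[folded 3(1)], unfolded 3(2)]])
   (auto simp: numeral_3_eq_3 numeral_2_eq_2 length_Suc_conv)
qed

lemmas comp_on_nths = comp_on_nth[of 0] comp_on_nth[of 1] comp_on_nth[of 2] comp_on_nth[of 3]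

lemma comp2_plus: "comp2 (+)"
proof -
 have "comp2 (%n a. rec_nat a (%i y. Suc y) n)"
  by (rule comp2_rec; intro comp_on_nths comp_on_app1[OF comp1_Suc]; simp)
 moreover have "rec_nat a (%i y. Suc y) n = n + a" for n a by (induction n) auto
 ultimately show ?thesis by simp
qed

lemma comp2_times: "comp2 (*)"
proof -
 have "comp2 (%n a. rec_nat 0 (%i y. y + a) n)"
  by (rule comp2_rec; intro comp_on_nths comp_on_const comp_on_app2[OF comp2_plus]; simp)
 moreover have "rec_nat 0 (%i y. y + a) n = n * a" for n a by (induction n) auto
 ultimately show ?thesis by simp
qed

lemma comp1_pred: "comp1 (%n. n - 1)"
proof -
 have "comp2 (%n a. rec_nat 0 (%i y. i) n)"
  by (rule comp2_rec; intro comp_on_nths comp_on_const; simp)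
 moreover have "rec_nat 0 (%i y. i) n = n - 1" for n by (cases n) auto
 ultimately have "comp2 (%n a. n - 1)" by simp
 from comp_on_app2[OF this comp_on_nth[of 0 1] comp_on_nth[of 0 1]] show ?thesis by simp
qed

lemma comp2_minus: "comp2 (-)"
proof -
 have "comp2 (%n a. rec_nat a (%i y. y - 1) n)"
  by (rule comp2_rec; intro comp_on_nths comp_on_app1[OF comp1_pred]; simp)
 moreover have "rec_nat a (%i y. y - 1) n = a - n" for n a by (induction n) auto
 ultimately have "comp2 (%n a. a - n)" by simp
 from comp_on_app2[OF this comp_on_nth[of 1 2] comp_on_nth[of 0 2]] show ?thesis by simp
qed

lemma comp3_bounded_sum:
 assumes "comp3 h" shows "comp3 (%n a b. \<Sum>i<n. h i a b)"
proof -
 have "comp3 (%n a b. rec_nat 0 (%i y. y + h i a b) n)"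
  by (rule comp3_rec; intro comp_on_nths comp_on_const comp_on_app2[OF comp2_plus] comp_on_app3[OF assms]; simp)
 moreover have "rec_nat 0 (%i y. y + h i a b) n = (\<Sum>i<n. h i a b)" for n a b by (induction n) auto
 ultimately show ?thesis by simp
qed

lemma comp3_bounded_prod:
 assumes "comp3 h" shows "comp3 (%n a b. \<Prod>i<n. h i a b)"
proof -
 have "comp3 (%n a b. rec_nat 1 (%i y. y * h i a b) n)"
  by (rule comp3_rec; intro comp_on_nths comp_on_const comp_on_app2[OF comp2_times] comp_on_app3[OF assms]; simp)
 moreover have "rec_nat 1 (%i y. y * h i a b) n = (\<Prod>i<n. h i a b)" for n a b by (induction n) auto
 ultimately show ?thesis by simp
qed

section \<open>The pairing function and its inverses\<close>

abbreviation pair :: "nat => nat => nat" where "pair a b \<equiv> prod_encode (a, b)"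
definition pfst :: "nat => nat" where "pfst n = fst (prod_decode n)"
definition psnd :: "nat => nat" where "psnd n = snd (prod_decode n)"

lemma pfst_psnd [simp]: "pfst (pair a b) = a" "psnd (pair a b) = b" "pair (pfst n) (psnd n) = n"
 by (simp_all add: pfst_def psnd_def)

lemma comp2_pair: "comp2 pair"
proof -
 have "comp2 (%n a. rec_nat 0 (%i y. y + Suc i) n)"
  by (rule comp2_rec; intro comp_on_nths comp_on_const comp_on_app1[OF comp1_Suc] comp_on_app2[OF comp2_plus]; simp)
 moreover have "rec_nat 0 (%i y. y + Suc i) n = triangle n" for n by (induction n) auto
 ultimately have "comp2 (%n a. triangle n)" by simp
 from comp_on_app2[OF this comp_on_nth[of 0 1] comp_on_nth[of 0 1]] have t: "comp1 triangle" by simp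
 show ?thesis unfolding prod_encode_def split
  by (intro comp_on_app2[OF comp2_plus] comp_on_app1[OF t] comp_on_nths) simp_all
qed

text \<open>The components are found by summing over all pairs below the code.\<close>

lemma comp1_pfst_psnd: "comp1 pfst" "comp1 psnd"
proof -
 \<comment> \<open>Truncated subtraction makes \<open>?d\<close> the indicator of
   \<open>pair i j = z\<close>.\<close>
 let ?d = "%i j z. (1 - ((pair i j - z) + (z - pair i j)))"
 have d: "?d i j z = (if pair i j = z then 1 else 0)" for i j z by auto
 have d3: "comp3 ?d"
  by (intro comp_on_app2[OF comp2_minus] comp_on_app2[OF comp2_plus] comp_on_app2[OF comp2_pair]
    comp_on_nths comp_on_const) simp_all
 have swap: "comp3 (%j i z. f i j z)" if "comp3 f" for f
  using comp_on_app3[OF that comp_on_nth[of 1 3] comp_on_nth[of 0 3] comp_on_nth[of 2 3]] by simp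
 have fin: "comp1 (%z. \<Sum>i<Suc z. \<Sum>j<Suc z. f i j z)" if f: "comp3 f" for f
 proof -
  have 1: "comp3 (%n i z. \<Sum>j<n. f i j z)" by (rule comp3_bounded_sum[OF swap[OF f]])
  have "comp3 (%i z _. \<Sum>j<Suc z. f i j z)"
   by (intro comp_on_app3[OF 1] comp_on_app1[OF comp1_Suc] comp_on_nths) simp_all
  from comp3_bounded_sum[OF this]
  have 2: "comp3 (%n z _. \<Sum>i<n. \<Sum>j<Suc z. f i j z)" .
  show ?thesis by (intro comp_on_app3[OF 2, where H = "%_. 0"] comp_on_app1[OF comp1_Suc] comp_on_nths comp_on_const) simp_all
 qed
 have "(\<Sum>i<Suc z. \<Sum>j<Suc z. i * ?d i j z) = pfst z" "(\<Sum>i<Suc z. \<Sum>j<Suc z. j * ?d i j z) = psnd z" for z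
 proof -
  have *: "(\<Sum>i<Suc z. \<Sum>j<Suc z. g i j * ?d i j z) = g (pfst z) (psnd z)" for g
  proof -
   have "(\<Sum>i<Suc z. \<Sum>j<Suc z. g i j * ?d i j z) =
     (\<Sum>i<Suc z. \<Sum>j<Suc z. if i = pfst z then if j = psnd z then g i j else 0 else 0)"
    unfolding d by (intro sum.cong refl) (auto simp del: lessThan_Suc)
   also have "\<dots> = (\<Sum>i<Suc z. if i = pfst z then g i (psnd z) else 0)"
   proof (rule sum.cong[OF refl])
    have "psnd z < Suc z" using le_prod_encode_2[of "psnd z" "pfst z"] by (simp add: less_Suc_eq_le)
    thus "(\<Sum>j<Suc z. if i = pfst z then if j = psnd z then g i j else 0 else 0) =
     (if i = pfst z then g i (psnd z) else 0)" for i by (simp del: sum.lessThan_Suc lessThan_Suc)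
   qed
   also have "\<dots> = g (pfst z) (psnd z)"
   proof -
    have "pfst z < Suc z" using le_prod_encode_1[of "pfst z" "psnd z"] by (simp add: less_Suc_eq_le)
    thus ?thesis by (simp del: sum.lessThan_Suc lessThan_Suc)
   qed
   finally show ?thesis .
  qed
  show "(\<Sum>i<Suc z. \<Sum>j<Suc z. i * ?d i j z) = pfst z" "(\<Sum>i<Suc z. \<Sum>j<Suc z. j * ?d i j z) = psnd z"
   using *[of "%i j. i"] *[of "%i j. j"] by blast+
 qed
 moreover have "comp1 (%z. \<Sum>i<Suc z. \<Sum>j<Suc z. i * ?d i j z)" "comp1 (%z. \<Sum>i<Suc z. \<Sum>j<Suc z. j * ?d i j z)"
  by (rule fin; intro comp_on_app2[OF comp2_times] comp_on_app3[OF d3] comp_on_nths; simp)+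
 ultimately show "comp1 pfst" "comp1 psnd" by (simp_all only:)
qed

lemmas comp_intros = comp_on_nths comp_on_const comp_on_app1[OF comp1_Suc] comp_on_app2[OF comp2_plus]
 comp_on_app2[OF comp2_times] comp_on_app2[OF comp2_minus] comp_on_app2[OF comp2_pair]
 comp_on_app1[OF comp1_pfst_psnd(1)] comp_on_app1[OF comp1_pfst_psnd(2)]

text \<open>Projections of decidable relations, with truth coded by 0 as in \<open>Mu\<close>; the
  witness is the first argument because the search runs over it.\<close>

definition re :: "nat set => bool" where
 "re A \<longleftrightarrow> (\<exists>d. comp2 d & A = {x. \<exists>w. d w x = 0})"

lemma re_vimage: 
 assumes "re A" "comp1 f" shows "re {x. f x \<in> A}"
proof -
 obtain d where d: "comp2 d" "A = {x. \<exists>w. d w x = 0}" using assms by (auto simp: re_def)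
 have "comp2 (%w x. d w (f x))"
  by (intro comp_on_app2[OF d(1)] comp_on_app1[OF assms(2)] comp_on_nths) simp_all
 thus ?thesis unfolding re_def by (intro exI[of _ "%w x. d w (f x)"]) (simp add: d(2))
qed

lemma re_Int: assumes "re A" "re B" shows "re (A \<inter> B)"
proof -
 obtain d e where d: "comp2 d" "A = {x. \<exists>w. d w x = 0}" and e: "comp2 e" "B = {x. \<exists>w. e w x = 0}"
  using assms by (auto simp: re_def)
 have "comp2 (%w x. d (pfst w) x + e (psnd w) x)"
  by (intro comp_on_app2[OF d(1)] comp_on_app2[OF e(1)] comp_intros) simp_all
 moreover have "A \<inter> B = {x. \<exists>w. d (pfst w) x + e (psnd w) x = 0}"
 proof (intro Set.set_eqI iffI)
  fix x assume "x \<in> A \<inter> B"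
  then obtain v w where "d v x = 0" "e w x = 0" using d e by auto
  thus "x \<in> {x. \<exists>w. d (pfst w) x + e (psnd w) x = 0}" by (auto intro!: exI[of _ "pair v w"])
 qed (auto simp: d e)
 ultimately show ?thesis unfolding re_def
  by (intro exI[of _ "%w x. d (pfst w) x + e (psnd w) x"] conjI)
qed

lemma re_Un: assumes "re A" "re B" shows "re (A \<union> B)"
proof -
 obtain d e where d: "comp2 d" "A = {x. \<exists>w. d w x = 0}" and e: "comp2 e" "B = {x. \<exists>w. e w x = 0}"
  using assms by (auto simp: re_def)
 have "comp2 (%w x. d w x * e w x)"
  by (intro comp_on_app2[OF d(1)] comp_on_app2[OF e(1)] comp_intros) simp_all
 moreover have "A \<union> B = {x. \<exists>w. d w x * e w x = 0}" by (auto simp: d e)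
 ultimately show ?thesis unfolding re_def by (intro exI[of _ "%w x. d w x * e w x"] conjI)
qed

lemma re_Ex: assumes "re A" shows "re {x. \<exists>y. pair x y \<in> A}"
proof -
 obtain d where d: "comp2 d" "A = {x. \<exists>w. d w x = 0}" using assms by (auto simp: re_def)
 have "comp2 (%w x. d (pfst w) (pair x (psnd w)))" by (intro comp_on_app2[OF d(1)] comp_intros) simp_all
 moreover have "{x. \<exists>y. pair x y \<in> A} = {x. \<exists>w. d (pfst w) (pair x (psnd w)) = 0}"
 proof (intro Set.set_eqI iffI)
  fix x assume "x \<in> {x. \<exists>y. pair x y \<in> A}"
  then obtain w y where "d w (pair x y) = 0" using d by auto
  thus "x \<in> {x. \<exists>w. d (pfst w) (pair x (psnd w)) = 0}" by (auto intro!: exI[of _ "pair w y"])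
 qed (auto simp: d)
 ultimately show ?thesis unfolding re_def
  by (intro exI[of _ "%w x. d (pfst w) (pair x (psnd w))"] conjI)
qed

lemma re_eq: assumes "comp1 f" "comp1 g" shows "re {x. f x = g x}"
proof -
 have "comp2 (%w x. (f x - g x) + (g x - f x))"
  by (intro comp_on_app1[OF assms(1)] comp_on_app1[OF assms(2)] comp_intros) simp_all
 moreover have "{x. f x = g x} = {x. \<exists>w::nat. (f x - g x) + (g x - f x) = 0}" by auto
 ultimately show ?thesis unfolding re_def by (intro exI[of _ "%w x. (f x - g x) + (g x - f x)"] conjI)
qed

lemma re_neq0: assumes "comp1 f" shows "re {x. f x ~= 0}"
proof -
 have "{x. f x ~= 0} = {x. 1 - f x = 0}" by auto
 moreover have "re {x. 1 - f x = 0}"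
  by (rule re_eq; intro comp_on_app1[OF assms] comp_intros; simp)
 ultimately show ?thesis by simp
qed

lemma re_UNIV: "re UNIV"
 using re_eq[of "%x. 0" "%x. 0"] comp_on_const by simp

text \<open>Collection: finitely many witnesses are bounded by a common number.\<close>

lemma re_All_less:
 assumes "re A" "comp1 f" shows "re {x. \<forall>i<f x. pair x i \<in> A}"
proof -
 obtain d where d: "comp2 d" "A = {x. \<exists>w. d w x = 0}" using assms by (auto simp: re_def)
 have 1: "comp3 (%v x i. d v (pair x i))" by (intro comp_on_app2[OF d(1)] comp_intros) simp_all
 have 2: "comp3 (%w x i. \<Prod>v<w. d v (pair x i))" by (rule comp3_bounded_prod[OF 1])
 have 3: "comp3 (%i w x. \<Prod>v<w. d v (pair x i))" by (intro comp_on_app3[OF 2] comp_intros) simp_all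
 have 4: "comp3 (%n w x. \<Sum>i<n. \<Prod>v<w. d v (pair x i))" by (rule comp3_bounded_sum[OF 3])
 have "comp2 (%w x. \<Sum>i<f x. \<Prod>v<w. d v (pair x i))"
  by (intro comp_on_app3[OF 4] comp_on_app1[OF assms(2)] comp_intros) simp_all
 moreover have "{x. \<forall>i<f x. pair x i \<in> A} = {x. \<exists>w. (\<Sum>i<f x. \<Prod>v<w. d v (pair x i)) = 0}"
 proof (intro Set.set_eqI iffI)
  fix x assume "x \<in> {x. \<forall>i<f x. pair x i \<in> A}"
  hence "\<forall>i<f x. \<exists>w. d w (pair x i) = 0" by (auto simp: d)
  then obtain w where w: "!!i. i < f x ==> d (w i) (pair x i) = 0" by metis
  define m where "m = Suc (\<Sum>i<f x. w i)"
  have "w i < m" if "i < f x" for i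
   unfolding m_def less_Suc_eq_le using that by (intro member_le_sum) auto
  hence "(\<Prod>v<m. d v (pair x i)) = 0" if "i < f x" for i
   using w[OF that] that by (intro prod_zero) auto
  hence "(\<Sum>i<f x. \<Prod>v<m. d v (pair x i)) = 0" by simp
  thus "x \<in> {x. \<exists>w. (\<Sum>i<f x. \<Prod>v<w. d v (pair x i)) = 0}" by blast
 qed (auto simp: d)
 ultimately show ?thesis unfolding re_def by (intro exI[of _ "%w x. \<Sum>i<f x. \<Prod>v<w. d v (pair x i)"] conjI)
qed

text \<open>The search runs over pairs of a witness and an output. The \<open>c\<close> it returns
  may differ from the given one, and is only known to form an element of \<open>A\<close> with the
  inputs.\<close>

lemma re_search:
 assumes "re A"
 obtains P where "!!x y c. pair x (pair y c) \<in> A ==> \<exists>c. computes P [x, y] c & pair x (pair y c) \<in> A"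
proof -
 obtain d where d: "comp2 d" "A = {x. \<exists>w. d w x = 0}" using assms by (auto simp: re_def)
 have "comp3 (%v x y. d (pfst v) (pair x (pair y (psnd v))))"
  by (intro comp_on_app2[OF d(1)] comp_intros) simp_all
 then obtain Q where Q0: "\<forall>xs. length xs = 3 --> computes Q xs (d (pfst (xs!0)) (pair (xs!1) (pair (xs!2) (psnd (xs!0)))))"
  unfolding comp_on_def by blast
 have Q: "computes Q [v, x, y] (d (pfst v) (pair x (pair y (psnd v))))" for v x y
  using Q0[rule_format, of "[v, x, y]"] by simp
 obtain S where S0: "\<forall>xs. length xs = 1 --> computes S xs (psnd (xs!0))"
  using comp1_pfst_psnd(2) unfolding comp_on_def by blast
 have S: "computes S [v] (psnd v)" for v using S0[rule_format, of "[v]"] by simp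
 have "\<exists>c. computes (Comp S [Mu Q]) [x, y] c & pair x (pair y c) \<in> A" if mem: "pair x (pair y c) \<in> A" for x y c
 proof -
  let ?g = "%v. d (pfst v) (pair x (pair y (psnd v)))"
  obtain w where "d w (pair x (pair y c)) = 0" using mem d by auto
  hence "?g (pair w c) = 0" by simp
  define v where "v = (LEAST v. ?g v = 0)"
  have v: "?g v = 0" unfolding v_def by (rule LeastI[of _ "pair w c"]) fact
  have "computes (Mu Q) [x, y] v"
  proof (rule computes.mu)
   show "computes Q [v, x, y] 0" using Q[of v x y] v by simp
   show "\<forall>m<v. \<exists>k. computes Q [m, x, y] (Suc k)"
   proof (intro allI impI)
    fix m assume "m < v"
    hence "?g m ~= 0" unfolding v_def using not_less_Least by blast
    thus "\<exists>k. computes Q [m, x, y] (Suc k)" using Q[of m x y] by (metis not0_implies_Suc)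
   qed
  qed
  hence "computes (Comp S [Mu Q]) [x, y] (psnd v)"
   by (intro computes.comp[where ys = "[v]"]) (auto intro: S)
  moreover have "pair x (pair y (psnd v)) \<in> A" using v d by auto
  ultimately show ?thesis by blast
 qed
 thus thesis by (rule that)
qed

text \<open>The empty list has code 0 and any other list a successor; \<open>tlc\<close> fixes 0, so
  dropping beyond the end gives 0, and the length can be read off from where 0 first
  appears.\<close>

definition hdc :: "nat => nat" where "hdc l = pfst (l - 1)"
definition tlc :: "nat => nat" where "tlc l = psnd (l - 1)"
definition dropc :: "nat => nat => nat" where "dropc i l = rec_nat l (%_. tlc) i"

lemma comp1_hdc: "comp1 hdc" and comp1_tlc: "comp1 tlc"
 unfolding hdc_def tlc_def by (intro comp_intros comp_on_app1[OF comp1_pred]; simp)+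

lemma comp2_dropc: "comp2 dropc"
 unfolding dropc_def by (rule comp2_rec; intro comp_intros comp_on_app1[OF comp1_tlc]; simp)

lemma hdc_encode: "hdc (list_encode (x # xs)) = x" by (simp add: hdc_def)
lemma tlc_encode: "tlc (list_encode xs) = list_encode (tl xs)"
proof (cases xs)
 case Nil
 have "pair 0 0 = 0" by (simp add: prod_encode_def)
 hence "psnd 0 = 0" using pfst_psnd(2)[of 0 0] by simp
 thus ?thesis using Nil by (simp add: tlc_def)
qed (simp add: tlc_def)
lemma dropc_encode: "dropc i (list_encode xs) = list_encode (drop i xs)"
 by (induction i) (simp_all add: dropc_def tlc_encode tl_drop drop_Suc)
lemma nthc_encode: "i < length xs ==> hdc (dropc i (list_encode xs)) = xs ! i"
 by (simp add: dropc_encode Cons_nth_drop_Suc[symmetric] hdc_encode del: list_encode.simps)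
lemma dropc_eq_0_iff: "dropc i (list_encode xs) = 0 \<longleftrightarrow> length xs \<le> i"
proof -
 have "list_encode ys = 0 \<longleftrightarrow> ys = []" for ys by (cases ys) auto
 thus ?thesis by (simp add: dropc_encode)
qed
lemma length_le_list_encode: "length xs \<le> list_encode xs"
proof (induction xs)
 case (Cons x xs)
 thus ?case using le_prod_encode_2[of "list_encode xs" x] by simp
qed simp

section \<open>Enumerability of relations between encoded objects\<close>

type_synonym 'a enc = "'a => nat"

text \<open>Only enumerability is asked of codes, and functions are represented by enumerable
  graphs; compositions and quantifiers then reduce to projections, without writing programs for each
  data type.\<close>

definition encoder :: "'a enc => bool" where "encoder e \<longleftrightarrow> inj e & re (range e)"
definition rep :: "'a enc => ('a => bool) => bool" where "rep e P \<longleftrightarrow> re (e ` {x. P x})"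
definition pe :: "'a enc => 'b enc => ('a \<times> 'b) enc" where "pe e e' = (%(x, y). pair (e x) (e' y))"
definition le :: "'a enc => 'a list enc" where "le e = (%xs. list_encode (map e xs))"
definition cfn :: "'a enc => 'b enc => ('a => 'b) => bool" where
 "cfn e e' f \<longleftrightarrow> re (range (%x. pair (e x) (e' (f x))))"
definition ne :: "nat enc" where [simp]: "ne n = n"

lemma dropc_pos_iff: "0 < dropc i (list_encode xs) \<longleftrightarrow> i < length xs"
 using dropc_eq_0_iff[of i xs] by linarith

lemma inj_encoder: "encoder e ==> e x = e y \<longleftrightarrow> x = y"
 unfolding encoder_def by (simp add: inj_eq)

lemma pair_eq: "pair a b = pair c d \<longleftrightarrow> a = c & b = d"
 by (metis pfst_psnd(1,2))

lemma pfst_psnd_pe [simp]: "pfst (pe e e' p) = e (fst p)" "psnd (pe e e' p) = e' (snd p)"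
 by (simp_all add: pe_def split_beta)

lemma inj_pe: "inj e ==> inj e' ==> inj (pe e e')"
 unfolding inj_def pe_def by (auto simp: pair_eq)

lemma inj_le: "inj e ==> inj (le e)"
 using inj_compose[OF inj_list_encode inj_mapI] by (simp add: le_def comp_def)

lemma re_pfst: "re A ==> re {n. pfst n \<in> A}" and re_psnd: "re A ==> re {n. psnd n \<in> A}"
 using re_vimage[of A pfst] re_vimage[of A psnd] comp1_pfst_psnd by auto

lemma re_vimage_f: "re A ==> comp1 f ==> B = {x. f x \<in> A} ==> re B"
 using re_vimage by simp

lemma re_ExI: 
 assumes "re A" "B = {x. \<exists>y. pair x y \<in> A}" shows "re B"
 using re_Ex[OF assms(1)] assms(2) by simp

lemma encoder_pe: 
 assumes "encoder e" "encoder e'" shows "encoder (pe e e')"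
proof -
 have "range (pe e e') = {n. pfst n \<in> range e} \<inter> {n. psnd n \<in> range e'}"
 proof (intro Set.set_eqI iffI)
  fix n assume "n \<in> {n. pfst n \<in> range e} \<inter> {n. psnd n \<in> range e'}"
  then obtain x y where "pfst n = e x" "psnd n = e' y" by auto
  hence "n = pe e e' (x, y)" unfolding pe_def by (metis pfst_psnd(3) case_prod_conv)
  thus "n \<in> range (pe e e')" by blast
 qed (auto simp: pe_def)
 thus ?thesis using assms unfolding encoder_def by (auto intro!: inj_pe re_Int re_pfst re_psnd)
qed

lemma rep_conj: "encoder e ==> rep e P ==> rep e Q ==> rep e (%x. P x & Q x)"
proof -
 assume e: "encoder e" "rep e P" "rep e Q"
 have "e ` {x. P x & Q x} = e ` {x. P x} \<inter> e ` {x. Q x}" using inj_encoder[OF e(1)] by auto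
 thus ?thesis using e by (auto simp: rep_def intro: re_Int)
qed

lemma rep_disj: "rep e P ==> rep e Q ==> rep e (%x. P x \<or> Q x)"
proof -
 assume e: "rep e P" "rep e Q"
 have "e ` {x. P x \<or> Q x} = e ` {x. P x} \<union> e ` {x. Q x}" by auto
 thus ?thesis using e by (auto simp: rep_def intro: re_Un)
qed

lemma rep_ex: 
 assumes "rep (pe e e') (%p. P (fst p) (snd p))" shows "rep e (%x. \<exists>y. P x y)"
proof -
 have "e ` {x. \<exists>y. P x y} = {n. \<exists>m. pair n m \<in> pe e e' ` {p. P (fst p) (snd p)}}"
  by (auto simp: pe_def image_iff pair_eq Bex_def)
 thus ?thesis using assms re_Ex by (auto simp: rep_def)
qed

text \<open>An existential quantifier over the code of \<open>f x\<close> replaces the evaluation of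
  \<open>f\<close>.\<close>

lemma rep_app: 
 assumes "encoder e'" "rep e' P" "cfn e e' f" shows "rep e (%x. P (f x))"
proof -
 have "e ` {x. P (f x)} = {n. \<exists>m. pair n m \<in> range (%x. pair (e x) (e' (f x))) \<inter> {n. psnd n \<in> e' ` {x. P x}}}"
  using inj_encoder[OF assms(1)] by (auto simp: image_iff pair_eq)
 moreover have "re (range (%x. pair (e x) (e' (f x))) \<inter> {n. psnd n \<in> e' ` {x. P x}})"
  using assms by (intro re_Int re_psnd) (auto simp: cfn_def rep_def)
 ultimately show ?thesis unfolding rep_def by (rule re_ExI[rotated])
qed

lemma cfn_iff_rep: "cfn e e' f \<longleftrightarrow> rep (pe e e') (%p. snd p = f (fst p))"
proof -
 have "pe e e' ` {p. snd p = f (fst p)} = range (%x. pair (e x) (e' (f x)))"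
  by (auto simp: pe_def image_iff)
 thus ?thesis by (simp add: cfn_def rep_def)
qed

lemma cfn_comp: 
 assumes e: "encoder e'" and f: "cfn e e' f" and g: "cfn e' e'' g" shows "cfn e e'' (%x. g (f x))"
proof -
 let ?A = "{n. pair (pfst (pfst n)) (psnd n) \<in> range (%x. pair (e x) (e' (f x)))} \<inter>
  {n. pair (psnd n) (psnd (pfst n)) \<in> range (%x. pair (e' x) (e'' (g x)))}"
 have "re ?A"
  using f g by (intro re_Int; intro re_vimage_f[OF _ _ refl]; simp add: cfn_def; intro comp_intros; simp)
 moreover have "range (%x. pair (e x) (e'' (g (f x)))) = {n. \<exists>m. pair n m \<in> ?A}"
 proof (intro Set.set_eqI iffI)
  fix n assume "n \<in> {n. \<exists>m. pair n m \<in> ?A}"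
  then obtain m x y where "pair (pfst n) m = pair (e x) (e' (f x))" "pair m (psnd n) = pair (e' y) (e'' (g y))"
   by auto
  hence "pfst n = e x" "psnd n = e'' (g (f x))" using inj_encoder[OF e] by (auto simp: pair_eq)
  hence "n = pair (e x) (e'' (g (f x)))" by (metis pfst_psnd(3))
  thus "n \<in> range (%x. pair (e x) (e'' (g (f x))))" by blast
 next
  fix n assume "n \<in> range (%x. pair (e x) (e'' (g (f x))))"
  then obtain x where "n = pair (e x) (e'' (g (f x)))" by blast
  thus "n \<in> {n. \<exists>m. pair n m \<in> ?A}" by (intro CollectI exI[of _ "e' (f x)"]) auto
 qed
 ultimately show ?thesis unfolding cfn_def by (rule re_ExI)
qed

lemma cfn_pair:
 assumes e: "encoder e" and f: "cfn e e1 f" and g: "cfn e e2 g" shows "cfn e (pe e1 e2) (%x. (f x, g x))"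
proof -
 let ?A = "{n. pair (pfst n) (pfst (psnd n)) \<in> range (%x. pair (e x) (e1 (f x)))} \<inter>
  {n. pair (pfst n) (psnd (psnd n)) \<in> range (%x. pair (e x) (e2 (g x)))}"
 have "re ?A"
  using f g by (intro re_Int; intro re_vimage_f[OF _ _ refl]; simp add: cfn_def; intro comp_intros; simp)
 moreover have "range (%x. pair (e x) (pe e1 e2 (f x, g x))) = ?A"
 proof (intro Set.set_eqI iffI)
  fix n assume "n \<in> ?A"
  then obtain x y where "pair (pfst n) (pfst (psnd n)) = pair (e x) (e1 (f x))"
   "pair (pfst n) (psnd (psnd n)) = pair (e y) (e2 (g y))" by auto
  hence "pfst n = e x" "pfst (psnd n) = e1 (f x)" "psnd (psnd n) = e2 (g x)"
   using inj_encoder[OF e] by (auto simp: pair_eq)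
  hence "n = pair (e x) (pe e1 e2 (f x, g x))" unfolding pe_def by (metis pfst_psnd(3) case_prod_conv)
  thus "n \<in> range (%x. pair (e x) (pe e1 e2 (f x, g x)))" by blast
 qed (auto simp: pe_def)
 ultimately show ?thesis by (simp add: cfn_def)
qed

lemma cfn_id: "encoder e ==> cfn e e (%x. x)"
proof -
 assume e: "encoder e"
 have "range (%x. pair (e x) (e x)) = {n. pfst n \<in> range e} \<inter> {n. pfst n = psnd n}"
 proof (intro Set.set_eqI iffI)
  fix n assume "n \<in> {n. pfst n \<in> range e} \<inter> {n. pfst n = psnd n}"
  hence "pfst n \<in> range e" by blast
  then obtain x where "pfst n = e x" by (rule rangeE)
  moreover have "psnd n = pfst n" using \<open>n \<in> _\<close> by simp
  ultimately have "pfst n = e x" "psnd n = e x" by simp_all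
  hence "n = pair (e x) (e x)" by (metis pfst_psnd(3))
  thus "n \<in> range (%x. pair (e x) (e x))" by blast
 qed auto
 thus ?thesis using e unfolding cfn_def encoder_def
  by (auto intro!: re_Int re_pfst re_eq comp1_pfst_psnd)
qed

lemma cfn_const: "encoder e ==> cfn e e' (%x. c)"
proof -
 assume e: "encoder e"
 have "range (%x. pair (e x) (e' c)) = {n. pfst n \<in> range e} \<inter> {n. psnd n = e' c}"
 proof (intro Set.set_eqI iffI)
  fix n assume "n \<in> {n. pfst n \<in> range e} \<inter> {n. psnd n = e' c}"
  then obtain x where "pfst n = e x" "psnd n = e' c" by auto
  hence "n = pair (e x) (e' c)" by (metis pfst_psnd(3))
  thus "n \<in> range (%x. pair (e x) (e' c))" by blast
 qed auto
 thus ?thesis using e unfolding cfn_def encoder_def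
  by (auto intro!: re_Int re_pfst re_eq comp1_pfst_psnd comp_on_const)
qed

lemma cfn_fst_snd: 
 assumes "encoder e" "encoder e'" shows "cfn (pe e e') e fst" "cfn (pe e e') e' snd"
proof -
 have "range (%x. pair (pe e e' x) (e (fst x))) = {n. pfst n \<in> range (pe e e')} \<inter> {n. pfst (pfst n) = psnd n}"
 proof (intro Set.set_eqI iffI)
  fix n assume "n \<in> {n. pfst n \<in> range (pe e e')} \<inter> {n. pfst (pfst n) = psnd n}"
  then obtain x where "pfst n = pe e e' x" by auto
  moreover have "psnd n = pfst (pfst n)" using \<open>n \<in> _\<close> by simp
  ultimately have "pfst n = pe e e' x" "psnd n = e (fst x)" by (simp_all add: pe_def split_beta)
  hence "n = pair (pe e e' x) (e (fst x))" by (metis pfst_psnd(3))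
  thus "n \<in> range (%x. pair (pe e e' x) (e (fst x)))" by blast
 qed auto
 moreover have "range (%x. pair (pe e e' x) (e' (snd x))) = {n. pfst n \<in> range (pe e e')} \<inter> {n. psnd (pfst n) = psnd n}"
 proof (intro Set.set_eqI iffI)
  fix n assume "n \<in> {n. pfst n \<in> range (pe e e')} \<inter> {n. psnd (pfst n) = psnd n}"
  then obtain x where "pfst n = pe e e' x" by auto
  moreover have "psnd n = psnd (pfst n)" using \<open>n \<in> _\<close> by simp
  ultimately have "pfst n = pe e e' x" "psnd n = e' (snd x)" by (simp_all add: pe_def split_beta)
  hence "n = pair (pe e e' x) (e' (snd x))" by (metis pfst_psnd(3))
  thus "n \<in> range (%x. pair (pe e e' x) (e' (snd x)))" by blast
 qed auto
 moreover have "re (range (pe e e'))" using encoder_pe[OF assms] by (simp add: encoder_def)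
 ultimately show "cfn (pe e e') e fst" "cfn (pe e e') e' snd" unfolding cfn_def
  by (auto intro!: re_Int re_pfst re_eq comp1_pfst_psnd comp_intros)
qed

lemma cfn_app2: 
 assumes "cfn (pe e1 e2) e3 (%p. h (fst p) (snd p))" "encoder e" "encoder e1" "encoder e2"
  and "cfn e e1 f" "cfn e e2 g"
 shows "cfn e e3 (%x. h (f x) (g x))"
 using cfn_comp[OF encoder_pe[OF assms(3,4)] cfn_pair[OF assms(2,5,6)] assms(1)] by simp

lemma rep_app2: 
 assumes "rep (pe e1 e2) (%p. P (fst p) (snd p))" "encoder e" "encoder e1" "encoder e2"
  and "cfn e e1 f" "cfn e e2 g"
 shows "rep e (%x. P (f x) (g x))"
 using rep_app[OF encoder_pe[OF assms(3,4)] assms(1) cfn_pair[OF assms(2,5,6)]] by simp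

lemma rep_eq:
 assumes "encoder e" "encoder e'" "cfn e e' f" "cfn e e' g" shows "rep e (%x. f x = g x)"
proof -
 have "e ` {x. f x = g x} = {n. \<exists>m. pair n m \<in> range (%x. pair (e x) (e' (f x))) \<inter> range (%x. pair (e x) (e' (g x)))}"
 proof (intro Set.set_eqI iffI)
  fix n assume "n \<in> {n. \<exists>m. pair n m \<in> range (%x. pair (e x) (e' (f x))) \<inter> range (%x. pair (e x) (e' (g x)))}"
  then obtain m x y where "pair n m = pair (e x) (e' (f x))" "pair n m = pair (e y) (e' (g y))" by auto
  thus "n \<in> e ` {x. f x = g x}" using inj_encoder[OF assms(1)] inj_encoder[OF assms(2)]
   by (auto simp: pair_eq)
 qed (force simp: pair_eq)
 thus ?thesis using assms(3,4) re_Ex[OF re_Int] by (auto simp: rep_def cfn_def)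
qed

lemma encoder_ne: "encoder ne" using re_UNIV by (simp add: encoder_def inj_def)

lemma cfn_nat1: "comp1 h ==> cfn ne ne h"
proof -
 assume h: "comp1 h"
 have "range (%x. pair x (h x)) = {n. h (pfst n) = psnd n}"
  by (auto simp: image_iff) (metis pfst_psnd(3))
 thus ?thesis unfolding cfn_def ne_def using comp_on_app1[OF h comp1_pfst_psnd(1)]
  by (auto intro!: re_eq comp1_pfst_psnd)
qed

lemma cfn_nat2: 
 assumes h: "comp2 h" and e: "encoder e" "cfn e ne f" "cfn e ne g" shows "cfn e ne (%x. h (f x) (g x))"
proof (rule cfn_app2[OF _ e(1) encoder_ne encoder_ne e(2,3)])
 have "comp1 (%n. h (pfst n) (psnd n))"
  using comp_on_app2[OF h comp1_pfst_psnd] by simp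
 from cfn_nat1[OF this] have "re (range (%n. pair n (h (pfst n) (psnd n))))" by (simp add: cfn_def)
 moreover have "range (%n. pair n (h (pfst n) (psnd n))) =
   range (%p. pair (pe ne ne p) (h (fst p) (snd p)))"
 proof (intro Set.set_eqI iffI)
  fix m assume "m \<in> range (%n. pair n (h (pfst n) (psnd n)))"
  then obtain n where "m = pair n (h (pfst n) (psnd n))" by auto
  hence "m = pair (pe ne ne (pfst n, psnd n)) (h (fst (pfst n, psnd n)) (snd (pfst n, psnd n)))"
   by (simp add: pe_def)
  thus "m \<in> range (%p. pair (pe ne ne p) (h (fst p) (snd p)))" by blast
 next
  fix m assume "m \<in> range (%p. pair (pe ne ne p) (h (fst p) (snd p)))"
  then obtain a b where "m = pair (pair a b) (h a b)" by (auto simp: pe_def)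
  hence "m = pair (pair a b) (h (pfst (pair a b)) (psnd (pair a b)))" by simp
  thus "m \<in> range (%n. pair n (h (pfst n) (psnd n)))" by blast
 qed
 ultimately show "cfn (pe ne ne) ne (%p. h (fst p) (snd p))" by (simp add: cfn_def)
qed

lemma rep_all_less:
 assumes e: "encoder e" and P: "rep (pe e ne) (%p. P (fst p) (snd p))" and f: "cfn e ne f"
 shows "rep e (%x. \<forall>i<f x. P x i)"
proof -
 let ?A = "pe e ne ` {p. P (fst p) (snd p)}"
 have 1: "re {n. \<forall>i<psnd n. pair n i \<in> {m. pair (pfst (pfst m)) (psnd m) \<in> ?A}}"
  using P unfolding rep_def by (intro re_All_less re_vimage_f[OF _ _ refl] comp_intros) simp_all
 have "e ` {x. \<forall>i<f x. P x i} = {n. \<exists>m. pair n m \<in> range (%x. pair (e x) (f x)) \<inter>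
   {n. \<forall>i<psnd n. pair n i \<in> {m. pair (pfst (pfst m)) (psnd m) \<in> ?A}}}"
  using inj_encoder[OF e] by (auto simp: pe_def pair_eq image_iff)
 thus ?thesis using re_Ex[OF re_Int[OF _ 1]] f by (auto simp: rep_def cfn_def)
qed

text \<open>Codes of lists are recognised by inspecting the positions below the code itself, which
  is never smaller than the length. The length is the first position from which nothing is
  left.\<close>

lemma rep_nth:
 assumes e: "encoder e" shows "rep (pe (pe (le e) ne) e) (%p. snd (fst p) < length (fst (fst p)) & fst (fst p) ! snd (fst p) = snd p)"
  "encoder (le e)" "cfn (le e) ne length"
proof -
 have r: "re (range e)" using e by (simp add: encoder_def)
 have "re {l. \<forall>i<l. pair l i \<in> {n. dropc (psnd n) (pfst n) = 0} \<union> {n. hdc (dropc (psnd n) (pfst n)) \<in> range e}}"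
  by (intro re_All_less re_Un re_eq re_vimage_f[OF r _ refl] comp_on_app2[OF comp2_dropc] comp_on_app1[OF comp1_hdc] comp_intros)
   simp_all
 also have "{l. \<forall>i<l. pair l i \<in> {n. dropc (psnd n) (pfst n) = 0} \<union> {n. hdc (dropc (psnd n) (pfst n)) \<in> range e}} = range (le e)"
 proof (intro Set.set_eqI iffI)
  fix l assume l: "l \<in> {l. \<forall>i<l. pair l i \<in> {n. dropc (psnd n) (pfst n) = 0} \<union> {n. hdc (dropc (psnd n) (pfst n)) \<in> range e}}"
  define xs where "xs = list_decode l"
  have lx: "l = list_encode xs" by (simp add: xs_def)
  have "xs ! i \<in> range e" if i: "i < length xs" for i
  proof -
   have "i < l" using i length_le_list_encode[of xs] lx by simp
   hence "dropc i l = 0 \<or> hdc (dropc i l) \<in> range e" using l by auto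
   thus ?thesis using i by (simp add: lx dropc_eq_0_iff nthc_encode)
  qed
  hence "set xs \<subseteq> range e" by (auto simp: in_set_conv_nth)
  then obtain ys where "xs = map e ys" by (metis ex_map_conv subset_iff rangeE)
  thus "l \<in> range (le e)" by (auto simp: lx le_def)
 next
  fix l assume "l \<in> range (le e)"
  then obtain ys where ys: "l = list_encode (map e ys)" by (auto simp: le_def)
  show "l \<in> {l. \<forall>i<l. pair l i \<in> {n. dropc (psnd n) (pfst n) = 0} \<union> {n. hdc (dropc (psnd n) (pfst n)) \<in> range e}}"
  proof (intro CollectI allI impI)
   fix i
   show "pair l i \<in> {n. dropc (psnd n) (pfst n) = 0} \<union> {n. hdc (dropc (psnd n) (pfst n)) \<in> range e}"
    using nthc_encode[of i "map e ys"] by (cases "i < length ys") (auto simp: ys dropc_eq_0_iff)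
  qed
 qed
 finally have r': "re (range (le e))" .
 thus 1: "encoder (le e)" using e inj_le by (auto simp: encoder_def)
 have "re ({n. pfst n \<in> range (le e)} \<inter> {n. dropc (psnd n) (pfst n) = 0} \<inter>
   {n. \<forall>i<psnd n. pair n i \<in> {n. dropc (psnd n) (pfst (pfst n)) ~= 0}})"
  by (intro re_Int re_All_less re_eq re_neq0 re_pfst r' comp_on_app2[OF comp2_dropc] comp_intros)
   simp_all
 also have "{n. pfst n \<in> range (le e)} \<inter> {n. dropc (psnd n) (pfst n) = 0} \<inter>
   {n. \<forall>i<psnd n. pair n i \<in> {n. dropc (psnd n) (pfst (pfst n)) ~= 0}} = range (%xs. pair (le e xs) (length xs))"
 proof (intro Set.set_eqI iffI)
  fix n assume n: "n \<in> {n. pfst n \<in> range (le e)} \<inter> {n. dropc (psnd n) (pfst n) = 0} \<inter>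
   {n. \<forall>i<psnd n. pair n i \<in> {n. dropc (psnd n) (pfst (pfst n)) ~= 0}}"
  then obtain xs where xs: "pfst n = list_encode (map e xs)" by (auto simp: le_def)
  have "dropc (psnd n) (pfst n) = 0" "\<forall>i<psnd n. dropc i (pfst n) ~= 0" using n by simp_all
  hence "length xs \<le> psnd n" "\<forall>i<psnd n. i < length xs" unfolding xs dropc_eq_0_iff by (simp_all add: not_le)
  hence "psnd n = length xs" by (metis le_less_linear nat_less_le order_le_less)
  hence "n = pair (le e xs) (length xs)" using xs by (metis le_def pfst_psnd(3))
  thus "n \<in> range (%xs. pair (le e xs) (length xs))" by blast
 qed (auto simp: le_def dropc_eq_0_iff dropc_pos_iff)
 finally show 2: "cfn (le e) ne length" by (simp add: cfn_def)
 let ?B = "{n. pfst (pfst n) \<in> range (le e)} \<inter> {n. psnd n \<in> range e} \<inter> {n. dropc (psnd (pfst n)) (pfst (pfst n)) ~= 0}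
   \<inter> {n. hdc (dropc (psnd (pfst n)) (pfst (pfst n))) = psnd n}"
 have "re ?B"
  by (intro re_Int re_All_less re_eq re_neq0 re_vimage_f[OF r' _ refl] re_psnd r comp_on_app1[OF comp1_hdc] comp_on_app2[OF comp2_dropc] comp_intros)
   simp_all
 also have "?B = pe (pe (le e) ne) e ` {p. snd (fst p) < length (fst (fst p)) & fst (fst p) ! snd (fst p) = snd p}"
 proof (intro Set.set_eqI iffI)
  fix n assume n: "n \<in> ?B"
  then obtain xs x where xs: "pfst (pfst n) = list_encode (map e xs)" "psnd n = e x" by (auto simp: le_def)
  have i: "psnd (pfst n) < length xs" using n by (simp add: xs dropc_pos_iff)
  have "e (xs ! psnd (pfst n)) = e x" using n i by (simp add: xs nthc_encode)
  hence x: "xs ! psnd (pfst n) = x" using inj_encoder[OF e] by simp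
  have "pe (pe (le e) ne) e ((xs, psnd (pfst n)), x) = pair (pair (pfst (pfst n)) (psnd (pfst n))) (psnd n)"
   using xs by (simp add: pe_def le_def)
  hence "n = pe (pe (le e) ne) e ((xs, psnd (pfst n)), x)" by simp
  thus "n \<in> pe (pe (le e) ne) e ` {p. snd (fst p) < length (fst (fst p)) & fst (fst p) ! snd (fst p) = snd p}"
   using i x by (intro image_eqI[of _ _ "((xs, psnd (pfst n)), x)"]) auto
 qed (auto simp: pe_def le_def dropc_eq_0_iff nthc_encode dropc_pos_iff)
 finally show "rep (pe (pe (le e) ne) e) (%p. snd (fst p) < length (fst (fst p)) & fst (fst p) ! snd (fst p) = snd p)"
  by (simp add: rep_def)
qed

lemmas encoder_le = rep_nth(2)

lemma cfn_length: "encoder d ==> encoder e ==> cfn d (le e) f ==> cfn d ne (%x. length (f x))"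
 by (rule cfn_comp[OF encoder_le _ rep_nth(3)])

lemma rep_nth_rule:
 assumes "encoder d" "encoder e" "cfn d (le e) l" "cfn d ne i" "cfn d e y"
 shows "rep d (%x. i x < length (l x) & l x ! i x = y x)"
proof -
 note enc = encoder_le[OF assms(2)] encoder_ne assms(2)
 have "cfn d (pe (pe (le e) ne) e) (%x. ((l x, i x), y x))" by (intro cfn_pair assms)
 from rep_app[OF _ rep_nth(1)[OF assms(2)] this] show ?thesis by (simp add: encoder_pe enc)
qed

lemmas encoder_intros = encoder_ne encoder_pe encoder_le

lemma cfn_fst: "encoder d ==> encoder e ==> encoder e' ==> cfn d (pe e e') f ==> cfn d e (%x. fst (f x))"
 by (rule cfn_comp[OF _ _ cfn_fst_snd(1)]) (auto intro: encoder_intros)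

lemma cfn_snd: "encoder d ==> encoder e ==> encoder e' ==> cfn d (pe e e') f ==> cfn d e' (%x. snd (f x))"
 by (rule cfn_comp[OF _ _ cfn_fst_snd(2)]) (auto intro: encoder_intros)

lemma cfnI_rep: "rep (pe e e') (%p. snd p = f (fst p)) ==> cfn e e' f"
 by (simp add: cfn_iff_rep)

lemma rep_cong: "rep e P ==> (!!x. P x \<longleftrightarrow> Q x) ==> rep e Q"
 by (simp add: rep_def)

lemma cfn_cong: "cfn e e' f ==> (!!x. f x = g x) ==> cfn e e' g"
 by (simp add: cfn_def)

lemma cfn_nat_ops:
 assumes "encoder e" "cfn e ne f" "cfn e ne g"
 shows "cfn e ne (%x. f x + g x)" "cfn e ne (%x. f x * g x)" "cfn e ne (%x. Suc (f x))"
 using cfn_nat2[OF comp2_plus assms] cfn_nat2[OF comp2_times assms]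
  cfn_comp[OF encoder_ne assms(2) cfn_nat1[OF comp1_Suc]] by simp_all

lemma rep_ball_set:
 assumes e: "encoder d" "encoder e" and P: "rep (pe d e) (%p. P (fst p) (snd p))" and l: "cfn d (le e) l"
 shows "rep d (%x. \<forall>y\<in>set (l x). P x y)"
proof -
 have "rep d (%x. \<forall>i<length (l x). \<exists>y. (i < length (l x) & l x ! i = y) & P x y)"
 proof (rule rep_all_less[OF e(1) _ cfn_length[OF e l]], rule rep_ex, rule rep_conj)
  let ?d = "pe (pe d ne) e"
  show enc: "encoder ?d" by (intro encoder_intros e)
  have 1: "cfn ?d d (%p. fst (fst p))"
   using cfn_fst_snd(1) by (intro cfn_fst[where e' = ne] cfn_fst[where e' = e] cfn_id) (simp_all add: encoder_intros e)
  have 2: "cfn ?d ne (%p. snd (fst p))"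
   by (intro cfn_snd[where e = d] cfn_fst[where e' = e] cfn_id) (simp_all add: encoder_intros e)
  have 3: "cfn ?d e (%p. snd p)"
   by (intro cfn_snd[where e = "pe d ne"] cfn_id) (simp_all add: encoder_intros e)
  show "rep ?d (%p. snd (fst p) < length (l (fst (fst p))) & l (fst (fst p)) ! snd (fst p) = snd p)"
   by (rule rep_nth_rule[OF enc e(2) cfn_comp[OF e(1) 1 l] 2 3])
  show "rep ?d (%p. P (fst (fst p)) (snd p))"
   by (rule rep_app2[OF P enc e 1 3])
 qed
 moreover have "(\<forall>i<length (l x). \<exists>y. (i < length (l x) & l x ! i = y) & P x y) \<longleftrightarrow> (\<forall>y\<in>set (l x). P x y)" for x
  by (auto simp: all_set_conv_all_nth)
 ultimately show ?thesis by simp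
qed

lemma rep_in_set:
 assumes e: "encoder d" "encoder e" and y: "cfn d e y" and l: "cfn d (le e) l"
 shows "rep d (%x. y x \<in> set (l x))"
proof -
 have "rep d (%x. \<exists>i. i < length (l x) & l x ! i = y x)"
 proof (rule rep_ex, rule rep_nth_rule[OF _ e(2)])
  have 1: "cfn (pe d ne) d fst" and 2: "cfn (pe d ne) ne snd" by (rule cfn_fst_snd; intro encoder_intros e)+
  show "encoder (pe d ne)" by (intro encoder_intros e)
  show "cfn (pe d ne) (le e) (%p. l (fst p))" "cfn (pe d ne) e (%p. y (fst p))" "cfn (pe d ne) ne (%p. snd p)"
   using cfn_comp[OF e(1) 1] l y 2 by auto
 qed
 thus ?thesis by (rule rep_cong) (auto simp: in_set_conv_nth)
qed

text \<open>The graph of a fold is enumerated by guessing the list \<open>ss\<close> of its values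
  on all suffixes: the first entry is the result, the last one the initial value, and neighbours are
  linked by \<open>step\<close>.\<close>

lemma cfn_foldr:
 assumes e: "encoder d" "encoder e" "encoder e'"
  and step: "cfn (pe e e') e' (%p. step (fst p) (snd p))"
  and l: "cfn d (le e) l" and a: "cfn d e' a"
 shows "cfn d e' (%x. foldr step (l x) (a x))"
proof (rule cfnI_rep, rule rep_cong)
 let ?d1 = "pe (pe d e') (le e')"
 let ?R = "%p ss. length ss = Suc (length (l (fst p))) &
   (\<forall>i<length (l (fst p)). \<exists>u. (i < length (l (fst p)) & l (fst p) ! i = u) &
    (\<exists>v. (Suc i < length ss & ss ! Suc i = v) & (i < length ss & ss ! i = step u v))) &
   (length (l (fst p)) < length ss & ss ! length (l (fst p)) = a (fst p)) & (0 < length ss & ss ! 0 = snd p)"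
 show "rep (pe d e') (%p. \<exists>ss. ?R p ss)"
 proof (rule rep_ex)
  have enc1: "encoder ?d1" by (intro encoder_intros e)
  have x: "cfn ?d1 d (%q. fst (fst q))"
   by (intro cfn_fst[where e' = e'] cfn_fst[where e' = "le e'"] cfn_id) (simp_all add: encoder_intros e)
  have b: "cfn ?d1 e' (%q. snd (fst q))"
   by (intro cfn_snd[where e = d] cfn_fst[where e' = "le e'"] cfn_id) (simp_all add: encoder_intros e)
  have ss: "cfn ?d1 (le e') (%q. snd q)"
   by (intro cfn_snd[where e = "pe d e'"] cfn_id) (simp_all add: encoder_intros e)
  note lx = cfn_comp[OF e(1) x l] and ax = cfn_comp[OF e(1) x a]
  note len = cfn_length[OF enc1 e(2) lx]
  have r1: "rep ?d1 (%q. length (snd q) = Suc (length (l (fst (fst q)))))"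
   by (rule rep_eq[OF enc1 encoder_ne cfn_length[OF enc1 e(3) ss] cfn_nat_ops(3)[OF enc1 len len]])
  have r2: "rep ?d1 (%q. length (l (fst (fst q))) < length (snd q) & snd q ! length (l (fst (fst q))) = a (fst (fst q)))"
   by (rule rep_nth_rule[OF enc1 e(3) ss len ax])
  have r3: "rep ?d1 (%q. 0 < length (snd q) & snd q ! 0 = snd (fst q))"
   by (rule rep_nth_rule[OF enc1 e(3) ss cfn_const[OF enc1] b])
  have r4: "rep ?d1 (%q. \<forall>i<length (l (fst (fst q))). \<exists>u. (i < length (l (fst (fst q))) & l (fst (fst q)) ! i = u) &
    (\<exists>v. (Suc i < length (snd q) & snd q ! Suc i = v) & (i < length (snd q) & snd q ! i = step u v)))"
  proof (rule rep_all_less[OF enc1 _ len], rule rep_ex, rule rep_conj)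
   let ?d2 = "pe ?d1 ne" let ?d3 = "pe ?d2 e"
   show enc3: "encoder ?d3" by (intro encoder_intros e)
   have q3: "cfn ?d3 ?d1 (%r. fst (fst r))"
    by (intro cfn_fst[where e' = ne] cfn_fst[where e' = e] cfn_id) (simp_all add: encoder_intros e)
   have i3: "cfn ?d3 ne (%r. snd (fst r))"
    by (intro cfn_snd[where e = ?d1] cfn_fst[where e' = e] cfn_id) (simp_all add: encoder_intros e)
   have u3: "cfn ?d3 e (%r. snd r)"
    by (intro cfn_snd[where e = ?d2] cfn_id) (simp_all add: encoder_intros e)
   show "rep ?d3 (%r. snd (fst r) < length (l (fst (fst (fst (fst r))))) & l (fst (fst (fst (fst r)))) ! snd (fst r) = snd r)"
    by (rule rep_nth_rule[OF enc3 e(2) cfn_comp[OF enc1 q3 lx] i3 u3])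
   show "rep ?d3 (%r. \<exists>v. (Suc (snd (fst r)) < length (snd (fst (fst r))) & snd (fst (fst r)) ! Suc (snd (fst r)) = v) &
     (snd (fst r) < length (snd (fst (fst r))) & snd (fst (fst r)) ! snd (fst r) = step (snd r) v))"
   proof (rule rep_ex)
    let ?d4 = "pe ?d3 e'"
    have enc4: "encoder ?d4" by (intro encoder_intros e)
    have r4: "cfn ?d4 ?d3 (%t. fst t)" and v4: "cfn ?d4 e' (%t. snd t)"
     by (rule cfn_fst_snd; intro enc3 e)+
    note i4 = cfn_comp[OF enc3 r4 i3] and u4 = cfn_comp[OF enc3 r4 u3]
     and s4 = cfn_comp[OF enc1 cfn_comp[OF enc3 r4 q3] ss]
    show "rep ?d4 (%t. (Suc (snd (fst (fst t))) < length (snd (fst (fst (fst t)))) & snd (fst (fst (fst t))) ! Suc (snd (fst (fst t))) = snd t) &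
     (snd (fst (fst t)) < length (snd (fst (fst (fst t)))) & snd (fst (fst (fst t))) ! snd (fst (fst t)) = step (snd (fst t)) (snd t)))"
     by (rule rep_conj[OF enc4 rep_nth_rule[OF enc4 e(3) s4 cfn_nat_ops(3)[OF enc4 i4 i4] v4]
        rep_nth_rule[OF enc4 e(3) s4 i4 cfn_app2[OF step enc4 e(2,3) u4 v4]]])
   qed
  qed
  show "rep ?d1 (%q. ?R (fst q) (snd q))"
   by (rule rep_conj[OF enc1 r1 rep_conj[OF enc1 r4 rep_conj[OF enc1 r2 r3]]])
 qed
 fix p
 show "(\<exists>ss. ?R p ss) \<longleftrightarrow> snd p = foldr step (l (fst p)) (a (fst p))"
 proof
  assume "\<exists>ss. ?R p ss"
  then obtain ss where ss: "?R p ss" by blast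
  have "ss ! (length (l (fst p)) - k) = foldr step (drop (length (l (fst p)) - k) (l (fst p))) (a (fst p))"
   if "k \<le> length (l (fst p))" for k
   using that
  proof (induction k)
   case 0
   thus ?case using ss by simp
  next
   case (Suc k)
   let ?n = "length (l (fst p))" let ?i = "?n - Suc k"
   have i: "?i < ?n" "Suc ?i = ?n - k" using Suc.prems by auto
   hence "ss ! ?i = step (l (fst p) ! ?i) (ss ! Suc ?i)" using ss by auto
   also have "ss ! Suc ?i = foldr step (drop (Suc ?i) (l (fst p))) (a (fst p))"
    using Suc i by simp
   also have "step (l (fst p) ! ?i) \<dots> = foldr step (drop ?i (l (fst p))) (a (fst p))"
    by (subst Cons_nth_drop_Suc[OF i(1), symmetric]) simp
   finally show ?case .
  qed
  from this[of "length (l (fst p))"] show "snd p = foldr step (l (fst p)) (a (fst p))" using ss by simp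
 next
  assume b: "snd p = foldr step (l (fst p)) (a (fst p))"
  define ss where "ss = map (%i. foldr step (drop i (l (fst p))) (a (fst p))) [0..<Suc (length (l (fst p)))]"
  have nth: "ss ! i = foldr step (drop i (l (fst p))) (a (fst p))" if "i < Suc (length (l (fst p)))" for i
   using that unfolding ss_def by (subst nth_map) (simp_all del: upt_Suc)
  have "length ss = Suc (length (l (fst p)))" by (simp add: ss_def)
  moreover have "ss ! i = step (l (fst p) ! i) (ss ! Suc i)" if "i < length (l (fst p))" for i
   using that by (simp add: nth Cons_nth_drop_Suc[symmetric])
  ultimately have "?R p ss" using b nth[of 0] nth[of "length (l (fst p))"] by auto
  thus "\<exists>ss. ?R p ss" by blast
 qed
qed

section \<open>Integers, rationals and coordinate vectors\<close>

lemma encoder_int: "encoder int_encode"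
 by (simp add: encoder_def surj_int_encode re_UNIV inj_int_encode)

lemma cfn_int: "cfn ne int_encode int" "cfn ne int_encode (%n. - int n - 1)"
proof -
 have "int_encode (int n) = n * 2" "int_encode (- int n - 1) = Suc (n * 2)" for n
  by (simp_all add: int_encode_def sum_encode_def)
 moreover have "cfn ne ne (%n. n * 2)" "cfn ne ne (%n. Suc (n * 2))"
  by (rule cfn_nat1, intro comp_intros, simp_all)+
 ultimately show "cfn ne int_encode int" "cfn ne int_encode (%n. - int n - 1)"
  by (simp_all add: cfn_def)
qed

lemma cfn_app1: "encoder e1 ==> cfn e1 e2 h ==> cfn e e1 f ==> cfn e e2 (%x. h (f x))"
 by (rule cfn_comp)

text \<open>Integers as differences of naturals reduce sums and products to natural arithmetic,
  without cases on signs.\<close>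

definition int_diff :: "int => nat => nat => bool" where "int_diff z m n \<longleftrightarrow> z = int m - int n"

lemma rep_int_diff:
 assumes e: "encoder e" "cfn e int_encode z" "cfn e ne m" "cfn e ne n"
 shows "rep e (%x. int_diff (z x) (m x) (n x))"
proof -
 let ?e = "pe e ne"
 have e': "encoder ?e" by (intro encoder_intros e)
 have f: "cfn ?e e (%p. fst p)" and s: "cfn ?e ne (%p. snd p)"
  by (rule cfn_fst_snd; intro e encoder_intros)+
 note z = cfn_comp[OF e(1) f e(2)] and m = cfn_comp[OF e(1) f e(3)] and n = cfn_comp[OF e(1) f e(4)]
 have 1: "rep e (%x. \<exists>k. z x = int k & k + n x = m x)"
  by (rule rep_ex, rule rep_conj[OF e' rep_eq[OF e' encoder_int z cfn_app1[OF encoder_ne cfn_int(1) s]]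
     rep_eq[OF e' encoder_ne cfn_nat_ops(1)[OF e' s n] m]])
 have 2: "rep e (%x. \<exists>k. z x = - int k - 1 & Suc (m x + k) = n x)"
  by (rule rep_ex, rule rep_conj[OF e' rep_eq[OF e' encoder_int z cfn_app1[OF encoder_ne cfn_int(2) s]]
     rep_eq[OF e' encoder_ne cfn_nat_ops(3)[OF e' cfn_nat_ops(1)[OF e' m s] cfn_nat_ops(1)[OF e' m s]] n]])
 show ?thesis
 proof (rule rep_cong[OF rep_disj[OF 1 2]])
  fix x
  show "((\<exists>k. z x = int k & k + n x = m x) \<or> (\<exists>k. z x = - int k - 1 & Suc (m x + k) = n x)) \<longleftrightarrow>
    int_diff (z x) (m x) (n x)"
  proof
   assume d: "int_diff (z x) (m x) (n x)"
   show "(\<exists>k. z x = int k & k + n x = m x) \<or> (\<exists>k. z x = - int k - 1 & Suc (m x + k) = n x)"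
   proof (cases "n x \<le> m x")
    case True
    thus ?thesis using d by (intro disjI1 exI[of _ "m x - n x"]) (auto simp: int_diff_def)
   next
    case False
    thus ?thesis using d by (intro disjI2 exI[of _ "n x - m x - 1"]) (auto simp: int_diff_def)
   qed
  qed (auto simp: int_diff_def)
 qed
qed

lemma int_diff_ex: "\<exists>m n. int_diff z m n"
 by (cases z rule: int_diff_cases) (auto simp: int_diff_def)

lemma cfn_int_ops:
 assumes e: "encoder e" and f: "cfn e int_encode f" and g: "cfn e int_encode g"
 shows "cfn e int_encode (%x. f x + g x)" "cfn e int_encode (%x. f x * g x)"
proof -
 let ?N = "pe ne ne"
 let ?e1 = "pe e int_encode" let ?e2 = "pe ?e1 ?N" let ?e3 = "pe ?e2 ?N"
 have e1: "encoder ?e1" and e2: "encoder ?e2" and e3: "encoder ?e3"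
  by (intro encoder_intros e encoder_int)+
 have N: "encoder ?N" by (intro encoder_intros)
 have q: "cfn ?e3 ?e2 (%t. fst t)" and v: "cfn ?e3 ?N (%t. snd t)"
  by (rule cfn_fst_snd; intro e2 N)+
 have u: "cfn ?e3 ?N (%t. snd (fst t))" by (rule cfn_snd[OF e3 e1 N q])
 have p: "cfn ?e3 ?e1 (%t. fst (fst t))" by (rule cfn_fst[OF e3 e1 N q])
 have x: "cfn ?e3 e (%t. fst (fst (fst t)))" by (rule cfn_fst[OF e3 e encoder_int p])
 have z: "cfn ?e3 int_encode (%t. snd (fst (fst t)))" by (rule cfn_snd[OF e3 e encoder_int p])
 note m = cfn_fst[OF e3 encoder_ne encoder_ne u] and n = cfn_snd[OF e3 encoder_ne encoder_ne u]
  and m' = cfn_fst[OF e3 encoder_ne encoder_ne v] and n' = cfn_snd[OF e3 encoder_ne encoder_ne v]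
 note F = cfn_comp[OF e x f] and G = cfn_comp[OF e x g]
 note plus = cfn_nat_ops(1)[OF e3] and times = cfn_nat_ops(2)[OF e3]
 \<comment> \<open>The common shape of sum and product: representatives \<open>u\<close> and
   \<open>v\<close> of the arguments are guessed, and the result is compared with the difference of
   two natural expressions \<open>h\<close> and \<open>k\<close> in them.\<close>
 have D: "rep ?e3 (%t. int_diff (f (fst (fst (fst t)))) (fst (snd (fst t))) (snd (snd (fst t))) &
   int_diff (g (fst (fst (fst t)))) (fst (snd t)) (snd (snd t)) &
   int_diff (snd (fst (fst t))) (h (fst (snd (fst t))) (snd (snd (fst t))) (fst (snd t)) (snd (snd t)))
    (k (fst (snd (fst t))) (snd (snd (fst t))) (fst (snd t)) (snd (snd t))))"
  if "cfn ?e3 ne (%t. h (fst (snd (fst t))) (snd (snd (fst t))) (fst (snd t)) (snd (snd t)))"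
   "cfn ?e3 ne (%t. k (fst (snd (fst t))) (snd (snd (fst t))) (fst (snd t)) (snd (snd t)))" for h k
  by (intro rep_conj e3 rep_int_diff F G z m n m' n' that)
 show "cfn e int_encode (%x. f x + g x)"
 proof (rule cfnI_rep, rule rep_cong)
  show "rep ?e1 (%q. \<exists>u v. int_diff (f (fst q)) (fst u) (snd u) & int_diff (g (fst q)) (fst v) (snd v) &
    int_diff (snd q) (fst u + fst v) (snd u + snd v))"
   by (rule rep_ex, rule rep_ex, rule D) (intro plus m n m' n')+
  fix q show "(\<exists>u v. int_diff (f (fst q)) (fst u) (snd u) & int_diff (g (fst q)) (fst v) (snd v) &
    int_diff (snd q) (fst u + fst v) (snd u + snd v)) \<longleftrightarrow> snd q = f (fst q) + g (fst q)"
  proof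
   assume s: "snd q = f (fst q) + g (fst q)"
   obtain a b c d where "int_diff (f (fst q)) a b" "int_diff (g (fst q)) c d" using int_diff_ex by metis
   moreover from this have "int_diff (snd q) (a + c) (b + d)" using s by (simp add: int_diff_def)
   ultimately show "\<exists>u v. int_diff (f (fst q)) (fst u) (snd u) & int_diff (g (fst q)) (fst v) (snd v) &
    int_diff (snd q) (fst u + fst v) (snd u + snd v)"
    by (intro exI[of _ "(a, b)"] exI[of _ "(c, d)"]) simp
  qed (auto simp: int_diff_def)
 qed
 show "cfn e int_encode (%x. f x * g x)"
 proof (rule cfnI_rep, rule rep_cong)
  show "rep ?e1 (%q. \<exists>u v. int_diff (f (fst q)) (fst u) (snd u) & int_diff (g (fst q)) (fst v) (snd v) &
    int_diff (snd q) (fst u * fst v + snd u * snd v) (fst u * snd v + snd u * fst v))"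
   by (rule rep_ex, rule rep_ex, rule D) (intro plus times m n m' n')+
  fix q show "(\<exists>u v. int_diff (f (fst q)) (fst u) (snd u) & int_diff (g (fst q)) (fst v) (snd v) &
    int_diff (snd q) (fst u * fst v + snd u * snd v) (fst u * snd v + snd u * fst v)) \<longleftrightarrow> snd q = f (fst q) * g (fst q)"
  proof
   assume s: "snd q = f (fst q) * g (fst q)"
   obtain a b c d where "int_diff (f (fst q)) a b" "int_diff (g (fst q)) c d" using int_diff_ex by metis
   moreover have "(int a - int b) * (int c - int d) = int (a * c + b * d) - int (a * d + b * c)"
    by (simp add: algebra_simps)
   ultimately have "int_diff (f (fst q)) a b & int_diff (g (fst q)) c d &
     int_diff (snd q) (a * c + b * d) (a * d + b * c)"
    using s unfolding int_diff_def by simp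
   thus "\<exists>u v. int_diff (f (fst q)) (fst u) (snd u) & int_diff (g (fst q)) (fst v) (snd v) &
    int_diff (snd q) (fst u * fst v + snd u * snd v) (fst u * snd v + snd u * fst v)"
    by (intro exI[of _ "(a, b)"] exI[of _ "(c, d)"]) simp
  next
   assume "\<exists>u v. int_diff (f (fst q)) (fst u) (snd u) & int_diff (g (fst q)) (fst v) (snd v) &
    int_diff (snd q) (fst u * fst v + snd u * snd v) (fst u * snd v + snd u * fst v)"
   then obtain a b c d where "int_diff (f (fst q)) a b" "int_diff (g (fst q)) c d"
    "int_diff (snd q) (a * c + b * d) (a * d + b * c)" by auto
   moreover have "(int a - int b) * (int c - int d) = int (a * c + b * d) - int (a * d + b * c)"
    by (simp add: algebra_simps)
   ultimately show "snd q = f (fst q) * g (fst q)" unfolding int_diff_def by simp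
  qed
 qed
qed

text \<open>The pairs \<open>quotient_of q\<close> are the coprime pairs with positive denominator.\<close>

abbreviation "ie \<equiv> int_encode"
abbreviation "qe \<equiv> encode_rat"

lemma encode_rat_pe: "qe q = pe ie ie (quotient_of q)"
 by (simp add: encode_rat_def pe_def split_beta)

lemma rep_quotients: "rep (pe ie ie) (%p. p \<in> range quotient_of)"
proof -
 let ?e = "pe ie ie"
 have e: "encoder ?e" by (intro encoder_intros encoder_int)
 have f: "cfn ?e ie (%p. fst p)" and s: "cfn ?e ie (%p. snd p)" by (rule cfn_fst_snd; rule encoder_int)+
 have 1: "rep ?e (%p. \<exists>n. snd p = int (Suc n))"
 proof (rule rep_ex, rule rep_eq[OF _ encoder_int])
  show e': "encoder (pe ?e ne)" by (intro encoder_intros e)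
  have g: "cfn (pe ?e ne) ?e (%t. fst t)" and n: "cfn (pe ?e ne) ne (%t. snd t)"
   by (rule cfn_fst_snd; intro e encoder_intros)+
  show "cfn (pe ?e ne) ie (%t. snd (fst t))" by (rule cfn_snd[OF e' encoder_int encoder_int g])
  show "cfn (pe ?e ne) ie (%t. int (Suc (snd t)))"
   by (rule cfn_app1[OF encoder_ne cfn_int(1) cfn_nat_ops(3)[OF e' n n]])
 qed
 have 2: "rep ?e (%p. \<exists>u. u * (1::int) = u & (\<exists>v. u * fst p + v * snd p = 1))"
 proof (rule rep_ex, rule rep_conj)
  let ?e1 = "pe ?e ie" let ?e2 = "pe ?e1 ie"
  show e1: "encoder ?e1" by (intro encoder_intros e encoder_int)
  have e2: "encoder ?e2" by (intro encoder_intros e1 encoder_int)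
  have u1: "cfn ?e1 ie (%t. snd t)" by (rule cfn_fst_snd[OF e encoder_int])
  show "rep ?e1 (%t. snd t * (1::int) = snd t)"
   by (rule rep_eq[OF e1 encoder_int cfn_int_ops(2)[OF e1 u1 cfn_const[OF e1]] u1])
  show "rep ?e1 (%t. \<exists>v. snd t * fst (fst t) + v * snd (fst t) = 1)"
  proof (rule rep_ex, rule rep_eq[OF e2 encoder_int _ cfn_const[OF e2]])
   have t: "cfn ?e2 ?e1 (%t. fst t)" and v: "cfn ?e2 ie (%t. snd t)"
    by (rule cfn_fst_snd; intro e1 encoder_int)+
   note p = cfn_fst[OF e2 e encoder_int t] and u = cfn_snd[OF e2 e encoder_int t]
   show "cfn ?e2 ie (%t. snd (fst t) * fst (fst (fst t)) + snd t * snd (fst (fst t)))"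
    by (intro cfn_int_ops e2 u v cfn_fst[OF e2 encoder_int encoder_int p] cfn_snd[OF e2 encoder_int encoder_int p])
  qed
 qed
 have "((\<exists>n. snd p = int (Suc n)) & (\<exists>u. u * (1::int) = u & (\<exists>v. u * fst p + v * snd p = 1))) \<longleftrightarrow> p \<in> range quotient_of"
  for p :: "int \<times> int"
 proof
  assume a: "(\<exists>n. snd p = int (Suc n)) & (\<exists>u. u * (1::int) = u & (\<exists>v. u * fst p + v * snd p = 1))"
  then obtain u v where "u * fst p + v * snd p = 1" by blast
  hence "coprime (fst p) (snd p)"
   by (metis coprimeI dvd_add dvd_mult)
  moreover have "snd p > 0" using a by auto
  ultimately have "quotient_of (Rat.Fract (fst p) (snd p)) = p"
   by (simp add: quotient_of_Fract normalize_def Let_def coprime_iff_gcd_eq_1)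
  thus "p \<in> range quotient_of" by (metis rangeI)
 next
  assume "p \<in> range quotient_of"
  then obtain q where q: "quotient_of q = p" by auto
  have "snd p > 0" using quotient_of_denom_pos[of q "fst p" "snd p"] q by simp
  moreover have "coprime (fst p) (snd p)" using quotient_of_coprime[of q "fst p" "snd p"] q by simp
  hence "\<exists>u v. u * fst p + v * snd p = 1" using bezout_int[of "fst p" "snd p"] by (auto simp: coprime_iff_gcd_eq_1)
  ultimately show "(\<exists>n. snd p = int (Suc n)) & (\<exists>u. u * (1::int) = u & (\<exists>v. u * fst p + v * snd p = 1))"
   by (auto intro!: exI[of _ "nat (snd p) - 1"])
 qed
 from rep_cong[OF rep_conj[OF e 1 2] this] show ?thesis .
qed

lemma inj_quotient_of: "inj quotient_of"
 by (rule injI) (metis quotient_of_div surj_pair)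

lemma encoder_rat: "encoder qe" and cfn_quotient_of: "cfn qe (pe ie ie) quotient_of"
proof -
 have i: "inj qe" unfolding encode_rat_pe[abs_def]
  using inj_compose[OF inj_pe[OF inj_int_encode inj_int_encode] inj_quotient_of] by (simp add: comp_def)
 have "range qe = pe ie ie ` {p. p \<in> range quotient_of}" by (auto simp: encode_rat_pe)
 hence r: "re (range qe)" using rep_quotients by (simp add: rep_def)
 with i show "encoder qe" by (simp add: encoder_def)
 have "range (%x. pair (qe x) (pe ie ie (quotient_of x))) = {n. pfst n \<in> range qe} \<inter> {n. pfst n = psnd n}"
 proof (intro Set.set_eqI iffI)
  fix n assume n: "n \<in> {n. pfst n \<in> range qe} \<inter> {n. pfst n = psnd n}"
  hence "pfst n \<in> range qe" by blast
  then obtain x where x: "pfst n = qe x" by (rule rangeE)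
  have "pair (qe x) (pe ie ie (quotient_of x)) = pair (pfst n) (psnd n)"
   using n x by (simp flip: encode_rat_pe)
  hence "n = pair (qe x) (pe ie ie (quotient_of x))" by simp
  thus "n \<in> range (%x. pair (qe x) (pe ie ie (quotient_of x)))" by blast
 qed (auto simp: encode_rat_pe)
 thus "cfn qe (pe ie ie) quotient_of" unfolding cfn_def
  using r by (auto intro!: re_Int re_pfst re_eq comp1_pfst_psnd)
qed

lemma cfn_num_den: "cfn e qe f ==> encoder e ==> cfn e ie (%x. fst (quotient_of (f x)))"
  "cfn e qe f ==> encoder e ==> cfn e ie (%x. snd (quotient_of (f x)))"
 by (rule cfn_fst cfn_snd, assumption, rule encoder_int, rule encoder_int,
   rule cfn_app1[OF encoder_rat cfn_quotient_of], assumption)+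

text \<open>Graphs of rational operations are tested by cross multiplication, so fractions need not
  be reduced.\<close>

lemma rat_eq_cross:
 fixes q r :: rat
 assumes "q = of_int a / of_int b" "b > 0"
 shows "r = q \<longleftrightarrow> fst (quotient_of r) * b = a * snd (quotient_of r)"
proof -
 obtain p d where pd: "quotient_of r = (p, d)" by (cases "quotient_of r")
 have r: "r = of_int p / of_int d" "d > 0" using quotient_of_div[OF pd] quotient_of_denom_pos[OF pd] by simp_all
 have "r = q \<longleftrightarrow> (of_int p * of_int b :: rat) = of_int a * of_int d"
  unfolding r(1) assms(1) using r(2) assms(2) by (simp add: frac_eq_eq)
 thus ?thesis by (simp add: pd flip: of_int_mult)
qed

lemma cfn_rat_ops:
 assumes e: "encoder e" and f: "cfn e qe f" and g: "cfn e qe g"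
 shows "cfn e qe (%x. f x + g x)" "cfn e qe (%x. f x * g x)"
proof -
 let ?e1 = "pe e qe"
 have e1: "encoder ?e1" by (intro encoder_intros e encoder_rat)
 have x: "cfn ?e1 e (%t. fst t)" and z: "cfn ?e1 qe (%t. snd t)" by (rule cfn_fst_snd; intro e encoder_rat)+
 note F = cfn_comp[OF e x f] and G = cfn_comp[OF e x g]
 note nd = cfn_num_den(1)[OF F e1] cfn_num_den(2)[OF F e1] cfn_num_den(1)[OF G e1] cfn_num_den(2)[OF G e1]
  cfn_num_den(1)[OF z e1] cfn_num_den(2)[OF z e1]
 have fr: "q = of_int (fst (quotient_of q)) / of_int (snd (quotient_of q))" "snd (quotient_of q) > 0" for q
  using quotient_of_div[of q] quotient_of_denom_pos[of q] by (metis prod.collapse)+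
 let ?a = "%q. fst (quotient_of q)" let ?b = "%q. snd (quotient_of q)"
 show "cfn e qe (%x. f x + g x)"
 proof (rule cfnI_rep, rule rep_cong)
  show "rep ?e1 (%t. ?a (snd t) * (?b (f (fst t)) * ?b (g (fst t))) =
    (?a (f (fst t)) * ?b (g (fst t)) + ?a (g (fst t)) * ?b (f (fst t))) * ?b (snd t))"
   by (rule rep_eq[OF e1 encoder_int]) (intro cfn_int_ops e1 nd)+
  fix t show "?a (snd t) * (?b (f (fst t)) * ?b (g (fst t))) =
    (?a (f (fst t)) * ?b (g (fst t)) + ?a (g (fst t)) * ?b (f (fst t))) * ?b (snd t) \<longleftrightarrow> snd t = f (fst t) + g (fst t)"
  proof (rule rat_eq_cross[symmetric])
   show "f (fst t) + g (fst t) = of_int (?a (f (fst t)) * ?b (g (fst t)) + ?a (g (fst t)) * ?b (f (fst t))) /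
     of_int (?b (f (fst t)) * ?b (g (fst t)))"
    by (subst fr(1)[of "f (fst t)"], subst fr(1)[of "g (fst t)"])
     (use fr(2)[of "f (fst t)"] fr(2)[of "g (fst t)"] in \<open>simp add: add_frac_eq\<close>)
  qed (simp add: fr(2))
 qed
 show "cfn e qe (%x. f x * g x)"
 proof (rule cfnI_rep, rule rep_cong)
  show "rep ?e1 (%t. ?a (snd t) * (?b (f (fst t)) * ?b (g (fst t))) =
    (?a (f (fst t)) * ?a (g (fst t))) * ?b (snd t))"
   by (rule rep_eq[OF e1 encoder_int]) (intro cfn_int_ops e1 nd)+
  fix t show "?a (snd t) * (?b (f (fst t)) * ?b (g (fst t))) =
    (?a (f (fst t)) * ?a (g (fst t))) * ?b (snd t) \<longleftrightarrow> snd t = f (fst t) * g (fst t)"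
  proof (rule rat_eq_cross[symmetric])
   show "f (fst t) * g (fst t) = of_int (?a (f (fst t)) * ?a (g (fst t))) / of_int (?b (f (fst t)) * ?b (g (fst t)))"
    by (subst fr(1)[of "f (fst t)"], subst fr(1)[of "g (fst t)"]) simp
  qed (simp add: fr(2))
 qed
qed

lemma cfn_rat_of_int:
 assumes e: "encoder e" and f: "cfn e ie f" shows "cfn e qe (%x. of_int (f x))"
proof (rule cfnI_rep, rule rep_cong)
 let ?e1 = "pe e qe"
 have e1: "encoder ?e1" by (intro encoder_intros e encoder_rat)
 have x: "cfn ?e1 e (%t. fst t)" and z: "cfn ?e1 qe (%t. snd t)" by (rule cfn_fst_snd; intro e encoder_rat)+
 show "rep ?e1 (%t. fst (quotient_of (snd t)) * 1 = f (fst t) * snd (quotient_of (snd t)))"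
  by (rule rep_eq[OF e1 encoder_int]; intro cfn_int_ops e1 cfn_num_den z cfn_comp[OF e x f] cfn_const)
 fix t show "fst (quotient_of (snd t)) * 1 = f (fst t) * snd (quotient_of (snd t)) \<longleftrightarrow> snd t = of_int (f (fst t))"
  by (rule rat_eq_cross[symmetric]) auto
qed

lemma cfn_Cons: "encoder e ==> cfn e e' f ==> cfn e (le e') g ==> cfn e (le e') (%x. f x # g x)"
proof -
 assume e: "encoder e" and f: "cfn e e' f" and g: "cfn e (le e') g"
 let ?A = "range (%x. pair (e x) (pe e' (le e') (f x, g x)))"
 have "re ?A" using cfn_pair[OF e f g] by (simp add: cfn_def)
 moreover have "comp1 (%n. pair (pfst n) (psnd n - 1))"
  by (intro comp_intros) simp_all
 ultimately have "re {n. pair (pfst n) (psnd n - 1) \<in> ?A}" by (rule re_vimage)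
 moreover have "re {n. psnd n ~= 0}" by (rule re_neq0[OF comp1_pfst_psnd(2)])
 ultimately have "re ({n. pair (pfst n) (psnd n - 1) \<in> ?A} \<inter> {n. psnd n ~= 0})" by (rule re_Int)
 also have "{n. pair (pfst n) (psnd n - 1) \<in> ?A} \<inter> {n. psnd n ~= 0} = range (%x. pair (e x) (le e' (f x # g x)))"
 proof (intro Set.set_eqI iffI)
  fix n assume n: "n \<in> {n. pair (pfst n) (psnd n - 1) \<in> ?A} \<inter> {n. psnd n ~= 0}"
  then obtain x where x: "pair (pfst n) (psnd n - 1) = pair (e x) (pe e' (le e') (f x, g x))" by auto
  hence "pfst n = e x" "psnd n = Suc (pe e' (le e') (f x, g x))" using n by (auto simp: pair_eq)
  hence "pair (pfst n) (psnd n) = pair (e x) (le e' (f x # g x))" by (simp add: pe_def le_def)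
  thus "n \<in> range (%x. pair (e x) (le e' (f x # g x)))" by simp
 qed (auto simp: pe_def le_def)
 finally show ?thesis by (simp add: cfn_def)
qed

text \<open>The list grows from its right end by \<open>Cons\<close>, hence the intervals ending at
  \<open>m\<close>.\<close>

lemma cfn_map_upt: 
 assumes e: "encoder e" and g: "!!i. i < m ==> cfn e e' (g i)"
 shows "k \<le> m ==> cfn e (le e') (%x. map (%i. g i x) [m - k..<m])"
proof (induction k)
 case 0
 show ?case using cfn_const[OF e] by simp
next
 case (Suc k)
 have "cfn e (le e') (%x. g (m - Suc k) x # map (%i. g i x) [m - k..<m])"
  using Suc by (intro cfn_Cons e g) auto
 moreover have "[m - Suc k..<m] = (m - Suc k) # [m - k..<m]"
  using Suc.prems by (subst upt_conv_Cons) (auto simp: Suc_diff_Suc)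
 ultimately show ?case by simp
qed


text \<open>The bijection with all lists of length \<open>n\<close> makes the set of codes
  enumerable and allows functions to be treated coordinate by coordinate.\<close>

locale vector_encoder =
 fixes e' :: "'c enc" and \<phi> :: "'a => 'c list" and n :: nat
 assumes e': "encoder e'" and inj: "inj \<phi>" and range: "range \<phi> = {v. length v = n}"
begin

definition ve :: "'a enc" where "ve x = le e' (\<phi> x)"

lemma length_phi: "length (\<phi> x) = n" using range by auto

lemma encoder_ve: "encoder ve"
proof -
 have "inj ve" unfolding ve_def[abs_def]
  using inj_compose[OF inj_le inj] e' by (simp add: comp_def encoder_def)
 moreover have "rep (le e') (%v. length v = n)"
  by (rule rep_eq[OF encoder_le[OF e'] encoder_ne cfn_length[OF encoder_le[OF e'] e' cfn_id[OF encoder_le[OF e']]]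
     cfn_const[OF encoder_le[OF e']]])
 moreover have "range ve = le e' ` {v. length v = n}" using range by (auto simp: ve_def image_image[symmetric] simp flip: range)
 ultimately show ?thesis by (simp add: encoder_def rep_def)
qed

lemma cfn_phi: "cfn ve (le e') \<phi>"
proof -
 have "re (range ve)" using encoder_ve by (simp add: encoder_def)
 moreover have "range (%x. pair (ve x) (le e' (\<phi> x))) = {n. pfst n \<in> range ve} \<inter> {n. pfst n = psnd n}"
 proof (intro Set.set_eqI iffI)
  fix n assume n: "n \<in> {n. pfst n \<in> range ve} \<inter> {n. pfst n = psnd n}"
  hence "pfst n \<in> range ve" by blast
  then obtain x where x: "pfst n = ve x" by (rule rangeE)
  have "pair (ve x) (le e' (\<phi> x)) = pair (pfst n) (psnd n)" using n x by (simp flip: ve_def)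
  hence "n = pair (ve x) (le e' (\<phi> x))" by simp
  thus "n \<in> range (%x. pair (ve x) (le e' (\<phi> x)))" by blast
 qed (auto simp: ve_def)
 ultimately show ?thesis unfolding cfn_def by (auto intro!: re_Int re_pfst re_eq comp1_pfst_psnd)
qed

lemma cfn_coordinate:
 assumes e: "encoder e" and f: "cfn e ve f" and i: "i < n" shows "cfn e e' (%x. \<phi> (f x) ! i)"
proof (rule cfnI_rep, rule rep_cong)
 let ?e1 = "pe e e'"
 have e1: "encoder ?e1" by (intro encoder_intros e e')
 have x: "cfn ?e1 e (%t. fst t)" and z: "cfn ?e1 e' (%t. snd t)" by (rule cfn_fst_snd; intro e e')+
 show "rep ?e1 (%t. i < length (\<phi> (f (fst t))) & \<phi> (f (fst t)) ! i = snd t)"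
  by (rule rep_nth_rule[OF e1 e' cfn_app1[OF encoder_ve cfn_phi cfn_comp[OF e x f]] cfn_const[OF e1] z])
 show "(i < length (\<phi> (f (fst t))) & \<phi> (f (fst t)) ! i = snd t) \<longleftrightarrow> snd t = \<phi> (f (fst t)) ! i" for t
  using i by (auto simp: length_phi)
qed

lemma cfn_vectorI:
 assumes e: "encoder e" and g: "!!i. i < n ==> cfn e e' (%x. \<phi> (f x) ! i)" shows "cfn e ve f"
proof -
 have "cfn e (le e') (%x. map (%i. \<phi> (f x) ! i) [n - n..<n])"
  by (rule cfn_map_upt[OF e g]) auto
 moreover have "map (%i. \<phi> (f x) ! i) [n - n..<n] = \<phi> (f x)" for x
  by (rule nth_equalityI) (auto simp: length_phi)
 ultimately have "cfn e (le e') (%x. \<phi> (f x))" by simp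
 thus ?thesis by (simp add: cfn_def ve_def)
qed

end

section \<open>Coordinates\<close>

lemma (in vector_space) coords_properties:
 assumes b: "ordered_basis scale bs"
 shows "length (coords scale bs x) = length bs"
  and "x = (\<Sum>i<length bs. scale (coords scale bs x ! i) (bs ! i))"
  and "i < length bs ==> coords scale bs (x + y) ! i = coords scale bs x ! i + coords scale bs y ! i"
  and "i < length bs ==> coords scale bs (scale c x) ! i = c * coords scale bs x ! i"
  and "inj (coords scale bs)" "range (coords scale bs) = {v. length v = length bs}"
proof -
 have ind: "independent (set bs)" "span (set bs) = UNIV" "distinct bs" using b by (auto simp: ordered_basis_def)
 show len: "length (coords scale bs x) = length bs" for x by (simp add: coords_def)
 have nth: "coords scale bs x ! i = representation (set bs) x (bs ! i)" if "i < length bs" for i x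
  using that by (simp add: coords_def)
 have sum: "sum h (set bs) = (\<Sum>i<length bs. h (bs ! i))" for h :: "'b => 'b"
  by (rule sum.reindex_bij_betw[symmetric, OF bij_betw_nth[OF ind(3) refl refl]])
 have expand: "x = (\<Sum>i<length bs. scale (coords scale bs x ! i) (bs ! i))" for x
 proof -
  have "(\<Sum>b\<in>set bs. scale (representation (set bs) x b) b) = x"
   by (rule sum_representation_eq) (use ind in auto)
  thus ?thesis unfolding sum using nth by simp
 qed
 show "x = (\<Sum>i<length bs. scale (coords scale bs x ! i) (bs ! i))" by (rule expand)
 show "coords scale bs (x + y) ! i = coords scale bs x ! i + coords scale bs y ! i" if "i < length bs"
  using that ind by (simp add: nth representation_add)
 show "coords scale bs (scale c x) ! i = c * coords scale bs x ! i" if "i < length bs"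
  using that ind by (simp add: nth representation_scale)
 show "inj (coords scale bs)"
 proof
  fix x y assume "coords scale bs x = coords scale bs y"
  thus "x = y" using expand[of x] expand[of y] by simp
 qed
 show "range (coords scale bs) = {v. length v = length bs}"
 proof (intro subset_antisym subsetI)
  fix v :: "'a list" assume "v \<in> {v. length v = length bs}"
  hence v: "length v = length bs" by simp
  define x where "x = (\<Sum>i<length bs. scale (v ! i) (bs ! i))"
  have "coords scale bs x = v"
  proof (rule nth_equalityI)
   show "length (coords scale bs x) = length v" by (simp add: len v)
   fix i assume i: "i < length (coords scale bs x)"
   hence i': "i < length bs" by (simp add: len)
   have "representation (set bs) (\<Sum>j<length bs. scale (v ! j) (bs ! j)) (bs ! i) =
     (\<Sum>j<length bs. v ! j * (if bs ! i = bs ! j then 1 else 0))"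
    by (subst representation_sum) (use ind in \<open>auto simp: representation_scale representation_basis intro!: sum.cong\<close>)
   also have "\<dots> = (\<Sum>j<length bs. if j = i then v ! j else 0)"
    using i' nth_eq_iff_index_eq[OF ind(3)] by (intro sum.cong) auto
   also have "\<dots> = v ! i" using i' by simp
   finally show "coords scale bs x ! i = v ! i" by (simp add: nth[OF i'] x_def)
  qed
  thus "v \<in> range (coords scale bs)" by blast
 qed (auto simp: len)
qed

locale encoded_space = vector_space scale
 for scale :: "'f::field => 'v::ab_group_add => 'v" +
 fixes bs :: "'v list" and e' :: "'f enc"
 assumes basis: "ordered_basis scale bs" and enc: "encoder e'"
  and scalar_add: "cfn (pe e' e') e' (%p. fst p + snd p)"
  and scalar_mult: "cfn (pe e' e') e' (%p. fst p * snd p)"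
begin

abbreviation "\<phi> \<equiv> coords scale bs"

sublocale vector_encoder e' \<phi> "length bs"
 using enc coords_properties(5,6)[OF basis] by unfold_locales

lemma scalar_ops:
 assumes "encoder d" "cfn d e' f" "cfn d e' g"
 shows "cfn d e' (%x. f x + g x)" "cfn d e' (%x. f x * g x)"
 using cfn_app2[OF scalar_add assms(1) enc enc assms(2,3)] cfn_app2[OF scalar_mult assms(1) enc enc assms(2,3)] .

lemma scalar_sum:
 assumes "encoder d" "!!i. i < (n::nat) ==> cfn d e' (h i)" shows "cfn d e' (%x. \<Sum>i<n. h i x)"
 using assms(2)
proof (induction n)
 case (Suc n)
 thus ?case using scalar_ops(1)[OF assms(1), of "%x. \<Sum>i<n. h i x" "h n"] by simp
qed (simp add: cfn_const[OF assms(1)])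

lemma coords_zero: "i < length bs ==> \<phi> 0 ! i = 0"
 using coords_properties(4)[OF basis, of i 0 0] by simp

lemma coords_sum: "finite A ==> i < length bs ==> \<phi> (sum h A) ! i = (\<Sum>a\<in>A. \<phi> (h a) ! i)"
 by (induction A rule: finite_induct) (simp_all add: coords_properties(3)[OF basis] coords_zero)

lemma cfn_add: "encoder d ==> cfn d ve f ==> cfn d ve g ==> cfn d ve (%x. f x + g x)"
 by (rule cfn_vectorI, assumption)
  (simp add: coords_properties(3)[OF basis], intro scalar_ops(1) cfn_coordinate)

lemma cfn_scale: "encoder d ==> cfn d e' c ==> cfn d ve f ==> cfn d ve (%x. scale (c x) (f x))"
 by (rule cfn_vectorI, assumption)
  (simp add: coords_properties(4)[OF basis], intro scalar_ops(2) cfn_coordinate)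

lemma cfn_linear:
 assumes F: "!!x y. F (x + y) = F x + F y" "!!c x. F (scale c x) = c * F x" and d: "encoder d" "cfn d ve f"
 shows "cfn d e' (%x. F (f x))"
proof -
 have lin: "F x = (\<Sum>i<length bs. \<phi> x ! i * F (bs ! i))" for x
 proof -
  have "F (sum h A) = (\<Sum>i\<in>A. F (h i))" for h and A :: "nat set"
   using F(2)[of 0 0] by (induction A rule: infinite_finite_induct) (simp_all add: F)
  thus ?thesis by (subst coords_properties(2)[OF basis, of x]) (simp add: F)
 qed
 have "cfn d e' (%x. \<Sum>i<length bs. \<phi> (f x) ! i * F (bs ! i))"
  by (intro scalar_sum scalar_ops(2) cfn_coordinate cfn_const d)
 thus ?thesis by (rule cfn_cong) (rule lin[symmetric])
qed

text \<open>The values of \<open>h\<close> on pairs of basis vectors are finitely many constants,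
  which may be built into the program; the coordinates of the result are polynomials in the
  coordinates of the arguments.\<close>

lemma cfn_bilinear:
 assumes h: "!!x y z. h (x + y) z = h x z + h y z" "!!c x z. h (scale c x) z = scale c (h x z)"
  "!!x y z. h z (x + y) = h z x + h z y" "!!c x z. h z (scale c x) = scale c (h z x)"
  and d: "encoder d" "cfn d ve f" "cfn d ve g"
 shows "cfn d ve (%x. h (f x) (g x))"
proof (rule cfn_vectorI[OF d(1)])
 fix k assume k: "k < length bs"
 have s1: "h (sum u A) z = (\<Sum>i\<in>A. h (u i) z)" for u z and A :: "nat set"
  using h(2)[of 0 0 z] by (induction A rule: infinite_finite_induct) (simp_all add: h)
 have s2: "h z (sum u A) = (\<Sum>i\<in>A. h z (u i))" for u z and A :: "nat set"
  using h(4)[of z 0 0] by (induction A rule: infinite_finite_induct) (simp_all add: h)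
 have b1: "h x y = (\<Sum>i<length bs. scale (\<phi> x ! i) (h (bs ! i) y))" for x y
  by (subst coords_properties(2)[OF basis, of x]) (simp add: s1 h)
 have b2: "h z y = (\<Sum>j<length bs. scale (\<phi> y ! j) (h z (bs ! j)))" for y z
  by (subst coords_properties(2)[OF basis, of y]) (simp add: s2 h)
 have hxy: "h x y = (\<Sum>i<length bs. scale (\<phi> x ! i) (\<Sum>j<length bs. scale (\<phi> y ! j) (h (bs ! i) (bs ! j))))" for x y
  by (rule trans[OF b1]) (intro sum.cong refl arg_cong[of _ _ "scale _"] b2)
 have lin: "\<phi> (h x y) ! k = (\<Sum>i<length bs. \<phi> x ! i * (\<Sum>j<length bs. \<phi> y ! j * \<phi> (h (bs ! i) (bs ! j)) ! k))" for x y
  unfolding hxy[of x y] by (simp add: coords_sum coords_properties(4)[OF basis] k)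
 have "cfn d e' (%x. \<Sum>i<length bs. \<phi> (f x) ! i * (\<Sum>j<length bs. \<phi> (g x) ! j * \<phi> (h (bs ! i) (bs ! j)) ! k))"
  by (intro scalar_sum scalar_ops(2) cfn_coordinate cfn_const d)
 thus "cfn d e' (%x. \<phi> (h (f x) (g x)) ! k)" by (rule cfn_cong) (rule lin[symmetric])
qed

end

text \<open>Horner's scheme as a fold over the lower coefficients of a monic polynomial, starting
  from the leading 1. The pair carries \<open>c\<close> along, since \<open>cfn_foldr\<close> takes
  a step function that does not vary with the input.\<close>

lemma aint_iff_Horner:
 fixes c :: "'a::field_char_0"
 shows "aint c \<longleftrightarrow>
  (\<exists>as. fst (foldr (%(a::int) p. (fst p * snd p + of_int a, snd p)) as (1, c)) = 0)"
proof -
 have H: "foldr (%(a::int) p. (fst p * snd p + of_int a, snd p)) as (1, c) =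
   (poly (map_poly of_int (Poly (as @ [1]))) c, c)" for as
 proof (induction as)
  case (Cons a as)
  have "map_poly of_int (Poly ((a # as) @ [1])) = pCons (of_int a :: 'a) (map_poly of_int (Poly (as @ [1])))"
   unfolding append_Cons Poly.simps by (rule Polynomial.map_poly_pCons) (rule of_int_0)
  hence p: "poly (map_poly of_int (Poly ((a # as) @ [1]))) c = of_int a + c * poly (map_poly of_int (Poly (as @ [1]))) c"
   by (simp only: poly_pCons)
  show ?case unfolding p foldr.simps comp_def Cons.IH by (simp add: mult.commute add.commute)
 qed simp
 show ?thesis
 proof
  assume "aint c"
  then obtain p :: "int poly" where p: "poly (map_poly of_int p) c = 0" "lead_coeff p = 1"
   unfolding algebraic_int_altdef_ipoly by blast
  have p0: "p ~= 0" using p(2) by auto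
  have "coeffs p = butlast (coeffs p) @ [1]"
   using p0 p(2) last_coeffs_eq_coeff_degree[OF p0] by (metis append_butlast_last_id not_0_coeffs_not_Nil)
  hence "Poly (butlast (coeffs p) @ [1]) = p" by (metis Poly_coeffs)
  thus "\<exists>as. fst (foldr (%(a::int) p. (fst p * snd p + of_int a, snd p)) as (1, c)) = 0"
   unfolding H using p(1) by (intro exI[of _ "butlast (coeffs p)"]) simp
 next
  assume "\<exists>as. fst (foldr (%(a::int) p. (fst p * snd p + of_int a, snd p)) as (1, c)) = 0"
  then obtain as where as: "poly (map_poly of_int (Poly (as @ [1]))) c = 0" unfolding H by auto
  have "coeffs (Poly (as @ [1::int])) = as @ [1]" by simp
  hence "lead_coeff (Poly (as @ [1::int])) = 1"
   by (metis last_coeffs_eq_coeff_degree coeffs_eq_Nil last_snoc snoc_eq_iff_butlast)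
  thus "aint c" unfolding algebraic_int_altdef_ipoly using as by blast
 qed
qed

text \<open>Lists of coefficients and generators have codes, unlike coefficient functions on finite
  sets; repetitions are harmless.\<close>

lemma (in number_field_space) O_span_iff_list:
 "x \<in> O_span smul (set l) \<longleftrightarrow>
  (\<exists>cs. (\<forall>p\<in>set cs. aint (fst p) & snd p \<in> set l) &
   foldr (%p s. smul (fst p) (snd p) + s) cs 0 = x)"
proof
 assume "x \<in> O_span smul (set l)"
 then obtain F c where F: "finite F" "F \<subseteq> set l" "\<forall>x\<in>F. aint (c x)" "x = (\<Sum>x\<in>F. smul (c x) x)"
  by (auto simp: O_span_def)
 obtain xs where xs: "set xs = F" "distinct xs" using finite_distinct_list[OF F(1)] by blast
 have "foldr (%p s. smul (fst p) (snd p) + s) (map (%x. (c x, x)) xs) 0 = sum_list (map (%x. smul (c x) x) xs)" for xs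
  by (induction xs) auto
 hence "foldr (%p s. smul (fst p) (snd p) + s) (map (%x. (c x, x)) xs) 0 = x"
  using xs by (simp add: F(4) sum_list_distinct_conv_sum_set)
 thus "\<exists>cs. (\<forall>p\<in>set cs. aint (fst p) & snd p \<in> set l) &
   foldr (%p s. smul (fst p) (snd p) + s) cs 0 = x"
  using F xs by (intro exI[of _ "map (%x. (c x, x)) xs"]) auto
next
 assume "\<exists>cs. (\<forall>p\<in>set cs. aint (fst p) & snd p \<in> set l) &
   foldr (%p s. smul (fst p) (snd p) + s) cs 0 = x"
 then obtain cs where cs: "\<forall>p\<in>set cs. aint (fst p) & snd p \<in> set l"
  "foldr (%p s. smul (fst p) (snd p) + s) cs 0 = x" by blast
 have "foldr (%p s. smul (fst p) (snd p) + s) cs 0 \<in> O_span smul (set l)"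
  using cs(1) O_submodule_O_span[of "set l"] O_span_base
  by (induction cs) (auto simp: O_submodule_def)
 thus "x \<in> O_span smul (set l)" by (simp add: cs(2))
qed

section \<open>Recursive enumerability of certificates\<close>

locale encoded_algebra = quaternion_algebra smul
 for smul :: "'k::number_field => 'b::ring_1 => 'b" +
 fixes \<kappa> :: "'k list" and \<beta> :: "'b list"
 assumes basis_K: "ordered_basis rat_scale \<kappa>" and basis_B: "ordered_basis smul \<beta>"
begin

sublocale space: number_field_space smul by unfold_locales

abbreviation "ke \<equiv> encode_K \<kappa>"
abbreviation "be \<equiv> encode_B smul \<kappa> \<beta>"

sublocale EK: encoded_space "rat_scale :: rat => 'k => 'k" \<kappa> encode_rat
proof
 have e: "encoder (pe qe qe)" by (intro encoder_intros encoder_rat)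
 note fs = cfn_fst_snd[OF encoder_rat encoder_rat]
 show "cfn (pe qe qe) qe (%p. fst p + snd p)" "cfn (pe qe qe) qe (%p. fst p * snd p)"
  by (rule cfn_rat_ops[OF e fs])+
qed (use basis_K encoder_rat in \<open>auto simp: algebra_simps of_rat_add of_rat_mult\<close>)

lemma ke_eq: "EK.ve = ke" by (auto simp: EK.ve_def encode_K_def le_def fun_eq_iff)

lemma K_mult: "encoder d ==> cfn d ke f ==> cfn d ke g ==> cfn d ke (%x. f x * g x)"
 using EK.cfn_bilinear[of "(*)" d f g, unfolded ke_eq] by (simp add: distrib_left distrib_right mult_ac)

lemmas K_add = EK.cfn_add[unfolded ke_eq] and encoder_ke = EK.encoder_ve[unfolded ke_eq]

sublocale EB: encoded_space smul \<beta> ke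
proof
 have e: "encoder (pe ke ke)" by (intro encoder_intros encoder_ke)
 note fs = cfn_fst_snd[OF encoder_ke encoder_ke]
 show "cfn (pe ke ke) ke (%p. fst p + snd p)" by (rule K_add[OF e fs])
 show "cfn (pe ke ke) ke (%p. fst p * snd p)" by (rule K_mult[OF e fs])
qed (use basis_B encoder_ke in auto)

lemma be_eq: "EB.ve = be" by (auto simp: EB.ve_def encode_B_def le_def fun_eq_iff)

lemma B_mult: "encoder d ==> cfn d be f ==> cfn d be g ==> cfn d be (%x. f x * g x)"
 using EB.cfn_bilinear[of "(*)" d f g, unfolded be_eq]
 by (simp add: smul_mult_left smul_mult_right distrib_left distrib_right)

lemmas B_add = EB.cfn_add[unfolded be_eq] and encoder_be = EB.encoder_ve[unfolded be_eq]
 and B_smul = EB.cfn_scale[unfolded be_eq]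

lemma B_tr: "encoder d ==> cfn d be f ==> cfn d ke (%x. tr (f x))"
 using EB.cfn_linear[of tr, unfolded be_eq] by (simp add: tr_add tr_smul)

text \<open>In the rules below the premises that instantiate the encodings come first, so that the
 side conditions on the encodings are solved last.\<close>

lemma K_diff: "cfn d ke f ==> cfn d ke g ==> encoder d ==> cfn d ke (%x. f x - g x)"
 using K_add[of d f "%x. (- 1) * g x"] K_mult[of d "%_. - 1" g] cfn_const[of d ke "- 1"] by simp

lemma B_diff: "cfn d be f ==> cfn d be g ==> encoder d ==> cfn d be (%x. f x - g x)"
 using B_add[of d f "%x. smul (- 1) (g x)"] B_smul[of d "%_. - 1" g] cfn_const[of d ke "- 1"] by simp

lemma K_power: "cfn d ke f ==> encoder d ==> cfn d ke (%x. f x ^ n)"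
 by (induction n) (auto intro: K_mult cfn_const)

lemma R_const: "encoder d ==> cfn d e (%x. c)" by (rule cfn_const)
lemma R_id: "encoder d ==> cfn d d (%x. x)" by (rule cfn_id)
lemma R_fst: "cfn d (pe e e') f ==> encoder d ==> encoder e ==> encoder e' ==> cfn d e (%x. fst (f x))"
 by (rule cfn_fst)
lemma R_snd: "cfn d (pe e e') f ==> encoder d ==> encoder e ==> encoder e' ==> cfn d e' (%x. snd (f x))"
 by (rule cfn_snd)
lemma R_Pair: "cfn d e f ==> cfn d e' g ==> encoder d ==> cfn d (pe e e') (%x. (f x, g x))"
 by (rule cfn_pair)
lemma R_ops:
 "cfn d ke f ==> cfn d ke g ==> encoder d ==> cfn d ke (%x. f x + g x)"
 "cfn d ke f ==> cfn d ke g ==> encoder d ==> cfn d ke (%x. f x * g x)"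
 "cfn d be f' ==> cfn d be g' ==> encoder d ==> cfn d be (%x. f' x + g' x)"
 "cfn d be f' ==> cfn d be g' ==> encoder d ==> cfn d be (%x. f' x * g' x)"
 "cfn d ke f ==> cfn d be g' ==> encoder d ==> cfn d be (%x. smul (f x) (g' x))"
 "cfn d be f' ==> encoder d ==> cfn d ke (%x. tr (f' x))"
 "cfn d e h ==> cfn d (le e) t ==> encoder d ==> cfn d (le e) (%x. h x # t x)"
 "cfn d ne n ==> cfn d ne m ==> encoder d ==> cfn d ne (%x. n x + m x)"
 "cfn d ne n ==> encoder d ==> cfn d ne (%x. Suc (n x))"
 "cfn d ie i ==> encoder d ==> cfn d ke (%x. of_int (i x))"
proof -
 assume i: "cfn d ie i" and d: "encoder d"
 have "cfn d EK.ve (%x. rat_scale (of_int (i x)) 1)"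
  by (rule EK.cfn_scale[OF d cfn_rat_of_int[OF d i] cfn_const[OF d]])
 thus "cfn d ke (%x. of_int (i x))" by (simp add: ke_eq)
qed (auto intro: K_add K_mult B_add B_mult B_smul B_tr cfn_Cons cfn_nat_ops)

lemma R_length: "cfn d (le ke) f ==> encoder d ==> cfn d ne (%x. length (f x))"
 "cfn d (le (le ke)) g ==> encoder d ==> cfn d ne (%x. length (g x))"
 by (rule cfn_length; (assumption | rule encoder_intros encoder_ke)+)+

lemma R_eq:
 "cfn d ke f ==> cfn d ke g ==> encoder d ==> rep d (%x. f x = g x)"
 "cfn d be f' ==> cfn d be g' ==> encoder d ==> rep d (%x. f' x = g' x)"
 "cfn d ne n ==> cfn d ne m ==> encoder d ==> rep d (%x. n x = m x)"
 "cfn d (le ke) l ==> cfn d (le ke) l' ==> encoder d ==> rep d (%x. l x = l' x)"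
 by (rule rep_eq; (assumption | rule encoder_intros encoder_ke encoder_be)+)+

lemma R_conj: "rep d P ==> rep d Q ==> encoder d ==> rep d (%x. P x & Q x)" by (rule rep_conj)
lemma R_disj: "rep d P ==> rep d Q ==> rep d (%x. P x \<or> Q x)" by (rule rep_disj)

text \<open>The encoding of a bound variable does not appear in the conclusion. One instance per
  type lets unification find it.\<close>

lemma R_ex:
 "rep (pe d ke) (%p. P1 (fst p) (snd p)) ==> rep d (%x. \<exists>y::'k. P1 x y)"
 "rep (pe d be) (%p. P2 (fst p) (snd p)) ==> rep d (%x. \<exists>y::'b. P2 x y)"
 "rep (pe d ne) (%p. P3 (fst p) (snd p)) ==> rep d (%x. \<exists>y::nat. P3 x y)"
 "rep (pe d (le ke)) (%p. P4 (fst p) (snd p)) ==> rep d (%x. \<exists>y::'k list. P4 x y)"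
 "rep (pe d (le (le ke))) (%p. P5 (fst p) (snd p)) ==> rep d (%x. \<exists>y::'k list list. P5 x y)"
 "rep (pe d (le (pe ne ke))) (%p. P6 (fst p) (snd p)) ==> rep d (%x. \<exists>y::(nat \<times> 'k) list. P6 x y)"
 "rep (pe d (le (pe ke be))) (%p. P7 (fst p) (snd p)) ==> rep d (%x. \<exists>y::('k \<times> 'b) list. P7 x y)"
 "rep (pe d (le (pe ke ke))) (%p. P8 (fst p) (snd p)) ==> rep d (%x. \<exists>y::('k \<times> 'k) list. P8 x y)"
 "rep (pe d (le ie)) (%p. P9 (fst p) (snd p)) ==> rep d (%x. \<exists>y::int list. P9 x y)"
 by (rule rep_ex, assumption)+

lemma R_ball:
 "cfn d (le ke) l1 ==> rep (pe d ke) (%p. P1 (fst p) (snd p)) ==> encoder d ==> rep d (%x. \<forall>y\<in>set (l1 x). P1 x y)"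
 "cfn d (le be) l2 ==> rep (pe d be) (%p. P2 (fst p) (snd p)) ==> encoder d ==> rep d (%x. \<forall>y\<in>set (l2 x). P2 x y)"
 "cfn d (le (le ke)) l3 ==> rep (pe d (le ke)) (%p. P3 (fst p) (snd p)) ==> encoder d ==> rep d (%x. \<forall>y\<in>set (l3 x). P3 x y)"
 "cfn d (le (pe ne ke)) l4 ==> rep (pe d (pe ne ke)) (%p. P4 (fst p) (snd p)) ==> encoder d ==> rep d (%x. \<forall>y\<in>set (l4 x). P4 x y)"
 "cfn d (le (pe ke be)) l5 ==> rep (pe d (pe ke be)) (%p. P5 (fst p) (snd p)) ==> encoder d ==> rep d (%x. \<forall>y\<in>set (l5 x). P5 x y)"
 "cfn d (le (pe ke ke)) l6 ==> rep (pe d (pe ke ke)) (%p. P6 (fst p) (snd p)) ==> encoder d ==> rep d (%x. \<forall>y\<in>set (l6 x). P6 x y)"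
 "cfn d (le (pe (le ke) (le ke))) l7 ==> rep (pe d (pe (le ke) (le ke))) (%p. P7 (fst p) (snd p)) ==> encoder d ==>
  rep d (%x. \<forall>y\<in>set (l7 x). P7 x y)"
 by (rule rep_ball_set; (assumption | rule encoder_intros encoder_ke encoder_be)+)+

lemma R_in:
 "cfn d (le ke) l1 ==> cfn d ke y1 ==> encoder d ==> rep d (%x. y1 x \<in> set (l1 x))"
 "cfn d (le be) l2 ==> cfn d be y2 ==> encoder d ==> rep d (%x. y2 x \<in> set (l2 x))"
 "cfn d (le (pe ne ke)) l3 ==> cfn d (pe ne ke) y3 ==> encoder d ==> rep d (%x. y3 x \<in> set (l3 x))"
 by (rule rep_in_set; (assumption | rule encoder_intros encoder_ke encoder_be)+)+

lemma R_nth: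
 "cfn d (le (le ke)) l ==> cfn d ne i ==> cfn d (le ke) y ==> encoder d ==>
  rep d (%x. i x < length (l x) & l x ! i x = y x)"
 by (rule rep_nth_rule; (assumption | rule encoder_intros encoder_ke)+)

lemmas R_encoder = encoder_ke encoder_be encoder_ne encoder_int encoder_le encoder_pe

lemma R_in_map_fst:
 "cfn d (le (pe (le ke) (le ke))) l ==> cfn d (le ke) y ==> encoder d ==> rep d (%x. y x \<in> set (map fst (l x)))"
proof -
 assume l: "cfn d (le (pe (le ke) (le ke))) l" and y: "cfn d (le ke) y" and d: "encoder d"
 let ?d = "pe d (le ke)"
 have d': "encoder ?d" by (intro R_encoder d)
 have f: "cfn ?d d fst" and s: "cfn ?d (le ke) snd" by (rule cfn_fst_snd; intro R_encoder d)+
 have "rep d (%x. \<exists>q. (y x, q) \<in> set (l x))"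
  by (rule rep_ex, rule rep_in_set[OF d' _ cfn_pair[OF d' cfn_comp[OF d f y] s] cfn_comp[OF d f l]])
   (intro R_encoder)
 thus ?thesis by (rule rep_cong) force
qed

lemmas R_rules = R_conj R_disj R_ex R_ball R_in R_nth R_eq R_length R_fst R_snd R_Pair R_ops
 K_diff B_diff K_power R_encoder R_id R_const

text \<open>Integrality is enumerable by guessing the lower coefficients of a monic
  equation.\<close>

lemma R_algint: "cfn d ke f ==> encoder d ==> rep d (%x. aint (f x))"
proof -
 assume f: "cfn d ke f" and d: "encoder d"
 let ?d = "pe d (le ie)"
 have d': "encoder ?d" by (intro R_encoder d)
 have p: "cfn ?d d fst" "cfn ?d (le ie) snd" by (rule cfn_fst_snd; intro R_encoder d)+
 have step: "cfn (pe ie (pe ke ke)) (pe ke ke)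
   (%p. (fst (snd p) * snd (snd p) + of_int (fst p), snd (snd p)))"
  by (rule R_rules)+
 have fold: "cfn ?d (pe ke ke) (%p. foldr (%a p. (fst p * snd p + of_int a, snd p)) (snd p) (1, f (fst p)))"
  by (rule cfn_foldr[OF d' encoder_int _ step p(2)])
   (intro R_encoder cfn_pair[OF d'] cfn_const[OF d'] cfn_comp[OF d p(1) f])+
 have "rep d (%x. \<exists>as. fst (foldr (%(a::int) p. (fst p * snd p + of_int a, snd p)) as (1, f x)) = 0)"
  by (intro R_ex R_eq R_fst[OF fold] d' R_encoder R_const)
 thus ?thesis by (rule rep_cong) (simp add: aint_iff_Horner[symmetric])
qed

lemma R_span_B: "cfn d be f ==> cfn d (le be) l ==> encoder d ==> rep d (%x. f x \<in> O_span smul (set (l x)))"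
proof -
 assume f: "cfn d be f" and l: "cfn d (le be) l" and d: "encoder d"
 let ?d = "pe d (le (pe ke be))"
 have d': "encoder ?d" by (intro R_encoder d)
 have p: "cfn ?d d fst" "cfn ?d (le (pe ke be)) snd" by (rule cfn_fst_snd; intro R_encoder d)+
 have step: "cfn (pe (pe ke be) be) be (%p. smul (fst (fst p)) (snd (fst p)) + snd p)"
  by (rule R_rules)+
 have fold: "cfn ?d be (%p. foldr (%p s. smul (fst p) (snd p) + s) (snd p) 0)"
  by (rule cfn_foldr[OF d' _ _ step p(2)]) (intro R_encoder cfn_const[OF d'])+
 let ?e = "pe ?d (pe ke be)"
 have e: "encoder ?e" by (intro R_encoder d)
 have q: "cfn ?e ?d fst" "cfn ?e (pe ke be) snd" by (rule cfn_fst_snd; intro R_encoder d)+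
 have "rep d (%x. \<exists>cs. (\<forall>p\<in>set cs. aint (fst p) & snd p \<in> set (l x)) &
   foldr (%p s. smul (fst p) (snd p) + s) cs 0 = f x)"
  by (intro R_ex R_conj R_ball R_algint R_in R_eq R_fst[OF q(2)] R_snd[OF q(2)] fold
    cfn_comp[OF d p(1)] p(2) cfn_comp[OF d' q(1)] f l d d' e R_encoder)
 thus ?thesis by (rule rep_cong) (simp add: space.O_span_iff_list)
qed

lemma R_span_K: "cfn d ke f ==> cfn d (le ke) l ==> encoder d ==> rep d (%x. f x \<in> O_span (*) (set (l x)))"
proof -
 interpret K: number_field_space "(*) :: 'k => 'k => 'k" by (rule number_field_space_self)
 assume f: "cfn d ke f" and l: "cfn d (le ke) l" and d: "encoder d"
 let ?d = "pe d (le (pe ke ke))"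
 have d': "encoder ?d" by (intro R_encoder d)
 have p: "cfn ?d d fst" "cfn ?d (le (pe ke ke)) snd" by (rule cfn_fst_snd; intro R_encoder d)+
 have step: "cfn (pe (pe ke ke) ke) ke (%p. fst (fst p) * snd (fst p) + snd p)"
  by (rule R_rules)+
 have fold: "cfn ?d ke (%p. foldr (%p s. fst p * snd p + s) (snd p) 0)"
  by (rule cfn_foldr[OF d' _ _ step p(2)]) (intro R_encoder cfn_const[OF d'])+
 let ?e = "pe ?d (pe ke ke)"
 have e: "encoder ?e" by (intro R_encoder d)
 have q: "cfn ?e ?d fst" "cfn ?e (pe ke ke) snd" by (rule cfn_fst_snd; intro R_encoder d)+
 have "rep d (%x. \<exists>cs. (\<forall>p\<in>set cs. aint (fst p) & snd p \<in> set (l x)) &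
   foldr (%p s. fst p * snd p + s) cs 0 = f x)"
  by (intro R_ex R_conj R_ball R_algint R_in R_eq R_fst[OF q(2)] R_snd[OF q(2)] fold
    cfn_comp[OF d p(1)] p(2) cfn_comp[OF d' q(1)] f l d d' e R_encoder)
 thus ?thesis by (rule rep_cong) (simp add: K.O_span_iff_list)
qed

end

section \<open>Correctness of certificates\<close>

lemma algebra_iso_trans:
 assumes "algebra_iso A M N" "algebra_iso A N Q" shows "algebra_iso A M Q"
proof -
 obtain g where g: "g \<in> ring_iso M N" "!!a x. a \<in> carrier A ==> x \<in> carrier M ==> g (a \<odot>\<^bsub>M\<^esub> x) = a \<odot>\<^bsub>N\<^esub> g x"
  using assms(1) by (auto simp: algebra_iso_def)
 obtain h where h: "h \<in> ring_iso N Q" "!!a x. a \<in> carrier A ==> x \<in> carrier N ==> h (a \<odot>\<^bsub>N\<^esub> x) = a \<odot>\<^bsub>Q\<^esub> h x"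
  using assms(2) by (auto simp: algebra_iso_def)
 have "h \<circ> g \<in> ring_iso M Q" using ring_iso_set_trans[OF g(1) h(1)] .
 moreover have "g x \<in> carrier N" if "x \<in> carrier M" for x
  using g(1) that by (auto simp: ring_iso_def Ring.ring_hom_def)
 ultimately show ?thesis using g(2) h(2) unfolding algebra_iso_def by (intro bexI[of _ "h \<circ> g"]) auto
qed

lemma algebra_iso_refl_trans_genus:
 assumes "same_genus smul R S" "same_genus smul S T" shows "same_genus smul R T"
 using assms algebra_iso_trans unfolding same_genus_def by blast

context quaternion_algebra
begin

sublocale space: number_field_space smul by unfold_locales

text \<open>\<open>D\<close>, with \<open>D'\<close> witnessing that it is nonzero, forces the span
  of \<open>out\<close> to have full rank. The last two clauses determine the genus, at the listed
  primes and at all others.\<close>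

definition certificate :: "'b list => ('k list \<times> 'k list) list => 'b list => bool" where
 "certificate gens pqs out \<longleftrightarrow> 1 \<in> O_span smul (set out) &
   (\<forall>x\<in>set out. \<forall>y\<in>set out. x * y \<in> O_span smul (set out)) & (\<forall>x\<in>set out. x \<in> O_span smul (set gens)) &
   (\<exists>D D'. aint D & D * D' = 1 & (\<forall>r\<in>set gens. smul D r \<in> O_span smul (set out))) &
   (\<forall>pq\<in>set pqs. local_certificate gens out (fst pq) (snd pq)) &
   chain_certificate smul (map fst pqs) gens out"

text \<open>A form enters the code of a genus only through its six coefficients.\<close>

definition genus_data :: "('k list \<times> (nat => nat => 'k)) list => ('k list \<times> 'k list) list" where
 "genus_data L = map (%(ps, f). (ps, form_coeffs f)) L"

lemma describes_genusD:
 assumes "describes_genus smul L G"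
 shows "!!ps f. (ps, f) \<in> set L ==> set ps \<subseteq> algints & nonzero_prime (O_span (*) (set ps)) & integral_form f"
  and "!!S ps f. S \<in> G ==> (ps, f) \<in> set L ==> \<pp> = O_span (*) (set ps) ==> algebra_iso (O_completion \<pp>)
   (order_completion smul \<pp> S) (even_clifford (O_completion \<pp>) (%i j. O_embed \<pp> (f i j)))"
  and "!!S. S \<in> G ==> nonzero_prime \<pp> ==> \<pp> \<notin> (%ps. O_span (*) (set ps)) ` set (map fst L) ==>
   algebra_iso (O_completion \<pp>) (order_completion smul \<pp> S) (matrix_algebra (O_completion \<pp>) 2)"
proof -
 have 1: "set ps \<subseteq> algints" if "(ps, f) \<in> set L" for ps f
  using assms that unfolding describes_genus_def integer_ring_def by fastforce
 have gen: "genideal integer_ring (set ps) = O_span (*) (set ps)" if "(ps, f) \<in> set L" for ps f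
  by (rule genideal_eq_O_span[OF 1[OF that]])
 show "set ps \<subseteq> algints & nonzero_prime (O_span (*) (set ps)) & integral_form f" if "(ps, f) \<in> set L" for ps f
  using assms that 1[OF that] gen[OF that] unfolding describes_genus_def by fastforce
 show "algebra_iso (O_completion \<pp>)
   (order_completion smul \<pp> S) (even_clifford (O_completion \<pp>) (%i j. O_embed \<pp> (f i j)))"
  if "S \<in> G" "(ps, f) \<in> set L" "\<pp> = O_span (*) (set ps)" for S ps f
 proof -
  have "\<forall>(ps, f)\<in>set L. let \<pp> = genideal integer_ring (set ps) in
      algebra_iso (O_completion \<pp>) (order_completion smul \<pp> S)
       (even_clifford (O_completion \<pp>) (%i j. O_embed \<pp> (f i j)))"
   using assms that(1) unfolding describes_genus_def by blast
  from bspec[OF this that(2)] show ?thesis by (simp add: Let_def gen[OF that(2)] that(3))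
 qed
 have im: "(%(ps, f). genideal integer_ring (set ps)) ` set L = (%ps. O_span (*) (set ps)) ` set (map fst L)"
  using gen by (force simp: image_iff)
 show "algebra_iso (O_completion \<pp>) (order_completion smul \<pp> S) (matrix_algebra (O_completion \<pp>) 2)"
  if "S \<in> G" "nonzero_prime \<pp>" "\<pp> \<notin> (%ps. O_span (*) (set ps)) ` set (map fst L)" for S
  using assms that unfolding describes_genus_def im by blast
qed

lemma O_span_mult:
 assumes "!!x y. x \<in> X ==> y \<in> X ==> x * y \<in> O_span smul X" and x: "x \<in> O_span smul X" and y: "y \<in> O_span smul X"
 shows "x * y \<in> O_span smul X"
proof -
 note O = space.O_submodule_O_span[of X, unfolded space.O_submodule_def]
 have 1: "x * y \<in> O_span smul X" if "x \<in> X" for x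
 proof -
  have "O_span smul X \<subseteq> {y. x * y \<in> O_span smul X}"
   by (rule space.O_span_minimal)
    (use O assms(1)[OF that] in \<open>auto simp: space.O_submodule_def distrib_left smul_mult_right\<close>)
  thus ?thesis using y by blast
 qed
 have "O_span smul X \<subseteq> {x. x * y \<in> O_span smul X}"
  by (rule space.O_span_minimal) (use O 1 in \<open>auto simp: space.O_submodule_def distrib_right smul_mult_left\<close>)
 thus ?thesis using x by blast
qed

lemma smul_O_span:
 assumes "!!r. r \<in> X ==> smul a r \<in> O_span smul Y" and "r \<in> O_span smul X"
 shows "smul a r \<in> O_span smul Y"
proof -
 note O = space.O_submodule_O_span[of Y, unfolded space.O_submodule_def]
 have "O_span smul X \<subseteq> {r. smul a r \<in> O_span smul Y}"
 proof (rule space.O_span_minimal)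
  have "smul a (smul b x) \<in> O_span smul Y" if "aint b" "smul a x \<in> O_span smul Y" for b x
  proof -
   have "smul b (smul a x) \<in> O_span smul Y" using O that by blast
   thus ?thesis by (simp add: mult.commute)
  qed
  thus "space.O_submodule {r. smul a r \<in> O_span smul Y}" using O by (auto simp: space.O_submodule_def scale_right_distrib)
 qed (use assms in auto)
 thus ?thesis using assms(2) by blast
qed

text \<open>The candidate is compared with the promised suborder \<open>S'\<close> prime by prime.
  At an unlisted prime \<open>S'\<close> coincides locally with \<open>R\<close> by
  \<open>matrix_maximal\<close>, and so does the candidate by the chain of products; conjugation by
  1 is then enough.\<close>

theorem certificate_sound:
 assumes R: "R = O_span smul (set gens)" "is_order smul R" and G: "is_genus smul G" "describes_genus smul L G"
  and S': "S' \<in> G" "S' \<subseteq> R" and cert: "certificate gens (genus_data L) out"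
 shows "O_span smul (set out) \<in> G" "O_span smul (set out) \<subseteq> R"
proof -
 let ?S = "O_span smul (set out)"
 note O = space.O_submodule_O_span[of "set out", unfolded space.O_submodule_def]
 obtain D D' where D: "D * D' = 1" "\<forall>r\<in>set gens. smul D r \<in> ?S" using cert by (auto simp: certificate_def)
 have one: "1 \<in> ?S" and mult: "\<forall>x\<in>set out. \<forall>y\<in>set out. x * y \<in> ?S" and sub: "\<forall>x\<in>set out. x \<in> R"
  and loc: "\<forall>pq\<in>set (genus_data L). local_certificate gens out (fst pq) (snd pq)"
  and chain: "chain_certificate smul (map fst (genus_data L)) gens out"
  using cert by (simp_all add: certificate_def R(1))
 have "space.O_submodule R" using R(2) space.is_latticeD by (simp add: is_order_def)
 thus SR: "?S \<subseteq> R" using sub by (intro space.O_span_minimal) auto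
 have "r \<in> span ?S" if "r \<in> R" for r
 proof -
  have "smul D r \<in> span ?S" using smul_O_span[of "set gens" D "set out" r] D(2) that R(1) span_base by blast
  from span_scale[OF this, of D'] show ?thesis using D(1) by (simp add: mult.commute)
 qed
 hence "span R \<subseteq> span ?S" by (intro span_minimal) auto
 hence "span ?S = UNIV" using R(2) by (auto simp: is_order_def is_lattice_def)
 hence order: "is_order smul ?S"
  using one O_span_mult[of "set out"] mult by (auto simp: is_order_def is_lattice_def)
 obtain R0 where R0: "G = {S. is_order smul S & same_genus smul R0 S}" using G(1) by (auto simp: is_genus_def)
 have oS': "is_order smul S'" using S'(1) R0 by simp
 have "same_genus smul S' ?S" unfolding same_genus_def
 proof (intro allI impI)
  fix \<pp> :: "'k set" assume \<pp>: "nonzero_prime \<pp>"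
  interpret P: local_orders smul \<pp> using \<pp> by unfold_locales
  show "algebra_iso (O_completion \<pp>) (order_completion smul \<pp> S') (order_completion smul \<pp> ?S)"
  proof (cases "\<pp> \<in> (%ps. O_span (*) (set ps)) ` set (map fst L)")
   case True
   then obtain ps f where psf: "(ps, f) \<in> set L" "\<pp> = O_span (*) (set ps)" by auto
   have c: "local_certificate gens out ps (form_coeffs f)"
   proof -
    have "(ps, form_coeffs f) \<in> set (genus_data L)" using psf(1) by (force simp: genus_data_def)
    from bspec[OF loc this] show ?thesis by simp
   qed
   have f: "integral_form f" using describes_genusD(1)[OF G(2) psf(1)] by blast
   show ?thesis
    by (rule P.local_certificate_sound[OF R refl order oS' S'(2) describes_genusD(2)[OF G(2) S'(1) psf] f psf(2) c])
  next
   case False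
   have "map fst (genus_data L) = map fst L" by (simp add: genus_data_def case_prod_beta comp_def)
   hence ch: "chain_certificate smul (map fst L) gens out" using chain by simp
   have "set ps \<subseteq> algints & nonzero_prime (O_span (*) (set ps)) & \<pp> ~= O_span (*) (set ps)"
    if "ps \<in> set (map fst L)" for ps
    using that False describes_genusD(1)[OF G(2)] by force
   then obtain a where a: "aint a" "a \<notin> \<pp>" "!!r. r \<in> set gens ==> smul a r \<in> ?S"
    using P.chain_certificateD[OF ch] by blast
   note iso = describes_genusD(3)[OF G(2) S'(1) \<pp> False]
   show ?thesis
   proof (rule P.algebra_iso_if_conjugate[OF oS' order, of 1 1])
    show "\<exists>b. aint b & b \<notin> \<pp> & smul b (1 * s * 1) \<in> ?S" if "s \<in> S'" for s
    proof -
     have "s \<in> O_span smul (set gens)" using that S'(2) R(1) by blast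
     from smul_O_span[OF a(3) this] show ?thesis using a(1,2) by auto
    qed
    show "\<exists>b. aint b & b \<notin> \<pp> & smul b (1 * s * 1) \<in> S'" if "s \<in> ?S" for s
     using P.matrix_maximal[OF oS' R(2) S'(2) iso, of s] that SR by auto
   qed simp_all
  qed
 qed
 hence "same_genus smul R0 ?S" using algebra_iso_refl_trans_genus S'(1) R0 by blast
 thus "?S \<in> G" using order R0 by simp
qed

text \<open>The chain of products is the only global part: it exists because the ideal of
  multipliers from \<open>R\<close> into \<open>S\<close> is contained in no prime outside the
  list.\<close>

theorem certificate_complete:
 assumes R: "R = O_span smul (set gens)" "is_order smul R" and G: "is_genus smul G" "describes_genus smul L G"
  and S: "S \<in> G" "S \<subseteq> R" "S = O_span smul (set out)"
 shows "certificate gens (genus_data L) out"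
proof -
 obtain R0 where R0: "G = {S. is_order smul S & same_genus smul R0 S}" using G(1) by (auto simp: is_genus_def)
 have oS: "is_order smul S" using S(1) R0 by simp
 have lat: "is_lattice smul S" using oS by (simp add: is_order_def)
 have sm: "0 \<in> S" "!!x y. x \<in> S ==> y \<in> S ==> x + y \<in> S" "!!a x. aint a ==> x \<in> S ==> smul a x \<in> S"
  using space.is_latticeD[OF lat] by (auto simp: space.O_submodule_def)
 have outS: "set out \<subseteq> S" using space.O_span_base S(3) by blast
 obtain D where D: "aint D" "D ~= 0" "\<forall>x\<in>R. smul D x \<in> S"
  using space.common_denominator[OF lat, of "set gens"] R(1) by auto
 have gR: "set gens \<subseteq> R" using space.O_span_base R(1) by blast
 have loc: "local_certificate gens out (fst pq) (snd pq)" if pq: "pq \<in> set (genus_data L)" for pq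
 proof -
  obtain ps f where psf: "(ps, f) \<in> set L" "pq = (ps, form_coeffs f)" using pq by (auto simp: genus_data_def)
  have d: "nonzero_prime (O_span (*) (set ps))" "integral_form f" using describes_genusD(1)[OF G(2) psf(1)] by auto
  interpret P: local_orders smul "O_span (*) (set ps)" using d(1) by unfold_locales
  show ?thesis
   using P.local_certificate_complete[OF R(1) S(3) oS describes_genusD(2)[OF G(2) S(1) psf(1) refl] d(2) refl]
   by (simp add: psf(2))
 qed
 \<comment> \<open>At an unlisted prime \<open>S\<close> and \<open>R\<close> agree locally, so
   \<open>J\<close> has an element outside that prime; hence every prime containing \<open>J\<close>
   is listed.\<close>
 define J where "J = {a. aint a & (\<forall>r\<in>set gens. smul a r \<in> S)}"
 have "ideal J integer_ring" unfolding ideal_integer_ring_iff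
 proof (intro conjI ballI allI impI)
  show "J \<subseteq> algints" by (auto simp: J_def)
  show "0 \<in> J" using sm(1) by (simp add: J_def aint_of_int)
  show "x + y \<in> J" if "x \<in> J" "y \<in> J" for x y
   using that sm(2) by (auto simp: J_def scale_left_distrib intro: aint_add_mult)
  fix a x :: 'k assume a: "aint a" "x \<in> J"
  have "smul (a * x) r \<in> S" if r: "r \<in> set gens" for r
  proof -
   have "smul x r \<in> S" using a(2) r by (auto simp: J_def)
   from sm(3)[OF a(1) this] show ?thesis by simp
  qed
  thus "a * x \<in> J" using a by (auto simp: J_def intro: aint_add_mult)
 qed
 moreover have "J ~= {0}"
 proof -
  have "D \<in> J" using D gR by (auto simp: J_def)
  thus ?thesis using D(2) by blast
 qed
 moreover have "\<pp> \<in> (%ps. O_span (*) (set ps)) ` set (map fst L)" if \<pp>: "nonzero_prime \<pp>" "J \<subseteq> \<pp>" for \<pp>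
 proof (rule ccontr)
  assume n: "\<not> ?thesis"
  interpret P: local_orders smul \<pp> using \<pp>(1) by unfold_locales
  have ex: "\<exists>b. aint b & b \<notin> \<pp> & smul b r \<in> S" if "r \<in> set gens" for r
   by (rule P.matrix_maximal[OF oS R(2) S(2) describes_genusD(3)[OF G(2) S(1) \<pp>(1) n]]) (use that gR in blast)
  have "\<exists>b. aint b & b \<notin> \<pp> & (\<forall>r\<in>X. smul b r \<in> S)" if "finite X" "X \<subseteq> set gens" for X
   using that
  proof (induction X)
   case empty
   thus ?case using P.one_notin by (intro exI[of _ 1]) (simp add: aint_of_int)
  next
   case (insert x X)
   obtain b where b: "aint b" "b \<notin> \<pp>" "\<forall>r\<in>X. smul b r \<in> S" using insert by auto
   obtain c where c: "aint c" "c \<notin> \<pp>" "smul c x \<in> S" using ex insert.prems by blast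
   have "smul b (smul c x) \<in> S" "!!r. r \<in> X ==> smul c (smul b r) \<in> S" using b c sm(3) by blast+
   hence "smul (b * c) x \<in> S" "!!r. r \<in> X ==> smul (b * c) r \<in> S" by (simp_all add: mult.commute)
   thus ?case using b c P.mult_notin by (intro exI[of _ "b * c"]) (auto intro: aint_add_mult)
  qed
  from this[of "set gens"] obtain b where "aint b" "b \<notin> \<pp>" "\<forall>r\<in>set gens. smul b r \<in> S" by auto
  hence "b \<in> J" by (simp add: J_def)
  thus False using \<pp>(2) \<open>b \<notin> \<pp>\<close> by blast
 qed
 ultimately obtain ls where ls: "set ls \<subseteq> set (map fst L)" "set (choices ls) \<subseteq> J"
  using exists_prime_products[of J "map fst L"] by blast
 have "map fst (genus_data L) = map fst L" by (simp add: genus_data_def case_prod_beta comp_def)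
 hence "chain_certificate smul (map fst (genus_data L)) gens out"
  using chain_certificateI[OF ls(1), of gens smul out] ls(2) S(3) by (auto simp: J_def)
 moreover have "D * inverse D = 1" using D(2) by simp
 moreover have "1 \<in> S" "!!x y. x \<in> S ==> y \<in> S ==> x * y \<in> S" using oS by (auto simp: is_order_def)
 moreover have "\<forall>r\<in>set gens. smul D r \<in> S" using D(3) gR by blast
 ultimately show ?thesis using loc outS S(2) D(1) unfolding certificate_def R(1)[symmetric] S(3)[symmetric] by blast
qed

end

section \<open>Certificates form an enumerable relation\<close>

context encoded_algebra
begin

definition unit_certificate :: "'k list => 'k => bool" where
 "unit_certificate ps a \<longleftrightarrow> (\<exists>u. aint u & (\<exists>w. w \<in> O_span (*) (set ps) & a * u + w = 1))"

definition dual_certificate :: "'k => 'b => 'b => 'b => bool" where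
 "dual_certificate c e1 e2 e3 \<longleftrightarrow> (\<exists>d0 d1 d2 d3.
   (\<forall>d\<in>set [d0, d1, d2, d3]. d \<in> O_span smul (set [1, e1, e2, e3])) &
   tr d0 = c & tr (d0 * e1) = 0 & tr (d0 * e2) = 0 & tr (d0 * e3) = 0 &
   tr d1 = 0 & tr (d1 * e1) = c & tr (d1 * e2) = 0 & tr (d1 * e3) = 0 &
   tr d2 = 0 & tr (d2 * e1) = 0 & tr (d2 * e2) = c & tr (d2 * e3) = 0 &
   tr d3 = 0 & tr (d3 * e1) = 0 & tr (d3 * e2) = 0 & tr (d3 * e3) = c)"

definition near_certificate :: "'k list => 'k => 'k => 'k list => 'b => 'b => 'b => bool" where
 "near_certificate ps a D q e1 e2 e3 \<longleftrightarrow> (\<exists>z. z \<in> O_span (*) (set ps) & (\<exists>z'. z * z' = 1) &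
   (\<forall>x\<in>set (clifford_relations smul q e1 e2 e3).
    \<exists>s. s \<in> O_span smul (set [1, e1, e2, e3]) & smul a x = smul ((4 * D) ^ 10 * z) s))"

text \<open>The same certificate with lists of fixed length replaced by tuples, and with every
  quantifier next to the clauses that use it; in this shape the enumeration rules apply.\<close>

definition local_certificate' :: "'b list => 'b list => 'k list => 'k list => bool" where
 "local_certificate' gens out ps q \<longleftrightarrow> (\<exists>e1 e2 e3 a D.
   (\<forall>x\<in>set [e1, e2, e3]. x \<in> O_span smul (set out)) & aint a & unit_certificate ps a &
   (\<forall>g\<in>set out. smul a g \<in> O_span smul (set [1, e1, e2, e3])) &
   aint D & (\<exists>D'. D * D' = 1) & (\<forall>g\<in>set gens. smul D g \<in> O_span smul (set out)) &
   dual_certificate (a * D) e1 e2 e3 & near_certificate ps a D q e1 e2 e3)"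

lemma all_less_4: "(\<forall>k<4. P k) \<longleftrightarrow> P 0 & P 1 & P 2 & P (3::nat)"
 by (auto simp: numeral_eq_Suc less_Suc_eq)

lemma length_3: "length es = 3 \<longleftrightarrow> (\<exists>e1 e2 e3. es = [e1, e2, e3])"
 and length_4: "length es = 4 \<longleftrightarrow> (\<exists>e1 e2 e3 e4. es = [e1, e2, e3, e4])"
 by (auto simp: numeral_eq_Suc length_Suc_conv)

lemma dual_system_4:
 "(\<forall>k<4. \<forall>l<4. tr ([d0, d1, d2, d3] ! k * (1 # [e1, e2, e3]) ! l) = (if k = l then c else 0)) \<longleftrightarrow>
   tr d0 = c & tr (d0 * e1) = 0 & tr (d0 * e2) = 0 & tr (d0 * e3) = 0 &
   tr d1 = 0 & tr (d1 * e1) = c & tr (d1 * e2) = 0 & tr (d1 * e3) = 0 &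
   tr d2 = 0 & tr (d2 * e1) = 0 & tr (d2 * e2) = c & tr (d2 * e3) = 0 &
   tr d3 = 0 & tr (d3 * e1) = 0 & tr (d3 * e2) = 0 & tr (d3 * e3) = c"
 unfolding all_less_4 by simp

lemma local_certificate_iff: "local_certificate gens out ps q \<longleftrightarrow> local_certificate' gens out ps q"
proof
 assume "local_certificate gens out ps q"
 then obtain es ds a u w D D' z z' where c: "length es = 3 & length ds = 4 & (\<forall>x\<in>set es. x \<in> O_span smul (set out)) &
   aint a & aint u & w \<in> O_span (*) (set ps) & a * u + w = 1 &
   (\<forall>g\<in>set out. smul a g \<in> O_span smul (set (1 # es))) &
   aint D & D * D' = 1 & z \<in> O_span (*) (set ps) & z * z' = 1 &
   (\<forall>g\<in>set gens. smul D g \<in> O_span smul (set out)) &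
   (\<forall>d\<in>set ds. d \<in> O_span smul (set (1 # es))) &
   (\<forall>k<4. \<forall>l<4. tr (ds ! k * (1 # es) ! l) = (if k = l then a * D else 0)) &
   (\<forall>x\<in>set (clifford_relations smul q (es ! 0) (es ! 1) (es ! 2)).
    \<exists>s. s \<in> O_span smul (set (1 # es)) & smul a x = smul ((4 * D) ^ 10 * z) s)"
  unfolding local_certificate_def by - (erule exE, erule exE, erule exE, erule exE, erule exE, erule exE,
   erule exE, erule exE, erule exE, rule that)
 note len = c[THEN conjunct1] c[THEN conjunct2, THEN conjunct1]
 note c1 = c[THEN conjunct2, THEN conjunct2]
 note es = c1[THEN conjunct1] and c2 = c1[THEN conjunct2]
 have a: "aint a" "aint u" "w \<in> O_span (*) (set ps)" "a * u + w = 1" using c2 by simp_all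
 note c3 = c2[THEN conjunct2, THEN conjunct2, THEN conjunct2, THEN conjunct2]
 note out = c3[THEN conjunct1] and c4 = c3[THEN conjunct2]
 have D: "aint D" "D * D' = 1" and z: "z \<in> O_span (*) (set ps)" "z * z' = 1" using c4 by simp_all
 note c5 = c4[THEN conjunct2, THEN conjunct2, THEN conjunct2, THEN conjunct2]
 note gens = c5[THEN conjunct1] and ds = c5[THEN conjunct2, THEN conjunct1]
  and dual = c5[THEN conjunct2, THEN conjunct2, THEN conjunct1]
  and rel = c5[THEN conjunct2, THEN conjunct2, THEN conjunct2]
 obtain e1 e2 e3 where e: "es = [e1, e2, e3]" using len(1) unfolding length_3 by - (erule exE, erule exE, erule exE, rule that)
 obtain d0 d1 d2 d3 where d: "ds = [d0, d1, d2, d3]" using len(2) unfolding length_4 by - (erule exE, erule exE, erule exE, erule exE, rule that)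
 have "unit_certificate ps a" unfolding unit_certificate_def using a by blast
 moreover have "dual_certificate (a * D) e1 e2 e3" unfolding dual_certificate_def
  by (rule exI[of _ d0], rule exI[of _ d1], rule exI[of _ d2], rule exI[of _ d3],
    rule conjI[OF ds[unfolded d e] dual[unfolded d e dual_system_4]])
 moreover have "near_certificate ps a D q e1 e2 e3" unfolding near_certificate_def
 proof (rule exI[of _ z], intro conjI)
  show "\<forall>x\<in>set (clifford_relations smul q e1 e2 e3).
   \<exists>s. s \<in> O_span smul (set [1, e1, e2, e3]) & smul a x = smul ((4 * D) ^ 10 * z) s"
   using rel by (simp add: e numeral_2_eq_2)
 qed (use z in blast)+
 ultimately show "local_certificate' gens out ps q" unfolding local_certificate'_def
  by - (rule exI[of _ e1], rule exI[of _ e2], rule exI[of _ e3], rule exI[of _ a], rule exI[of _ D],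
   use es a(1) out D(1) exI[of "%D'. D * D' = 1", OF D(2)] gens in \<open>simp add: e\<close>)
next
 assume "local_certificate' gens out ps q"
 then obtain e1 e2 e3 a D where *: "\<forall>x\<in>set [e1, e2, e3]. x \<in> O_span smul (set out)" "aint a" "unit_certificate ps a"
   "\<forall>g\<in>set out. smul a g \<in> O_span smul (set [1, e1, e2, e3])"
   "aint D" "\<exists>D'. D * D' = 1" "\<forall>g\<in>set gens. smul D g \<in> O_span smul (set out)"
   "dual_certificate (a * D) e1 e2 e3" "near_certificate ps a D q e1 e2 e3"
  unfolding local_certificate'_def by - (elim exE conjE, rule that; (rule exI)?; assumption)
 obtain u w where u: "aint u" "w \<in> O_span (*) (set ps)" "a * u + w = 1"
  using *(3) unfolding unit_certificate_def by blast
 obtain D' where D': "D * D' = 1" using *(6) by blast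
 obtain d0 d1 d2 d3 where d: "\<forall>d\<in>set [d0, d1, d2, d3]. d \<in> O_span smul (set [1, e1, e2, e3])"
  "\<forall>k<4. \<forall>l<4. tr ([d0, d1, d2, d3] ! k * (1 # [e1, e2, e3]) ! l) = (if k = l then a * D else 0)"
  using *(8) unfolding dual_certificate_def dual_system_4[symmetric] by - (elim exE conjE, rule that, assumption+)
 obtain z z' where z: "z \<in> O_span (*) (set ps)" "z * z' = 1" "\<forall>x\<in>set (clifford_relations smul q e1 e2 e3).
   \<exists>s. s \<in> O_span smul (set [1, e1, e2, e3]) & smul a x = smul ((4 * D) ^ 10 * z) s"
  using *(9) unfolding near_certificate_def by - (elim exE conjE, rule that, assumption+)
 show "local_certificate gens out ps q" unfolding local_certificate_def
  by (rule exI[of _ "[e1, e2, e3]"], rule exI[of _ "[d0, d1, d2, d3]"], rule exI[of _ a], rule exI[of _ u],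
    rule exI[of _ w], rule exI[of _ D], rule exI[of _ D'], rule exI[of _ z], rule exI[of _ z'], intro conjI)
   (use * u D' d z in \<open>simp_all add: numeral_2_eq_2\<close>)
qed

text \<open>With variables in place of list positions the relations become polynomial expressions,
  to which the rules apply directly.\<close>

lemma clifford_relations_6:
 "clifford_relations smul [a, w, v, b, u, c] i j k =
  [i * i - (smul u i - smul (b * c) 1), j * j - (smul v j - smul (c * a) 1), k * k - (smul w k - smul (a * b) 1),
   j * k - smul a (smul u 1 - i), k * i - smul b (smul v 1 - j), i * j - smul c (smul w 1 - k),
   k * j - (smul a i + smul w j + smul v k - smul (v * w) 1),
   i * k - (smul b j + smul u k + smul w i - smul (w * u) 1),
   j * i - (smul c k + smul v i + smul u j - smul (u * v) 1)]"
 by (simp add: clifford_relations_def)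

lemmas rules = R_span_B R_span_K R_algint R_in_map_fst R_rules

lemma rep_unit: "rep (pe (le ke) ke) (%p. unit_certificate (fst p) (snd p))"
 unfolding unit_certificate_def by (rule rules)+

lemma rep_dual: "rep (pe ke (pe be (pe be be)))
 (%p. dual_certificate (fst p) (fst (snd p)) (fst (snd (snd p))) (snd (snd (snd p))))"
 unfolding dual_certificate_def by (rule rules)+

lemma list_6:
 "(\<exists>a w v b u c. q = [a, w, v, b, u, c] & N [a, w, v, b, u, c]) \<longleftrightarrow> length q = 6 & N q"
proof
 assume "\<exists>a w v b u c. q = [a, w, v, b, u, c] & N [a, w, v, b, u, c]"
 thus "length q = 6 & N q" by (elim exE conjE) simp
next
 assume q: "length q = 6 & N q"
 hence "length q = 6" by simp
 hence "\<exists>a w v b u c. q = [a, w, v, b, u, c]" by (auto simp: numeral_eq_Suc length_Suc_conv)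
 then obtain a w v b u c where 1: "q = [a, w, v, b, u, c]"
  by - (erule exE, erule exE, erule exE, erule exE, erule exE, erule exE, rule that)
 have "N [a, w, v, b, u, c]" using q unfolding 1 by simp
 with 1 show "\<exists>a w v b u c. q = [a, w, v, b, u, c] & N [a, w, v, b, u, c]"
  by - (rule exI[of _ a], rule exI[of _ w], rule exI[of _ v], rule exI[of _ b], rule exI[of _ u], rule exI[of _ c],
   rule conjI)
qed

text \<open>The guard on the length turns \<open>q\<close> into six quantified coefficients;
  \<open>genus_data\<close> always satisfies it.\<close>

lemma rep_near: "rep (pe (pe (le ke) (pe ke (pe ke (le ke)))) (pe be (pe be be)))
 (%p. length (snd (snd (snd (fst p)))) = 6 & near_certificate (fst (fst p)) (fst (snd (fst p))) (fst (snd (snd (fst p)))) (snd (snd (snd (fst p))))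
  (fst (snd p)) (fst (snd (snd p))) (snd (snd (snd p))))"
proof -
 have "rep (pe (pe (le ke) (pe ke (pe ke (le ke)))) (pe be (pe be be)))
  (%p. \<exists>a w v b u c. snd (snd (snd (fst p))) = [a, w, v, b, u, c] &
   near_certificate (fst (fst p)) (fst (snd (fst p))) (fst (snd (snd (fst p)))) [a, w, v, b, u, c]
    (fst (snd p)) (fst (snd (snd p))) (snd (snd (snd p))))"
  unfolding near_certificate_def clifford_relations_6 by (rule rules)+
 thus ?thesis by (rule rep_cong) (rule list_6)
qed

lemma R_unit: "cfn d (le ke) ps ==> cfn d ke a ==> encoder d ==> rep d (%x. unit_certificate (ps x) (a x))"
 using rep_app[OF _ rep_unit, of d "%x. (ps x, a x)"] by (simp add: R_encoder R_Pair)

lemma R_dual: "cfn d ke c ==> cfn d be e1 ==> cfn d be e2 ==> cfn d be e3 ==> encoder d ==>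
  rep d (%x. dual_certificate (c x) (e1 x) (e2 x) (e3 x))"
 using rep_app[OF _ rep_dual, of d "%x. (c x, e1 x, e2 x, e3 x)"] by (simp add: R_encoder R_Pair)

lemma R_near: "cfn d (le ke) ps ==> cfn d ke a ==> cfn d ke D ==> cfn d (le ke) q ==>
  cfn d be e1 ==> cfn d be e2 ==> cfn d be e3 ==> encoder d ==>
  rep d (%x. length (q x) = 6 & near_certificate (ps x) (a x) (D x) (q x) (e1 x) (e2 x) (e3 x))"
 using rep_app[OF _ rep_near, of d "%x. ((ps x, a x, D x, q x), e1 x, e2 x, e3 x)"] by (simp add: R_encoder R_Pair)

lemma rep_local: "rep (pe (pe (le be) (le be)) (pe (le ke) (le ke)))
 (%p. length (snd (snd p)) = 6 & local_certificate (fst (fst p)) (snd (fst p)) (fst (snd p)) (snd (snd p)))"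
proof -
 have "rep (pe (pe (le be) (le be)) (pe (le ke) (le ke))) (%p. length (snd (snd p)) = 6 & (\<exists>e1 e2 e3 a D.
   (\<forall>x\<in>set [e1, e2, e3]. x \<in> O_span smul (set (snd (fst p)))) & aint a & unit_certificate (fst (snd p)) a &
   (\<forall>g\<in>set (snd (fst p)). smul a g \<in> O_span smul (set [1, e1, e2, e3])) &
   aint D & (\<exists>D'. D * D' = 1) & (\<forall>g\<in>set (fst (fst p)). smul D g \<in> O_span smul (set (snd (fst p)))) &
   dual_certificate (a * D) e1 e2 e3 &
   (length (snd (snd p)) = 6 & near_certificate (fst (snd p)) a D (snd (snd p)) e1 e2 e3)))"
  by (rule R_unit R_dual R_near rules)+
 thus ?thesis unfolding local_certificate_iff local_certificate'_def
 proof (rule rep_cong, goal_cases)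
  case (1 p)
  show ?case by (cases "length (snd (snd p)) = 6") simp_all
 qed
qed

text \<open>Enumerable relations are not closed under implication. Distinguishing whether a position
  is before, at or beyond the end turns both implications into positive alternatives.\<close>

lemma chain_certificate_iff:
 "chain_certificate smul pss gens out \<longleftrightarrow> (\<exists>ls T. (\<forall>l\<in>set ls. l \<in> set pss) & (0::nat, 1) \<in> set T &
   (\<forall>t\<in>set T. (\<exists>l. (fst t < length ls & ls ! fst t = l) & (\<forall>g\<in>set l. (Suc (fst t), snd t * g) \<in> set T)) \<or>
    (fst t = length ls & (\<forall>r\<in>set gens. smul (snd t) r \<in> O_span smul (set out))) \<or>
    (\<exists>k. fst t = Suc (length ls + k))))"
proof -
 have key: "((\<forall>l. i < n & l = ls ! i --> A l) & (i = n --> B)) \<longleftrightarrow>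
  (\<exists>l. (i < n & ls ! i = l) & A l) \<or> (i = n & B) \<or> (\<exists>k. i = Suc (n + k))" for i n A B and ls :: "'k list list"
  by (cases i n rule: linorder_cases) (auto dest: less_imp_Suc_add)
 show ?thesis unfolding chain_certificate_def key ..
qed

lemma rep_chain: "rep (pe (pe (le be) (le (pe (le ke) (le ke)))) (le be))
 (%p. chain_certificate smul (map fst (snd (fst p))) (fst (fst p)) (snd p))"
 unfolding chain_certificate_iff by (rule rules)+

lemma R_local: "cfn d (le be) gens ==> cfn d (le be) out ==> cfn d (le ke) ps ==> cfn d (le ke) q ==> encoder d ==>
  rep d (%x. length (q x) = 6 & local_certificate (gens x) (out x) (ps x) (q x))"
 using rep_app[OF _ rep_local, of d "%x. ((gens x, out x), ps x, q x)"] by (simp add: R_encoder R_Pair)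

lemma R_chain: "cfn d (le be) gens ==> cfn d (le (pe (le ke) (le ke))) pqs ==> cfn d (le be) out ==> encoder d ==>
  rep d (%x. chain_certificate smul (map fst (pqs x)) (gens x) (out x))"
 using rep_app[OF _ rep_chain, of d "%x. ((gens x, pqs x), out x)"] by (simp add: R_encoder R_Pair)

lemma rep_certificate: "rep (pe (le be) (pe (le (pe (le ke) (le ke))) (le be)))
 (%p. certificate (fst p) (fst (snd p)) (snd (snd p)) & (\<forall>pq\<in>set (fst (snd p)). length (snd pq) = 6))"
proof -
 have "rep (pe (le be) (pe (le (pe (le ke) (le ke))) (le be)))
  (%p. 1 \<in> O_span smul (set (snd (snd p))) &
   (\<forall>x\<in>set (snd (snd p)). \<forall>y\<in>set (snd (snd p)). x * y \<in> O_span smul (set (snd (snd p)))) &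
   (\<forall>x\<in>set (snd (snd p)). x \<in> O_span smul (set (fst p))) &
   (\<exists>D. aint D & (\<exists>D'. D * D' = 1) & (\<forall>r\<in>set (fst p). smul D r \<in> O_span smul (set (snd (snd p))))) &
   (\<forall>pq\<in>set (fst (snd p)). length (snd pq) = 6 & local_certificate (fst p) (snd (snd p)) (fst pq) (snd pq)) &
   chain_certificate smul (map fst (fst (snd p))) (fst p) (snd (snd p)))"
  by (rule R_local R_chain rules)+
 moreover have "(\<exists>D D'. A D & C D D' & B D) \<longleftrightarrow> (\<exists>D. A D & (\<exists>D'. C D D') & B D)"
  for A B :: "'k => bool" and C by blast
 note key = this
 ultimately show ?thesis unfolding certificate_def key ball_conj_distrib
  by (elim rep_cong) (intro iffI conjI; elim conjE; assumption)
qed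

lemma encode_gens_eq: "encode_gens smul \<kappa> \<beta> = le be"
 by (auto simp: encode_gens_def le_def fun_eq_iff)

lemma encode_genus_eq: "encode_genus \<kappa> L = le (pe (le ke) (le ke)) (genus_data L)"
 by (simp add: encode_genus_def le_def genus_data_def pe_def encode_form_def form_coeffs_def case_prod_unfold comp_def)

text \<open>The search yields a code together with the codes of the input; as the encodings are
  injective, it decodes to an output certified for exactly this input.\<close>

theorem search_certificate:
 obtains P where "!!gens L out. certificate gens (genus_data L) out ==>
  \<exists>out. computes P [encode_gens smul \<kappa> \<beta> gens, encode_genus \<kappa> L] (encode_gens smul \<kappa> \<beta> out) &
   certificate gens (genus_data L) out"
proof -
 let ?e = "pe (le be) (pe (le (pe (le ke) (le ke))) (le be))"
 let ?C = "%p. certificate (fst p) (fst (snd p)) (snd (snd p)) & (\<forall>pq\<in>set (fst (snd p)). length (snd pq) = 6)"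
 have "re (?e ` {p. ?C p})" using rep_certificate unfolding rep_def .
 from re_search[OF this] obtain P where P: "!!x y c. pair x (pair y c) \<in> ?e ` {p. ?C p} ==>
  \<exists>c. computes P [x, y] c & pair x (pair y c) \<in> ?e ` {p. ?C p}" by blast
 have inj: "inj ?e" using R_encoder by (auto simp: encoder_def intro!: inj_pe inj_le)
 show thesis
 proof (rule that[of P])
  fix gens L out assume c: "certificate gens (genus_data L) out"
  let ?x = "encode_gens smul \<kappa> \<beta> gens" and ?y = "encode_genus \<kappa> L"
  have "?C (gens, genus_data L, out)" using c by (auto simp: genus_data_def form_coeffs_def)
  hence "?e (gens, genus_data L, out) \<in> ?e ` {p. ?C p}" by blast
  hence "pair ?x (pair ?y (le be out)) \<in> ?e ` {p. ?C p}"
   by (simp add: encode_gens_eq encode_genus_eq pe_def)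
  then obtain n where n: "computes P [?x, ?y] n" "pair ?x (pair ?y n) \<in> ?e ` {p. ?C p}" using P by blast
  then obtain p where p: "?C p" "pair ?x (pair ?y n) = ?e p" by blast
  obtain gens' pqs out' where p': "p = (gens', pqs, out')" by (metis surj_pair)
  have "le be gens = le be gens'" "le (pe (le ke) (le ke)) (genus_data L) = le (pe (le ke) (le ke)) pqs" "n = le be out'"
   using p(2) unfolding p' by (auto simp: pe_def[of "le be"] pe_def[of "le (pe (le ke) (le ke))"] pair_eq encode_gens_eq encode_genus_eq)
  moreover have "inj (le be)" "inj (le (pe (le ke) (le ke)))"
   using R_encoder by (auto simp: encoder_def intro!: inj_pe inj_le)
  ultimately have "gens' = gens" "pqs = genus_data L" "n = encode_gens smul \<kappa> \<beta> out'"
   by (auto simp: encode_gens_eq dest: injD)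
  thus "\<exists>out. computes P [?x, ?y] (encode_gens smul \<kappa> \<beta> out) & certificate gens (genus_data L) out"
   using n(1) p(1) by (auto simp: p')
 qed
qed

end

theorem theoremA:
  fixes smul :: "'k::number_field \<Rightarrow> 'b::ring_1 \<Rightarrow> 'b"
    and \<kappa> :: "'k list" and \<beta> :: "'b list"
  assumes "quaternion_algebra smul"
    and "ordered_basis rat_scale \<kappa>"
    and "ordered_basis smul \<beta>"
  shows "\<exists>P. \<forall>R gens G L.
     bass_order smul R \<and> R = O_span smul (set gens) \<and>
     is_genus smul G \<and> (\<forall>S\<in>G. bass_order smul S) \<and> describes_genus smul L G \<and>
     (\<exists>S\<in>G. S \<subseteq> R) \<and>
     ((\<forall>\<pp>::'k set. nonzero_prime \<pp> \<and> 2 \<in> \<pp> \<longrightarrow>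
         \<not> ideal_dvd integer_ring \<pp> (reduced_disc smul R) \<and>
         (\<forall>S\<in>G. \<not> ideal_dvd integer_ring \<pp> (reduced_disc smul S)))
      \<or> primeideal (genideal (integer_ring :: 'k ring) {2}) integer_ring)
     \<longrightarrow> (\<exists>out. computes P [encode_gens smul \<kappa> \<beta> gens, encode_genus \<kappa> L]
                    (encode_gens smul \<kappa> \<beta> out) \<and>
               O_span smul (set out) \<in> G \<and> O_span smul (set out) \<subseteq> R)"
proof -
 interpret encoded_algebra smul \<kappa> \<beta>
  using assms by (intro encoded_algebra.intro encoded_algebra_axioms.intro)
 obtain P where P: "!!gens L out. certificate gens (genus_data L) out ==>
  \<exists>out. computes P [encode_gens smul \<kappa> \<beta> gens, encode_genus \<kappa> L] (encode_gens smul \<kappa> \<beta> out) &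
   certificate gens (genus_data L) out" using search_certificate by blast
 show ?thesis
 proof (rule exI[of _ P], intro allI impI)
  fix R gens G L
  assume "bass_order smul R & R = O_span smul (set gens) &
   is_genus smul G & (\<forall>S\<in>G. bass_order smul S) & describes_genus smul L G &
   (\<exists>S\<in>G. S \<subseteq> R) &
   ((\<forall>\<pp>::'k set. nonzero_prime \<pp> & 2 \<in> \<pp> -->
     \<not> ideal_dvd integer_ring \<pp> (reduced_disc smul R) &
     (\<forall>S\<in>G. \<not> ideal_dvd integer_ring \<pp> (reduced_disc smul S)))
   \<or> primeideal (genideal (integer_ring :: 'k ring) {2}) integer_ring)"
  hence R: "R = O_span smul (set gens)" "is_order smul R" and G: "is_genus smul G" "describes_genus smul L G"
   and ex: "\<exists>S\<in>G. S \<subseteq> R" by (auto simp: bass_order_def)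
  obtain S where S: "S \<in> G" "S \<subseteq> R" using ex by blast
  \<comment> \<open>Generators of the promised suborder form a certified output, so the search
    terminates. It may find a different one, to which soundness applies as well.\<close>
  have "is_order smul S" using G(1) S(1) by (auto simp: is_genus_def)
  then obtain F where F: "finite F" "S = O_span smul F" by (auto simp: is_order_def is_lattice_def)
  obtain out0 where "set out0 = F" using finite_list[OF F(1)] by blast
  hence "certificate gens (genus_data L) out0" using certificate_complete[OF R G S] F(2) by simp
  then obtain out where "computes P [encode_gens smul \<kappa> \<beta> gens, encode_genus \<kappa> L] (encode_gens smul \<kappa> \<beta> out)"
   "certificate gens (genus_data L) out" using P by blast
  thus "\<exists>out. computes P [encode_gens smul \<kappa> \<beta> gens, encode_genus \<kappa> L]
          (encode_gens smul \<kappa> \<beta> out) &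
        O_span smul (set out) \<in> G & O_span smul (set out) \<subseteq> R"
   using certificate_sound[OF R G S] by blast
 qed
qed

end
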